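(* Let $d\ge 2$ be an integer and let $\beta\ge d-3$ be real. Let $\phi=(\phi_1,\dots,\phi_d)\in\mathcal O(\mathbb D^d,\mathbb D^d)\cap\mathcal C^1(\overline{\mathbb D}^d)$. Then $C_\phi:A^2_\beta(\mathbb D^d)\to A^2_\beta(\mathbb D^d)$ is bounded if and only if the following two conditions hold: (a) for all $j\in\{1,\dots,d-1\}$, $\phi(\overline{\mathbb D}^d\setminus T_{j+1,d})\cap T_{j+1,d}=\emptyset$; (b) for all $j\in\{1,\dots,d\}$, all $I\subset\{1,\dots,d\}$ with $|I|=j$ and all $\xi\in T_{j,d}\setminus T_{j+1,d}$ such that $\phi_I(\xi)\in\mathbb T^{j}$, the matrix $\left(\frac{\partial\phi_i}{\partial z_k}(\xi)\right)_{i\in I,\,k\in P_I}$ is invertible (in particular it is square, i.e. $|P_I|=|I|$), where $P_I=P_I(\xi)=\{k\in\{1,\dots,d\}:\ \exists i\in I,\ \frac{\partial\phi_i}{\partial z_k}(\xi)\neq 0\}$.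
   Context: $\mathbb D$ is the open unit disc of $\mathbb C$, $\mathbb T$ the unit circle. $\mathcal O(\mathbb D^d,\mathbb D^d)$ is the set of holomorphic self-maps of $\mathbb D^d$; $\phi\in\mathcal C^1(\overline{\mathbb D}^d)$ means that $\phi$ and its first order partial derivatives extend continuously to $\overline{\mathbb D}^d$ (the extension is still denoted $\phi$). For $I=\{i_1<\dots<i_p\}$, $\phi_I=(\phi_{i_1},\dots,\phi_{i_p})$. For $1\le j\le d$, $T_{j,d}=\{z\in\overline{\mathbb D}^d:\ \exists I\subset\{1,\dots,d\},\ |I|=j,\ |z_k|=1\ \forall k\in I\}$, and $T_{d+1,d}=\emptyset$. For $\beta>-1$, let $dA_\beta(z)=(\beta+1)(1-|z|^2)^\beta dA(z)$ with $dA$ the normalized area measure on $\mathbb D$, and $dV_\beta(z)=dA_\beta(z_1)\cdots dA_\beta(z_d)$ on $\mathbb D^d$. $A^2_\beta(\mathbb D^d)$ is the space of holomorphic $f:\mathbb D^d\to\mathbb C$ with $\|f\|^2=\int_{\mathbb D^d}|f|^2dV_\beta<\infty$. By convention $A^2_{-1}(\mathbb D^d)=H^2(\mathbb D^d)$, the Hardy space of holomorphic $f:\mathbb D^d\to\mathbb C$ with $\|f\|^2=\sup_{0<r<1}\int_{\mathbb T^d}|f(r\zeta)|^2d\sigma_d(\zeta)<\infty$, $\sigma_d$ being the normalized surface measure on $\mathbb T^d$. The composition operator is $C_\phi(f)=f\circ\phi$. *)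

theory Defs
  imports "HOL-Analysis.Analysis"
begin

definition polydisc :: "(complex ^ 'n) set" where
  "polydisc = {z. \<forall>k. norm (z $ k) < 1}"

definition cpolydisc :: "(complex ^ 'n) set" where
  "cpolydisc = {z. \<forall>k. norm (z $ k) \<le> 1}"

definition torus :: "(complex ^ 'n) set" where
  "torus = {z. \<forall>k. norm (z $ k) = 1}"

(* T j is the set T_{j,d} with d = CARD('n). It is automatically empty for j = d + 1,
   as 'n has no subset of cardinality d + 1. *)
definition T :: "nat \<Rightarrow> (complex ^ 'n) set" where
  "T j = {z \<in> cpolydisc. \<exists>I :: 'n set. card I = j \<and> (\<forall>k\<in>I. norm (z $ k) = 1)}"

text \<open>Holomorphy in several variables: a complex-linear Frechet derivative exists at every
  point of the (open) set.\<close>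

definition holo_on :: "(complex ^ 'n \<Rightarrow> complex) \<Rightarrow> (complex ^ 'n) set \<Rightarrow> bool" where
  "holo_on f S \<longleftrightarrow>
     (\<forall>z\<in>S. \<exists>D. (f has_derivative D) (at z) \<and> (\<forall>c v. D (c *s v) = c * D v))"

definition holo_selfmap :: "(complex ^ 'n \<Rightarrow> complex ^ 'n) \<Rightarrow> bool" where
  "holo_selfmap \<phi> \<longleftrightarrow> (\<forall>i. holo_on (\<lambda>z. \<phi> z $ i) polydisc) \<and> \<phi> ` polydisc \<subseteq> polydisc"

definition partial_deriv :: "(complex ^ 'n \<Rightarrow> complex) \<Rightarrow> 'n \<Rightarrow> complex ^ 'n \<Rightarrow> complex" where
  "partial_deriv f k z = deriv (\<lambda>w. f (\<chi> m. if m = k then w else z $ m)) (z $ k)"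

text \<open>The function \<open>\<phi>\<close> is total; its values on the closed polydisc are those of the continuous
  extension of its restriction to the open polydisc (unique by density), and its values elsewhere
  are irrelevant. The partial derivatives are only taken inside the open polydisc.\<close>

definition C1_closed :: "(complex ^ 'n \<Rightarrow> complex ^ 'n) \<Rightarrow> bool" where
  "C1_closed \<phi> \<longleftrightarrow> continuous_on cpolydisc \<phi> \<and>
     (\<forall>i k. \<exists>g. continuous_on cpolydisc g \<and>
        (\<forall>z\<in>polydisc. g z = partial_deriv (\<lambda>w. \<phi> w $ i) k z))"

text \<open>The \<open>(i,k)\<close> entry of the Jacobian matrix at a point \<open>\<xi>\<close> of the closed polydisc, i.e. the value
  at \<open>\<xi>\<close> of the continuous extension of the partial derivative.\<close>

definition jac :: "(complex ^ 'n \<Rightarrow> complex ^ 'n) \<Rightarrow> complex ^ 'n \<Rightarrow> 'n \<Rightarrow> 'n \<Rightarrow> complex" where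
  "jac \<phi> \<xi> i k = Lim (at \<xi> within polydisc) (partial_deriv (\<lambda>z. \<phi> z $ i) k)"

definition P :: "(complex ^ 'n \<Rightarrow> complex ^ 'n) \<Rightarrow> 'n set \<Rightarrow> complex ^ 'n \<Rightarrow> 'n set" where
  "P \<phi> I \<xi> = {k. \<exists>i\<in>I. jac \<phi> \<xi> i k \<noteq> 0}"

text \<open>Invertibility of the matrix \<open>A\<close> with rows indexed by \<open>I\<close> and columns indexed by \<open>K\<close>.
  For finite index sets the cardinality condition already follows from the two-sided inverse.\<close>

definition invertible_on :: "'a set \<Rightarrow> 'b set \<Rightarrow> ('a \<Rightarrow> 'b \<Rightarrow> complex) \<Rightarrow> bool" where
  "invertible_on I K A \<longleftrightarrow> card I = card K \<and>
     (\<exists>B. (\<forall>i\<in>I. \<forall>i'\<in>I. (\<Sum>k\<in>K. A i k * B k i') = (if i = i' then 1 else 0)) \<and>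
          (\<forall>k\<in>K. \<forall>k'\<in>K. (\<Sum>i\<in>I. B k i * A i k') = (if k = k' then 1 else 0)))"

text \<open>The measure \<open>dA\<^sub>\<beta>\<close> has the stated density with respect to normalized area on the unit disc;
  \<open>dV\<^sub>\<beta>\<close> and \<open>\<sigma>\<^sub>d\<close> are the product measures, transported from functions to vectors.\<close>

definition dA :: "real \<Rightarrow> complex measure" where
  "dA \<beta> = density (uniform_measure lborel (ball 0 1))
            (\<lambda>z. ennreal ((\<beta> + 1) * (1 - (norm z)\<^sup>2) powr \<beta>))"

definition dV :: "real \<Rightarrow> (complex ^ 'n) measure" where
  "dV \<beta> = distr (PiM (UNIV :: 'n set) (\<lambda>_. dA \<beta>)) borel vec_lambda"

definition arc_measure :: "complex measure" where
  "arc_measure = distr (uniform_measure lborel {0..2 * pi}) borel cis"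

definition torus_measure :: "(complex ^ 'n) measure" where
  "torus_measure = distr (PiM (UNIV :: 'n set) (\<lambda>_. arc_measure)) borel vec_lambda"

text \<open>Squared norms. The integrals are restricted to the sets carrying the measures, because the
  values of \<open>f\<close> off the polydisc are arbitrary (and need not be measurable).\<close>

definition bergman_sq :: "real \<Rightarrow> (complex ^ 'n \<Rightarrow> complex) \<Rightarrow> ennreal" where
  "bergman_sq \<beta> f = (\<integral>\<^sup>+ z \<in> polydisc. ennreal ((norm (f z))\<^sup>2) \<partial>dV \<beta>)"

definition hardy_sq :: "(complex ^ 'n \<Rightarrow> complex) \<Rightarrow> ennreal" where
  "hardy_sq f =
     (SUP r \<in> {0<..<1::real}. \<integral>\<^sup>+ \<zeta> \<in> torus. ennreal ((norm (f (r *\<^sub>R \<zeta>)))\<^sup>2) \<partial>torus_measure)"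

definition A2_sq :: "real \<Rightarrow> (complex ^ 'n \<Rightarrow> complex) \<Rightarrow> ennreal" where
  "A2_sq \<beta> f = (if \<beta> = -1 then hardy_sq f else bergman_sq \<beta> f)"

definition A2 :: "real \<Rightarrow> (complex ^ 'n \<Rightarrow> complex) set" where
  "A2 \<beta> = {f. holo_on f polydisc \<and> A2_sq \<beta> f < \<infinity>}"

definition A2_norm :: "real \<Rightarrow> (complex ^ 'n \<Rightarrow> complex) \<Rightarrow> real" where
  "A2_norm \<beta> f = sqrt (enn2real (A2_sq \<beta> f))"

definition composition_bounded :: "real \<Rightarrow> (complex ^ 'n \<Rightarrow> complex ^ 'n) \<Rightarrow> bool" where
  "composition_bounded \<beta> \<phi> \<longleftrightarrow>
     (\<exists>C. \<forall>f\<in>A2 \<beta>. f \<circ> \<phi> \<in> A2 \<beta> \<and> A2_norm \<beta> (f \<circ> \<phi>) \<le> C * A2_norm \<beta> f)"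

end

theory Submission
 imports Defs "HOL-Complex_Analysis.Complex_Analysis" "HOL-Real_Asymp.Real_Asymp"
begin

text \<open>Necessity is tested on products of powers of the kernels \<open>1 / (1 - cnj w * z)\<close>: boundedness forces the preimage of every
  small boundary box to have measure at most a constant times that of the box, and moving the boundary coordinates along angles
  in the kernel of the Jacobian produces too large a preimage unless (a) and (b) hold. Conversely, (a) and (b) give a Hall condition:
  at a boundary point, any rows \<open>I\<close> with unimodular value involve at least \<open>card I\<close> variables, and the block is invertible
  in case of equality. For \<open>\<beta> > -1\<close> a flag of pivot columns, together with the radial constraints of the remaining columns (this is
  where \<open>\<beta> \<ge> d - 3\<close> enters), gives the Carleson condition for boxes, and the mean value property turns it into boundedness. For \<open>\<beta> = -1\<close>
  one has \<open>d = 2\<close> and the Carleson condition for boxes does not suffice; instead the arguments of the components are locally bi-Lipschitz coordinates of the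
  torus, so the iterated radial maximal function, which is bounded on \<open>L\<^sup>2\<close>, dominates \<open>f \<circ> \<phi>\<close>.\<close>

text \<open>What links (a) and (b) to the Hall condition is rigidity: if \<phi>_i is unimodular at
  \<xi>, then \<phi>_i and its Jacobian row keep their values when the variables with vanishing
  entries are changed arbitrarily. Setting these variables to 0 gives a point with exactly |P_I|
  unimodular coordinates, and there (a) and (b) speak about I. Rigidity is a Hopf lemma, drawn from
  Harnack on analytic discs that may lie inside the boundary. The Jacobian rows are moreover real in
  angular coordinates, so a complex kernel vector yields a real one, that is, a motion along the
  torus. A pivot column confines a variable to a box, worth \<delta>^(\<beta>+2); a radial
  constraint is worth only \<delta>^(\<beta>+1). With p rows and q pivots, the p - q remaining rows
  are paid for by p - q + 1 radial columns. The surplus \<delta>^(\<beta>+1) has to cover p - q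
  missing factors, and q \<ge> 1, p \<le> d - 1 leave p - q \<le> d - 2: hence \<beta> \<ge> d - 3.
  For \<beta> = -1 boxes fail because Carleson measures of the product Hardy space are tested on
  arbitrary open sets of the torus.\<close>

abbreviation arc_int (binder "ARC " 10) where "arc_int f \<equiv> nn_integral arc_measure f"
abbreviation leb_int (binder "LEB " 10) where "leb_int f \<equiv> nn_integral lborel f"
abbreviation nsq :: "'a::real_normed_vector => ennreal" where "nsq x \<equiv> ennreal ((norm x)^2)"
abbreviation "borel_fun \<equiv> borel_measurable borel"

section \<open>Measures on the disc and the circle\<close>

lemma lborel_complex: "(lborel :: complex measure) = distr (lborel \<Otimes>\<^sub>M lborel) borel (%(x, y). Complex x y)"
proof (rule lborel_eqI)
 have [measurable]: "(%(x, y). Complex x y) \<in> borel_measurable (borel \<Otimes>\<^sub>M borel)"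
  unfolding Complex_eq split_beta by measurable
 fix l u :: complex
 assume le: "\<And>b. b \<in> Basis ==> l \<bullet> b <= u \<bullet> b"
 have *: "Re l <= Re u" "Im l <= Im u" using le[of 1] le[of \<i>] by (auto simp: Basis_complex_def)
 have "(%(x, y). Complex x y) -` box l u = {Re l<..<Re u} \<times> {Im l<..<Im u}"
  by (auto simp: box_def Basis_complex_def)
 then have "emeasure (distr (lborel \<Otimes>\<^sub>M lborel) borel (%(x, y). Complex x y)) (box l u)
  = emeasure (lborel \<Otimes>\<^sub>M lborel) ({Re l<..<Re u} \<times> {Im l<..<Im u})"
  by (subst emeasure_distr) (auto simp: space_pair_measure)
 also have "... = ennreal (Re u - Re l) * ennreal (Im u - Im l)"
  using * by (subst lborel.emeasure_pair_measure_Times) auto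
 also have "... = (\<Prod>b\<in>Basis. (u - l) \<bullet> b)"
  using * by (simp add: Basis_complex_def ennreal_mult)
 finally show "emeasure (distr (lborel \<Otimes>\<^sub>M lborel) borel (%(x, y). Complex x y)) (box l u) = (\<Prod>b\<in>Basis. (u - l) \<bullet> b)" .
qed simp

lemma measurable_Complex [measurable]: "(%(x, y). Complex x y) \<in> borel_measurable (borel \<Otimes>\<^sub>M borel)"
  unfolding Complex_eq split_beta by measurable

lemma nn_integral_lborel_complex:
 fixes f :: "complex => ennreal"
 assumes [measurable]: "f \<in> borel_fun"
 shows "(LEB z. f z) = (LEB x. (LEB y. f (Complex x y)))" (is "_ = ?A")
  and "(LEB z. f z) = (LEB y. (LEB x. f (Complex x y)))"
proof -
 have "(LEB z. f z) = (\<integral>\<^sup>+p. f (case p of (x, y) => Complex x y) \<partial>(lborel \<Otimes>\<^sub>M lborel))"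
  by (subst lborel_complex, subst nn_integral_distr) auto
 also have "... = ?A"
  by (subst lborel.nn_integral_fst[symmetric]) (auto simp: split_beta)
 finally show "(LEB z. f z) = ?A" .
 also have "... = (LEB y. (LEB x. f (Complex x y)))"
  by (rule lborel_pair.Fubini'[symmetric]) (auto simp: split_beta)
 finally show "(LEB z. f z) = (LEB y. (LEB x. f (Complex x y)))" .
qed

text \<open>Fubini and one-variable affine substitutions suffice. If \<open>cos t\<close> is
  nonzero, the new abscissa replaces x at cost 1/|c|, then the new ordinate replaces y at cost |c|,
  the identity c^2 + s^2 = 1 reducing the coefficient of y to 1/c; the two costs cancel. A quarter
  turn only exchanges the axes up to sign.\<close>

lemma nn_integral_lborel_cis:
 fixes f :: "complex => ennreal"
 assumes [measurable]: "f \<in> borel_fun"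
 shows "(LEB z. f (cis t * z)) = (LEB z. f z)"
proof (cases "cos t = 0")
 case True
 then have s: "\<bar>sin t\<bar> = 1" using sin_cos_squared_add[of t] by (simp add: abs_square_eq_1)
 have e: "cis t * Complex x y = Complex (- (sin t) * y) (sin t * x)" for x y
  using True by (simp add: complex_eq_iff)
 have "(LEB z. f (cis t * z)) = (LEB x. (LEB y. f (Complex (- (sin t) * y) (sin t * x))))"
  by (subst nn_integral_lborel_complex(1)) (auto simp: e)
 also have "... = (LEB x. (LEB y. f (Complex y (sin t * x))))"
  using s by (subst nn_integral_real_affine[where c="- sin t" and t=0 and f="%y. f (Complex y _)"]) auto
 also have "... = (LEB x. (LEB y. f (Complex y x)))"
  using s by (subst (2) nn_integral_real_affine[where c="sin t" and t=0 ]) auto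
 also have "... = (LEB z. f z)" by (simp add: nn_integral_lborel_complex(2))
 finally show ?thesis .
next
 case False
 define c s where "c = cos t" and "s = sin t"
 have cs: "c^2 + s^2 = 1" "c \<noteq> 0" using False by (auto simp: c_def s_def)
 have e: "cis t * Complex x y = Complex (c * x - s * y) (s * x + c * y)" for x y
  by (simp add: complex_eq_iff c_def s_def)
 have "(LEB z. f (cis t * z)) = (LEB y. (LEB x. f (Complex (c * x - s * y) (s * x + c * y))))"
  by (subst nn_integral_lborel_complex(2)) (auto simp: e)
 also have "... = (LEB y. \<bar>1/c\<bar> * (LEB p. f (Complex p ((s * p + y) / c))))"
 proof (intro nn_integral_cong)
  fix y
  have 1: "c * (s*y/c + 1/c * p) - s * y = p" for p using cs by (simp add: field_simps)
  have 2: "s * (s*y/c + 1/c * p) + c * y = (s * p + y) / c" for p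
  proof -
   have "s * (s*y/c + 1/c * p) + c * y = (s * p + (c^2+s^2) * y) / c"
    using cs(2) by (simp add: field_simps power2_eq_square)
   then show ?thesis using cs by simp
  qed
  have "(LEB x. f (Complex (c * x - s * y) (s * x + c * y)))
   = \<bar>1/c\<bar> * (LEB p. f (Complex (c * (s*y/c + 1/c * p) - s * y) (s * (s*y/c + 1/c * p) + c * y)))"
   using cs by (intro nn_integral_real_affine) auto
  then show "(LEB x. f (Complex (c * x - s * y) (s * x + c * y))) =
   \<bar>1/c\<bar> * (LEB p. f (Complex p ((s * p + y) / c)))" unfolding 1 2 .
 qed
 also have "... = \<bar>1/c\<bar> * (LEB y. (LEB p. f (Complex p ((s * p + y) / c))))"
  by (rule nn_integral_cmult) auto
 also have "(LEB y. (LEB p. f (Complex p ((s * p + y) / c))))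
  = (LEB p. (LEB y. f (Complex p ((s * p + y) / c))))"
  by (rule lborel_pair.Fubini'[symmetric]) (auto simp: split_beta)
 also have "... = (LEB p. \<bar>c\<bar> * (LEB q. f (Complex p q)))"
 proof (intro nn_integral_cong)
  fix p
  have "(LEB y. f (Complex p ((s * p + y) / c))) = \<bar>c\<bar> * (LEB q. f (Complex p ((s * p + (- s * p + c * q)) / c)))"
   using cs by (intro nn_integral_real_affine) auto
  then show "(LEB y. f (Complex p ((s * p + y) / c))) = \<bar>c\<bar> * (LEB q. f (Complex p q))"
   using cs by simp
 qed
 also have "... = \<bar>c\<bar> * (LEB p. (LEB q. f (Complex p q)))"
  by (rule nn_integral_cmult) auto
 also have "\<bar>1/c\<bar> * (\<bar>c\<bar> * (LEB p. (LEB q. f (Complex p q)))) = (LEB z. f z)"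
  using cs by (simp add: nn_integral_lborel_complex(1) mult.assoc[symmetric] ennreal_mult[symmetric])
 finally show ?thesis .
qed

section \<open>The weighted area measure near the circle\<close>

definition wdens :: "real => complex => real" where
 "wdens \<beta> z = (\<beta> + 1) * (1 - (norm z)^2) powr \<beta> / pi"

lemma wdens_measurable [measurable]: "wdens \<beta> \<in> borel_fun"
 unfolding wdens_def by measurable

lemma sets_dA [measurable_cong, simp]: "sets (dA \<beta>) = sets borel"
 by (simp add: dA_def)

lemma space_dA [simp]: "space (dA \<beta>) = UNIV"
 by (simp add: dA_def)

lemma nn_integral_dA:
 assumes [measurable]: "f \<in> borel_fun"
 shows "(\<integral>\<^sup>+z. f z \<partial>dA \<beta>) = (LEB z. f z * ennreal (wdens \<beta> z) * indicator (ball 0 1) z)"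
proof -
 have pi: "emeasure lborel (ball (0::complex) 1) = ennreal pi"
  using emeasure_ball[of 1 "0::complex"] by (simp add: unit_ball_vol_2)
 have "(\<integral>\<^sup>+z. f z \<partial>dA \<beta>) = (LEB z. indicator (ball 0 1) z / ennreal pi * (ennreal ((\<beta> + 1) * (1 - (norm z)^2) powr \<beta>) * f z))"
  unfolding dA_def uniform_measure_def pi
  by (subst nn_integral_density, simp, simp, subst nn_integral_density)
    (auto intro!: borel_measurable_divide_ennreal borel_measurable_indicator)
 also have "... = (LEB z. f z * ennreal (wdens \<beta> z) * indicator (ball 0 1) z)"
 proof (intro nn_integral_cong)
  fix z :: complex
  have "inverse (ennreal pi) * ennreal a = ennreal (a / pi)" for a
   by (cases "a >= 0") (auto simp: divide_ennreal[symmetric] divide_ennreal_def ennreal_neg divide_nonpos_pos mult.commute)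
  note e = this[symmetric]
  show "indicator (ball 0 1) z / ennreal pi * (ennreal ((\<beta> + 1) * (1 - (norm z)^2) powr \<beta>) * f z) = f z * ennreal (wdens \<beta> z) * indicator (ball 0 1) z"
   unfolding wdens_def e by (auto simp: divide_ennreal_def indicator_def mult_ac)
 qed
 finally show ?thesis .
qed

text \<open>With b = sqrt (1 - y^2) the weight factors as 1 - x^2 - y^2 = (b - |x|) (b + |x|). The
  restriction |x| \<ge> 1/2 keeps the second factor in [1, 2], so only (b - |x|)^\<beta> matters,
  and b - |x| ranges over [0, 2\<delta>]. The leading 2 in the bound counts both signs of x.\<close>

lemma slice_bound:
 fixes \<beta> y \<delta> :: real
 assumes "\<beta> > -1" "\<delta> > 0"
 defines "A \<equiv> {x::real. \<bar>x\<bar> >= 1/2 \<and> x^2 + y^2 < 1 \<and> 1 - \<delta> <= sqrt (x^2+y^2)}"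
 shows "(LEB x. ennreal ((1 - (x^2 + y^2)) powr \<beta>) * indicator A x)
   <= ennreal (2 * (max 1 (2 powr \<beta>) * ((2 * \<delta>) powr (\<beta>+1) / (\<beta>+1))))"
proof -
 define K where "K = max 1 (2 powr \<beta>)"
 define b where "b = sqrt (1 - y^2)"
 define g where "g t = ennreal (K * t powr \<beta>) * indicator {0..2*\<delta>} t" for t
 have K: "K >= 1" by (simp add: K_def)
 have [measurable]: "g \<in> borel_fun" unfolding g_def by measurable
 have g: "(LEB t. g t) = ennreal (K * ((2 * \<delta>) powr (\<beta>+1) / (\<beta>+1)))"
 proof -
  have "((%x. x powr \<beta>) has_integral ((2*\<delta>) powr (\<beta>+1) / (\<beta>+1))) {0..2*\<delta>}"
   using assms by (intro has_integral_powr_from_0) auto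
  then have "(LEB t. ennreal (indicator {0..2*\<delta>} t * t powr \<beta>)) = ennreal ((2 * \<delta>) powr (\<beta>+1) / (\<beta>+1))"
   by (intro nn_integral_has_integral_lebesgue) auto
  moreover have "g t = ennreal K * ennreal (indicator {0..2*\<delta>} t * t powr \<beta>)" for t
   using K by (auto simp: g_def ennreal_mult indicator_def)
  ultimately have "(LEB t. g t) = ennreal K * ennreal ((2 * \<delta>) powr (\<beta>+1) / (\<beta>+1))"
   by (simp add: nn_integral_cmult del: ennreal_indicator)
  then show ?thesis using K assms(1,2) by (subst ennreal_mult) auto
 qed
 have point: "ennreal ((1 - (x^2 + y^2)) powr \<beta>) * indicator A x <= g (b - x) + g (b + x)" for x
 proof (cases "x \<in> A")
  case True
  define a where "a = \<bar>x\<bar>"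
  have a: "a >= 1/2" "a^2 + y^2 < 1" "1 - \<delta> <= sqrt (a^2+y^2)" using True by (auto simp: A_def a_def)
  have y1: "y^2 <= 1" using a(2) zero_le_power2[of a] by linarith
  have b2: "b^2 = 1 - y^2" using y1 by (simp add: b_def)
  have b0: "b >= 0" using y1 by (simp add: b_def)
  have b1: "b <= 1" by (simp add: b_def)
  have ab: "a < b" using a b2 b0 by (intro power2_less_imp_less[of a b]) auto
  have e: "1 - (a^2+y^2) = (b - a) * (b + a)" using b2 by (simp add: algebra_simps power2_eq_square)
  define r where "r = sqrt (a^2+y^2)"
  have r: "0 <= r" "r <= 1" "r^2 = a^2+y^2" "1 - r <= \<delta>" using a by (auto simp: r_def)
  have "1 - r^2 = (1-r)*(1+r)" by (simp add: algebra_simps power2_eq_square)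
  also have "... <= \<delta> * 2" using r by (intro mult_mono) auto
  finally have "(b-a)*(b+a) <= 2*\<delta>" using e r by simp
  moreover have "(b-a)*1 <= (b-a)*(b+a)" using ab a by (intro mult_left_mono) auto
  ultimately have d: "b - a <= 2*\<delta>" by simp
  have "(b+a) powr \<beta> <= K"
  proof (cases "\<beta> >= 0")
   case True
   then have "(b+a) powr \<beta> <= 2 powr \<beta>" using ab a b1 by (intro powr_mono2) auto
   then show ?thesis by (simp add: K_def)
  next
   case False
   then have "(b+a) powr \<beta> <= 1" using ab a powr_mono2'[of \<beta> 1 "b+a"] by auto
   then show ?thesis by (simp add: K_def)
  qed
  then have "(1 - (a^2+y^2)) powr \<beta> <= K * (b-a) powr \<beta>"
   using ab a unfolding e by (simp add: powr_mult mult.commute mult_right_mono)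
  then have "ennreal ((1 - (a^2 + y^2)) powr \<beta>) <= g (b - a)"
   using ab d by (auto simp: g_def indicator_def intro!: ennreal_leI)
  moreover have "g (b - a) <= g (b - x) + g (b + x)"
   by (cases "x >= 0") (auto simp: a_def)
  ultimately show ?thesis using True by (auto simp: a_def)
 qed simp
 have "(LEB x. ennreal ((1 - (x^2 + y^2)) powr \<beta>) * indicator A x) <= (LEB x. g (b - x) + g (b + x))"
  by (intro nn_integral_mono point)
 also have "... = (LEB x. g (b - x)) + (LEB x. g (b + x))"
  by (intro nn_integral_add) auto
 also have "... = (LEB x. g x) + (LEB x. g x)"
  using nn_integral_real_affine[of g "-1" b] nn_integral_real_affine[of g 1 b] by simp
 also have "... = ennreal (2 * (K * ((2 * \<delta>) powr (\<beta>+1) / (\<beta>+1))))"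
  unfolding g using K assms by (simp add: ennreal_plus[symmetric] del: ennreal_plus)
 finally show ?thesis by (simp add: K_def)
qed


text \<open>The bound of \<open>slice_bound\<close> at \<delta> = 1; the power \<delta>^(\<beta>+1)
  is split off.\<close>

definition mball :: "real => real" where "mball \<beta> = 2 * (max 1 (2 powr \<beta>) * (2 powr (\<beta>+1) / (\<beta>+1)))"

lemma mball_nonneg: "\<beta> > -1 ==> mball \<beta> >= 0" by (simp add: mball_def)

text \<open>\<open>F\<close> is either order of the coordinates, so that one integration over slices
  serves horizontal and vertical strips alike.\<close>

lemma strip_bound:
 fixes \<beta> \<delta> r c :: real and F :: "real => real => complex"
 assumes b: "\<beta> > -1" and d: "\<delta> > 0" and r: "r >= 0"
  and F: "F = Complex \<or> F = (%x y. Complex y x)"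
 defines "A \<equiv> {p. \<bar>fst p\<bar> >= 1/2 \<and> (fst p)^2 + (snd p)^2 < 1 \<and> 1 - \<delta> <= sqrt ((fst p)^2+(snd p)^2) \<and> \<bar>snd p - c\<bar> <= r}"
 shows "(LEB y. (LEB x. ennreal (wdens \<beta> (F x y)) * indicator A (x, y)))
   <= ennreal ((\<beta>+1) / pi * mball \<beta> * (2 * r) * \<delta> powr (\<beta>+1))"
proof -
 have n: "(norm (F x y))^2 = x^2 + y^2" for x y using F by (auto simp: cmod_power2)
 define K where "K = (\<beta>+1) / pi * (2 * (max 1 (2 powr \<beta>) * ((2 * \<delta>) powr (\<beta>+1) / (\<beta>+1))))"
 have K: "K >= 0" using b by (auto simp: K_def)
 have K2: "K = (\<beta>+1) / pi * mball \<beta> * \<delta> powr (\<beta>+1)"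
  using d by (simp add: K_def mball_def powr_mult)
 have inner: "(LEB x. ennreal (wdens \<beta> (F x y)) * indicator A (x, y)) <= ennreal K * indicator {c-r..c+r} y" for y
 proof (cases "y \<in> {c-r..c+r}")
  case False
  then have "indicator A (x, y) = (0::ennreal)" for x by (auto simp: A_def indicator_def)
  then show ?thesis using False by simp
 next
  case True
  define A' where "A' = {x::real. \<bar>x\<bar> >= 1/2 \<and> x^2 + y^2 < 1 \<and> 1 - \<delta> <= sqrt (x^2+y^2)}"
  have [measurable]: "A' \<in> sets borel" unfolding A'_def by measurable
  have "(LEB x. ennreal (wdens \<beta> (F x y)) * indicator A (x, y))
    = (LEB x. ennreal ((\<beta>+1)/pi) * (ennreal ((1 - (x^2 + y^2)) powr \<beta>) * indicator A' x))"
  proof (intro nn_integral_cong)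
   fix x
   have "ennreal (wdens \<beta> (F x y)) = ennreal ((\<beta>+1)/pi) * ennreal ((1 - (x^2 + y^2)) powr \<beta>)"
    using b unfolding wdens_def n by (subst ennreal_mult[symmetric]) (auto simp: field_simps)
   moreover have "indicator A (x, y) = (indicator A' x :: ennreal)"
    using True by (auto simp: A_def A'_def indicator_def abs_le_iff)
   ultimately show "ennreal (wdens \<beta> (F x y)) * indicator A (x, y) = ennreal ((\<beta>+1)/pi) * (ennreal ((1 - (x^2 + y^2)) powr \<beta>) * indicator A' x)"
    by (simp add: mult.assoc)
  qed
  also have "... = ennreal ((\<beta>+1)/pi) * (LEB x. (ennreal ((1 - (x^2 + y^2)) powr \<beta>) * indicator A' x))"
   by (rule nn_integral_cmult) auto
  also have "... <= ennreal ((\<beta>+1)/pi) * ennreal (2 * (max 1 (2 powr \<beta>) * ((2 * \<delta>) powr (\<beta>+1) / (\<beta>+1))))"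
   unfolding A'_def by (intro mult_left_mono slice_bound b d) auto
  also have "... = ennreal K" using b unfolding K_def by (subst ennreal_mult[symmetric]) auto
  finally show ?thesis using True by simp
 qed
 have "(LEB y. (LEB x. ennreal (wdens \<beta> (F x y)) * indicator A (x, y))) <= (LEB y. ennreal K * indicator {c-r..c+r} y)"
  by (intro nn_integral_mono inner)
 also have "... = ennreal K * ennreal (2 * r)"
  using r by (simp add: nn_integral_cmult_indicator)
 also have "... = ennreal (K * (2 * r))" using K r by (simp add: ennreal_mult)
 also have "K * (2 * r) = (\<beta>+1) / pi * mball \<beta> * (2 * r) * \<delta> powr (\<beta>+1)" by (simp add: K2)
 finally show ?thesis .
qed

lemma dA_annulus_piece:
 assumes b: "\<beta> > -1" and d: "0 < \<delta>" "\<delta> <= 1/4" and r: "r >= 0"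
 shows "emeasure (dA \<beta>) {z. 1 - \<delta> <= norm z \<and> \<bar>Re z - Re c\<bar> <= r \<and> \<bar>Im z - Im c\<bar> <= r}
   <= ennreal ((\<beta>+1) / pi * mball \<beta> * (4 * r) * \<delta> powr (\<beta>+1))"
proof -
 let ?S = "{z. 1 - \<delta> <= norm z \<and> \<bar>Re z - Re c\<bar> <= r \<and> \<bar>Im z - Im c\<bar> <= r}"
 define A where "A c = {p. \<bar>fst p\<bar> >= 1/2 \<and> (fst p)^2 + (snd p)^2 < 1 \<and> 1 - \<delta> <= sqrt ((fst p)^2+(snd p)^2) \<and> \<bar>snd p - c\<bar> <= r}" for c :: real
 have [measurable]: "A c \<in> sets (borel \<Otimes>\<^sub>M borel)" for c
 proof -
  have "A c = {p \<in> space (borel \<Otimes>\<^sub>M borel). \<bar>fst p\<bar> >= 1/2 \<and> (fst p)^2 + (snd p)^2 < 1 \<and> 1 - \<delta> <= sqrt ((fst p)^2+(snd p)^2) \<and> \<bar>snd p - c\<bar> <= r}"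
   by (auto simp: A_def space_pair_measure)
  also have "... \<in> sets (borel \<Otimes>\<^sub>M borel)" by measurable
  finally show ?thesis .
 qed
 have [measurable]: "?S \<in> sets borel" by measurable
 let ?f1 = "%z. ennreal (wdens \<beta> z) * indicator (A (Im c)) (Re z, Im z)"
 let ?f2 = "%z. ennreal (wdens \<beta> z) * indicator (A (Re c)) (Im z, Re z)"
 have [measurable]: "?f1 \<in> borel_fun" "?f2 \<in> borel_fun" by measurable
 have pt: "indicator ?S z * ennreal (wdens \<beta> z) * indicator (ball 0 1) z <= ?f1 z + ?f2 z" for z
 proof (cases "z \<in> ?S \<inter> ball 0 1")
  case True
  then have *: "1 - \<delta> <= norm z" "norm z < 1" by auto
  have n: "norm z = sqrt ((Re z)^2 + (Im z)^2)" by (simp add: cmod_def)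
  have l: "(Re z)^2 + (Im z)^2 < 1" "1 - \<delta> <= sqrt ((Re z)^2 + (Im z)^2)" "1 - \<delta> <= sqrt ((Im z)^2 + (Re z)^2)" using * by (auto simp: n add.commute)
  \<comment> \<open>Two coordinates below 1/2 would give |z|^2 < 1/2 < (3/4)^2, whereas \<delta>
    \<le> 1/4 forces |z| \<ge> 3/4. Hence slicing along one of the two axes is always
    available.\<close>
  have "\<bar>Re z\<bar> >= 1/2 \<or> \<bar>Im z\<bar> >= 1/2"
  proof (rule ccontr)
   assume "\<not> ?thesis"
   then have "\<bar>Re z\<bar>^2 < (1/2)^2" "\<bar>Im z\<bar>^2 < (1/2)^2"
    by (intro power_strict_mono; simp)+
   then have "(norm z)^2 < (3/4)^2" unfolding cmod_power2 by (simp add: power2_eq_square)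
   then have "norm z < 3/4" by (rule power2_less_imp_less) auto
   then show False using * d by simp
  qed
  then have "(Re z, Im z) \<in> A (Im c) \<or> (Im z, Re z) \<in> A (Re c)" using True l by (auto simp: A_def add.commute)
  then show ?thesis using True by (auto simp: indicator_def)
 qed (auto simp: indicator_def)
 have "emeasure (dA \<beta>) ?S = (\<integral>\<^sup>+z. indicator ?S z \<partial>dA \<beta>)" by simp
 also have "... = (LEB z. indicator ?S z * ennreal (wdens \<beta> z) * indicator (ball 0 1) z)"
  by (rule nn_integral_dA) simp
 also have "... <= (LEB z. ?f1 z + ?f2 z)" by (intro nn_integral_mono pt)
 also have "... = (LEB z. ?f1 z) + (LEB z. ?f2 z)" by (intro nn_integral_add) auto
 also have "(LEB z. ?f1 z) <= ennreal ((\<beta>+1) / pi * mball \<beta> * (2 * r) * \<delta> powr (\<beta>+1))"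
  by (subst nn_integral_lborel_complex(2), simp) (use strip_bound[OF b d(1) r, of Complex "Im c"] in \<open>simp add: A_def\<close>)
 also have "(LEB z. ?f2 z) <= ennreal ((\<beta>+1) / pi * mball \<beta> * (2 * r) * \<delta> powr (\<beta>+1))"
  by (subst nn_integral_lborel_complex(1), simp) (use strip_bound[OF b d(1) r, of "%x y. Complex y x" "Re c"] in \<open>simp add: A_def\<close>)
 also have "ennreal ((\<beta>+1) / pi * mball \<beta> * (2 * r) * \<delta> powr (\<beta>+1)) + ennreal ((\<beta>+1) / pi * mball \<beta> * (2 * r) * \<delta> powr (\<beta>+1))
  = ennreal ((\<beta>+1) / pi * mball \<beta> * (4 * r) * \<delta> powr (\<beta>+1))"
  (is "ennreal ?a + _ = _")
 proof -
  have "?a >= 0" using b r mball_nonneg[OF b] by (intro mult_nonneg_nonneg divide_nonneg_pos) auto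
  then have "ennreal ?a + ennreal ?a = ennreal (?a + ?a)" by (intro ennreal_plus[symmetric])
  also have "?a + ?a = (\<beta>+1) / pi * mball \<beta> * (4 * r) * \<delta> powr (\<beta>+1)" by simp
  finally show ?thesis .
 qed
 finally show ?thesis by (auto intro: add_mono)
qed


text \<open>For \<beta> < 0 the density is unbounded, so the outer annulus is left to
  \<open>dA_annulus_piece\<close>; on |z| \<le> 3/4 one has 7/16 \<le> 1 - |z|^2 \<le> 1 and the
  density is bounded.\<close>

lemma finite_dA:
 assumes b: "\<beta> > -1"
 shows "emeasure (dA \<beta>) UNIV < \<infinity>"
proof -
 let ?A = "{z::complex. 1 - 1/4 <= norm z \<and> \<bar>Re z - Re 0\<bar> <= 1 \<and> \<bar>Im z - Im 0\<bar> <= 1}"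
 let ?B = "{z::complex. norm z <= 3/4}"
 let ?C = "{z::complex. norm z >= 1}"
 have [measurable]: "?A \<in> sets borel" "?B \<in> sets borel" "?C \<in> sets borel" by measurable
 define K where "K = (\<beta>+1) / pi * max 1 ((7/16) powr \<beta>)"
 have K: "K >= 0" using b by (auto simp: K_def)
 have "UNIV \<subseteq> ?A \<union> ?B \<union> ?C"
 proof
  fix z :: complex
  show "z \<in> ?A \<union> ?B \<union> ?C" using abs_Re_le_cmod[of z] abs_Im_le_cmod[of z] by auto
 qed
 then have "emeasure (dA \<beta>) UNIV <= emeasure (dA \<beta>) (?A \<union> ?B \<union> ?C)"
  by (intro emeasure_mono) auto
 also have "... <= emeasure (dA \<beta>) (?A \<union> ?B) + emeasure (dA \<beta>) ?C" by (intro emeasure_subadditive) auto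
 also have "emeasure (dA \<beta>) (?A \<union> ?B) <= emeasure (dA \<beta>) ?A + emeasure (dA \<beta>) ?B" by (intro emeasure_subadditive) auto
 also have "emeasure (dA \<beta>) ?C = (\<integral>\<^sup>+z. indicator ?C z \<partial>dA \<beta>)" by simp
 also have "... = (\<integral>\<^sup>+(z::complex). 0 \<partial>lborel)"
  by (subst nn_integral_dA, simp, rule nn_integral_cong) (auto split: split_indicator)
 finally have le: "emeasure (dA \<beta>) UNIV <= emeasure (dA \<beta>) ?A + emeasure (dA \<beta>) ?B" by (simp add: add_mono)
 have A: "emeasure (dA \<beta>) ?A < \<infinity>"
  using dA_annulus_piece[OF b, of "1/4" 1 0] by (auto simp: top_unique le_less_trans[OF _ ennreal_less_top])
 have "emeasure (dA \<beta>) ?B = (\<integral>\<^sup>+z. indicator ?B z \<partial>dA \<beta>)" by simp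
 also have "... = (LEB z. indicator ?B z * ennreal (wdens \<beta> z) * indicator (ball 0 1) z)"
  by (rule nn_integral_dA) simp
 also have "... <= (LEB z. ennreal K * indicator (ball (0::complex) 1) z)"
 proof (intro nn_integral_mono)
  fix z :: complex
  show "indicator ?B z * ennreal (wdens \<beta> z) * indicator (ball 0 1) z <= ennreal K * indicator (ball (0::complex) 1) z"
  proof (cases "norm z <= 3/4")
   case True
   then have "(norm z)^2 <= (3/4)^2" by (intro power_mono) auto
   then have z: "7/16 <= 1 - (norm z)^2" "1 - (norm z)^2 <= 1" by (auto simp: power2_eq_square)
   have "(1 - (norm z)^2) powr \<beta> <= max 1 ((7/16) powr \<beta>)"
   proof (cases "\<beta> >= 0")
    case True
    then show ?thesis using powr_mono2[of \<beta> "1 - (norm z)^2" 1] z by auto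
   next
    case False
    then show ?thesis using powr_mono2'[of \<beta> "7/16" "1 - (norm z)^2"] z by auto
   qed
   then have "wdens \<beta> z <= K" using b unfolding wdens_def K_def
    by (simp add: divide_right_mono mult_left_mono)
   then show ?thesis by (auto simp: indicator_def intro!: ennreal_leI)
  qed (auto simp: indicator_def)
 qed
 also have "... = ennreal K * emeasure lborel (ball (0::complex) 1)" by (simp add: nn_integral_cmult_indicator)
 also have "... < \<infinity>" by (simp add: ennreal_mult_less_top emeasure_ball)
 finally have "emeasure (dA \<beta>) ?A + emeasure (dA \<beta>) ?B < \<infinity>" using A by simp
 then show ?thesis using le by (rule le_less_trans[rotated])
qed

section \<open>The normalized arc measure\<close>

lemma sets_arc [measurable_cong, simp]: "sets arc_measure = sets borel"
 by (simp add: arc_measure_def)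

lemma space_arc [simp]: "space arc_measure = UNIV"
 by (simp add: arc_measure_def)

lemma cis_measurable [measurable]: "cis \<in> borel_fun"
 by (intro borel_measurable_continuous_onI continuous_intros)

lemma nn_integral_arc:
 assumes [measurable]: "f \<in> borel_fun"
 shows "(ARC z. f z) = (LEB t. f (cis t) * indicator {0..2*pi} t) / ennreal (2*pi)"
 unfolding arc_measure_def
 by (subst nn_integral_distr) (auto simp: nn_integral_uniform_measure)

lemma emeasure_arc:
 assumes [measurable]: "A \<in> sets borel"
 shows "emeasure arc_measure A = emeasure lborel {t\<in>{0..2*pi}. cis t \<in> A} / ennreal (2*pi)"
proof -
 have "{t\<in>{0..2*pi}. cis t \<in> A} = {t \<in> space borel. 0 <= t \<and> t <= 2*pi \<and> cis t \<in> A}" by auto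
 also have "... \<in> sets borel" by measurable
 finally have [measurable]: "{t\<in>{0..2*pi}. cis t \<in> A} \<in> sets borel" .
 have "emeasure arc_measure A = (ARC z. indicator A z)" by simp
 also have "... = (LEB t. indicator {t\<in>{0..2*pi}. cis t \<in> A} t) / ennreal (2*pi)"
  by (subst nn_integral_arc, simp, rule arg_cong2[where f="(/)"], rule nn_integral_cong) (auto split: split_indicator)
 also have "... = emeasure lborel {t\<in>{0..2*pi}. cis t \<in> A} / ennreal (2*pi)" by simp
 finally show ?thesis .
qed

lemma arc_prob: "emeasure arc_measure UNIV = 1"
proof -
 have "{t\<in>{0..2*pi}. cis t \<in> UNIV} = {0..2*pi}" by auto
 then show ?thesis by (subst emeasure_arc) (auto simp: ennreal_divide_self)
qed

lemma sin_ge_half: "0 <= t ==> t <= pi/2 ==> t/2 <= sin t"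
proof (cases "t <= pi/3")
 case True
 assume t: "0 <= t"
 have "sin 0 - 0/2 <= sin t - t/2"
 proof (rule DERIV_nonneg_imp_nondecreasing[OF t])
  fix x assume x: "0 <= x" "x <= t"
  have "cos (pi/3) <= cos x" using x True pi_gt_zero by (intro cos_monotone_0_pi_le) auto
  then show "\<exists>y. ((%a. sin a - a/2) has_real_derivative y) (at x) \<and> 0 <= y"
   by (intro exI[of _ "cos x - 1/2"]) (auto intro!: derivative_eq_intros simp: cos_60)
 qed
 then show ?thesis by simp
next
 case False
 assume t: "0 <= t" "t <= pi/2"
 have "sin (pi/3) <= sin t" using False t pi_gt_zero by (intro sin_monotone_2pi_le) auto
 moreover have "sqrt 3 >= 17/10" by (rule real_le_rsqrt) (auto simp: power2_eq_square)
 ultimately show ?thesis using t pi_less_4 pi_approx by (simp add: sin_60)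
qed

lemma norm_cis_diff: "norm (cis a - cis b) = 2 * \<bar>sin ((a - b)/2)\<bar>"
proof -
 have "(norm (cis a - cis b))^2 = (2 * \<bar>sin ((a - b)/2)\<bar>)^2"
 proof -
  have "(norm (cis a - cis b))^2 = (cos a)^2 + (sin a)^2 + ((cos b)^2 + (sin b)^2) - 2 * (cos a * cos b + sin a * sin b)"
   by (simp only: cmod_power2) (simp add: power2_eq_square algebra_simps)
  also have "... = 2 - 2 * cos (a - b)" by (simp add: cos_diff)
  also have "... = (2 * \<bar>sin ((a - b)/2)\<bar>)^2"
  proof -
   have "2 * ((a - b)/2) = a - b" by simp
   then have "cos (a - b) = 1 - 2 * (sin ((a - b)/2))^2" using cos_double_sin[of "(a - b)/2"] by metis
   then show ?thesis by (simp add: power_mult_distrib)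
  qed
  finally show ?thesis .
 qed
 then show ?thesis by (rule power2_eq_imp_eq) auto
qed


lemma norm_cis_diff_le: "norm (cis a - cis b) <= \<bar>a - b\<bar>"
 unfolding norm_cis_diff using abs_sin_x_le_abs_x[of "(a-b)/2"] by simp

text \<open>The left side is the length of the shorter arc between the two points; a chord is at
  least half of it, by \<open>sin_ge_half\<close>.\<close>

lemma norm_cis_diff_ge:
 assumes "\<bar>a - b\<bar> <= 2 * pi"
 shows "min \<bar>a - b\<bar> (2*pi - \<bar>a - b\<bar>) <= 2 * norm (cis a - cis b)"
proof -
 define t where "t = \<bar>a - b\<bar>/2"
 have t: "0 <= t" "t <= pi" using assms by (auto simp: t_def)
 have "\<bar>sin ((a-b)/2)\<bar> = sin t"
 proof -
  have "(a-b)/2 = t \<or> (a-b)/2 = -t" by (auto simp: t_def abs_if)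
  then show ?thesis using t sin_ge_zero[of t] by auto
 qed
 moreover have "min t (pi - t) / 2 <= sin t"
  using sin_ge_half[of t] sin_ge_half[of "pi - t"] t by (cases "t <= pi/2") (auto simp: min_def)
 ultimately show ?thesis unfolding norm_cis_diff by (auto simp: t_def min_def split: if_splits)
qed

lemma arc_ball_upper:
 assumes d: "\<delta> > 0"
 shows "emeasure arc_measure {z. norm (z - c) <= \<delta>} <= ennreal (4 * \<delta>)"
proof -
 let ?A = "{t\<in>{0..2*pi}. cis t \<in> {z. norm (z - c) <= \<delta>}}"
 have "emeasure lborel ?A <= ennreal (16 * \<delta>)"
 proof (cases "?A = {}")
  case False
  then obtain b where b: "b \<in> {0..2*pi}" "norm (cis b - c) <= \<delta>" by auto
  \<comment> \<open>The centre c need not lie on the circle, so distances are measured from a point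
    b of the set itself. The two end intervals catch parameters that are close to b across the cut
    between 0 and 2 pi.\<close>
  have "?A \<subseteq> {b - 4*\<delta>..b + 4*\<delta>} \<union> {0..4*\<delta>} \<union> {2*pi-4*\<delta>..2*pi}"
  proof
   fix a assume "a \<in> ?A"
   then have a: "a \<in> {0..2*pi}" "norm (cis a - c) <= \<delta>" by auto
   have "norm (cis a - cis b) <= 2 * \<delta>"
    using norm_triangle_ineq4[of "cis a - c" "cis b - c"] a b by simp
   moreover have "\<bar>a - b\<bar> <= 2*pi" using a b by auto
   ultimately have "min \<bar>a - b\<bar> (2*pi - \<bar>a - b\<bar>) <= 4*\<delta>" using norm_cis_diff_ge[of a b] by linarith
   then show "a \<in> {b - 4*\<delta>..b + 4*\<delta>} \<union> {0..4*\<delta>} \<union> {2*pi-4*\<delta>..2*pi}" using a b by (auto simp: min_def abs_if split: if_splits)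
  qed
  then have "emeasure lborel ?A <= emeasure lborel ({b - 4*\<delta>..b + 4*\<delta>} \<union> {0..4*\<delta>} \<union> {2*pi-4*\<delta>..2*pi})"
   by (intro emeasure_mono) auto
  also have "... <= emeasure lborel ({b - 4*\<delta>..b + 4*\<delta>} \<union> {0..4*\<delta>}) + emeasure lborel {2*pi-4*\<delta>..2*pi}"
   by (intro emeasure_subadditive) auto
  also have "... <= emeasure lborel {b - 4*\<delta>..b + 4*\<delta>} + emeasure lborel {0..4*\<delta>} + emeasure lborel {2*pi-4*\<delta>..2*pi}"
   by (intro add_mono emeasure_subadditive) auto
  also have "... = ennreal (16 * \<delta>)" using d by (simp add: ennreal_plus[symmetric] del: ennreal_plus)
  finally show ?thesis .
 next
  case True
  show ?thesis unfolding True by simp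
 qed
 then have "emeasure arc_measure {z. norm (z - c) <= \<delta>} <= ennreal (16 * \<delta>) / ennreal (2 * pi)"
  by (subst emeasure_arc) (auto intro!: divide_right_mono_ennreal)
 also have "... = ennreal (16 * \<delta> / (2 * pi))" using d by (simp add: divide_ennreal)
 also have "... <= ennreal (4 * \<delta>)" using d pi_gt3 by (intro ennreal_leI) (auto simp: field_simps)
 finally show ?thesis .
qed

lemma arc_ball_lower:
 assumes d: "\<delta> > 0" "\<delta> <= 1" and xi: "norm \<xi> = 1"
 shows "ennreal (\<delta> / (2*pi)) <= emeasure arc_measure (ball \<xi> \<delta>)"
proof -
 obtain b where b: "\<xi> = cis b" "0 <= b" "b < 2*pi"
  using xi Arg2pi_ge_0 Arg2pi_lt_2pi by (metis Arg2pi_eq cis_conv_exp mult_1 of_real_1)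
 \<comment> \<open>A one-sided interval at b, pointing towards the interior of [0, 2 pi]; as
   \<delta> \<le> 1 < pi it does not leave the parameter range.\<close>
 define J where "J = (if b <= pi then {b<..<b+\<delta>} else {b-\<delta><..<b})"
 have J: "emeasure lborel J = ennreal \<delta>" "J \<in> sets borel" using d by (auto simp: J_def)
 have sub: "J \<subseteq> {t\<in>{0..2*pi}. cis t \<in> ball \<xi> \<delta>}"
 proof
  fix t assume t: "t \<in> J"
  then have "norm (cis b - cis t) < \<delta>" using norm_cis_diff_le[of b t] by (auto simp: J_def split: if_splits)
  moreover have "t \<in> {0..2*pi}" using t b d pi_gt3 by (auto simp: J_def split: if_splits)
  ultimately show "t \<in> {t\<in>{0..2*pi}. cis t \<in> ball \<xi> \<delta>}" by (auto simp: b dist_norm)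
 qed
 have m: "{t\<in>{0..2*pi}. cis t \<in> ball \<xi> \<delta>} \<in> sets lborel"
 proof -
  have "{t\<in>{0..2*pi}. cis t \<in> ball \<xi> \<delta>} = {t \<in> space borel. 0 <= t \<and> t <= 2*pi \<and> norm (\<xi> - cis t) < \<delta>}" by (auto simp: dist_norm)
  also have "... \<in> sets borel" by measurable
  finally show ?thesis by simp
 qed
 have "ennreal \<delta> <= emeasure lborel {t\<in>{0..2*pi}. cis t \<in> ball \<xi> \<delta>}"
  using emeasure_mono[OF sub m] J by simp
 then have "ennreal \<delta> / ennreal (2*pi) <= emeasure arc_measure (ball \<xi> \<delta>)"
  by (subst emeasure_arc) (auto intro!: divide_right_mono_ennreal)
 then show ?thesis using d by (simp add: divide_ennreal)
qed

section \<open>One coordinate measure for both spaces: mass of shells and boxes at the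
  circle\<close>

definition mm :: "real => complex measure" where "mm \<beta> = (if \<beta> = -1 then arc_measure else dA \<beta>)"

lemma sets_mm [measurable_cong, simp]: "sets (mm \<beta>) = sets borel"
 by (simp add: mm_def)

lemma space_mm [simp]: "space (mm \<beta>) = UNIV"
 by (simp add: mm_def)

lemma finite_mm: "\<beta> >= -1 ==> emeasure (mm \<beta>) UNIV < \<infinity>"
 using finite_dA[of \<beta>] by (auto simp: mm_def arc_prob)

text \<open>A shell of width \<delta> has mass of order \<delta>^(\<beta>+1), and confining the
  argument to length \<delta> gains one more power. At \<beta> = -1 the shell bound is trivial and
  the box bound is arc length, so both spaces share the exponents \<beta>+2 and \<beta>+1. For
  \<delta> > 1/4 and \<beta> > -1 the total mass suffices, since (4\<delta>)^p \<ge> 1.\<close>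

lemma mm_shell_box:
 assumes b: "\<beta> >= -1"
 obtains C where "C > 0"
  "\<And>c \<delta>. \<delta> > 0 ==> emeasure (mm \<beta>) {z. 1 - \<delta> <= norm z \<and> norm (z - c) <= \<delta>} <= ennreal (C * \<delta> powr (\<beta>+2))"
  "\<And>\<delta>. \<delta> > 0 ==> emeasure (mm \<beta>) {z. 1 - \<delta> <= norm z} <= ennreal (C * \<delta> powr (\<beta>+1))"
proof (cases "\<beta> = -1")
 case True
 show ?thesis
 proof (rule that[of 4])
  fix c :: complex and \<delta> :: real assume d: "\<delta> > 0"
  have "emeasure (mm \<beta>) {z. 1 - \<delta> <= norm z \<and> norm (z - c) <= \<delta>} <= emeasure arc_measure {z. norm (z - c) <= \<delta>}"
   using True unfolding mm_def by (auto intro!: emeasure_mono)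
  also have "... <= ennreal (4 * \<delta>)" by (rule arc_ball_upper[OF d])
  finally show "emeasure (mm \<beta>) {z. 1 - \<delta> <= norm z \<and> norm (z - c) <= \<delta>} <= ennreal (4 * \<delta> powr (\<beta>+2))"
   using True d by simp
 next
  fix \<delta> :: real assume d: "\<delta> > 0"
  have "emeasure (mm \<beta>) {z. 1 - \<delta> <= norm z} <= emeasure arc_measure UNIV"
   using True unfolding mm_def by (auto intro!: emeasure_mono)
  also have "... <= ennreal (4 * \<delta> powr (\<beta>+1))" using True d by (simp add: arc_prob)
  finally show "emeasure (mm \<beta>) {z. 1 - \<delta> <= norm z} <= ennreal (4 * \<delta> powr (\<beta>+1))" .
 qed simp
next
 case False
 then have b: "\<beta> > -1" using b by auto
 have mm: "mm \<beta> = dA \<beta>" using False by (simp add: mm_def)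
 obtain M where M: "emeasure (dA \<beta>) UNIV = ennreal M" "M >= 0"
  using finite_dA[OF b] by (metis ennreal_cases infinity_ennreal_def less_irrefl)
 define L where "L = (\<beta>+1) / pi * mball \<beta> * 4"
 have L: "L >= 0" using b by (auto simp: L_def mball_def)
 define C where "C = L + M * 4 powr (\<beta>+2) + 1"
 have C: "C > 0" "L <= C" "M * 4 powr (\<beta>+2) <= C" "M * 4 powr (\<beta>+1) <= C"
 proof -
  have "M * 4 powr (\<beta>+1) <= M * 4 powr (\<beta>+2)" using M by (intro mult_left_mono powr_mono) auto
  then show "C > 0" "L <= C" "M * 4 powr (\<beta>+2) <= C" "M * 4 powr (\<beta>+1) <= C"
   using L M unfolding C_def by (auto simp: add_nonneg_pos)
 qed
 have large: "emeasure (dA \<beta>) A <= ennreal (C * \<delta> powr p)" if "\<delta> > 1/4" "p >= 0" "M * 4 powr p <= C" for A \<delta> p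
 proof -
  have "emeasure (dA \<beta>) A <= ennreal (M * 1)" using emeasure_space[of "dA \<beta>" A] M by simp
  also have "M * 1 <= M * (4 * \<delta>) powr p" using that M by (intro mult_left_mono ge_one_powr_ge_zero) auto
  also have "... = M * 4 powr p * \<delta> powr p" using that by (simp add: powr_mult)
  also have "... <= C * \<delta> powr p" using that by (intro mult_right_mono) auto
  finally show ?thesis by (meson ennreal_leI order_trans)
 qed
 show ?thesis
 proof (rule that[OF C(1)])
  fix c :: complex and \<delta> :: real assume d: "\<delta> > 0"
  show "emeasure (mm \<beta>) {z. 1 - \<delta> <= norm z \<and> norm (z - c) <= \<delta>} <= ennreal (C * \<delta> powr (\<beta>+2))"
  proof (cases "\<delta> <= 1/4")
   case True
   have "emeasure (dA \<beta>) {z. 1 - \<delta> <= norm z \<and> norm (z - c) <= \<delta>} <= emeasure (dA \<beta>) {z. 1 - \<delta> <= norm z \<and> \<bar>Re z - Re c\<bar> <= \<delta> \<and> \<bar>Im z - Im c\<bar> <= \<delta>}"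
   proof (intro emeasure_mono subsetI CollectI)
    fix z assume "z \<in> {z. 1 - \<delta> <= norm z \<and> norm (z - c) <= \<delta>}"
    then show "1 - \<delta> <= norm z \<and> \<bar>Re z - Re c\<bar> <= \<delta> \<and> \<bar>Im z - Im c\<bar> <= \<delta>"
     using abs_Re_le_cmod[of "z - c"] abs_Im_le_cmod[of "z - c"] by auto
   qed simp
   also have "... <= ennreal ((\<beta>+1) / pi * mball \<beta> * (4 * \<delta>) * \<delta> powr (\<beta>+1))"
    using d True by (intro dA_annulus_piece b) auto
   also have "(\<beta>+1) / pi * mball \<beta> * (4 * \<delta>) * \<delta> powr (\<beta>+1) = L * \<delta> powr (\<beta>+2)"
    using d powr_add[of \<delta> "\<beta>+1" 1] by (simp add: L_def field_simps)
   also have "... <= C * \<delta> powr (\<beta>+2)" using C by (intro mult_right_mono) auto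
   finally show ?thesis unfolding mm by (meson ennreal_leI order_trans)
  next
   case False
   then show ?thesis unfolding mm using C b by (intro large) auto
  qed
 next
  fix \<delta> :: real assume d: "\<delta> > 0"
  show "emeasure (mm \<beta>) {z. 1 - \<delta> <= norm z} <= ennreal (C * \<delta> powr (\<beta>+1))"
  proof (cases "\<delta> <= 1/4")
   case True
   let ?C = "{z::complex. norm z >= 1}"
   have C0: "emeasure (dA \<beta>) ?C = 0"
   proof -
    have "emeasure (dA \<beta>) ?C = (\<integral>\<^sup>+z. indicator ?C z \<partial>dA \<beta>)" by simp
    also have "... = (\<integral>\<^sup>+(z::complex). 0 \<partial>lborel)"
     by (subst nn_integral_dA, simp, rule nn_integral_cong) (auto split: split_indicator)
    finally show ?thesis by simp
   qed
   have "emeasure (dA \<beta>) {z. 1 - \<delta> <= norm z} <= emeasure (dA \<beta>) ({z. 1 - \<delta> <= norm z \<and> \<bar>Re z - Re 0\<bar> <= 1 \<and> \<bar>Im z - Im 0\<bar> <= 1} \<union> ?C)"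
   proof (intro emeasure_mono subsetI)
    fix z :: complex assume "z \<in> {z. 1 - \<delta> <= norm z}"
    then show "z \<in> {z. 1 - \<delta> <= norm z \<and> \<bar>Re z - Re 0\<bar> <= 1 \<and> \<bar>Im z - Im 0\<bar> <= 1} \<union> ?C"
     using abs_Re_le_cmod[of z] abs_Im_le_cmod[of z] by auto
   qed simp
   also have "... <= emeasure (dA \<beta>) {z. 1 - \<delta> <= norm z \<and> \<bar>Re z - Re 0\<bar> <= 1 \<and> \<bar>Im z - Im 0\<bar> <= 1} + emeasure (dA \<beta>) ?C"
    by (intro emeasure_subadditive) auto
   also have "... <= ennreal ((\<beta>+1) / pi * mball \<beta> * (4 * 1) * \<delta> powr (\<beta>+1))"
    unfolding C0 add_0_right using d True by (intro dA_annulus_piece b) auto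
   also have "(\<beta>+1) / pi * mball \<beta> * (4 * 1) * \<delta> powr (\<beta>+1) = L * \<delta> powr (\<beta>+1)"
    by (simp add: L_def)
   also have "... <= C * \<delta> powr (\<beta>+1)" using C by (intro mult_right_mono) auto
   finally show ?thesis unfolding mm by (meson ennreal_leI order_trans)
  next
   case False
   then show ?thesis unfolding mm using C b by (intro large) auto
  qed
 qed
qed


text \<open>For \<beta> > -1 the disc of radius \<delta>/4 about (1 - \<delta>/2)\<xi> lies inside
  \<open>ball \<xi> \<delta>\<close>, and on it \<delta>/4 \<le> 1 - |z|^2 \<le> 2\<delta>;
  \<open>k\<close> takes the worse end according to the sign of \<beta>.\<close>

lemma mm_ball_lower:
 assumes b: "\<beta> >= -1"
 obtains c where "c > 0"
  "\<And>\<xi> \<delta>. norm \<xi> = 1 ==> 0 < \<delta> ==> \<delta> <= 1 ==> ennreal (c * \<delta> powr (\<beta>+2)) <= emeasure (mm \<beta>) (ball \<xi> \<delta>)"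
proof (cases "\<beta> = -1")
 case True
 show ?thesis
 proof (rule that[of "1/(2*pi)"])
  fix \<xi> :: complex and \<delta> :: real assume d: "norm \<xi> = 1" "0 < \<delta>" "\<delta> <= 1"
  show "ennreal (1/(2*pi) * \<delta> powr (\<beta>+2)) <= emeasure (mm \<beta>) (ball \<xi> \<delta>)"
   using arc_ball_lower[OF d(2,3,1)] True d by (simp add: mm_def)
 qed simp
next
 case False
 then have b: "\<beta> > -1" using b by auto
 have mm: "mm \<beta> = dA \<beta>" using False by (simp add: mm_def)
 define k where "k = min ((1/4) powr \<beta>) (2 powr \<beta>)"
 define c where "c = (\<beta>+1) / 16 * k"
 have k: "k > 0" by (simp add: k_def)
 have c: "c > 0" using b k by (simp add: c_def)
 show ?thesis
 proof (rule that[OF c])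
  fix \<xi> :: complex and \<delta> :: real assume d: "norm \<xi> = 1" "0 < \<delta>" "\<delta> <= 1"
  define p where "p = complex_of_real (1 - \<delta>/2) * \<xi>"
  have np: "norm p = 1 - \<delta>/2" using d by (simp add: p_def norm_mult del: of_real_diff of_real_divide)
  have pd: "norm (p - \<xi>) = \<delta>/2"
  proof -
   have "p - \<xi> = complex_of_real (- \<delta>/2) * \<xi>" by (simp add: p_def algebra_simps)
   then show ?thesis using d by (simp add: norm_mult del: of_real_diff of_real_divide of_real_minus)
  qed
  have sub: "ball p (\<delta>/4) \<subseteq> ball \<xi> \<delta>"
  proof
   fix z assume z: "z \<in> ball p (\<delta>/4)"
   have "norm (\<xi> - z) <= norm (p - \<xi>) + norm (p - z)" using norm_triangle_ineq4[of "p - z" "p - \<xi>"] by (simp add: add.commute norm_minus_commute)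
   then show "z \<in> ball \<xi> \<delta>" using z pd d by (auto simp: dist_norm)
  qed
  have "ennreal ((\<beta>+1)/pi * (k * \<delta> powr \<beta>)) * emeasure lborel (ball p (\<delta>/4)) = (LEB z. ennreal ((\<beta>+1)/pi * (k * \<delta> powr \<beta>)) * indicator (ball p (\<delta>/4)) z)"
   by (simp add: nn_integral_cmult_indicator)
  also have "... <= (LEB z. indicator (ball p (\<delta>/4)) z * ennreal (wdens \<beta> z) * indicator (ball 0 1) z)"
  proof (intro nn_integral_mono)
   fix z
   show "ennreal ((\<beta>+1)/pi * (k * \<delta> powr \<beta>)) * indicator (ball p (\<delta>/4)) z <= indicator (ball p (\<delta>/4)) z * ennreal (wdens \<beta> z) * indicator (ball 0 1) z"
   proof (cases "z \<in> ball p (\<delta>/4)")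
    case True
    then have z: "norm (p - z) < \<delta>/4" by (simp add: dist_norm)
    have "norm z <= 1 - \<delta>/4" "norm z >= 1 - 3*\<delta>/4"
     using z np norm_triangle_ineq2[of z p] norm_triangle_ineq2[of p z] by (auto simp: norm_minus_commute)
    define r where "r = norm z"
    have r: "0 <= r" "r <= 1 - \<delta>/4" "r >= 1 - 3*\<delta>/4" using \<open>norm z <= 1 - \<delta>/4\<close> \<open>norm z >= 1 - 3*\<delta>/4\<close> by (auto simp: r_def)
    have e: "1 - r^2 = (1-r)*(1+r)" by (simp add: algebra_simps power2_eq_square)
    have lo: "\<delta> / 4 <= 1 - r^2"
    proof -
     have "\<delta>/4 * 1 <= (1-r)*(1+r)" using r d by (intro mult_mono) auto
     then show ?thesis by (simp add: e)
    qed
    have hi: "1 - r^2 <= 2 * \<delta>"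
    proof -
     have "(1-r)*(1+r) <= (3*\<delta>/4) * 2" using r d by (intro mult_mono) auto
     then show ?thesis using d by (simp add: e)
    qed
    have "k * \<delta> powr \<beta> <= (1 - r^2) powr \<beta>"
    proof (cases "\<beta> >= 0")
     case True
     have "k * \<delta> powr \<beta> <= (1/4) powr \<beta> * \<delta> powr \<beta>" by (intro mult_right_mono) (auto simp: k_def)
     also have "... = (\<delta>/4) powr \<beta>" using d by (simp add: powr_mult[symmetric])
     also have "... <= (1 - r^2) powr \<beta>" using lo d True by (intro powr_mono2) auto
     finally show ?thesis .
    next
     case False
     have "k * \<delta> powr \<beta> <= 2 powr \<beta> * \<delta> powr \<beta>" by (intro mult_right_mono) (auto simp: k_def)
     also have "... = (2 * \<delta>) powr \<beta>" using d by (simp add: powr_mult[symmetric])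
     also have "... <= (1 - r^2) powr \<beta>" using hi lo d False by (intro powr_mono2') auto
     finally show ?thesis .
    qed
    then have "(\<beta>+1) * (k * \<delta> powr \<beta>) / pi <= wdens \<beta> z" unfolding wdens_def r_def using b by (intro divide_right_mono mult_left_mono) auto
    moreover have "norm z < 1" using r d by (auto simp: r_def)
    ultimately show ?thesis by (auto simp: indicator_def intro!: ennreal_leI)
   qed simp
  qed
  also have "... = (\<integral>\<^sup>+z. indicator (ball p (\<delta>/4)) z \<partial>dA \<beta>)"
   by (subst nn_integral_dA) (auto intro!: borel_measurable_indicator)
  also have "... = emeasure (dA \<beta>) (ball p (\<delta>/4))" by simp
  also have "... <= emeasure (dA \<beta>) (ball \<xi> \<delta>)" by (intro emeasure_mono sub) auto
  finally have *: "ennreal ((\<beta>+1)/pi * (k * \<delta> powr \<beta>)) * emeasure lborel (ball p (\<delta>/4)) <= emeasure (dA \<beta>) (ball \<xi> \<delta>)" .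
  have "emeasure lborel (ball p (\<delta>/4)) = ennreal (pi * (\<delta>/4)^2)"
   using d emeasure_ball[of "\<delta>/4" p] by (simp add: unit_ball_vol_2)
  then have "ennreal ((\<beta>+1)/pi * (k * \<delta> powr \<beta>)) * emeasure lborel (ball p (\<delta>/4)) = ennreal ((\<beta>+1)/pi * (k * \<delta> powr \<beta>) * (pi * (\<delta>/4)^2))"
   using b k by (simp only: ennreal_mult) (subst ennreal_mult, auto)
  also have "(\<beta>+1)/pi * (k * \<delta> powr \<beta>) * (pi * (\<delta>/4)^2) = c * \<delta> powr (\<beta>+2)"
   using d powr_add[of \<delta> \<beta> 2] by (simp add: c_def power2_eq_square)
  finally show "ennreal (c * \<delta> powr (\<beta>+2)) <= emeasure (mm \<beta>) (ball \<xi> \<delta>)" using * by (simp add: mm)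
 qed
qed

text \<open>The Forelli-Rudin estimate. With \<delta> = 1 - |w| and e = w/|w|, the points where |1 -
  cnj w z| is of size 2^j \<delta> lie in a box of size 4 * 2^j \<delta> at e, whose mass is of
  order (2^j \<delta>)^(\<beta>+2). The dyadic sum is geometric with ratio q = 2^(\<beta>+2-2N) < 1.
  For |w| \<le> 1/2, where e may be undefined, the integrand is simply bounded.\<close>

lemma mm_kernel_bound:
 assumes b: "\<beta> >= -1" and N: "2 * real N > \<beta> + 2"
 obtains C where "C > 0" "\<And>w. norm w < 1 ==>
   (\<integral>\<^sup>+z\<in>cball 0 1. ennreal (1 / norm (1 - cnj w * z) ^ (2*N)) \<partial>mm \<beta>) <= ennreal (C * (1 - norm w) powr (\<beta> + 2 - 2 * real N))"
proof -
 obtain C where C: "C > 0"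
  "\<And>c \<delta>. \<delta> > 0 ==> emeasure (mm \<beta>) {z. 1 - \<delta> <= norm z \<and> norm (z - c) <= \<delta>} <= ennreal (C * \<delta> powr (\<beta>+2))"
  using mm_shell_box[OF b] by metis
 obtain M where M: "emeasure (mm \<beta>) UNIV = ennreal M" "M >= 0"
  using finite_mm[OF b] by (metis ennreal_cases infinity_ennreal_def less_irrefl)
 define q where "q = 2 powr (\<beta> + 2 - 2 * real N)"
 have q: "0 < q" "q < 1" using N by (auto simp: q_def powr_less_one)
 define K where "K = C * 4 powr (\<beta>+2) / (1 - q)"
 have K: "K > 0" using C q by (simp add: K_def)
 define L where "L = M * 2 powr (2 * real N)"
 have L: "L >= 0" using M by (simp add: L_def)
 show ?thesis
 proof (rule that[of "K + L"])
  show "K + L > 0" using K L by simp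
  fix w :: complex assume w: "norm w < 1"
  define \<delta> where "\<delta> = 1 - norm w"
  have d: "0 < \<delta>" "\<delta> <= 1" using w by (auto simp: \<delta>_def)
  have lower: "\<delta> <= norm (1 - cnj w * z)" if "norm z <= 1" for z
  proof -
   have "norm (cnj w * z) <= norm w * 1" using that by (simp add: norm_mult mult_left_le)
   then show ?thesis using norm_triangle_ineq2[of 1 "cnj w * z"] by (simp add: \<delta>_def)
  qed
  show "(\<integral>\<^sup>+z\<in>cball 0 1. ennreal (1 / norm (1 - cnj w * z) ^ (2*N)) \<partial>mm \<beta>) <= ennreal ((K + L) * (1 - norm w) powr (\<beta> + 2 - 2 * real N))"
  proof (cases "norm w <= 1/2")
   case True
   have "(\<integral>\<^sup>+z\<in>cball 0 1. ennreal (1 / norm (1 - cnj w * z) ^ (2*N)) \<partial>mm \<beta>) <= (\<integral>\<^sup>+z. ennreal (2 powr (2 * real N)) \<partial>mm \<beta>)"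
   proof (intro nn_integral_mono)
    fix z
    show "ennreal (1 / norm (1 - cnj w * z) ^ (2*N)) * indicator (cball 0 1) z <= ennreal (2 powr (2 * real N))"
    proof (cases "norm z <= 1")
     case z: True
     have h: "1/2 <= norm (1 - cnj w * z)" using lower[OF z] True by (simp add: \<delta>_def)
     have "1 / norm (1 - cnj w * z) ^ (2*N) <= 1 / (1/2) ^ (2*N)"
      using h by (intro divide_left_mono power_mono) (auto intro!: mult_pos_pos zero_less_power)
     also have "... = 2 powr (2 * real N)" using powr_realpow[of 2 "2*N"] by (simp add: power_divide)
     finally show ?thesis using z by (simp add: ennreal_leI)
    qed simp
   qed
   also have "... = ennreal L" using M by (simp add: L_def ennreal_mult mult.commute)
   also have "... <= ennreal ((K + L) * \<delta> powr (\<beta> + 2 - 2 * real N))"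
   proof (rule ennreal_leI)
    have "1 <= \<delta> powr (\<beta> + 2 - 2 * real N)" using powr_mono2'[of "\<beta> + 2 - 2 * real N" \<delta> 1] d N by auto
    then have "L * 1 <= (K + L) * \<delta> powr (\<beta> + 2 - 2 * real N)" using K L by (intro mult_mono) auto
    then show "L <= (K + L) * \<delta> powr (\<beta> + 2 - 2 * real N)" by simp
   qed
   finally show ?thesis by (simp add: \<delta>_def)
  next
   case False
   define e where "e = sgn w"
   have w0: "w \<noteq> 0" using False by auto
   have e: "norm e = 1" using w0 by (simp add: e_def norm_sgn)
   have we: "w = complex_of_real (1 - \<delta>) * e" using w0 by (simp add: e_def \<delta>_def sgn_eq)
   define A where "A j = {z. 1 - 4 * 2^j * \<delta> <= norm z \<and> norm (z - e) <= 4 * 2^j * \<delta>}" for j :: nat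
   have [measurable]: "A j \<in> sets borel" for j unfolding A_def by measurable
   define t where "t j = 1 / (2^j * \<delta>) ^ (2*N)" for j :: nat
   have t0: "t j >= 0" for j using d by (simp add: t_def)
   have pt: "ennreal (1 / norm (1 - cnj w * z) ^ (2*N)) * indicator (cball 0 1) z <= (\<Sum>j. ennreal (t j) * indicator (A j) z)" for z
   proof (cases "norm z <= 1")
    case z: True
    define r where "r = norm (1 - cnj w * z)"
    have r: "\<delta> <= r" using lower[OF z] by (simp add: r_def)
    obtain j where j: "2^j * \<delta> <= r" "r < 2^(Suc j) * \<delta>"
    proof -
     have "\<exists>n. r / \<delta> < 2^n" by (rule real_arch_pow) simp
     then obtain n0 where "r / \<delta> < 2^n0" by auto
     define n where "n = (LEAST n. r / \<delta> < 2^n)"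
     have n: "r / \<delta> < 2^n" unfolding n_def by (rule LeastI) fact
     have "n \<noteq> 0"
     proof
      assume "n = 0"
      then show False using n r d by (simp add: field_simps)
     qed
     then obtain j where j: "n = Suc j" by (cases n) auto
     have "\<not> r / \<delta> < 2^j" using not_less_Least[of j "%n. r / \<delta> < 2^n"] j by (simp add: n_def[symmetric])
     then show ?thesis using n j d by (intro that[of j]) (auto simp: field_simps)
    qed
    have zA: "norm (z - e) <= 4 * 2^j * \<delta>"
    proof -
     have ee: "cnj e * e = 1" using e by (simp add: complex_norm_square[symmetric] mult.commute)
     have "z - e = e * (cnj e * z - 1)" using ee by (simp add: algebra_simps)
     then have "norm (z - e) = norm (1 - cnj e * z)" using e by (simp add: norm_mult norm_minus_commute)
     also have "1 - cnj e * z = (1 - cnj w * z) - complex_of_real \<delta> * (cnj e * z)" by (simp add: we algebra_simps)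
     also have "norm ... <= r + \<delta>"
     proof -
      have "norm (complex_of_real \<delta> * (cnj e * z)) <= \<delta> * 1" using d e z by (simp add: norm_mult mult_left_le)
      then show ?thesis using norm_triangle_ineq4[of "1 - cnj w * z" "complex_of_real \<delta> * (cnj e * z)"] by (simp add: r_def)
     qed
     also have "... <= 4 * 2^j * \<delta>"
     proof -
      have "1 * \<delta> <= 2^j * \<delta>" using d by (intro mult_right_mono) auto
      then show ?thesis using j by simp
     qed
     finally show ?thesis .
    qed
    have "1 - 4 * 2^j * \<delta> <= norm z" using norm_triangle_ineq2[of e z] zA e by (simp add: norm_minus_commute)
    with zA have inA: "z \<in> A j" by (simp add: A_def)
    have "1 / r ^ (2*N) <= t j" unfolding t_def using j d by (intro divide_left_mono power_mono) (auto intro!: mult_pos_pos zero_less_power)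
    then have "ennreal (1 / norm (1 - cnj w * z) ^ (2*N)) * indicator (cball 0 1) z <= ennreal (t j) * indicator (A j) z"
     using z inA by (auto simp: r_def intro!: ennreal_leI)
    also have "... <= (\<Sum>j. ennreal (t j) * indicator (A j) z)"
    proof -
     define F where "F j = ennreal (t j) * indicator (A j) z" for j
     have "sum F {j} <= suminf F" by (rule sum_le_suminf) auto
     then show ?thesis by (simp add: F_def[symmetric])
    qed
    finally show ?thesis .
   qed simp
   have trm: "ennreal (t j) * emeasure (mm \<beta>) (A j) <= ennreal (C * 4 powr (\<beta>+2) * \<delta> powr (\<beta> + 2 - 2 * real N)) * ennreal (q ^ j)" for j
   proof -
    have dj: "2^j * \<delta> > 0" using d by simp
    have "ennreal (t j) * emeasure (mm \<beta>) (A j) <= ennreal (t j) * ennreal (C * (4 * 2^j * \<delta>) powr (\<beta>+2))"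
     unfolding A_def using d by (intro mult_left_mono C) auto
    also have "... = ennreal (t j * (C * (4 * (2^j * \<delta>)) powr (\<beta>+2)))" using t0 C by (simp add: ennreal_mult mult.assoc)
    also have "t j * (C * (4 * (2^j * \<delta>)) powr (\<beta>+2)) = C * 4 powr (\<beta>+2) * (2^j * \<delta>) powr (\<beta> + 2 - 2 * real N)"
    proof -
     define X where "X = 2^j * \<delta>"
     have X: "X > 0" using dj by (simp add: X_def)
     have "t j = X powr (- (2 * real N))" using powr_realpow[OF X, of "2*N"] by (simp add: t_def X_def[symmetric] powr_minus_divide)
     moreover have "(4 * X) powr (\<beta>+2) = 4 powr (\<beta>+2) * X powr (\<beta>+2)" by (simp add: powr_mult)
     moreover have "X powr (\<beta> + 2 - 2 * real N) = X powr (\<beta>+2) * X powr (- (2 * real N))" by (simp add: powr_add[symmetric])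
     ultimately show ?thesis unfolding X_def[symmetric] by simp
    qed
    also have "(2^j * \<delta>) powr (\<beta> + 2 - 2 * real N) = \<delta> powr (\<beta> + 2 - 2 * real N) * q ^ j"
    proof -
     have "(2^j * \<delta>) powr (\<beta> + 2 - 2 * real N) = (2^j) powr (\<beta> + 2 - 2 * real N) * \<delta> powr (\<beta> + 2 - 2 * real N)" using d by (simp add: powr_mult)
     also have "(2^j) powr (\<beta> + 2 - 2 * real N) = q ^ j" by (simp add: q_def powr_power powr_realpow[symmetric] powr_powr mult.commute)
     finally show ?thesis by simp
    qed
    also have "ennreal (C * 4 powr (\<beta>+2) * (\<delta> powr (\<beta> + 2 - 2 * real N) * q ^ j)) = ennreal (C * 4 powr (\<beta>+2) * \<delta> powr (\<beta> + 2 - 2 * real N)) * ennreal (q ^ j)"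
     using C q by (subst ennreal_mult[symmetric]) (auto simp: mult.assoc)
    finally show ?thesis .
   qed
   have "(\<integral>\<^sup>+z\<in>cball 0 1. ennreal (1 / norm (1 - cnj w * z) ^ (2*N)) \<partial>mm \<beta>) <= (\<integral>\<^sup>+z. (\<Sum>j. ennreal (t j) * indicator (A j) z) \<partial>mm \<beta>)"
    by (intro nn_integral_mono pt)
   also have "... = (\<Sum>j. \<integral>\<^sup>+z. ennreal (t j) * indicator (A j) z \<partial>mm \<beta>)" by (intro nn_integral_suminf) auto
   also have "... = (\<Sum>j. ennreal (t j) * emeasure (mm \<beta>) (A j))" by (simp add: nn_integral_cmult_indicator)
   also have "... <= (\<Sum>j. ennreal (C * 4 powr (\<beta>+2) * \<delta> powr (\<beta> + 2 - 2 * real N)) * ennreal (q ^ j))"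
    by (intro suminf_le trm) auto
   also have "... = ennreal (C * 4 powr (\<beta>+2) * \<delta> powr (\<beta> + 2 - 2 * real N)) * (\<Sum>j. ennreal (q ^ j))" by simp
   also have "(\<Sum>j. ennreal (q ^ j)) = ennreal (1 / (1 - q))"
    using q by (subst suminf_ennreal2) (auto simp: suminf_geometric)
   also have "ennreal (C * 4 powr (\<beta>+2) * \<delta> powr (\<beta> + 2 - 2 * real N)) * ennreal (1 / (1 - q)) = ennreal (K * \<delta> powr (\<beta> + 2 - 2 * real N))"
    using C q by (subst ennreal_mult[symmetric]) (auto simp: K_def)
   also have "... <= ennreal ((K + L) * \<delta> powr (\<beta> + 2 - 2 * real N))" using L by (intro ennreal_leI mult_right_mono) auto
   finally show ?thesis by (simp add: \<delta>_def)
  qed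
 qed
qed

section \<open>Poisson kernels and the radial maximal function\<close>

definition disc_alg :: "(complex => complex) => bool" where
 "disc_alg h \<longleftrightarrow> continuous_on (cball 0 1) h \<and> h holomorphic_on ball 0 1"

definition poisson :: "complex => complex => real" where
 "poisson w y = (1 - (norm w)^2) / (norm (1 - cnj w * y))^2"

lemma poisson_nonneg: "norm w <= 1 ==> poisson w y >= 0"
 by (simp add: poisson_def power_le_one)

lemma one_minus_cnj_nz: "norm w < 1 ==> norm y <= 1 ==> 1 - cnj w * y \<noteq> 0"
proof
 assume a: "norm w < 1" "norm y <= 1" "1 - cnj w * y = 0"
 then have "cnj w * y = 1" by simp
 then have "norm (cnj w * y) = norm (1::complex)" by (rule arg_cong)
 moreover have "norm (cnj w * y) <= norm w * 1" using a(1,2) by (simp add: norm_mult mult_left_le)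
 ultimately show False using a(1) by simp
qed

text \<open>Cauchy's formula at w for \<open>F\<close>, the product of h with (1 - |w|^2)/(1 - cnj w
  u): this factor is 1 at u = w, and on the circle u - w = u cnj (1 - cnj w u), so the Cauchy kernel
  times the factor is the Poisson kernel.\<close>

lemma poisson_has_integral:
 fixes h :: "complex => complex"
 assumes h: "disc_alg h" and w: "norm w < 1"
 shows "((%t. poisson w (cis t) * h (cis t)) has_integral (2 * pi * h w)) {0..2*pi}"
proof -
 define q where "q = complex_of_real (1 - (norm w)^2)"
 define F where "F u = h u * q / (1 - cnj w * u)" for u
 have F: "continuous_on (cball 0 1) F" "F holomorphic_on ball 0 1"
  using h w one_minus_cnj_nz[OF w] unfolding F_def disc_alg_def
  by (auto intro!: continuous_intros holomorphic_intros)
 have "1 - cnj w * w = q" unfolding q_def of_real_diff complex_norm_square by (simp add: mult.commute)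
 moreover have "1 - (norm w)^2 \<noteq> 0" using w abs_square_less_1[of "norm w"] by simp
 then have "q \<noteq> 0" unfolding q_def of_real_eq_0_iff .
 ultimately have Fw: "F w = h w" by (simp add: F_def)
 have "((%u. F u / (u - w)) has_contour_integral 2 * of_real pi * \<i> * F w) (circlepath 0 1)"
  using F w by (intro Cauchy_integral_circlepath) auto
 then have "((%t. F (0 + 1 * cis t) / (0 + 1 * cis t - w) * 1 * \<i> * cis t) has_integral 2 * of_real pi * \<i> * h w) {0..2*pi}"
  unfolding circlepath_def Fw by (subst (asm) has_contour_integral_part_circlepath_iff) auto
 then have "((%t. (F (0 + 1 * cis t) / (0 + 1 * cis t - w) * 1 * \<i> * cis t) * (- \<i>)) has_integral 2 * of_real pi * \<i> * h w * (- \<i>)) {0..2*pi}"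
  by (rule has_integral_mult_left)
 moreover have "(F (0 + 1 * cis t) / (0 + 1 * cis t - w) * 1 * \<i> * cis t) * (- \<i>) = poisson w (cis t) * h (cis t)" for t
 proof -
  define u where "u = cis t"
  have nu: "norm u = 1" by (simp add: u_def)
  have cu: "u * cnj u = 1" using nu by (simp add: complex_norm_square[symmetric])
  have n0: "1 - cnj w * u \<noteq> 0" using one_minus_cnj_nz[OF w] nu by auto
  have uw: "u - w = u * cnj (1 - cnj w * u)" using cu by (simp add: algebra_simps)
  have u0: "u \<noteq> 0" using nu by auto
  have "(F u / (u - w) * \<i> * u) * (- \<i>) = F u * u / (u - w)" by (simp add: field_simps)
  also have "... = F u / cnj (1 - cnj w * u)" using u0 by (simp only: uw) simp
  also have "... = h u * q / ((1 - cnj w * u) * cnj (1 - cnj w * u))" by (simp add: F_def)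
  also have "(1 - cnj w * u) * cnj (1 - cnj w * u) = of_real ((norm (1 - cnj w * u))^2)" by (simp only: complex_norm_square)
  finally show ?thesis by (simp add: u_def poisson_def q_def)
 qed
 ultimately show ?thesis by (simp add: mult_ac)
qed

lemma poisson_cont: "norm w < 1 ==> continuous_on (cball 0 1) (poisson w)"
 unfolding poisson_def using one_minus_cnj_nz[of w] by (auto intro!: continuous_intros)

lemma poisson_measurable [measurable]: "poisson w \<in> borel_fun"
 unfolding poisson_def by measurable

lemma poisson_measurable2 [measurable]:
 "f \<in> borel_measurable M ==> g \<in> borel_measurable M ==> (%x. poisson (f x) (g x)) \<in> borel_measurable M"
proof -
 assume [measurable]: "f \<in> borel_measurable M" "g \<in> borel_measurable M"
 have [measurable]: "cnj \<in> borel_fun" by (intro borel_measurable_continuous_onI continuous_intros)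
 show ?thesis unfolding poisson_def by measurable
qed

lemma nn_integral_arc_has_integral:
 assumes [measurable]: "f \<in> borel_fun"
  and f: "\<And>t. f (cis t) = ennreal (g t)" "\<And>t. g t >= 0" and g: "(g has_integral I) {0..2*pi}"
 shows "(ARC z. f z) = ennreal (I / (2 * pi))"
proof -
 have I: "I >= 0" using g f(2) has_integral_nonneg by blast
 have "(LEB t. f (cis t) * indicator {0..2*pi} t) = (LEB t. ennreal (indicator {0..2*pi} t * g t))"
  by (intro nn_integral_cong) (auto simp: f split: split_indicator)
 also have "... = ennreal I" using g f(2) by (intro nn_integral_has_integral_lebesgue) auto
 finally show ?thesis by (subst nn_integral_arc) (auto simp: divide_ennreal I)
qed

lemma AE_arc: "AE z in arc_measure. norm z = 1"
proof -
 have m: "{z. norm z = (1::real)} \<in> sets borel" by measurable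
 have "emeasure arc_measure {z. norm z \<noteq> 1} = 0"
 proof -
  have [measurable]: "{z::complex. norm z \<noteq> 1} \<in> sets borel" by measurable
  show ?thesis by (subst emeasure_arc) auto
 qed
 then show ?thesis by (intro AE_I[of _ _ "{z. norm z \<noteq> 1}"]) auto
qed

text \<open>The indicator restores measurability: h is continuous on the closed disc and arbitrary
  elsewhere, and the arc measure does not charge the complement.\<close>

lemma poisson_norm_le:
 fixes h :: "complex => complex"
 assumes h: "disc_alg h" and w: "norm w < 1"
 shows "ennreal (norm (h w)) <= (ARC y. ennreal (poisson w y) * (ennreal (norm (h y)) * indicator (cball 0 1) y))"
proof -
 define g where "g t = poisson w (cis t) * norm (h (cis t))" for t
 have cc: "continuous_on {0..2*pi} (%t. F (cis t))" if "continuous_on (cball 0 1) F" for F :: "complex => real"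
  by (rule continuous_on_compose2[OF that]) (auto intro!: continuous_intros)
 have "continuous_on (cball 0 1) (%z. norm (h z))" using h by (auto simp: disc_alg_def intro: continuous_on_norm)
 then have contg: "continuous_on {0..2*pi} g"
  unfolding g_def using poisson_cont[OF w] by (intro continuous_on_mult cc)
 then have gi: "(g has_integral integral {0..2*pi} g) {0..2*pi}" by (intro integrable_integral integrable_continuous_real)
 have [measurable]: "(%y. ennreal (norm (h y)) * indicator (cball 0 1) y) \<in> borel_fun"
 proof -
  have "(%y. indicator (cball 0 1) y *\<^sub>R norm (h y)) \<in> borel_fun"
   using h by (intro borel_measurable_continuous_on_indicator continuous_on_norm) (auto simp: disc_alg_def)
  then have "(%y. ennreal (indicator (cball 0 1) y *\<^sub>R norm (h y))) \<in> borel_fun" by measurable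
  then show ?thesis by (rule measurable_cong[THEN iffD1, rotated]) (auto split: split_indicator)
 qed
 have "(ARC y. ennreal (poisson w y) * (ennreal (norm (h y)) * indicator (cball 0 1) y)) = ennreal (integral {0..2*pi} g / (2*pi))"
  by (rule nn_integral_arc_has_integral[OF _ _ _ gi]) (use w in \<open>auto simp: g_def poisson_nonneg ennreal_mult\<close>)
 moreover have "norm (2 * pi * h w) <= integral {0..2*pi} g"
 proof -
  note H = poisson_has_integral[OF h w]
  have "norm (integral {0..2*pi} (%t. poisson w (cis t) * h (cis t))) <= integral {0..2*pi} g"
   using H gi w by (intro integral_norm_bound_integral) (auto simp: has_integral_integrable g_def norm_mult poisson_nonneg)
  then show ?thesis using integral_unique[OF H] by simp
 qed
 then have "norm (h w) <= integral {0..2*pi} g / (2 * pi)" by (simp add: norm_mult field_simps)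
 ultimately show ?thesis by (simp add: ennreal_leI)
qed

text \<open>|h|^2 is the modulus of h^2, which is again in the disc algebra.\<close>

lemma poisson_norm_sq_le:
 fixes h :: "complex => complex"
 assumes h: "disc_alg h" and w: "norm w < 1"
 shows "nsq (h w) <= (ARC y. ennreal (poisson w y) * (nsq (h y) * indicator (cball 0 1) y))"
proof -
 have "disc_alg (%z. (h z)^2)" using h by (auto simp: disc_alg_def intro!: continuous_intros holomorphic_intros)
 from poisson_norm_le[OF this w] show ?thesis by (simp add: norm_power)
qed

lemma poisson_has_integral_Re:
 fixes h :: "complex => complex"
 assumes h: "disc_alg h" and w: "norm w < 1"
 shows "((%t. poisson w (cis t) * Re (h (cis t))) has_integral (2 * pi * Re (h w))) {0..2*pi}"
 using has_integral_Re[OF poisson_has_integral[OF h w]] by simp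

lemma harnack:
 fixes h :: "complex => complex"
 assumes h: "disc_alg h" and pos: "\<And>z. norm z <= 1 ==> Re (h z) >= 0" and r: "0 <= r" "r < 1"
 shows "(1 - r) / (1 + r) * Re (h 0) <= Re (h (of_real r))"
  and "Re (h (of_real r)) <= (1 + r) / (1 - r) * Re (h 0)"
proof -
 have 0: "((%t. Re (h (cis t))) has_integral (2 * pi * Re (h 0))) {0..2*pi}"
  using poisson_has_integral_Re[OF h, of 0] by (simp add: poisson_def)
 have 1: "((%t. poisson r (cis t) * Re (h (cis t))) has_integral (2 * pi * Re (h r))) {0..2*pi}"
  using poisson_has_integral_Re[OF h, of "of_real r"] r by simp
 have b: "1 - r <= norm (1 - r * cis t)" "norm (1 - r * cis t) <= 1 + r" for t
  using norm_triangle_ineq2[of 1 "r * cis t"] norm_triangle_ineq4[of 1 "r * cis t"] r by (auto simp: norm_mult)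
 have e: "1 - r^2 = (1-r)*(1+r)" by (simp add: algebra_simps power2_eq_square)
 have low: "(1 - r) / (1 + r) <= poisson r (cis t)" for t
 proof -
  have "(1 - r) / (1 + r) = (1 - r^2) / (1+r)^2" using r unfolding e by (simp add: power2_eq_square)
  also have "... <= (1 - r^2) / (norm (1 - r * cis t))^2"
   using b[of t] r by (intro divide_left_mono power_mono mult_pos_pos zero_less_power) (auto simp: power_le_one)
  finally show ?thesis by (simp add: poisson_def)
 qed
 have up: "poisson r (cis t) <= (1 + r) / (1 - r)" for t
 proof -
  have "(1 - r^2) / (norm (1 - r * cis t))^2 <= (1 - r^2) / (1-r)^2"
   using b[of t] r by (intro divide_left_mono power_mono mult_pos_pos zero_less_power) (auto simp: power_le_one)
  also have "... = (1 + r) / (1 - r)" using r unfolding e by (simp add: power2_eq_square)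
  finally show ?thesis by (simp add: poisson_def)
 qed
 have sw: "c * (2 * pi * X) = 2 * pi * (c * X)" for c X :: real by simp
 have "(1 - r) / (1 + r) * (2 * pi * Re (h 0)) <= 2 * pi * Re (h r)"
  by (rule has_integral_le[OF has_integral_mult_right[OF 0] 1]) (rule mult_right_mono[OF low pos]; simp)
 then have "2 * pi * ((1 - r) / (1 + r) * Re (h 0)) <= 2 * pi * Re (h r)" by (subst (asm) sw)
 then show "(1 - r) / (1 + r) * Re (h 0) <= Re (h (of_real r))" by (rule mult_left_le_imp_le) simp
 have "2 * pi * Re (h r) <= (1 + r) / (1 - r) * (2 * pi * Re (h 0))"
  by (rule has_integral_le[OF 1 has_integral_mult_right[OF 0]]) (rule mult_right_mono[OF up pos]; simp)
 then have "2 * pi * Re (h r) <= 2 * pi * ((1 + r) / (1 - r) * Re (h 0))" by (subst (asm) sw)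
 then show "Re (h (of_real r)) <= (1 + r) / (1 - r) * Re (h 0)" by (rule mult_left_le_imp_le) simp
qed

text \<open>On the circle \<open>poisson v\<close> is the real part of u \<mapsto> (1 + cnj v u)/(1
  - cnj v u), which belongs to the disc algebra, so integrating it against \<open>poisson w\<close>
  evaluates that real part at w.\<close>

lemma poisson_conv:
 assumes w: "norm w < 1" "norm v < 1"
 shows "(ARC y. ennreal (poisson w y) * ennreal (poisson v y)) = ennreal ((1 - (norm w * norm v)^2) / (norm (1 - cnj v * w))^2)"
proof -
 define h where "h u = (1 + cnj v * u) / (1 - cnj v * u)" for u
 have h: "disc_alg h" using one_minus_cnj_nz[OF w(2)] unfolding disc_alg_def h_def
  by (auto intro!: continuous_intros holomorphic_intros)
 have Re: "Re (h u) = (1 - (norm v * norm u)^2) / (norm (1 - cnj v * u))^2" for u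
 proof -
  define a where "a = cnj v * u"
  have "Re ((1 + a) / (1 - a)) = Re ((1 + a) * cnj (1 - a)) / (norm (1-a))^2" by (simp add: Re_divide' cmod_power2)
  also have "Re ((1 + a) * cnj (1 - a)) = 1 - (norm a)^2" unfolding cmod_power2 by (simp add: algebra_simps power2_eq_square)
  finally show ?thesis by (simp add: h_def a_def norm_mult)
 qed
 have "((%t. poisson w (cis t) * Re (h (cis t))) has_integral (2 * pi * Re (h w))) {0..2*pi}"
  by (rule poisson_has_integral_Re[OF h w(1)])
 moreover have "Re (h (cis t)) = poisson v (cis t)" for t by (simp add: Re poisson_def)
 ultimately have "((%t. poisson w (cis t) * poisson v (cis t)) has_integral (2 * pi * Re (h w))) {0..2*pi}" by simp
 then have "(ARC y. ennreal (poisson w y) * ennreal (poisson v y)) = ennreal (2 * pi * Re (h w) / (2 * pi))"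
  by (intro nn_integral_arc_has_integral) (use w in \<open>auto simp: poisson_nonneg ennreal_mult\<close>)
 then show ?thesis by (simp add: Re mult.commute)
qed

lemma poisson_int: "norm w < 1 ==> (ARC y. ennreal (poisson w y)) = 1"
 using poisson_conv[of w 0] by (simp add: poisson_def)

lemma poisson_swap: "norm e = 1 ==> norm y = 1 ==> poisson (of_real r * e) y = poisson (of_real r * y) e"
proof -
 assume *: "norm e = 1" "norm y = 1"
 have "norm (1 - cnj (of_real r * e) * y) = norm (cnj (1 - cnj (of_real r * e) * y))" by (simp only: complex_mod_cnj)
 also have "cnj (1 - cnj (of_real r * e) * y) = 1 - cnj (of_real r * y) * e" by simp
 finally show ?thesis using * by (simp add: poisson_def norm_mult)
qed

lemma poisson_le:
 assumes "norm w <= r" "r < 1" "norm y <= 1"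
 shows "poisson w y <= (1 + r) / (1 - r)"
proof -
 define s where "s = norm w"
 have s: "0 <= s" "s <= r" "s < 1" using assms by (auto simp: s_def)
 have "norm (cnj w * y) <= s * 1" using assms s by (simp add: norm_mult s_def mult_left_le)
 then have b: "1 - s <= norm (1 - cnj w * y)" using norm_triangle_ineq2[of 1 "cnj w * y"] by simp
 have e: "1 - s^2 = (1-s)*(1+s)" by (simp add: algebra_simps power2_eq_square)
 have "poisson w y <= (1 - s^2) / (1-s)^2"
  unfolding poisson_def s_def[symmetric]
  using b s by (intro divide_left_mono power_mono mult_pos_pos zero_less_power) (auto simp: power_le_one)
 also have "... = (1 + s) / (1 - s)" using s unfolding e by (simp add: power2_eq_square)
 also have "... <= (1 + r) / (1 - r)" using s assms by (intro frac_le) auto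
 finally show ?thesis .
qed

text \<open>Write u = cnj e' e and A = |1 - r s u|. From r (1 - s) \<le> 1 - r s \<le> A follow |1 -
  r u| \<le> 2A and, by symmetry, |1 - s u| \<le> 2A; moreover 1 - (r s)^2 \<le> (1 - r^2) + (1 -
  s^2), and each summand goes to one Poisson kernel. This is what lets the maximal operator control
  its own composition with the adjoint.\<close>

lemma poisson_product_le:
 assumes "norm e = 1" "norm e' = 1" "0 <= r" "r < 1" "0 <= s" "s < 1"
 shows "(1 - (norm (of_real r * e) * norm (of_real s * e'))^2) / (norm (1 - cnj (of_real s * e') * (of_real r * e)))^2
   <= 4 * (poisson (of_real r * e) e' + poisson (of_real s * e') e)"
proof -
 define u where "u = cnj e' * e"
 have u: "norm u = 1" using assms by (simp add: u_def norm_mult)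
 define A where "A = norm (1 - of_real (r * s) * u)"
 have nz: "A > 0"
 proof -
  have "r * s <= r * 1" using assms by (intro mult_left_mono) auto
  then have "r * s < 1" using assms by simp
  moreover have "1 - r * s <= A" unfolding A_def using norm_triangle_ineq2[of 1 "of_real (r * s) * u"] assms u by (simp add: norm_mult)
  ultimately show ?thesis by linarith
 qed
 have r2: "norm (1 - of_real r * u) <= 2 * A" if rs: "0 <= r" "r < 1" "0 <= s" "s < 1" "A = norm (1 - of_real (r * s) * u)" for r s
 proof -
  have "1 - of_real r * u = (1 - of_real (r * s) * u) - of_real (r * (1-s)) * u" by (simp add: algebra_simps)
  then have "norm (1 - of_real r * u) <= norm (1 - of_real (r * s) * u) + norm (of_real (r * (1-s)) * u)"
   by (simp only: norm_triangle_ineq4)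
  moreover have "norm (of_real (r * (1-s)) * u) = r * (1 - s)" using rs u by (simp add: norm_mult del: of_real_mult of_real_diff)
  ultimately have "norm (1 - of_real r * u) <= A + r * (1 - s)" using rs by simp
  moreover have "r * (1 - s) <= 1 - r * s" using rs by (simp add: algebra_simps)
  moreover have "1 - r * s <= A" unfolding rs(5) using norm_triangle_ineq2[of 1 "of_real (r * s) * u"] rs u by (simp add: norm_mult)
  ultimately show ?thesis by simp
 qed
 have c1: "cnj (of_real r * e) * e' = cnj (of_real r * u)" by (simp add: u_def)
 have c2: "cnj (of_real s * e') * e = of_real s * u" by (simp add: u_def)
 have c3: "cnj (of_real s * e') * (of_real r * e) = of_real (r * s) * u" by (simp add: u_def)
 have n1: "norm (1 - cnj (of_real r * u)) = norm (1 - of_real r * u)" by (metis complex_cnj_diff complex_cnj_one complex_mod_cnj)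
 have "1 - r <= norm (1 - of_real r * u)" using norm_triangle_ineq2[of 1 "of_real r * u"] assms u by (simp add: norm_mult)
 then have nr: "norm (1 - of_real r * u) > 0" using assms by linarith
 have "1 - s <= norm (1 - of_real s * u)" using norm_triangle_ineq2[of 1 "of_real s * u"] assms u by (simp add: norm_mult)
 then have ns: "norm (1 - of_real s * u) > 0" using assms by linarith
 have P1: "poisson (of_real r * e) e' >= (1 - r^2) / (4 * A^2)"
 proof -
  have "(1 - r^2) / (2 * A)^2 <= (1 - r^2) / (norm (1 - of_real r * u))^2"
   using r2[of r s] assms nr nz by (intro divide_left_mono power_mono mult_pos_pos zero_less_power) (auto simp: A_def power_le_one)
  then show ?thesis unfolding poisson_def c1 n1 using assms by (simp add: norm_mult power_mult_distrib)
 qed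
 have P2: "poisson (of_real s * e') e >= (1 - s^2) / (4 * A^2)"
 proof -
  have "(1 - s^2) / (2 * A)^2 <= (1 - s^2) / (norm (1 - of_real s * u))^2"
   using r2[of s r] assms ns nz by (intro divide_left_mono power_mono mult_pos_pos zero_less_power) (auto simp: A_def power_le_one mult.commute)
  then show ?thesis unfolding poisson_def c2 using assms by (simp add: norm_mult power_mult_distrib)
 qed
 have rs2: "1 - (r * s)^2 <= (1 - r^2) + (1 - s^2)"
 proof -
  have "0 <= (1 - r^2) * (1 - s^2)" using assms by (intro mult_nonneg_nonneg) (auto simp: power_le_one)
  then show ?thesis by (simp add: algebra_simps power_mult_distrib)
 qed
 have "(1 - (r * s)^2) / A^2 <= ((1 - r^2) + (1 - s^2)) / A^2" using rs2 nz by (intro divide_right_mono) auto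
 also have "... = 4 * ((1 - r^2) / (4 * A^2) + (1 - s^2) / (4 * A^2))" using nz by (simp add: field_simps)
 also have "... <= 4 * (poisson (of_real r * e) e' + poisson (of_real s * e') e)" using P1 P2 by (intro mult_left_mono add_mono) auto
 finally show ?thesis unfolding c3 A_def using assms by (simp add: norm_mult)
qed

text \<open>The Schwarz lemma for g, precomposed with the affine map onto the disc of radius 1 - |a|
  about a and postcomposed with the Moebius map that sends g a to 0. The affine map costs only the
  factor 1 + |a| of the sharp inequality.\<close>

lemma schwarz_pick:
 assumes g: "g holomorphic_on ball 0 1" and b: "\<And>z. norm z < 1 ==> norm (g z) < 1" and a: "norm a < 1"
 shows "(1 - norm a) * norm (deriv g a) <= 1 - (norm (g a))^2"
proof -
 define R where "R = 1 - norm a"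
 have R: "R > 0" using a by (simp add: R_def)
 define b where "b = g a"
 have nb: "norm b < 1" using assms by (simp add: b_def)
 define k where "k z = Moebius_function 0 b (g (a + of_real R * z))" for z
 have inb: "norm (a + of_real R * z) < 1" if "norm z < 1" for z
 proof -
  have "norm (a + of_real R * z) <= norm a + R * norm z" using norm_triangle_ineq[of a "of_real R * z"] R by (simp add: norm_mult)
  also have "... < norm a + R * 1" using that R by simp
  finally show ?thesis by (simp add: R_def)
 qed
 have hk: "k holomorphic_on ball 0 1"
 proof -
  have "(%z. g (a + of_real R * z)) holomorphic_on ball 0 1"
   using inb by (intro holomorphic_on_compose_gen[OF _ g, unfolded o_def] holomorphic_intros) auto
  then show ?thesis unfolding k_def
   using inb assms(2) by (intro holomorphic_on_compose_gen[OF _ Moebius_function_holomorphic[OF nb], unfolded o_def]) auto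
 qed
 have k0: "k 0 = 0" by (simp add: k_def b_def Moebius_function_eq_zero)
 have kb: "norm (k z) < 1" if "norm z < 1" for z
  unfolding k_def using nb assms(2)[OF inb[OF that]] by (intro Moebius_function_norm_lt_1) auto
 have 1: "norm (deriv k 0) <= 1" using Schwarz_Lemma(2)[OF hk k0 kb, of 0] by simp
 have dg: "(g has_field_derivative deriv g a) (at a)" using g a by (auto intro!: holomorphic_derivI)
 have nz: "1 - cnj b * b \<noteq> 0" using one_minus_cnj_nz[of b b] nb by simp
 have "(k has_field_derivative deriv g a * of_real R / (1 - cnj b * b)) (at 0)"
 proof -
  have "((%z. g (a + of_real R * z)) has_field_derivative deriv g a * of_real R) (at 0)"
   by (rule DERIV_chain2[where g="%z. a + of_real R * z"]) (auto intro!: derivative_eq_intros dg)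
  then have "((%z. (g (a + of_real R * z) - b) / (1 - cnj b * g (a + of_real R * z))) has_field_derivative
    ((deriv g a * of_real R) * (1 - cnj b * b) - (b - b) * (- (cnj b * (deriv g a * of_real R)))) / ((1 - cnj b * b) * (1 - cnj b * b))) (at 0)"
   using nz by (auto intro!: derivative_eq_intros simp: b_def)
  then show ?thesis using nz by (simp add: k_def[abs_def] Moebius_function_simple)
 qed
 then have "deriv k 0 = deriv g a * of_real R / (1 - cnj b * b)" by (rule DERIV_imp_deriv)
 moreover have "1 - cnj b * b = of_real (1 - (norm b)^2)" by (simp add: complex_norm_square mult.commute del: of_real_power)
 moreover have "(norm b)^2 < 1" using nb by (simp add: power_less_one_iff abs_square_less_1)
 ultimately have "norm (deriv g a) * R <= 1 - (norm b)^2"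
  using 1 R by (simp add: norm_mult norm_divide del: of_real_diff of_real_power)
 then show ?thesis by (simp add: R_def b_def mult.commute)
qed


section \<open>The radial maximal theorem on the circle\<close>

declare arc_prob [simp]

lemma sigma_finite_arc: "sigma_finite_measure arc_measure"
 by (intro finite_measure.axioms(1) finite_measureI) (simp add: arc_prob)

interpretation arc: sigma_finite_measure arc_measure by (rule sigma_finite_arc)
interpretation arc2: pair_sigma_finite arc_measure arc_measure ..

lemma ennreal_square_le:
 assumes "x\<^sup>2 <= (ennreal q)^2" "q >= 0"
 shows "x <= ennreal q"
proof (cases x)
 case (real r)
 then have "r\<^sup>2 <= q\<^sup>2" using assms by (simp add: ennreal_power)
 then show ?thesis using real assms power2_le_imp_le[of r q] by (simp add: ennreal_leI)
next
 case top
 then have "(ennreal q)^2 = \<infinity>" using assms by (simp add: power2_eq_square top_unique)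
 then show ?thesis using assms by (simp add: ennreal_power)
qed

lemma cauchy_schwarz_real:
 assumes [measurable]: "f \<in> borel_measurable M" "g \<in> borel_measurable M"
  and "(\<integral>\<^sup>+x. f x ^ 2 \<partial>M) <= ennreal a" "(\<integral>\<^sup>+x. g x ^ 2 \<partial>M) <= ennreal b" "a >= 0" "b >= 0"
 shows "(\<integral>\<^sup>+x. f x * g x \<partial>M) <= ennreal (sqrt (a * b))"
proof -
 have "(\<integral>\<^sup>+x. f x * g x \<partial>M)^2 <= (\<integral>\<^sup>+x. f x ^ 2 \<partial>M) * (\<integral>\<^sup>+x. g x ^ 2 \<partial>M)"
  by (rule Cauchy_Schwarz_nn_integral) auto
 also have "... <= ennreal a * ennreal b" using assms by (intro mult_mono) auto
 also have "... = ennreal ((sqrt (a * b))^2)" using assms by (simp add: ennreal_mult)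
 also have "... = (ennreal (sqrt (a*b)))^2" using assms by (simp add: ennreal_power)
 finally show ?thesis by (rule ennreal_square_le) (use assms in simp)
qed

text \<open>The maximal operator, linearized by a measurable choice \<open>\<rho>\<close> of radii, is estimated through its composition with its adjoint:
 an \<open>L\<^sup>2\<close> bound \<open>c\<close> improves to \<open>8 * sqrt c\<close>, whose fixed point is 64.\<close>

locale linmax =
 fixes \<rho> :: "complex => real" and r0 :: real
 assumes rho_meas [measurable]: "\<rho> \<in> borel_fun" and rho: "\<And>e. 0 <= \<rho> e" "\<And>e. \<rho> e <= r0" and r0: "r0 < 1"
begin

text \<open>The radius depends on the first variable alone, so the kernel is not symmetric and the
  adjoint of \<open>Tf\<close> integrates over \<open>e\<close>.\<close>

definition K :: "complex => complex => ennreal" where "K e y = ennreal (poisson (of_real (\<rho> e) * e) y)"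
definition Tf :: "(complex => ennreal) => complex => ennreal" where "Tf f e = (ARC y. K e y * f y)"

lemma r0_nonneg: "0 <= r0" using rho[of 0] by simp

lemma K_meas [measurable]: "(%x. K (f x) (g x)) \<in> borel_measurable M" if [measurable]: "f \<in> borel_measurable M" "g \<in> borel_measurable M"
 unfolding K_def by measurable

lemma Tf_meas [measurable]: "Tf f \<in> borel_fun" if [measurable]: "f \<in> borel_fun"
 unfolding Tf_def by measurable

lemma K_bound: "norm e = 1 ==> norm y = 1 ==> K e y <= ennreal ((1 + r0) / (1 - r0))"
 unfolding K_def using rho[of e] r0 by (intro ennreal_leI poisson_le) (auto simp: norm_mult)

text \<open>The left side is the kernel of the composition of \<open>Tf\<close> with its adjoint;
  the right side is made of the kernels of \<open>Tf\<close> and of the adjoint.\<close>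

lemma K_conv:
 assumes "norm e = 1" "norm e' = 1"
 shows "(ARC y. K e y * K e' y) <= 4 * (K e e' + K e' e)"
proof -
 have w: "norm (of_real (\<rho> e) * e) < 1" "norm (of_real (\<rho> e') * e') < 1"
  using assms rho[of e] rho[of e'] r0 by (auto simp: norm_mult)
 have "(ARC y. K e y * K e' y) <= ennreal (4 * (poisson (of_real (\<rho> e) * e) e' + poisson (of_real (\<rho> e') * e') e))"
  unfolding K_def poisson_conv[OF w] using assms rho[of e] rho[of e'] r0
  by (intro ennreal_leI poisson_product_le) auto
 also have "... = 4 * (K e e' + K e' e)" unfolding K_def using w
  by (simp add: ennreal_mult poisson_nonneg less_imp_le)
 finally show ?thesis .
qed

lemma nn_const_arc: "(ARC y. c) = c" by (simp add: arc_prob)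

lemma Tf_bounded:
 assumes [measurable]: "f \<in> borel_fun" and f: "\<And>y. f y <= ennreal B" and B: "B >= 0"
 shows "AE e in arc_measure. Tf f e <= ennreal ((1 + r0) / (1 - r0) * B)"
proof -
 have "Tf f e <= ennreal ((1 + r0) / (1 - r0) * B)" if e: "norm e = 1" for e
 proof -
  have "Tf f e <= (ARC y. ennreal ((1 + r0) / (1 - r0)) * ennreal B)"
   unfolding Tf_def using AE_arc
   by (intro nn_integral_mono_AE) (auto elim!: eventually_mono intro!: mult_mono K_bound e f)
  also have "... = ennreal ((1 + r0) / (1 - r0) * B)" using r0 r0_nonneg B by (subst ennreal_mult) auto
  finally show ?thesis .
 qed
 then show ?thesis using AE_arc by (auto elim: eventually_mono)
qed

text \<open>\<open>c\<close> bounds the square of the operator norm. For bounded f all integrals are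
  finite, so that factors may be cancelled.\<close>

definition valid :: "real => bool" where
 "valid c \<longleftrightarrow> c >= 0 \<and> (\<forall>f B. f \<in> borel_measurable borel --> B >= 0 --> (\<forall>y. f y <= ennreal B) -->
   (ARC e. (Tf f e)^2) <= ennreal c * (ARC y. (f y)^2))"

lemma fin_sq:
 assumes [measurable]: "f \<in> borel_fun" and f: "AE y in arc_measure. f y <= ennreal B" "B >= 0"
 obtains a where "a >= 0" "(ARC y. (f y)^2) = ennreal a"
proof -
 have "(ARC y. (f y)^2) <= (ARC y. (ennreal B)^2)"
  using f(1) by (intro nn_integral_mono_AE) (auto elim!: eventually_mono intro!: power_mono)
 also have "... = ennreal (B^2)" using f by (simp add: nn_const_arc ennreal_power)
 finally have "(ARC y. (f y)^2) < \<infinity>" by (rule le_less_trans) simp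
 then show ?thesis using that by (metis ennreal_cases infinity_ennreal_def less_irrefl)
qed

text \<open>A crude bound that blows up as \<open>r0\<close> tends to 1. It provides one valid
  constant, so that the infimum of the valid constants makes sense.\<close>

lemma valid_init: "valid (((1 + r0) / (1 - r0))^2)"
 unfolding valid_def
proof (intro conjI allI impI)
 fix f :: "complex => ennreal" and B :: real
 assume [measurable]: "f \<in> borel_fun" and B: "0 <= B" and f: "\<forall>y. f y <= ennreal B"
 define c where "c = (1 + r0) / (1 - r0)"
 have c: "c >= 0" using r0 r0_nonneg by (simp add: c_def)
 obtain b where b: "b >= 0" "(ARC y. (f y)^2) = ennreal b" using fin_sq[of f B] f B by auto
 have 1: "(Tf f e)^2 <= ennreal (c^2) * ennreal b" if e: "norm e = 1" for e
 proof -
  have "Tf f e <= (ARC y. ennreal c * f y)"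
   unfolding Tf_def c_def using AE_arc
   by (intro nn_integral_mono_AE) (auto elim!: eventually_mono intro!: mult_right_mono K_bound e)
  also have "... <= ennreal (sqrt (c^2 * b))"
   using b c by (intro cauchy_schwarz_real) (auto simp: nn_const_arc ennreal_power)
  finally have "(Tf f e)^2 <= (ennreal (sqrt (c^2 * b)))^2" by (intro power_mono) auto
  also have "... = ennreal (c^2) * ennreal b" using b c by (simp add: ennreal_power ennreal_mult)
  finally show ?thesis .
 qed
 have "(ARC e. (Tf f e)^2) <= (ARC e. ennreal (c^2) * ennreal b)"
  using AE_arc by (intro nn_integral_mono_AE) (auto elim!: eventually_mono intro: 1)
 then show "(ARC e. (Tf f e)^2) <= ennreal (((1 + r0) / (1 - r0))^2) * (ARC y. (f y)^2)"
  unfolding b nn_const_arc by (simp add: c_def)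
qed simp

text \<open>Let g be \<open>Tf f\<close> and h the adjoint applied to g. By \<open>K_conv\<close>,
  ||h||^2 \<le> 8 <g, Tf g> \<le> 8 sqrt c ||g||^2, while ||g||^2 = <f, h> \<le> ||f|| ||h||.
  Squaring the last inequality and cancelling one factor ||g||^2 leaves ||g||^2 \<le> 8 sqrt c
  ||f||^2.\<close>

lemma valid_step:
 assumes v: "valid c"
 shows "valid (8 * sqrt c)"
 unfolding valid_def
proof (intro conjI allI impI)
 show "0 <= 8 * sqrt c" using v by (simp add: valid_def)
 fix f :: "complex => ennreal" and B :: real
 assume [measurable]: "f \<in> borel_fun" and B: "0 <= B" and f: "\<forall>y. f y <= ennreal B"
 define B' where "B' = (1 + r0) / (1 - r0) * B"
 have B': "B' >= 0" using r0 r0_nonneg B by (simp add: B'_def)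
 have c: "c >= 0" using v by (simp add: valid_def)
 \<comment> \<open>Truncation at the almost everywhere bound of \<open>Tf f\<close>, since
   \<open>valid\<close> speaks only of functions bounded everywhere.\<close>
 define g where "g e = min (Tf f e) (ennreal B')" for e
 have [measurable]: "g \<in> borel_fun" unfolding g_def by measurable
 have gT: "AE e in arc_measure. g e = Tf f e"
  using Tf_bounded[of f B] f B by (auto simp: g_def B'_def min_def elim!: eventually_mono)
 obtain b where b: "b >= 0" "(ARC y. (f y)^2) = ennreal b" using fin_sq[of f B] f B by auto
 obtain a where a: "a >= 0" "(ARC y. (g y)^2) = ennreal a" using fin_sq[of g B'] B' by (auto simp: g_def)
 have Tg: "(ARC e. (Tf g e)^2) <= ennreal (c * a)"
 proof -
  have "\<forall>y. g y <= ennreal B'" by (simp add: g_def)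
  then have "(ARC e. (Tf g e)^2) <= ennreal c * (ARC y. (g y)^2)"
   using v B' unfolding valid_def by simp
  then show ?thesis using a c by (simp add: ennreal_mult)
 qed
 define h where "h y = (ARC e. K e y * g e)" for y
 have [measurable]: "h \<in> borel_fun" unfolding h_def by measurable
 have gTg: "(ARC e. g e * Tf g e) <= ennreal (sqrt (a * (c * a)))"
  using a c Tg by (intro cauchy_schwarz_real) auto
 have h2: "(ARC y. (h y)^2) <= ennreal (8 * sqrt c * a)"
 proof -
  have "(ARC y. (h y)^2) = (ARC y. (ARC e. (ARC e'. (K e y * g e) * (K e' y * g e'))))"
   unfolding h_def power2_eq_square by (simp add: nn_integral_cmult nn_integral_multc)
  also have "... = (ARC e. (ARC y. (ARC e'. (K e y * g e) * (K e' y * g e'))))"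
   by (rule arc2.Fubini') measurable
  also have "... = (ARC e. (ARC e'. (ARC y. (K e y * g e) * (K e' y * g e'))))"
   by (intro nn_integral_cong arc2.Fubini') measurable
  also have "... = (ARC e. (ARC e'. g e * g e' * (ARC y. K e y * K e' y)))"
   by (intro nn_integral_cong) (simp add: nn_integral_cmult[symmetric] mult_ac)
  also have "... <= (ARC e. (ARC e'. g e * g e' * (4 * (K e e' + K e' e))))"
  proof (rule nn_integral_mono_AE)
   show "AE e in arc_measure. (ARC e'. g e * g e' * (ARC y. K e y * K e' y)) <= (ARC e'. g e * g e' * (4 * (K e e' + K e' e)))"
    using AE_arc
   proof (rule eventually_mono)
    fix e :: complex assume e: "norm e = 1"
    show "(ARC e'. g e * g e' * (ARC y. K e y * K e' y)) <= (ARC e'. g e * g e' * (4 * (K e e' + K e' e)))"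
    proof (rule nn_integral_mono_AE, rule eventually_mono[OF AE_arc])
     fix e' :: complex assume e': "norm e' = 1"
     show "g e * g e' * (ARC y. K e y * K e' y) <= g e * g e' * (4 * (K e e' + K e' e))"
      by (rule mult_left_mono[OF K_conv[OF e e']]) simp
    qed
   qed
  qed
  also have "... = (ARC e. (4 * (g e * Tf g e) + (ARC e'. 4 * (g e * g e' * K e' e))))"
  proof (intro nn_integral_cong)
   fix e
   have "(ARC e'. g e * g e' * (4 * (K e e' + K e' e))) = (ARC e'. 4 * (g e * (K e e' * g e')) + 4 * (g e * g e' * K e' e))"
    by (intro nn_integral_cong) (simp add: algebra_simps)
   also have "... = (ARC e'. 4 * (g e * (K e e' * g e'))) + (ARC e'. 4 * (g e * g e' * K e' e))"
    by (intro nn_integral_add) measurable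
   also have "(ARC e'. 4 * (g e * (K e e' * g e'))) = 4 * (g e * Tf g e)"
    by (simp add: nn_integral_cmult Tf_def)
   finally show "(ARC e'. g e * g e' * (4 * (K e e' + K e' e))) = 4 * (g e * Tf g e) + (ARC e'. 4 * (g e * g e' * K e' e))" .
  qed
  also have "... = (ARC e. 4 * (g e * Tf g e)) + (ARC e. (ARC e'. 4 * (g e * g e' * K e' e)))"
   by (intro nn_integral_add) measurable
  also have "(ARC e. (ARC e'. 4 * (g e * g e' * K e' e))) = (ARC e'. (ARC e. 4 * (g e * g e' * K e' e)))"
   by (rule arc2.Fubini') measurable
  also have "... = (ARC e'. 4 * (g e' * Tf g e'))"
   unfolding Tf_def by (intro nn_integral_cong) (simp add: nn_integral_cmult[symmetric] mult_ac)
  also have "(ARC e. 4 * (g e * Tf g e)) + (ARC e'. 4 * (g e' * Tf g e')) = 8 * (ARC e. g e * Tf g e)"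
   by (simp add: nn_integral_cmult distrib_right[symmetric])
  also have "... <= 8 * ennreal (sqrt (a * (c * a)))" by (intro mult_left_mono gTg) auto
  also have "... = ennreal (8 * sqrt (a * (c * a)))" using a c by (simp add: ennreal_mult)
  also have "sqrt (a * (c * a)) = sqrt c * a" using a c by (simp add: real_sqrt_mult)
  finally show ?thesis by (simp add: mult.assoc)
 qed
 have "ennreal a = (ARC e. g e * Tf f e)"
  unfolding a(2)[symmetric] power2_eq_square using gT by (intro nn_integral_cong_AE) (auto elim: eventually_mono)
 also have "... = (ARC e. (ARC y. g e * (K e y * f y)))"
  unfolding Tf_def by (simp add: nn_integral_cmult)
 also have "... = (ARC y. (ARC e. g e * (K e y * f y)))"
  by (rule arc2.Fubini') measurable
 also have "... = (ARC y. f y * h y)"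
  unfolding h_def by (intro nn_integral_cong) (simp add: nn_integral_cmult[symmetric] mult_ac)
 also have "... <= ennreal (sqrt (b * (8 * sqrt c * a)))"
  using a b c h2 by (intro cauchy_schwarz_real) auto
 finally have le: "a <= sqrt (b * (8 * sqrt c * a))" using a b c by simp
 have "a <= 8 * sqrt c * b"
 proof (cases "a = 0")
  case False
  have "a^2 <= b * (8 * sqrt c * a)"
  proof -
   have "a^2 <= (sqrt (b * (8 * sqrt c * a)))^2" using le a by (intro power_mono) auto
   then show ?thesis using a b c by simp
  qed
  then have "a * a <= (8 * sqrt c * b) * a" by (simp add: power2_eq_square mult_ac)
  then show ?thesis using False a by (simp add: mult_le_cancel_right)
 qed (use b c in auto)
 then have "ennreal a <= ennreal (8 * sqrt c) * ennreal b" using b c by (simp add: ennreal_mult[symmetric] ennreal_leI)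
 moreover have "(ARC e. (Tf f e)^2) = ennreal a"
  unfolding a(2)[symmetric] using gT by (intro nn_integral_cong_AE) (auto elim: eventually_mono)
 ultimately show "(ARC e. (Tf f e)^2) <= ennreal (8 * sqrt c) * (ARC y. (f y)^2)"
  by (simp add: b)
qed

text \<open>If the infimum c of the valid constants exceeded 64, then c < (c/8)^2, and a valid d
  below (c/8)^2 would yield the valid constant 8 sqrt d < c. The bound is thereby free of
  \<open>r0\<close>.\<close>

lemma valid_64: "valid 64"
proof -
 define c where "c = Inf {c. valid c}"
 have bdd: "bdd_below {c. valid c}" by (rule bdd_belowI[of _ 0]) (auto simp: valid_def)
 have ne: "{c. valid c} \<noteq> {}" using valid_init by auto
 have c0: "c >= 0" unfolding c_def using ne by (intro cInf_greatest) (auto simp: valid_def)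
 have mono: "valid d'" if "valid d" "d <= d'" for d d'
  unfolding valid_def
 proof (intro conjI allI impI)
  show "0 <= d'" using that by (auto simp: valid_def)
  fix f :: "complex => ennreal" and B :: real
  assume *: "f \<in> borel_fun" "0 <= B" "\<forall>y. f y <= ennreal B"
  have "(ARC e. (Tf f e)^2) <= ennreal d * (ARC y. (f y)^2)"
   using that(1) * unfolding valid_def by blast
  also have "... <= ennreal d' * (ARC y. (f y)^2)" using that by (intro mult_right_mono ennreal_leI) auto
  finally show "(ARC e. (Tf f e)^2) <= ennreal d' * (ARC y. (f y)^2)" .
 qed
 have c64: "c <= 64"
 proof (rule ccontr)
  assume "\<not> c <= 64"
  then have c: "c > 64" by simp
  have "8 * sqrt c < c"
  proof -
   have "8 < sqrt c" using c by (intro real_less_rsqrt) auto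
   then have "8 * sqrt c < sqrt c * sqrt c" using c by (intro mult_strict_right_mono) auto
   then show ?thesis using c0 by simp
  qed
  then have "sqrt (c/8 * (c/8)) > sqrt c" using c by (simp add: real_sqrt_mult field_simps)
  then have "Inf {c. valid c} < c/8 * (c/8)" by (simp add: c_def)
  then obtain d where d: "valid d" "d < c/8 * (c/8)" using cInf_lessD[OF ne] by blast
  have "sqrt d < c/8" using d c by (intro real_less_lsqrt) (auto simp: valid_def power2_eq_square)
  then have "8 * sqrt d < c" by simp
  moreover have "c <= 8 * sqrt d" unfolding c_def using valid_step[OF d(1)] bdd by (intro cInf_lower) auto
  ultimately show False by simp
 qed
 show ?thesis
  unfolding valid_def
 proof (intro conjI allI impI)
  fix f :: "complex => ennreal" and B :: real
  assume f[measurable]: "f \<in> borel_fun" and B: "0 <= B" and f2: "\<forall>y. f y <= ennreal B"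
  obtain b where b: "b >= 0" "(ARC y. (f y)^2) = ennreal b" using fin_sq[of f B] f2 B by auto
  \<comment> \<open>The infimum need not be attained, so constants close to it are used; dividing e
    by b + 1 absorbs the factor b.\<close>
  have eps: "(ARC e. (Tf f e)^2) <= ennreal (64 * b) + ennreal e" if e: "e > 0" for e
  proof -
   have "e / (b + 1) > 0" using e b by simp
   then have "Inf {c. valid c} < 64 + e / (b + 1)" using c64 by (simp add: c_def)
   then obtain d where d: "valid d" "d < 64 + e / (b + 1)" using cInf_lessD[OF ne] by blast
   have "(ARC e. (Tf f e)^2) <= ennreal d * ennreal b"
    using d(1) f B f2 b(2) unfolding valid_def by metis
   also have "... = ennreal (d * b)" using d b by (simp add: ennreal_mult valid_def)
   also have "... <= ennreal (64 * b + e)"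
   proof (rule ennreal_leI)
    have "d * b <= (64 + e / (b+1)) * b" using d b by (intro mult_right_mono) auto
    also have "... = 64 * b + e * (b / (b+1))" by (simp add: algebra_simps)
    also have "... <= 64 * b + e * 1" using b e by (intro add_left_mono mult_left_mono) auto
    finally show "d * b <= 64 * b + e" by simp
   qed
   finally show ?thesis using e b by (simp add: ennreal_plus)
  qed
  have "(ARC e. (Tf f e)^2) <= ennreal (64 * b)"
   by (rule ennreal_le_epsilon) (rule eps)
  also have "... = ennreal 64 * ennreal b" using b(1) by (rule ennreal_mult[rotated]) simp
  finally show "(ARC e. (Tf f e)^2) <= ennreal 64 * (ARC y. (f y)^2)"
   unfolding b(2) .
 qed simp
qed

end


definition Mx :: "real set => (complex => ennreal) => complex => ennreal" where
 "Mx R f e = (SUP r\<in>R. (ARC y. ennreal (poisson (of_real r * e) y) * f y))"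

text \<open>With finitely many radii the supremum is attained, and the smallest maximizing radius is
  a measurable function of e; this is the choice of radii handed to \<open>linmax\<close>.\<close>

lemma maximal_L2:
 assumes R: "finite R" "R \<noteq> {}" "R \<subseteq> {0..<1}"
  and [measurable]: "f \<in> borel_fun" and f: "\<And>y. f y <= ennreal B" "B >= 0"
 shows "(ARC e. (Mx R f e)^2) <= 64 * (ARC y. (f y)^2)"
proof -
 define S where "S r e = (ARC y. ennreal (poisson (of_real r * e) y) * f y)" for r e
 have [measurable]: "(%e. S r e) \<in> borel_fun" for r unfolding S_def by measurable
 define A where "A e = {r\<in>R. \<forall>s\<in>R. S s e <= S r e}" for e
 define \<rho> where "\<rho> e = Min (A e)" for e
 have Mx: "Mx R f e = (SUP r\<in>R. S r e)" for e by (simp add: Mx_def S_def)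
 have A: "finite (A e)" "A e \<noteq> {}" "A e \<subseteq> R" for e
 proof -
  have "Max ((%r. S r e) ` R) \<in> (%r. S r e) ` R" using R by (intro Max_in) auto
  then obtain r where r: "r \<in> R" "S r e = Max ((%r. S r e) ` R)" by auto
  then have "r \<in> A e" using R by (auto simp: A_def)
  then show "A e \<noteq> {}" by auto
 qed (use R in \<open>auto simp: A_def\<close>)
 have rho: "\<rho> e \<in> A e" for e unfolding \<rho>_def using A[of e] by (intro Min_in)
 have MS: "Mx R f e = S (\<rho> e) e" for e
 proof (rule antisym)
  show "Mx R f e <= S (\<rho> e) e" unfolding Mx using rho[of e] by (intro SUP_least) (auto simp: A_def)
  show "S (\<rho> e) e <= Mx R f e" unfolding Mx using rho[of e] by (intro SUP_upper) (auto simp: A_def)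
 qed
 have [measurable]: "\<rho> \<in> borel_fun"
 proof (rule borel_measurableI_le)
  fix c
  have "{e \<in> space borel. \<rho> e <= c} = (\<Union>r\<in>{r\<in>R. r <= c}. {e \<in> space borel. \<forall>s\<in>R. S s e <= S r e})"
  proof (intro set_eqI iffI)
   fix e assume "e \<in> {e \<in> space borel. \<rho> e <= c}"
   then show "e \<in> (\<Union>r\<in>{r\<in>R. r <= c}. {e \<in> space borel. \<forall>s\<in>R. S s e <= S r e})"
    using rho[of e] by (auto simp: A_def)
  next
   fix e assume "e \<in> (\<Union>r\<in>{r\<in>R. r <= c}. {e \<in> space borel. \<forall>s\<in>R. S s e <= S r e})"
   then obtain r where r: "r \<in> A e" "r <= c" by (auto simp: A_def)
   then have "\<rho> e <= r" unfolding \<rho>_def using A(1) by (intro Min_le)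
   then show "e \<in> {e \<in> space borel. \<rho> e <= c}" using r by auto
  qed
  also have "... \<in> sets borel"
  proof (rule sets.finite_UN)
   fix r
   have "{e \<in> space borel. \<forall>s\<in>R. S s e <= S r e} = (\<Inter>s\<in>R. {e \<in> space borel. S s e <= S r e})" using R by auto
   also have "... \<in> sets borel" using R by (intro sets.finite_INT) measurable
   finally show "{e \<in> space borel. \<forall>s\<in>R. S s e <= S r e} \<in> sets borel" .
  qed (use R in auto)
  finally show "{e \<in> space borel. \<rho> e <= c} \<in> sets borel" .
 qed
 interpret linmax \<rho> "Max R"
 proof
  fix e
  have "\<rho> e \<in> R" using rho[of e] by (auto simp: A_def)
  then show "0 <= \<rho> e" "\<rho> e <= Max R" using R by auto
  show "Max R < 1" using R by auto
 qed measurable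
 have "Mx R f e = Tf f e" for e unfolding MS by (simp add: S_def Tf_def K_def)
 then show ?thesis using valid_64 f unfolding valid_def by auto
qed

lemma Mx_measurable [measurable]:
 assumes "finite R" and [measurable]: "f \<in> borel_fun"
 shows "Mx R f \<in> borel_fun"
proof -
 have [simp]: "countable R" using assms(1) by (rule countable_finite)
 show ?thesis unfolding Mx_def by measurable
qed

text \<open>Averaging the circular mean value property over rotations of the disc replaces polar coordinates.\<close>

lemma area_mean_value:
 assumes h: "continuous_on (cball a r) h" "h holomorphic_on ball a r" and r: "r > 0"
 shows "ennreal (pi * r\<^sup>2) * nsq (h a) <= (LEB z. nsq (h z) * indicator (ball a r) z)"
proof -
 define G where "G z = nsq (h (a + z)) * indicator (ball 0 r) z" for z
 have contG: "continuous_on (ball 0 r) (%z. (norm (h (a + z)))^2)"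
  by (intro continuous_intros continuous_on_compose2[OF h(1)]) (auto simp: dist_norm)
 have [measurable]: "G \<in> borel_fun"
 proof -
  have "(%z. indicator (ball 0 r) z *\<^sub>R (norm (h (a + z)))^2) \<in> borel_fun"
   using contG by (intro borel_measurable_continuous_on_indicator) auto
  then have "(%z. ennreal (indicator (ball 0 r) z *\<^sub>R (norm (h (a + z)))^2)) \<in> borel_fun" by measurable
  then show ?thesis by (rule measurable_cong[THEN iffD1, rotated]) (auto simp: G_def split: split_indicator)
 qed
 have "(LEB z. nsq (h z) * indicator (ball a r) z) = (LEB z. G (z - a))"
  by (intro nn_integral_cong) (auto simp: G_def dist_norm norm_minus_commute split: split_indicator)
 also have "... = (LEB z. G z)"
 proof -
  have "(LEB z. G z) = (\<integral>\<^sup>+z. G z \<partial>(distr lborel borel (%z. - a + z)))"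
   by (subst lborel_distr_plus) simp
  also have "... = (LEB z. G (z - a))" by (subst nn_integral_distr) auto
  finally show ?thesis by simp
 qed
 finally have 1: "(LEB z. nsq (h z) * indicator (ball a r) z) = (LEB z. G z)" .
 have "(LEB z. G z) = (LEB t. (LEB z. G (cis t * z)) * indicator {0..2*pi} t) / ennreal (2*pi)"
  by (subst nn_integral_lborel_cis) (simp_all add: nn_integral_cmult_indicator ennreal_mult_divide_eq)
 also have "... = (LEB t. (LEB z. G (cis t * z) * indicator {0..2*pi} t)) / ennreal (2*pi)"
  by (simp add: nn_integral_multc)
 also have "(LEB t. (LEB z. G (cis t * z) * indicator {0..2*pi} t)) = (LEB z. (LEB t. G (cis t * z) * indicator {0..2*pi} t))"
 proof -
  have "pair_sigma_finite (lborel :: real measure) (lborel :: complex measure)"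
   by (intro pair_sigma_finite.intro lborel.sigma_finite_measure_axioms)
  then show ?thesis by (rule pair_sigma_finite.Fubini'[symmetric]) measurable
 qed
 also have "(LEB z. (LEB t. G (cis t * z) * indicator {0..2*pi} t)) / ennreal (2*pi)
  = (LEB z. (LEB t. G (cis t * z) * indicator {0..2*pi} t) / ennreal (2*pi))"
  by (simp add: nn_integral_divide)
 also have "... >= (LEB z. nsq (h a) * indicator (ball (0::complex) r) z)"
 proof (intro nn_integral_mono)
  fix z :: complex
  show "nsq (h a) * indicator (ball 0 r) z <= (LEB t. G (cis t * z) * indicator {0..2*pi} t) / ennreal (2*pi)"
  proof (cases "z \<in> ball 0 r")
   case True
   \<comment> \<open>For fixed z the points a + u z with |u| = 1 trace a circle about a, so the mean
     value inequality for u \<mapsto> h (a + u z) at u = 0 bounds |h a|^2 by the average over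
     rotations of z.\<close>
   define k where "k u = h (a + u * z)" for u
   have inb: "a + u * z \<in> ball a r" if "norm u <= 1" for u
   proof -
    have "norm (u * z) <= 1 * norm z" unfolding norm_mult using that by (intro mult_right_mono) auto
    then show ?thesis using True by (simp add: dist_norm)
   qed
   have "continuous_on (ball a r) h" using h(1) by (rule continuous_on_subset) auto
   then have "continuous_on (cball 0 1) k" unfolding k_def
    by (rule continuous_on_compose2) (auto intro!: continuous_intros inb simp del: mem_ball)
   moreover have "k holomorphic_on ball 0 1" unfolding k_def
    by (rule holomorphic_on_compose_gen[OF _ h(2), unfolded o_def]) (auto intro!: holomorphic_intros inb simp del: mem_ball)
   ultimately have k: "disc_alg k" by (simp add: disc_alg_def)
   have [measurable]: "(%y. G (y * z)) \<in> borel_fun" by measurable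
   have "nsq (h a) <= (ARC y. nsq (k y) * indicator (cball 0 1) y)"
    using poisson_norm_sq_le[OF k, of 0] by (simp add: k_def poisson_def)
   also have "... <= (ARC y. G (y * z))"
    using inb by (intro nn_integral_mono) (auto simp: G_def k_def dist_norm split: split_indicator)
   also have "... = (LEB t. G (cis t * z) * indicator {0..2*pi} t) / ennreal (2*pi)"
    by (subst nn_integral_arc) auto
   finally show ?thesis using True by simp
  qed simp
 qed
 finally have "(LEB z. nsq (h a) * indicator (ball (0::complex) r) z) <= (LEB z. G z)" .
 moreover have "(LEB z. nsq (h a) * indicator (ball (0::complex) r) z) = ennreal (pi * r\<^sup>2) * nsq (h a)"
  using r emeasure_ball[of r "0::complex"] by (subst nn_integral_cmult_indicator) (simp_all add: unit_ball_vol_2 mult.commute)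
 ultimately show ?thesis using 1 by simp
qed

text \<open>The area mean value over the disc of radius \<delta>/2 about a, with \<delta> = 1 - |a|:
  there \<delta>/2 \<le> 1 - |z|^2 \<le> 3\<delta>, so the weight is comparable to \<delta>^\<beta>.
  \<open>C\<close> is chosen so that all constants multiply to 1.\<close>

lemma mean_value_dA:
 assumes b: "\<beta> > -1"
 obtains C where "C > 0" "\<And>h a. h holomorphic_on ball 0 1 ==> norm a < 1 ==>
  nsq (h a) <= ennreal (C * (1 - norm a) powr (- (\<beta>+2))) * (\<integral>\<^sup>+z. nsq (h z) * indicator (ball a ((1 - norm a)/2)) z \<partial>dA \<beta>)"
proof -
 define k where "k = min ((1/2) powr \<beta>) (3 powr \<beta>)"
 have k: "k > 0" by (simp add: k_def)
 define C where "C = 4 / ((\<beta>+1) * k)"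
 have C: "C > 0" using b k by (simp add: C_def)
 show ?thesis
 proof (rule that[OF C])
  fix h :: "complex => complex" and a :: complex
  assume h: "h holomorphic_on ball 0 1" and a: "norm a < 1"
  define \<delta> where "\<delta> = 1 - norm a"
  have d: "0 < \<delta>" "\<delta> <= 1" using a by (auto simp: \<delta>_def)
  have sub: "cball a (\<delta>/2) \<subseteq> ball 0 1"
  proof
   fix z assume "z \<in> cball a (\<delta>/2)"
   then have "norm (a - z) <= \<delta>/2" by (simp add: dist_norm)
   then show "z \<in> ball 0 1" using norm_triangle_ineq2[of z a] d by (simp add: \<delta>_def norm_minus_commute)
  qed
  define I where "I = (LEB z. nsq (h z) * indicator (ball a (\<delta>/2)) z)"
  define J where "J = (\<integral>\<^sup>+z. nsq (h z) * indicator (ball a (\<delta>/2)) z \<partial>dA \<beta>)"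
  define w where "w = (\<beta>+1) / pi * (k * \<delta> powr \<beta>)"
  have w: "w > 0" using b k d by (simp add: w_def)
  have [measurable]: "(%z. nsq (h z) * indicator (ball a (\<delta>/2)) z) \<in> borel_fun"
  proof -
   have "continuous_on (ball a (\<delta>/2)) (%z. (norm (h z))^2)"
    using holomorphic_on_imp_continuous_on[OF h] sub by (intro continuous_intros) (auto elim!: continuous_on_subset)
   then have "(%z. indicator (ball a (\<delta>/2)) z *\<^sub>R (norm (h z))^2) \<in> borel_fun"
    by (intro borel_measurable_continuous_on_indicator) auto
   then have "(%z. ennreal (indicator (ball a (\<delta>/2)) z *\<^sub>R (norm (h z))^2)) \<in> borel_fun" by measurable
   then show ?thesis by (rule measurable_cong[THEN iffD1, rotated]) (auto split: split_indicator)
  qed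
  have mv: "ennreal (pi * (\<delta>/2)^2) * nsq (h a) <= I" unfolding I_def
  proof (rule area_mean_value)
   show "continuous_on (cball a (\<delta>/2)) h" using holomorphic_on_imp_continuous_on[OF h] sub by (rule continuous_on_subset)
   show "h holomorphic_on ball a (\<delta>/2)" using h by (rule holomorphic_on_subset) (use sub in auto)
  qed (use d in auto)
  have "ennreal w * I = (LEB z. ennreal w * (nsq (h z) * indicator (ball a (\<delta>/2)) z))"
   unfolding I_def by (simp add: nn_integral_cmult)
  also have "... <= (LEB z. nsq (h z) * indicator (ball a (\<delta>/2)) z * ennreal (wdens \<beta> z) * indicator (ball 0 1) z)"
  proof (intro nn_integral_mono)
   fix z
   show "ennreal w * (nsq (h z) * indicator (ball a (\<delta>/2)) z) <= nsq (h z) * indicator (ball a (\<delta>/2)) z * ennreal (wdens \<beta> z) * indicator (ball 0 1) z"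
   proof (cases "z \<in> ball a (\<delta>/2)")
    case True
    then have z1: "norm (a - z) < \<delta>/2" by (simp add: dist_norm)
    have "z \<in> cball a (\<delta>/2)" using True by auto
    then have z2: "z \<in> ball 0 1" by (rule subsetD[OF sub])
    define r where "r = norm z"
    have r: "0 <= r" "r <= 1 - \<delta>/2" "r >= 1 - 3*\<delta>/2"
    proof -
     have "norm z - norm a <= norm (a - z)" "norm a - norm z <= norm (a - z)"
      using norm_triangle_ineq2[of z a] norm_triangle_ineq2[of a z] by (auto simp: norm_minus_commute)
     moreover have "norm a = 1 - \<delta>" by (simp add: \<delta>_def)
     ultimately show "0 <= r" "r <= 1 - \<delta>/2" "r >= 1 - 3*\<delta>/2" using z1 by (auto simp: r_def field_simps)
    qed
    have e: "1 - r^2 = (1-r)*(1+r)" by (simp add: algebra_simps power2_eq_square)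
    have lo: "\<delta> / 2 <= 1 - r^2"
    proof -
     have "\<delta>/2 * 1 <= (1-r)*(1+r)" using r d by (intro mult_mono) auto
     then show ?thesis by (simp add: e)
    qed
    have hi: "1 - r^2 <= 3 * \<delta>"
    proof -
     have "(1-r)*(1+r) <= (3*\<delta>/2) * 2" using r d by (intro mult_mono) auto
     then show ?thesis using d by (simp add: e)
    qed
    have "k * \<delta> powr \<beta> <= (1 - r^2) powr \<beta>"
    proof (cases "\<beta> >= 0")
     case True
     have "k * \<delta> powr \<beta> <= (1/2) powr \<beta> * \<delta> powr \<beta>" by (intro mult_right_mono) (auto simp: k_def)
     also have "... = (\<delta>/2) powr \<beta>" using d by (simp add: powr_mult[symmetric])
     also have "... <= (1 - r^2) powr \<beta>" using lo d True by (intro powr_mono2) auto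
     finally show ?thesis .
    next
     case False
     have "k * \<delta> powr \<beta> <= 3 powr \<beta> * \<delta> powr \<beta>" by (intro mult_right_mono) (auto simp: k_def)
     also have "... = (3 * \<delta>) powr \<beta>" using d by (simp add: powr_mult[symmetric])
     also have "... <= (1 - r^2) powr \<beta>" using hi lo d False by (intro powr_mono2') auto
     finally show ?thesis .
    qed
    then have "(\<beta>+1) * (k * \<delta> powr \<beta>) / pi <= wdens \<beta> z" unfolding wdens_def r_def using b by (intro divide_right_mono mult_left_mono) auto
    then have "ennreal w <= ennreal (wdens \<beta> z)" by (intro ennreal_leI) (simp add: w_def)
    then show ?thesis using True z2 by (simp add: mult.commute[of "nsq (h z)"] mult_right_mono)
   qed simp
  qed
  also have "... = J" unfolding J_def by (subst nn_integral_dA) auto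
  finally have wJ: "ennreal w * I <= J" .
  have "nsq (h a) = ennreal (C * \<delta> powr (- (\<beta>+2)) * w * (pi * (\<delta>/2)^2)) * nsq (h a)"
  proof -
   have "C * \<delta> powr (- (\<beta>+2)) * w * (pi * (\<delta>/2)^2) = \<delta> powr (- (\<beta>+2)) * \<delta> powr \<beta> * \<delta>\<^sup>2"
   proof -
    have ff: "4 / (s * k) * X * (s / pi * (k * Y)) * (pi * (\<delta>/2)^2) = X * Y * \<delta>\<^sup>2" if "s \<noteq> 0" for s X Y
     using that k by (simp add: power2_eq_square)
    show ?thesis unfolding C_def w_def by (rule ff) (use b in auto)
   qed
   also have "\<delta>\<^sup>2 = \<delta> powr 2" using d by simp
   also have "\<delta> powr (- (\<beta>+2)) * \<delta> powr \<beta> * \<delta> powr 2 = 1" by (simp only: powr_add[symmetric]) (use d in simp)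
   finally show ?thesis by simp
  qed
  also have "... = ennreal (C * \<delta> powr (- (\<beta>+2))) * (ennreal w * (ennreal (pi * (\<delta>/2)^2) * nsq (h a)))"
  proof -
   have "ennreal (P * w * Q) = ennreal P * ennreal w * ennreal Q" if "P >= 0" "Q >= 0" for P Q
    using that w by (simp add: ennreal_mult)
   then have "ennreal (C * \<delta> powr (- (\<beta>+2)) * w * (pi * (\<delta>/2)^2)) = ennreal (C * \<delta> powr (- (\<beta>+2))) * ennreal w * ennreal (pi * (\<delta>/2)^2)"
    using C by simp
   then show ?thesis by (simp only: mult.assoc)
  qed
  also have "... <= ennreal (C * \<delta> powr (- (\<beta>+2))) * (ennreal w * I)" by (intro mult_left_mono mv) auto
  also have "... <= ennreal (C * \<delta> powr (- (\<beta>+2))) * J" by (intro mult_left_mono wJ) auto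
  finally show "nsq (h a) <= ennreal (C * (1 - norm a) powr (- (\<beta>+2))) * (\<integral>\<^sup>+z. nsq (h z) * indicator (ball a ((1 - norm a)/2)) z \<partial>dA \<beta>)"
   by (simp add: J_def \<delta>_def)
 qed
qed

section \<open>Self-maps of the polydisc up to the boundary\<close>

no_notation fps_nth (infixl "$" 75)

section \<open>The closed polydisc: topology, dilations and analytic discs\<close>

lemmas vec_nth_norm_le = Finite_Cartesian_Product.norm_nth_le

lemma polydisc_subset: "polydisc \<subseteq> cpolydisc"
 by (auto simp: polydisc_def cpolydisc_def less_imp_le)

lemma polydisc_component: "z \<in> polydisc ==> norm (z $ k) < 1"
 and cpolydisc_component: "z \<in> cpolydisc ==> norm (z $ k) <= 1"
 by (auto simp: polydisc_def cpolydisc_def)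

lemma convex_polydisc: "convex (polydisc :: (complex^'n) set)"
proof -
 have "polydisc = {z :: complex^'n. \<forall>k. z $ k \<in> ball 0 1}" by (auto simp: polydisc_def)
 moreover have "convex {z :: complex^'n. \<forall>k. z $ k \<in> ball 0 1}"
  using convex_ball[of "0::complex" 1] by (auto simp: convex_def simp del: mem_ball)
 ultimately show ?thesis by simp
qed

lemma open_polydisc: "open (polydisc :: (complex^'n) set)"
proof -
 have "polydisc = (\<Inter>k\<in>UNIV. {z :: complex^'n. norm (z $ k) < 1})" by (auto simp: polydisc_def)
 moreover have "open ..." by (intro open_INT ballI open_Collect_less continuous_intros) auto
 ultimately show ?thesis by simp
qed

lemma closed_cpolydisc: "closed (cpolydisc :: (complex^'n) set)"
proof -
 have "cpolydisc = (\<Inter>k\<in>UNIV. {z :: complex^'n. norm (z $ k) <= 1})" by (auto simp: cpolydisc_def)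
 moreover have "closed ..." by (intro closed_INT ballI closed_Collect_le continuous_intros)
 ultimately show ?thesis by simp
qed

lemma norm_le_sum_vec: "norm (z :: complex^'n) <= (\<Sum>k\<in>UNIV. norm (z $ k))"
 unfolding norm_vec_def by (rule L2_set_le_sum) simp

lemma compact_cpolydisc: "compact (cpolydisc :: (complex^'n) set)"
proof -
 have "bounded (cpolydisc :: (complex^'n) set)"
 proof (rule boundedI)
  fix z :: "complex^'n" assume "z \<in> cpolydisc"
  then have "(\<Sum>k\<in>UNIV. norm (z $ k)) <= (\<Sum>k\<in>(UNIV::'n set). 1)" by (intro sum_mono) (auto simp: cpolydisc_def)
  then show "norm z <= real CARD('n)" using norm_le_sum_vec[of z] by simp
 qed
 then show ?thesis by (simp add: compact_eq_bounded_closed closed_cpolydisc)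
qed

lemma scale_polydisc: "z \<in> cpolydisc ==> 0 <= r ==> r < 1 ==> r *\<^sub>R z \<in> polydisc"
proof -
 assume *: "z \<in> cpolydisc" "0 <= r" "r < 1"
 have "r * norm (z $ k) < 1" for k
  using mult_left_le[of "norm (z $ k)" r] * cpolydisc_component[OF *(1), of k] by linarith
 then show ?thesis using * by (simp add: polydisc_def)
qed

lemma at_left_1_pos: "eventually (%r::real. 0 <= r \<and> r < 1) (at_left 1)"
 using eventually_at_left_real[of 0 "1::real"] by (auto elim: eventually_mono)

lemma tendsto_scale_left: "((%r::real. r *\<^sub>R z) \<longlongrightarrow> z) (at_left 1)" for z :: "complex^'n"
proof -
 have "((%r::real. r *\<^sub>R z) \<longlongrightarrow> 1 *\<^sub>R z) (at_left 1)" by (intro tendsto_intros)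
 then show ?thesis by simp
qed

lemma continuous_scale_limit:
 fixes f :: "complex^'n => 'b::t2_space"
 assumes f: "continuous_on cpolydisc f" and z: "z \<in> cpolydisc"
 shows "((%r. f (r *\<^sub>R z)) \<longlongrightarrow> f z) (at_left 1)"
proof (rule continuous_on_tendsto_compose[OF f tendsto_scale_left z])
 show "\<forall>\<^sub>F r in at_left 1. r *\<^sub>R z \<in> cpolydisc"
  using at_left_1_pos by (rule eventually_mono) (use scale_polydisc[OF z] polydisc_subset in auto)
qed

text \<open>Guarantees that the filter in the definition of \<open>jac\<close> is nontrivial, so
  that its \<open>Lim\<close> is a genuine limit on the boundary too.\<close>

lemma islimpt_polydisc:
 assumes z: "z \<in> cpolydisc"
 shows "z islimpt (polydisc :: (complex^'n) set)"
proof (cases "z \<in> polydisc")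
 case True
 then show ?thesis using interior_limit_point[of z polydisc] by (simp add: interior_open open_polydisc)
next
 case False
 have "z \<in> closure polydisc"
  unfolding closure_approachable
 proof (intro allI impI)
  fix e :: real assume "e > 0"
  then have "eventually (%r::real. dist (r *\<^sub>R z) z < e) (at_left 1)" using tendsto_scale_left by (rule tendstoD[rotated])
  then have "eventually (%r::real. dist (r *\<^sub>R z) z < e \<and> 0 <= r \<and> r < 1) (at_left 1)" using at_left_1_pos by (rule eventually_conj)
  then obtain r :: real where "dist (r *\<^sub>R z) z < e" "0 <= r" "r < 1"
   using eventually_happens'[of "at_left (1::real)"] trivial_limit_at_left_real by blast
  then show "\<exists>y\<in>polydisc. dist y z < e" using scale_polydisc[OF z] by blast
 qed
 then show ?thesis using False by (simp add: closure_def)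
qed

lemma vec_expand: "v = (\<Sum>k\<in>UNIV. (v $ k) *s axis k 1)" for v :: "complex^'n"
 by (simp add: basis_expansion)

lemma holo_along_line:
 assumes f: "holo_on f polydisc" and l: "a + l *s b \<in> polydisc"
 shows "\<exists>D. ((%l. f (a + l *s b)) has_field_derivative D) (at l)"
proof -
 obtain D where D: "(f has_derivative D) (at (a + l *s b))" "\<And>c v. D (c *s v) = c * D v"
  using f l by (auto simp: holo_on_def)
 have "linear (%h. h *s b)" by (rule linearI) (auto simp: vec_eq_iff algebra_simps)
 then have bl: "bounded_linear (%h. h *s b)" by (rule linear_conv_bounded_linear[THEN iffD1])
 have "((%l. a + l *s b) has_derivative (%h. h *s b)) (at l)"
  using bounded_linear.has_derivative[OF bl has_derivative_ident] by (auto intro!: derivative_eq_intros)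
 then have "((%l. f (a + l *s b)) has_derivative (%h. D (h *s b))) (at l)"
  using D(1) by (rule has_derivative_compose)
 then have "((%l. f (a + l *s b)) has_field_derivative D b) (at l)"
  by (simp add: has_field_derivative_def D(2) mult.commute[of _ "D b"])
 then show ?thesis by blast
qed

text \<open>The analytic disc may lie in the boundary, where f need not have a derivative. Its
  dilates by r < 1 lie in the open polydisc, and uniform continuity on the compact closed polydisc
  lets r tend to 1 uniformly in l.\<close>

lemma disc_alg_slice:
 assumes c: "continuous_on cpolydisc f" and f: "holo_on f polydisc"
  and pq: "\<And>l. norm l <= 1 ==> p + l *s q \<in> cpolydisc"
 shows "disc_alg (%l. f (p + l *s q))"
proof -
 have cl: "continuous_on S (%l. r *\<^sub>R (p + l *s q))" for S and r :: real
  by (intro continuous_intros) (auto simp: vector_scalar_mult_def intro!: continuous_intros)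
 have r: "continuous_on (cball 0 1) (%l. f (r *\<^sub>R (p + l *s q))) \<and> (%l. f (r *\<^sub>R (p + l *s q))) holomorphic_on ball 0 1"
  if "0 <= r" "r < 1" for r :: real
 proof
  have in': "r *\<^sub>R (p + l *s q) \<in> polydisc" if "norm l <= 1" for l
   using scale_polydisc[OF pq] that \<open>0 <= r\<close> \<open>r < 1\<close> by blast
  have "continuous_on polydisc f" using c polydisc_subset by (rule continuous_on_subset)
  then show "continuous_on (cball 0 1) (%l. f (r *\<^sub>R (p + l *s q)))"
   by (rule continuous_on_compose2[OF _ cl]) (auto intro: in')
  show "(%l. f (r *\<^sub>R (p + l *s q))) holomorphic_on ball 0 1"
  proof (subst holomorphic_on_open, simp, intro ballI)
   fix l :: complex assume l: "l \<in> ball 0 1"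
   have e: "r *\<^sub>R (p + l *s q) = r *\<^sub>R p + l *s (r *\<^sub>R q)" for l by (simp add: vec_eq_iff algebra_simps)
   show "\<exists>f'. ((%l. f (r *\<^sub>R (p + l *s q))) has_field_derivative f') (at l)"
    unfolding e using in'[of l] l by (intro holo_along_line[OF f]) (auto simp: e[symmetric])
  qed
 qed
 have u: "uniform_limit (cball 0 1) (%r l. f (r *\<^sub>R (p + l *s q))) (%l. f (p + l *s q)) (at_left (1::real))"
 proof (rule uniform_limitI)
  fix e :: real assume e: "e > 0"
  have "uniformly_continuous_on cpolydisc f" using c compact_cpolydisc by (rule compact_uniformly_continuous)
  then obtain d where d: "d > 0" "\<And>x y. x \<in> cpolydisc ==> y \<in> cpolydisc ==> dist y x < d ==> dist (f y) (f x) < e"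
   using e unfolding uniformly_continuous_on_def by metis
  obtain B where B: "B > 0" "\<And>z. z \<in> (cpolydisc :: (complex^'a) set) ==> norm z <= B"
   using compact_imp_bounded[OF compact_cpolydisc] by (auto simp: bounded_pos)
  have "eventually (%r::real. r \<in> {max 0 (1 - d / B)<..<1}) (at_left 1)"
   using d B by (intro eventually_at_left_real) auto
  then show "\<forall>\<^sub>F r in at_left (1::real). \<forall>l\<in>cball 0 1. dist (f (r *\<^sub>R (p + l *s q))) (f (p + l *s q)) < e"
  proof (rule eventually_mono, intro ballI)
   fix r :: real and l :: complex assume r: "r \<in> {max 0 (1 - d / B)<..<1}" and l: "l \<in> cball 0 1"
   define z where "z = p + l *s q"
   have z: "z \<in> cpolydisc" using pq l by (auto simp: z_def)
   have "dist (r *\<^sub>R z) z = (1 - r) * norm z"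
   proof -
    have "r *\<^sub>R z - z = (- (1 - r)) *\<^sub>R z" by (simp add: algebra_simps)
    then show ?thesis using r by (simp only: dist_norm norm_scaleR) simp
   qed
   also have "... <= (1 - r) * B" using r B(2)[OF z] by (intro mult_left_mono) auto
   also have "... < d" using r B by (simp add: field_simps)
   finally show "dist (f (r *\<^sub>R (p + l *s q))) (f (p + l *s q)) < e"
    unfolding z_def[symmetric] using z scale_polydisc[OF z, of r] r polydisc_subset by (intro d) auto
  qed
 qed
 have ev: "\<forall>\<^sub>F r in at_left (1::real). continuous_on (cball 0 1) (%l. f (r *\<^sub>R (p + l *s q))) \<and> (%l. f (r *\<^sub>R (p + l *s q))) holomorphic_on ball 0 1"
  using at_left_1_pos by (rule eventually_mono) (use r in auto)
 from holomorphic_uniform_limit[OF ev u] show ?thesis unfolding disc_alg_def by (metis trivial_limit_at_left_real)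
qed

lemma norm_axis_vec: "norm (axis m w) = norm w" for w :: complex
 by (simp add: norm_eq_sqrt_inner inner_axis_axis)

section \<open>First-order behaviour of a self-map at boundary points\<close>

locale smooth_selfmap =
 fixes \<phi> :: "complex ^ 'n => complex ^ 'n"
 assumes hs: "holo_selfmap \<phi>" and c1: "C1_closed \<phi>"
begin

lemma cont: "continuous_on cpolydisc \<phi>" using c1 by (simp add: C1_closed_def)
lemma cont_i: "continuous_on cpolydisc (%z. \<phi> z $ i)" by (intro continuous_intros cont)
lemma holo: "holo_on (%z. \<phi> z $ i) polydisc" using hs by (simp add: holo_selfmap_def)
lemma map_polydisc: "z \<in> polydisc ==> \<phi> z \<in> polydisc" using hs by (auto simp: holo_selfmap_def)

lemma map_cpolydisc: assumes z: "z \<in> cpolydisc" shows "\<phi> z \<in> cpolydisc"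
proof -
 have "norm (\<phi> z $ i) <= 1" for i
 proof (rule tendsto_upperbound)
  show "((%r. norm (\<phi> (r *\<^sub>R z) $ i)) \<longlongrightarrow> norm (\<phi> z $ i)) (at_left 1)"
   by (intro tendsto_norm continuous_scale_limit cont_i z)
  show "\<forall>\<^sub>F r in at_left 1. norm (\<phi> (r *\<^sub>R z) $ i) <= 1"
   using at_left_1_pos by (rule eventually_mono) (use map_polydisc scale_polydisc[OF z] in \<open>auto simp: polydisc_def less_imp_le\<close>)
 qed simp
 then show ?thesis by (simp add: cpolydisc_def)
qed

lemma jac_ext:
 obtains g where "continuous_on cpolydisc g" "\<And>z. z \<in> polydisc ==> g z = partial_deriv (%w. \<phi> w $ i) k z"
  "\<And>z. z \<in> cpolydisc ==> jac \<phi> z i k = g z"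
proof -
 obtain g where g: "continuous_on cpolydisc g" "\<And>z. z \<in> polydisc ==> g z = partial_deriv (%w. \<phi> w $ i) k z"
  using c1 unfolding C1_closed_def by blast
 have "jac \<phi> z i k = g z" if z: "z \<in> cpolydisc" for z
  unfolding jac_def
 proof (rule tendsto_Lim)
  show "at z within polydisc \<noteq> bot" using islimpt_polydisc[OF z] by (simp add: trivial_limit_within)
  have "(g \<longlongrightarrow> g z) (at z within polydisc)"
   using g(1) z polydisc_subset unfolding continuous_on_def by (blast intro: tendsto_within_subset)
  then show "(partial_deriv (%w. \<phi> w $ i) k \<longlongrightarrow> g z) (at z within polydisc)"
   by (rule Lim_transform_eventually) (auto simp: eventually_at_filter g(2))
 qed
 then show ?thesis using that g by blast
qed

lemma jac_cont: "continuous_on cpolydisc (%z. jac \<phi> z i k)"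
proof -
 obtain g where "continuous_on cpolydisc g" "\<And>z. z \<in> cpolydisc ==> jac \<phi> z i k = g z" using jac_ext by metis
 then show ?thesis by (simp cong: continuous_on_cong)
qed

lemma jac_partial: "z \<in> polydisc ==> jac \<phi> z i k = partial_deriv (%w. \<phi> w $ i) k z"
 using jac_ext polydisc_subset by (metis subsetD)

lemma has_derivative_jac:
 assumes z: "z \<in> polydisc"
 shows "((%z. \<phi> z $ i) has_derivative (%v. \<Sum>k\<in>UNIV. jac \<phi> z i k * v $ k)) (at z)"
  and "((%l. \<phi> (z + (l - z $ k) *s axis k 1) $ i) has_field_derivative jac \<phi> z i k) (at (z $ k))"
proof -
 obtain D where D: "((%z. \<phi> z $ i) has_derivative D) (at z)" "\<And>c v. D (c *s v) = c * D v"
  using holo[of i] z by (auto simp: holo_on_def)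
 have lin: "linear D" using D(1) has_derivative_bounded_linear bounded_linear.linear by blast
 have slice: "((%l. \<phi> (z + (l - z $ k) *s axis k 1) $ i) has_field_derivative D (axis k 1)) (at (z $ k))" for k
 proof -
  have "linear (%h. h *s (axis k 1 :: complex^'n))" by (rule linearI) (auto simp: vec_eq_iff algebra_simps)
  then have bl: "bounded_linear (%h. h *s (axis k 1 :: complex^'n))" by (rule linear_conv_bounded_linear[THEN iffD1])
  have "((%l. l - z $ k) has_derivative (%h. h)) (at (z $ k))" by (auto intro!: derivative_eq_intros)
  from has_derivative_add[OF has_derivative_const[of z] bounded_linear.has_derivative[OF bl this]]
  have "((%l. z + (l - z $ k) *s axis k 1) has_derivative (%h. h *s axis k 1)) (at (z $ k))" by (simp only: add_0_left)
  moreover have "((%z. \<phi> z $ i) has_derivative D) (at (z + (z $ k - z $ k) *s axis k 1))" using D(1) by simp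
  ultimately have "((%l. \<phi> (z + (l - z $ k) *s axis k 1) $ i) has_derivative (%h. D (h *s axis k 1))) (at (z $ k))"
   by (rule has_derivative_compose)
  then show ?thesis by (simp add: has_field_derivative_def D(2) mult.commute[of _ "D _"])
 qed
 have jd: "jac \<phi> z i k = D (axis k 1)" for k
 proof -
  have "(\<chi> m. if m = k then w else z $ m) = z + (w - z $ k) *s axis k 1" for w
   by (auto simp: vec_eq_iff axis_def)
  then show ?thesis unfolding jac_partial[OF z] partial_deriv_def using slice[of k] by (simp add: DERIV_imp_deriv)
 qed
 have "D v = (\<Sum>k\<in>UNIV. jac \<phi> z i k * v $ k)" for v
 proof -
  have "D v = D (\<Sum>k\<in>UNIV. (v $ k) *s axis k 1)" using vec_expand[of v] by simp
  also have "... = (\<Sum>k\<in>UNIV. D ((v $ k) *s axis k 1))" using lin by (simp add: linear_sum)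
  finally show ?thesis by (simp add: D(2) jd mult.commute)
 qed
 then have "D = (%v. \<Sum>k\<in>UNIV. jac \<phi> z i k * v $ k)" by auto
 then show "((%z. \<phi> z $ i) has_derivative (%v. \<Sum>k\<in>UNIV. jac \<phi> z i k * v $ k)) (at z)" using D(1) by simp
 show "((%l. \<phi> (z + (l - z $ k) *s axis k 1) $ i) has_field_derivative jac \<phi> z i k) (at (z $ k))"
  unfolding jd by (rule slice)
qed

lemma jac_unif:
 assumes "e > 0"
 shows "\<exists>r>0. \<forall>i k. \<forall>x\<in>cpolydisc. \<forall>y\<in>cpolydisc. dist x y < r --> norm (jac \<phi> x i k - jac \<phi> y i k) < e"
proof -
 have "\<exists>r>0. \<forall>x\<in>cpolydisc. \<forall>y\<in>cpolydisc. dist x y < r --> norm (jac \<phi> x i k - jac \<phi> y i k) < e" for i k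
 proof -
  have "uniformly_continuous_on cpolydisc (%z. jac \<phi> z i k)" using jac_cont compact_cpolydisc by (rule compact_uniformly_continuous)
  then show ?thesis using assms unfolding uniformly_continuous_on_def dist_norm by (metis norm_minus_commute)
 qed
 then obtain r where r: "\<And>i k. r i k > 0" "\<And>i k x y. x \<in> cpolydisc ==> y \<in> cpolydisc ==> dist x y < r i k ==> norm (jac \<phi> x i k - jac \<phi> y i k) < e"
  by metis
 define R where "R = Min (range (%(i,k). r i k))"
 have "R \<in> range (%(i,k). r i k)" unfolding R_def by (intro Min_in) auto
 then have "R > 0" using r(1) by auto
 moreover have "R <= r i k" for i k unfolding R_def by (intro Min_le) auto
 ultimately show ?thesis using r(2) by (meson less_le_trans)
qed

text \<open>The mean value inequality on the convex open set
  \<open>polydisc \<inter> ball \<xi> r\<close>, with uniform continuity of the Jacobian for a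
  radius independent of \<xi>; boundary points are reached by dilating x and y together.\<close>

lemma strict_diff:
 assumes e: "e > 0"
 shows "\<exists>r>0. \<forall>i. \<forall>\<xi>\<in>cpolydisc. \<forall>x\<in>cpolydisc. \<forall>y\<in>cpolydisc. dist x \<xi> < r \<and> dist y \<xi> < r -->
   norm (\<phi> x $ i - \<phi> y $ i - (\<Sum>k\<in>UNIV. jac \<phi> \<xi> i k * (x $ k - y $ k))) <= e * norm (x - y)"
proof -
 have "e / real CARD('n) > 0" using e by simp
 from jac_unif[OF this] obtain r where r: "r > 0" "\<And>i k x y. x \<in> cpolydisc ==> y \<in> cpolydisc ==> dist x y < r ==> norm (jac \<phi> x i k - jac \<phi> y i k) < e / real CARD('n)"
  by blast
 show ?thesis
 proof (intro exI[of _ r] conjI r(1) allI ballI impI; (elim conjE)?)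
  fix i :: 'n and x y \<xi> :: "complex^'n" assume *: "\<xi> \<in> cpolydisc" "x \<in> cpolydisc" "y \<in> cpolydisc" "dist x \<xi> < r" "dist y \<xi> < r"
  define g where "g z = \<phi> z $ i - (\<Sum>k\<in>UNIV. jac \<phi> \<xi> i k * z $ k)" for z
  have int: "norm (g x - g y) <= e * norm (x - y)" if xy: "x \<in> polydisc \<inter> ball \<xi> r" "y \<in> polydisc \<inter> ball \<xi> r" for x y
  proof (rule differentiable_bound[OF _ _ _ xy])
   show "convex (polydisc \<inter> ball \<xi> r)" by (intro convex_Int convex_polydisc convex_ball)
   fix z assume z: "z \<in> polydisc \<inter> ball \<xi> r"
   have "bounded_linear (%v :: complex^'n. \<Sum>k\<in>UNIV. jac \<phi> \<xi> i k * v $ k)"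
    by (intro bounded_linear_sum bounded_linear_compose[OF bounded_linear_mult_right bounded_linear_vec_nth])
   moreover have "((%z. \<phi> z $ i) has_derivative (%v. \<Sum>k\<in>UNIV. jac \<phi> z i k * v $ k)) (at z)"
    using has_derivative_jac(1) z by blast
   ultimately have "(g has_derivative (%v. (\<Sum>k\<in>UNIV. jac \<phi> z i k * v $ k) - (\<Sum>k\<in>UNIV. jac \<phi> \<xi> i k * v $ k))) (at z)"
    unfolding g_def by (intro has_derivative_diff bounded_linear_imp_has_derivative)
   then show "(g has_derivative (%v. \<Sum>k\<in>UNIV. (jac \<phi> z i k - jac \<phi> \<xi> i k) * v $ k)) (at z within polydisc \<inter> ball \<xi> r)"
    unfolding left_diff_distrib sum_subtractf by (rule has_derivative_at_withinI)
   show "onorm (%v. \<Sum>k\<in>UNIV. (jac \<phi> z i k - jac \<phi> \<xi> i k) * v $ k) <= e"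
   proof (rule onorm_le)
    fix v :: "complex^'n"
    have "norm (\<Sum>k\<in>UNIV. (jac \<phi> z i k - jac \<phi> \<xi> i k) * v $ k) <= (\<Sum>k\<in>(UNIV::'n set). e / real CARD('n) * norm v)"
    proof (rule sum_norm_le)
     fix k
     have "norm (jac \<phi> z i k - jac \<phi> \<xi> i k) <= e / real CARD('n)"
      using r(2)[of z \<xi> i k] z *(1) polydisc_subset by (auto simp: dist_commute less_imp_le)
     then show "norm ((jac \<phi> z i k - jac \<phi> \<xi> i k) * v $ k) <= e / real CARD('n) * norm v"
      unfolding norm_mult by (intro mult_mono vec_nth_norm_le) (use e in auto)
    qed
    then show "norm (\<Sum>k\<in>UNIV. (jac \<phi> z i k - jac \<phi> \<xi> i k) * v $ k) <= e * norm v" by simp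
   qed
  qed
  have cg: "continuous_on cpolydisc g" unfolding g_def by (intro continuous_intros cont_i)
  have "norm (g x - g y) <= e * norm (x - y)"
  proof (rule tendsto_le[OF trivial_limit_at_left_real])
   show "((%t. norm (g (t *\<^sub>R x) - g (t *\<^sub>R y))) \<longlongrightarrow> norm (g x - g y)) (at_left 1)"
    using * by (intro tendsto_intros continuous_scale_limit cg)
   show "((%t. e * norm (t *\<^sub>R x - t *\<^sub>R y)) \<longlongrightarrow> e * norm (x - y)) (at_left 1)"
    by (intro tendsto_intros tendsto_scale_left)
   have "eventually (%t. t *\<^sub>R x \<in> ball \<xi> r) (at_left 1)" "eventually (%t. t *\<^sub>R y \<in> ball \<xi> r) (at_left 1)"
    by (rule topological_tendstoD[OF tendsto_scale_left open_ball], use * in \<open>simp add: dist_commute\<close>)+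
   then show "\<forall>\<^sub>F t in at_left 1. norm (g (t *\<^sub>R x) - g (t *\<^sub>R y)) <= e * norm (t *\<^sub>R x - t *\<^sub>R y)"
    using at_left_1_pos by eventually_elim (use * scale_polydisc in \<open>auto intro!: int\<close>)
  qed
  then show "norm (\<phi> x $ i - \<phi> y $ i - (\<Sum>k\<in>UNIV. jac \<phi> \<xi> i k * (x $ k - y $ k))) <= e * norm (x - y)"
  proof -
   have "g x - g y = \<phi> x $ i - \<phi> y $ i - (\<Sum>k\<in>UNIV. jac \<phi> \<xi> i k * (x $ k - y $ k))"
    by (simp add: g_def right_diff_distrib sum_subtractf)
   then show ?thesis using \<open>norm (g x - g y) <= e * norm (x - y)\<close> by simp
  qed
 qed
qed

text \<open>The real part of cnj (\<phi>_i \<xi>) \<phi>_i is at most 1 and equals 1 at \<xi>, so it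
  cannot increase to first order in a direction that stays in the closed polydisc.\<close>

lemma deriv_direction:
 fixes \<xi> :: "complex^'n"
 assumes xi: "\<xi> \<in> cpolydisc" "norm (\<phi> \<xi> $ i) = 1" and t0: "t0 > 0" and v: "\<And>t. 0 < t ==> t < t0 ==> \<xi> + t *\<^sub>R v \<in> cpolydisc"
 shows "Re (cnj (\<phi> \<xi> $ i) * (\<Sum>k\<in>UNIV. jac \<phi> \<xi> i k * v $ k)) <= 0"
proof (rule field_le_epsilon)
 fix e :: real assume e: "e > 0"
 define c where "c = \<phi> \<xi> $ i"
 define L where "L = (\<Sum>k\<in>UNIV. jac \<phi> \<xi> i k * v $ k)"
 have "e / (norm v + 1) > 0" using e by (simp add: add_nonneg_pos)
 from strict_diff[OF this] obtain r where r: "r > 0" "\<And>i x y \<xi>. \<xi> \<in> cpolydisc ==> x \<in> cpolydisc ==> y \<in> cpolydisc ==> dist x \<xi> < r ==> dist y \<xi> < r ==>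
   norm (\<phi> x $ i - \<phi> y $ i - (\<Sum>k\<in>UNIV. jac \<phi> \<xi> i k * (x $ k - y $ k))) <= e / (norm v + 1) * norm (x - y)"
  by blast
 define t where "t = min (t0/2) (r / (2 * (norm v + 1)))"
 have t: "0 < t" "t < t0" using t0 r by (auto simp: t_def add_nonneg_pos)
 have "t * norm v <= r / (2 * (norm v + 1)) * norm v" by (intro mult_right_mono) (auto simp: t_def)
 also have "... < r"
 proof -
  have "norm v < 2 * (norm v + 1)" by (simp add: add_strict_increasing2)
  then have "r * norm v < r * (2 * (norm v + 1))" using r(1) by (rule mult_strict_left_mono)
  moreover have "2 * (norm v + 1) > 0" by (simp add: add_nonneg_pos)
  ultimately show ?thesis by (simp add: pos_divide_less_eq)
 qed
 finally have tv: "t * norm v < r" .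
 define x where "x = \<xi> + t *\<^sub>R v"
 have x: "x \<in> cpolydisc" using v t by (simp add: x_def)
 have "norm (\<phi> x $ i - c - (\<Sum>k\<in>UNIV. jac \<phi> \<xi> i k * (x $ k - \<xi> $ k))) <= e / (norm v + 1) * norm (x - \<xi>)"
  unfolding c_def using xi x r(1) tv t by (intro r(2)) (auto simp: x_def dist_norm)
 moreover have "(\<Sum>k\<in>UNIV. jac \<phi> \<xi> i k * (x $ k - \<xi> $ k)) = of_real t * L"
  by (simp add: x_def L_def sum_distrib_left scaleR_conv_of_real[where 'a=complex] mult_ac)
 moreover have "norm (x - \<xi>) = t * norm v" using t by (simp add: x_def)
 ultimately have est: "norm (\<phi> x $ i - c - of_real t * L) <= e / (norm v + 1) * (t * norm v)" by simp
 also have "... <= t * e"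
 proof -
  have "norm v / (norm v + 1) <= 1" by (simp add: divide_le_eq_1 add_nonneg_pos)
  then have "t * e * (norm v / (norm v + 1)) <= t * e * 1" using t e by (intro mult_left_mono) auto
  then show ?thesis by (simp add: field_simps)
 qed
 finally have est: "norm (\<phi> x $ i - c - of_real t * L) <= t * e" .
 have c: "norm c = 1" using xi by (simp add: c_def)
 have "norm (cnj c * \<phi> x $ i) <= 1" using cpolydisc_component[OF map_cpolydisc[OF x], of i] c by (simp add: norm_mult)
 then have 1: "Re (cnj c * \<phi> x $ i) <= 1" using complex_Re_le_cmod[of "cnj c * \<phi> x $ i"] by linarith
 have cc: "cnj c * c = 1" using c by (simp add: complex_norm_square[symmetric] mult.commute)
 have "norm (cnj c * (\<phi> x $ i - c - of_real t * L)) <= t * e" using est c by (simp add: norm_mult)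
 then have "\<bar>Re (cnj c * (\<phi> x $ i - c - of_real t * L))\<bar> <= t * e" using abs_Re_le_cmod order_trans by blast
 moreover have "cnj c * (\<phi> x $ i - c - of_real t * L) = cnj c * \<phi> x $ i - 1 - of_real t * (cnj c * L)"
  using cc by (simp add: algebra_simps)
 ultimately have "t * Re (cnj c * L) <= t * e" using 1 by (simp add: abs_le_iff)
 then show "Re (cnj (\<phi> \<xi> $ i) * (\<Sum>k\<in>UNIV. jac \<phi> \<xi> i k * v $ k)) <= 0 + e" using t by (simp add: c_def L_def)
qed

lemma sum_axis:
 fixes f :: "'n => complex" and w :: complex
 shows "(\<Sum>k\<in>UNIV. f k * ((axis m w) $ k)) = f m * w"
proof -
 have "(\<Sum>k\<in>UNIV. f k * ((axis m w) $ k)) = (\<Sum>k\<in>UNIV. if k = m then f k * w else 0)"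
  by (intro sum.cong) (auto simp: axis_def)
 then show ?thesis by simp
qed

text \<open>A coordinate inside the disc may move in every direction; the direction \<open>w\<close>
  is chosen to turn the first-order term into |a|^2.\<close>

lemma jac_interior_zero:
 fixes \<xi> :: "complex^'n"
 assumes xi: "\<xi> \<in> cpolydisc" "norm (\<phi> \<xi> $ i) = 1" and k: "norm (\<xi> $ k) < 1"
 shows "jac \<phi> \<xi> i k = 0"
proof -
 define a where "a = jac \<phi> \<xi> i k"
 define w where "w = \<phi> \<xi> $ i * cnj a"
 have nw: "norm w + 1 > 0" by (simp add: add_nonneg_pos)
 have "Re (cnj (\<phi> \<xi> $ i) * (\<Sum>m\<in>UNIV. jac \<phi> \<xi> i m * ((axis k w) $ m))) <= 0"
 proof (rule deriv_direction[OF xi])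
  show "(1 - norm (\<xi> $ k)) / (norm w + 1) > 0" using k nw by simp
  fix t :: real assume t: "0 < t" "t < (1 - norm (\<xi> $ k)) / (norm w + 1)"
  have "t * (norm w + 1) < 1 - norm (\<xi> $ k)" using t nw by (simp add: field_simps)
  then have "norm (\<xi> $ k) + t * norm w <= 1" using t by (simp add: algebra_simps)
  then have "norm (\<xi> $ k + of_real t * w) <= 1" using norm_triangle_ineq[of "\<xi> $ k" "of_real t * w"] t by (simp add: norm_mult)
  then show "\<xi> + t *\<^sub>R axis k w \<in> cpolydisc"
   using cpolydisc_component[OF xi(1)] by (auto simp: cpolydisc_def axis_def scaleR_conv_of_real[where 'a=complex])
 qed
 then have "Re (cnj (\<phi> \<xi> $ i) * (a * w)) <= 0" unfolding sum_axis a_def .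
 moreover have "cnj (\<phi> \<xi> $ i) * (a * w) = (\<phi> \<xi> $ i * cnj (\<phi> \<xi> $ i)) * (a * cnj a)" by (simp add: w_def mult_ac)
 then have "cnj (\<phi> \<xi> $ i) * (a * w) = of_real ((norm a)^2)" using xi(2) by (simp only: complex_norm_square[symmetric]) simp
 ultimately have "(norm a)^2 <= 0" by (simp only: Re_complex_of_real)
 then show ?thesis by (simp add: a_def)
qed

text \<open>A unimodular coordinate may move in the directions \<xi>_k (-d \<plusminus> \<i>),
  nearly tangential and slightly inwards. Letting d tend to 0 bounds the imaginary part from both
  sides. This is a Julia-Caratheodory fact: in angular coordinates at source and target the
  derivative is real.\<close>

lemma jac_real:
 fixes \<xi> :: "complex^'n"
 assumes xi: "\<xi> \<in> cpolydisc" "norm (\<phi> \<xi> $ i) = 1"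
 shows "Im (cnj (\<phi> \<xi> $ i) * jac \<phi> \<xi> i k * \<xi> $ k) = 0"
proof (cases "norm (\<xi> $ k) < 1")
 case True
 then show ?thesis using jac_interior_zero[OF xi] by simp
next
 case False
 then have k: "norm (\<xi> $ k) = 1" using cpolydisc_component[OF xi(1), of k] by simp
 define q where "q = cnj (\<phi> \<xi> $ i) * jac \<phi> \<xi> i k * \<xi> $ k"
 have main: "- s * Im q <= 0" if s: "s = 1 \<or> s = -1" for s
 proof (rule field_le_epsilon)
  fix e :: real assume e: "e > 0"
  define d where "d = e / (\<bar>Re q\<bar> + 1)"
  have d: "d > 0" using e by (simp add: d_def add_nonneg_pos)
  define w where "w = \<xi> $ k * Complex (-d) s"
  have "Re (cnj (\<phi> \<xi> $ i) * (\<Sum>m\<in>UNIV. jac \<phi> \<xi> i m * ((axis k w) $ m))) <= 0"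
  proof (rule deriv_direction[OF xi])
   \<comment> \<open>The largest t for which \<xi>_k (1 - t d + \<i> t s) still lies in the closed
     disc, from (1 - t d)^2 + t^2 \<le> 1.\<close>
   show "2 * d / (1 + d\<^sup>2) > 0" using d by (simp add: add_pos_nonneg)
   fix t :: real assume t: "0 < t" "t < 2 * d / (1 + d\<^sup>2)"
   have "t * (1 + d\<^sup>2) < 2 * d" using t d by (simp add: field_simps add_pos_nonneg)
   then have "t * (t * (1 + d\<^sup>2)) <= t * (2 * d)" using t by (intro mult_left_mono) auto
   then have "(1 - t * d)^2 + (t * s)^2 <= 1" using s by (auto simp: power2_eq_square algebra_simps)
   then have "(norm (Complex (1 - t * d) (t * s)))^2 <= 1\<^sup>2" by (simp add: cmod_power2)
   then have "norm (Complex (1 - t * d) (t * s)) <= 1" by (rule power2_le_imp_le) simp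
   moreover have "\<xi> $ k + of_real t * w = \<xi> $ k * Complex (1 - t * d) (t * s)"
    by (simp add: w_def complex_eq_iff algebra_simps)
   ultimately have "norm (\<xi> $ k + of_real t * w) <= 1" using k by (simp add: norm_mult)
   then show "\<xi> + t *\<^sub>R axis k w \<in> cpolydisc"
    using cpolydisc_component[OF xi(1)] by (auto simp: cpolydisc_def axis_def scaleR_conv_of_real[where 'a=complex])
  qed
  then have "Re (q * Complex (-d) s) <= 0" unfolding sum_axis by (simp add: q_def w_def mult_ac)
  then have "- s * Im q <= d * Re q" by (simp add: algebra_simps)
  also have "... <= d * (\<bar>Re q\<bar> + 1)" using d by (intro mult_left_mono) auto
  also have "... = e" by (simp add: d_def add_nonneg_pos)
  finally show "- s * Im q <= 0 + e" by simp
 qed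
 from main[of 1] main[of "-1"] show ?thesis by (simp add: q_def)
qed


lemma unimod_eqI: "norm c = 1 ==> norm z <= 1 ==> Re (cnj c * z) >= 1 ==> z = c" for c z :: complex
proof -
 assume *: "norm c = 1" "norm z <= 1" "Re (cnj c * z) >= 1"
 define u where "u = cnj c * z"
 have u: "norm u <= 1" "Re u >= 1" using * by (auto simp: u_def norm_mult)
 then have "(norm u)^2 <= 1" by (simp add: power_le_one)
 then have "(Re u)^2 + (Im u)^2 <= 1" by (simp add: cmod_power2)
 moreover have "(Re u)^2 >= 1" using u(2) by simp
 ultimately have "(Im u)^2 <= 0" by linarith
 moreover have "Re u = 1" using u complex_Re_le_cmod[of u] by linarith
 ultimately have "u = 1" by (simp add: complex_eq_iff)
 then have "c * u = c" by simp
 moreover have "c * cnj c = 1" using *(1) by (simp add: complex_norm_square[symmetric])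
 ultimately show "z = c" by (simp add: u_def mult.assoc[symmetric])
qed

text \<open>Let p be \<xi> with the coordinates outside N set to 0. On the analytic disc from p
  through \<xi> the function 1 - cnj c \<phi>_i has nonnegative real part and vanishes at \<xi>
  faster than linearly, because the derivative in this direction involves only entries outside N.
  Harnack's lower bound is linear in the distance to the boundary, so the real part is 0 already at
  p; Harnack's upper bound on the disc from p through z then carries the value c to z.\<close>

lemma rigidity:
 fixes \<xi> :: "complex^'n"
 assumes xi: "\<xi> \<in> cpolydisc" "norm (\<phi> \<xi> $ i) = 1" and N: "\<And>k. k \<notin> N ==> jac \<phi> \<xi> i k = 0"
  and z: "z \<in> cpolydisc" "\<And>k. k \<in> N ==> z $ k = \<xi> $ k"
 shows "\<phi> z $ i = \<phi> \<xi> $ i"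
proof -
 define c where "c = \<phi> \<xi> $ i"
 have c: "norm c = 1" using xi by (simp add: c_def)
 define p :: "complex^'n" where "p = (\<chi> k. if k \<in> N then \<xi> $ k else 0)"
 have seg: "Re (1 - cnj c * \<phi> y $ i) >= 0" if "y \<in> cpolydisc" for y
 proof -
  have "norm (cnj c * \<phi> y $ i) <= 1" using cpolydisc_component[OF map_cpolydisc[OF that], of i] c by (simp add: norm_mult)
  then show ?thesis using complex_Re_le_cmod[of "cnj c * \<phi> y $ i"] by simp
 qed
 have line: "p + l *s (y - p) \<in> cpolydisc" if "y \<in> cpolydisc" "\<And>k. k \<in> N ==> y $ k = \<xi> $ k" "norm l <= 1" for y l
  unfolding cpolydisc_def
 proof (intro CollectI allI)
  fix k
  show "norm ((p + l *s (y - p)) $ k) <= 1"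
  proof (cases "k \<in> N")
   case True
   then show ?thesis using cpolydisc_component[OF xi(1)] that(2) by (simp add: p_def)
  next
   case False
   then show ?thesis using cpolydisc_component[OF that(1), of k] that(3) by (simp add: p_def norm_mult mult_le_one)
  qed
 qed
 have da: "disc_alg (%l. 1 - cnj c * \<phi> (p + l *s (y - p)) $ i)" if "y \<in> cpolydisc" "\<And>k. k \<in> N ==> y $ k = \<xi> $ k" for y
  using disc_alg_slice[OF cont_i holo line[OF that], of i]
  by (auto simp: disc_alg_def intro!: continuous_intros holomorphic_intros)
 have pc: "\<phi> p $ i = c"
 proof -
  define h where "h l = 1 - cnj c * \<phi> (p + l *s (\<xi> - p)) $ i" for l
  have h: "disc_alg h" unfolding h_def using xi by (intro da) auto
  have pos: "Re (h l) >= 0" if "norm l <= 1" for l unfolding h_def using xi that by (intro seg line) auto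
  have "Re (h 0) <= 0"
  proof (rule field_le_epsilon)
   fix e :: real assume e: "e > 0"
   define B where "B = norm (\<xi> - p) + 1"
   have B: "B > 0" "norm (\<xi> - p) < B" by (auto simp: B_def add_nonneg_pos)
   have "e / (2 * B) > 0" using e B by simp
   from strict_diff[OF this] obtain r where r: "r > 0" "\<And>i x y \<xi>. \<xi> \<in> cpolydisc ==> x \<in> cpolydisc ==> y \<in> cpolydisc ==> dist x \<xi> < r ==> dist y \<xi> < r ==>
     norm (\<phi> x $ i - \<phi> y $ i - (\<Sum>k\<in>UNIV. jac \<phi> \<xi> i k * (x $ k - y $ k))) <= e / (2 * B) * norm (x - y)"
    by blast
   define t where "t = min (1/2) (r / B)"
   have t: "0 < t" "t < 1" "t * norm (\<xi> - p) < r"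
   proof -
    show "0 < t" "t < 1" using r B by (auto simp: t_def)
    have "t * norm (\<xi> - p) < t * B" using \<open>0 < t\<close> B by (intro mult_strict_left_mono) auto
    also have "... <= r / B * B" using B by (intro mult_right_mono) (auto simp: t_def)
    finally show "t * norm (\<xi> - p) < r" using B by simp
   qed
   define x where "x = p + of_real (1 - t) *s (\<xi> - p)"
   have x: "x \<in> cpolydisc" unfolding x_def using xi t by (intro line) (auto simp del: of_real_diff)
   have xx: "x - \<xi> = (- t) *\<^sub>R (\<xi> - p)" by (simp add: x_def vec_eq_iff algebra_simps scaleR_conv_of_real[where 'a=complex])
   \<comment> \<open>x differs from \<xi> only outside N, where the row vanishes, so the whole
     increment of \<phi>_i is error term.\<close>
   have "(\<Sum>k\<in>UNIV. jac \<phi> \<xi> i k * (x $ k - \<xi> $ k)) = 0"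
   proof (rule sum.neutral, intro ballI)
    fix k
    show "jac \<phi> \<xi> i k * (x $ k - \<xi> $ k) = 0" using N[of k] by (cases "k \<in> N") (auto simp: x_def p_def)
   qed
   moreover have "norm (\<phi> x $ i - \<phi> \<xi> $ i - (\<Sum>k\<in>UNIV. jac \<phi> \<xi> i k * (x $ k - \<xi> $ k))) <= e / (2 * B) * norm (x - \<xi>)"
    using xi x r(1) t by (intro r(2)) (auto simp: dist_norm xx simp del: scaleR_minus_left)
   ultimately have "norm (\<phi> x $ i - c) <= e / (2 * B) * (t * norm (\<xi> - p))" using t by (simp add: xx c_def)
   also have "... <= e / (2 * B) * (t * B)" using e B t by (intro mult_left_mono) auto
   also have "... = t * e / 2" using B by simp
   finally have est: "norm (\<phi> x $ i - c) <= t * e / 2" .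
   have cc: "cnj c * c = 1" using c by (simp add: complex_norm_square[symmetric] mult.commute)
   have "h (of_real (1 - t)) = - (cnj c * (\<phi> x $ i - c))" using cc by (simp add: h_def x_def algebra_simps)
   then have "norm (h (of_real (1 - t))) <= t * e / 2" using est c by (simp add: norm_mult)
   then have "Re (h (of_real (1 - t))) <= t * e / 2" using complex_Re_le_cmod order_trans by blast
   moreover have "(1 - (1 - t)) / (1 + (1 - t)) * Re (h 0) <= Re (h (of_real (1 - t)))"
    using t by (intro harnack(1)[OF h pos]) auto
   moreover have "t / 2 * Re (h 0) <= (1 - (1 - t)) / (1 + (1 - t)) * Re (h 0)"
   proof -
    have "t / 2 <= t / (2 - t)" using t by (intro divide_left_mono) auto
    then have "t / 2 * Re (h 0) <= t / (2 - t) * Re (h 0)" using pos[of 0] by (intro mult_right_mono) auto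
    moreover have "(1 - (1 - t)) / (1 + (1 - t)) = t / (2 - t)" by simp
    ultimately show ?thesis by simp
   qed
   ultimately have "t / 2 * Re (h 0) <= t / 2 * e" by linarith
   then show "Re (h 0) <= 0 + e" using t by simp
  qed
  then have "Re (cnj c * \<phi> p $ i) >= 1" by (simp add: h_def)
  moreover have "p \<in> cpolydisc" using line[OF xi(1), of 0] by simp
  ultimately show ?thesis using cpolydisc_component[OF map_cpolydisc] c by (intro unimod_eqI) auto
 qed
 define h where "h l = 1 - cnj c * \<phi> (p + l *s (z - p)) $ i" for l
 have h: "disc_alg h" unfolding h_def using z by (intro da)
 have pos: "Re (h l) >= 0" if "norm l <= 1" for l unfolding h_def using z that by (intro seg line)
 have cc: "cnj c * c = 1" using c by (simp add: complex_norm_square[symmetric] mult.commute)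
 have h0: "h 0 = 0" using cc by (simp add: h_def pc)
 have "Re (h 1) <= 0"
 proof (rule tendsto_upperbound)
  have "((%r. h (of_real r)) \<longlongrightarrow> h (of_real 1)) (at_left 1)"
  proof (rule continuous_on_tendsto_compose[where s="cball 0 1" and f=h])
   show "continuous_on (cball 0 1) h" using h by (simp add: disc_alg_def)
   show "((%r. of_real r :: complex) \<longlongrightarrow> of_real 1) (at_left 1)" by (intro tendsto_intros)
   show "\<forall>\<^sub>F r in at_left 1. complex_of_real r \<in> cball 0 1" using at_left_1_pos by (rule eventually_mono) auto
  qed auto
  then show "((%r. Re (h (of_real r))) \<longlongrightarrow> Re (h 1)) (at_left 1)" by (auto intro: tendsto_Re)
  show "\<forall>\<^sub>F r in at_left 1. Re (h (of_real r)) <= 0"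
   using at_left_1_pos
  proof (rule eventually_mono)
   fix r :: real assume "0 <= r \<and> r < 1"
   then show "Re (h (of_real r)) <= 0" using harnack(2)[OF h pos, of r] h0 by simp
  qed
 qed simp
 then have "Re (cnj c * \<phi> z $ i) >= 1" by (simp add: h_def)
 then show ?thesis using cpolydisc_component[OF map_cpolydisc[OF z(1)]] c unfolding c_def[symmetric] by (intro unimod_eqI) auto
qed

text \<open>For m outside N, \<phi>_i does not change along the m-th coordinate by
  \<open>rigidity\<close>, so the entry is 0 at z as at \<xi>. For m in N with |\<xi>_m| = 1, the
  radial derivative along an analytic disc on which \<phi>_i is constant is a uniform limit of
  holomorphic difference quotients; by \<open>jac_real\<close> it is real after multiplication by
  cnj c, hence constant.\<close>

lemma jac_rigidity:
 fixes \<xi> :: "complex^'n"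
 assumes xi: "\<xi> \<in> cpolydisc" "norm (\<phi> \<xi> $ i) = 1" and N: "\<And>k. k \<notin> N ==> jac \<phi> \<xi> i k = 0"
  and z: "z \<in> cpolydisc" "\<And>k. k \<in> N ==> z $ k = \<xi> $ k"
 shows "jac \<phi> z i m = jac \<phi> \<xi> i m"
proof (cases "m \<in> N")
 case False
 have "norm (\<phi> z $ i) = 1" using rigidity[OF xi N z] xi by simp
 \<comment> \<open>One of 0 and 1 differs from z_m; the segment from z_m to y stays in the closed
   disc.\<close>
 obtain y where y: "norm y <= 1" "y \<noteq> z $ m" using norm_one norm_zero zero_neq_one by (metis order_refl zero_le_one)
 define v :: "complex^'n" where "v = axis m (y - z $ m)"
 have zv: "z + t *\<^sub>R v \<in> cpolydisc" if "0 <= t" "t <= 1" for t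
 proof -
  have "norm (z $ m + t *\<^sub>R (y - z $ m)) <= 1"
  proof -
   have "z $ m + t *\<^sub>R (y - z $ m) = (1 - t) *\<^sub>R (z $ m) + t *\<^sub>R y" by (simp add: algebra_simps)
   moreover have "norm ((1 - t) *\<^sub>R (z $ m) + t *\<^sub>R y) <= (1 - t) * 1 + t * 1"
    using that y cpolydisc_component[OF z(1), of m]
    by (intro order_trans[OF norm_triangle_ineq] add_mono) (auto intro!: mult_left_mono simp del: mult_1_right)
   ultimately show ?thesis by simp
  qed
  then show ?thesis using cpolydisc_component[OF z(1)] by (auto simp: cpolydisc_def v_def axis_def)
 qed
 have same: "\<phi> (z + t *\<^sub>R v) $ i = \<phi> z $ i" if "0 <= t" "t <= 1" for t
 proof -
  have "(z + t *\<^sub>R v) $ k = \<xi> $ k" if "k \<in> N" for k using z(2)[OF that] that False by (auto simp: v_def axis_def)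
  then show ?thesis using rigidity[OF xi N z] rigidity[OF xi N zv[OF that], of N] by simp
 qed
 have "jac \<phi> z i m * (y - z $ m) = 0"
 proof (rule ccontr)
  assume nz: "jac \<phi> z i m * (y - z $ m) \<noteq> 0"
  define a where "a = norm (jac \<phi> z i m * (y - z $ m))"
  have a: "a > 0" using nz by (simp add: a_def)
  define B where "B = norm v + 1"
  have B: "B > 0" "norm v < B" by (auto simp: B_def add_nonneg_pos)
  have "a / (2 * B) > 0" using a B by simp
  from strict_diff[OF this] obtain r where r: "r > 0" "\<And>i x y \<xi>. \<xi> \<in> cpolydisc ==> x \<in> cpolydisc ==> y \<in> cpolydisc ==> dist x \<xi> < r ==> dist y \<xi> < r ==>
     norm (\<phi> x $ i - \<phi> y $ i - (\<Sum>k\<in>UNIV. jac \<phi> \<xi> i k * (x $ k - y $ k))) <= a / (2 * B) * norm (x - y)"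
   by blast
  define t where "t = min 1 (r / B)"
  have t: "0 < t" "t <= 1" "t * norm v < r"
  proof -
   show "0 < t" "t <= 1" using r B by (auto simp: t_def)
   have "t * norm v < t * B" using \<open>0 < t\<close> B by (intro mult_strict_left_mono) auto
   also have "... <= r / B * B" using B by (intro mult_right_mono) (auto simp: t_def)
   finally show "t * norm v < r" using B by simp
  qed
  define x where "x = z + t *\<^sub>R v"
  have "norm (\<phi> x $ i - \<phi> z $ i - (\<Sum>k\<in>UNIV. jac \<phi> z i k * (x $ k - z $ k))) <= a / (2 * B) * norm (x - z)"
   using z zv t r(1) by (intro r(2)) (auto simp: dist_norm x_def)
  moreover have "(\<Sum>k\<in>UNIV. jac \<phi> z i k * (x $ k - z $ k)) = of_real t * (jac \<phi> z i m * (y - z $ m))"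
  proof -
   have "(\<Sum>k\<in>UNIV. jac \<phi> z i k * (x $ k - z $ k)) = of_real t * (\<Sum>k\<in>UNIV. jac \<phi> z i k * v $ k)"
    by (simp add: x_def sum_distrib_left scaleR_conv_of_real[where 'a=complex] mult_ac)
   then show ?thesis unfolding v_def sum_axis .
  qed
  moreover have "\<phi> x $ i = \<phi> z $ i" unfolding x_def using t by (intro same) auto
  ultimately have "t * a <= a / (2 * B) * (t * norm v)" using t by (simp add: norm_mult a_def x_def)
  also have "... <= a / (2 * B) * (t * B)" using a B t by (intro mult_left_mono) auto
  also have "... = t * a / 2" using B by simp
  finally show False using t a by simp
 qed
 then show ?thesis using y N[OF False] by simp
next
 case True
 show ?thesis
 proof (cases "norm (\<xi> $ m) < 1")
  case lt: True
  have n: "norm (\<phi> z $ i) = 1" using rigidity[OF xi N z] xi by simp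
  have "norm (z $ m) < 1" using z(2) True lt by simp
  then show ?thesis using jac_interior_zero[OF xi lt] jac_interior_zero[OF z(1) n, of m] by simp
 next
  case False
  then have m1: "norm (\<xi> $ m) = 1" using cpolydisc_component[OF xi(1), of m] by simp
  define c where "c = \<phi> \<xi> $ i"
  define p :: "complex^'n" where "p = (\<chi> k. if k \<in> N then \<xi> $ k else 0)"
  have const: "jac \<phi> y i m = jac \<phi> p i m" if y: "y \<in> cpolydisc" "\<And>k. k \<in> N ==> y $ k = \<xi> $ k" for y
  proof -
   define q where "q = y - p"
   have comp: "norm ((p + l *s q) $ k) <= 1" if "norm l <= 1" for l k
   proof (cases "k \<in> N")
    case True
    then show ?thesis using cpolydisc_component[OF xi(1)] y(2) by (simp add: p_def q_def)
   next
    case False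
    then show ?thesis using cpolydisc_component[OF y(1), of k] that by (simp add: p_def q_def norm_mult mult_le_one)
   qed
   have line: "p + l *s q \<in> cpolydisc" if "norm l <= 1" for l using comp[OF that] by (simp add: cpolydisc_def)
   have atm: "(p + l *s q) $ m = \<xi> $ m" for l using True y(2) by (simp add: p_def q_def)
   have phil: "\<phi> (p + l *s q) $ i = c" if "norm l <= 1" for l
    unfolding c_def using y(2) by (intro rigidity[OF xi N line[OF that]]) (auto simp: p_def q_def)
   \<comment> \<open>The points of inward difference quotients: the m-th coordinate, equal to
     \<xi>_m along the whole analytic disc, is shrunk to (1 - t) \<xi>_m.\<close>
   define s where "s t l = p + l *s q - t *\<^sub>R axis m (\<xi> $ m)" for t :: real and l
   have sl: "s t l \<in> cpolydisc" if "0 <= t" "t <= 1" "norm l <= 1" for t l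
   proof -
    have "norm (s t l $ k) <= 1" for k
    proof (cases "k = m")
     case True
     have "s t l $ m = of_real (1 - t) * \<xi> $ m" using atm[of l] by (simp add: s_def axis_def algebra_simps scaleR_conv_of_real[where 'a=complex])
     then show ?thesis using True m1 that by (simp add: norm_mult del: of_real_diff)
    next
     case False
     then show ?thesis using comp[OF that(3), of k] by (simp add: s_def axis_def)
    qed
    then show ?thesis by (simp add: cpolydisc_def)
   qed
   define Q where "Q t l = (c - \<phi> (s t l) $ i) / of_real t" for t l
   define L where "L l = jac \<phi> (p + l *s q) i m * \<xi> $ m" for l
   have Qd: "disc_alg (Q t)" if t: "0 < t" "t <= 1" for t
   proof -
    have "disc_alg (%l. \<phi> ((p - t *\<^sub>R axis m (\<xi> $ m)) + l *s q) $ i)"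
    proof (rule disc_alg_slice[OF cont_i holo])
     fix l :: complex assume "norm l <= 1"
     then show "(p - t *\<^sub>R axis m (\<xi> $ m)) + l *s q \<in> cpolydisc"
      using sl[of t l] t by (simp add: s_def algebra_simps)
    qed
    moreover have "(p - t *\<^sub>R axis m (\<xi> $ m)) + l *s q = s t l" for l by (simp add: s_def algebra_simps)
    ultimately show ?thesis unfolding Q_def[abs_def] disc_alg_def using t
     by (auto intro!: continuous_intros holomorphic_intros)
   qed
   have u: "uniform_limit (cball 0 1) Q L (at_right (0::real))"
   proof (rule uniform_limitI)
    fix e :: real assume e: "e > 0"
    have "e / 2 > 0" using e by simp
    from strict_diff[OF this] obtain r where r: "r > 0" "\<And>i x y \<xi>. \<xi> \<in> cpolydisc ==> x \<in> cpolydisc ==> y \<in> cpolydisc ==> dist x \<xi> < r ==> dist y \<xi> < r ==>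
      norm (\<phi> x $ i - \<phi> y $ i - (\<Sum>k\<in>UNIV. jac \<phi> \<xi> i k * (x $ k - y $ k))) <= e / 2 * norm (x - y)"
     by blast
    have "eventually (%t. t \<in> {0<..<min 1 r}) (at_right (0::real))" using r by (intro eventually_at_right_real) auto
    then show "\<forall>\<^sub>F t in at_right (0::real). \<forall>l\<in>cball 0 1. dist (Q t l) (L l) < e"
    proof (rule eventually_mono, intro ballI)
     fix t :: real and l :: complex assume t: "t \<in> {0<..<min 1 r}" and l: "l \<in> cball 0 1"
     define x where "x = p + l *s q"
     have x: "x \<in> cpolydisc" using line l by (auto simp: x_def)
     have st: "s t l \<in> cpolydisc" using sl t l by auto
     have nxs: "x - s t l = t *\<^sub>R axis m (\<xi> $ m)" by (simp add: x_def s_def)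
     have nn: "norm (x - s t l) = t" unfolding nxs using t m1 by (simp add: norm_axis_vec)
     have "norm (\<phi> x $ i - \<phi> (s t l) $ i - (\<Sum>k\<in>UNIV. jac \<phi> x i k * (x $ k - s t l $ k))) <= e / 2 * norm (x - s t l)"
      using x st r(1) t nn by (intro r(2)) (auto simp: dist_norm norm_minus_commute)
     moreover have "(\<Sum>k\<in>UNIV. jac \<phi> x i k * (x $ k - s t l $ k)) = of_real t * L l"
     proof -
      have "(\<Sum>k\<in>UNIV. jac \<phi> x i k * (x $ k - s t l $ k)) = (\<Sum>k\<in>UNIV. jac \<phi> x i k * ((x - s t l) $ k))" by simp
      also have "... = of_real t * (\<Sum>k\<in>UNIV. jac \<phi> x i k * ((axis m (\<xi> $ m)) $ k))"
       unfolding nxs by (simp add: sum_distrib_left scaleR_conv_of_real[where 'a=complex] mult_ac)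
      also have "... = of_real t * L l" unfolding sum_axis by (simp add: L_def x_def)
      finally show ?thesis .
     qed
     moreover have "\<phi> x $ i = c" using phil l by (auto simp: x_def)
     ultimately have le: "norm (c - \<phi> (s t l) $ i - of_real t * L l) <= e / 2 * t" using nn by simp
     have "Q t l - L l = (c - \<phi> (s t l) $ i - of_real t * L l) / of_real t" using t by (simp add: Q_def field_simps)
     then have "norm (Q t l - L l) = norm (c - \<phi> (s t l) $ i - of_real t * L l) / t" using t by (simp add: norm_divide)
     also have "... <= e / 2 * t / t" using le t by (intro divide_right_mono) auto
     also have "... < e" using t e by simp
     finally show "dist (Q t l) (L l) < e" by (simp add: dist_norm)
    qed
   qed
   have ev: "\<forall>\<^sub>F t in at_right (0::real). continuous_on (cball 0 1) (Q t) \<and> Q t holomorphic_on ball 0 1"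
    using eventually_at_right_real[of 0 "1::real"]
   proof (rule eventually_mono)
    show "(0::real) < 1" by simp
    fix t :: real assume "t \<in> {0<..<1}"
    then show "continuous_on (cball 0 1) (Q t) \<and> Q t holomorphic_on ball 0 1" using Qd[of t] by (simp add: disc_alg_def)
   qed
   obtain Lc: "continuous_on (cball 0 1) L" and Lh: "L holomorphic_on ball 0 1"
    using holomorphic_uniform_limit[OF ev u trivial_limit_at_right_real] by blast
   define h where "h l = cnj c * L l" for l
   have hh: "h holomorphic_on ball 0 1" "continuous_on (cball 0 1) h" unfolding h_def using Lc Lh by (auto intro!: holomorphic_intros continuous_intros)
   have hreal: "Im (h l) = 0" if "norm l <= 1" for l
   proof -
    have "norm (\<phi> (p + l *s q) $ i) = 1" using phil[OF that] xi by (simp add: c_def)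
    from jac_real[OF line[OF that] this, of m] show ?thesis unfolding h_def L_def phil[OF that] atm by (simp add: mult.assoc)
   qed
   \<comment> \<open>A holomorphic function with vanishing imaginary part has derivative 0, because
     its directional derivatives are real in the directions 1 and \<i> alike.\<close>
   have d0: "deriv h l = 0" if l: "l \<in> ball 0 1" for l
   proof -
    have d: "(h has_field_derivative deriv h l) (at l)" using hh(1) l by (intro holomorphic_derivI) auto
    have im0: "Im (deriv h l * w) = 0" for w
    proof -
     have "((%t. l + t *\<^sub>R w) has_vector_derivative w) (at (0::real))"
      by (auto intro!: derivative_eq_intros)
     then have "((%t. l + of_real t * w) has_vector_derivative w) (at (0::real))"
      by (simp only: scaleR_conv_of_real)
     moreover have "(h has_field_derivative deriv h l) (at (l + of_real 0 * w))" using d by simp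
     ultimately have "((%t. h (l + of_real t * w)) has_vector_derivative w * deriv h l) (at (0::real))"
      using field_vector_diff_chain_at[of "%t. l + of_real t * w" w 0 h "deriv h l"] by (simp add: o_def)
     then have 1: "((%t. Im (h (l + of_real t * w))) has_vector_derivative Im (w * deriv h l)) (at (0::real))"
      using bounded_linear.has_vector_derivative[OF bounded_linear_Im] by fastforce
     have op: "open ((%t::real. l + of_real t * w) -` ball 0 1)"
      by (intro open_vimage continuous_intros) auto
     have "((%t::real. 0::real) has_vector_derivative Im (w * deriv h l)) (at (0::real))"
      by (rule has_vector_derivative_transform_within_open[OF 1 op]) (use l hreal in \<open>auto simp: less_imp_le\<close>)
     then have "Im (w * deriv h l) = 0" using vector_derivative_unique_at has_vector_derivative_const by blast
     then show ?thesis by (simp add: mult.commute)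
    qed
    show ?thesis using im0[of 1] im0[of \<i>] by (simp add: complex_eq_iff)
   qed
   have hc: "h l = h 0" if l: "l \<in> ball 0 1" for l
   proof -
    have "\<exists>c. \<forall>x\<in>ball 0 1. h x = c"
    proof (rule has_field_derivative_zero_constant)
     fix x :: complex assume x: "x \<in> ball 0 1"
     have "(h has_field_derivative deriv h x) (at x)" using hh(1) x by (intro holomorphic_derivI) auto
     then show "(h has_field_derivative 0) (at x within ball 0 1)" using d0[OF x] by (simp add: has_field_derivative_at_within)
    qed simp
    then show ?thesis using l by auto
   qed
   have "h 1 = h 0"
   proof (rule tendsto_unique[OF trivial_limit_at_left_real])
    show "((%r. h (of_real r)) \<longlongrightarrow> h 1) (at_left (1::real))"
    proof -
     have "((%r. h (of_real r)) \<longlongrightarrow> h (of_real 1)) (at_left (1::real))"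
     proof (rule continuous_on_tendsto_compose[OF hh(2)])
      show "((%r. of_real r :: complex) \<longlongrightarrow> of_real 1) (at_left 1)" by (intro tendsto_intros)
      show "\<forall>\<^sub>F r in at_left 1. complex_of_real r \<in> cball 0 1" using at_left_1_pos by (rule eventually_mono) auto
     qed auto
     then show ?thesis by simp
    qed
    have "\<forall>\<^sub>F r in at_left (1::real). h 0 = h (of_real r)"
     using at_left_1_pos by (rule eventually_mono) (rule hc[symmetric], auto)
    then show "((%r. h (of_real r)) \<longlongrightarrow> h 0) (at_left (1::real))" by (rule Lim_transform_eventually[OF tendsto_const])
   qed
   then have "L 1 = L 0" using xi by (auto simp: h_def c_def)
   then have "jac \<phi> (p + q) i m = jac \<phi> p i m" using m1 by (auto simp: L_def)
   then show ?thesis by (simp add: q_def)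
  qed
  show ?thesis using const[OF z] const[OF xi(1)] by simp
 qed
qed

end

section \<open>Product measures and the combinatorics of the Jacobian\<close>

lemma borel_measurable_vecI:
 fixes f :: "'a => complex^'n"
 assumes "\<And>i. (%x. f x $ i) \<in> borel_measurable M"
 shows "f \<in> borel_measurable M"
proof (subst borel_measurable_euclidean_space, intro ballI)
 fix b :: "complex^'n" assume "b \<in> Basis"
 then obtain i c where b: "b = axis i c" by (auto simp: Basis_vec_def)
 have "(%x. f x \<bullet> b) = (%x. f x $ i \<bullet> c)" by (simp add: b inner_axis)
 then show "(%x. f x \<bullet> b) \<in> borel_measurable M" using assms[of i] by simp
qed

lemma vec_nth_measurable [measurable]: "(%z :: complex^'n. z $ i) \<in> borel_fun"
 by (intro borel_measurable_continuous_onI continuous_intros)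

lemma vec_nth_measurable' [measurable (raw)]:
 "f \<in> borel_measurable M ==> (%x. (f x :: complex^'n) $ i) \<in> borel_measurable M"
 using measurable_compose[OF _ vec_nth_measurable] .

definition upd :: "complex^'n => 'n => complex => complex^'n" where
 "upd z k y = (\<chi> i. if i = k then y else z $ i)"

lemma upd_nth: "upd z k y $ i = (if i = k then y else z $ i)" by (simp add: upd_def)

lemma upd_measurable [measurable (raw)]:
 assumes [measurable]: "f \<in> borel_measurable M" "g \<in> borel_measurable M"
 shows "(%x. upd (f x) k (g x)) \<in> borel_measurable M"
proof (rule borel_measurable_vecI)
 fix i show "(%x. upd (f x) k (g x) $ i) \<in> borel_measurable M" unfolding upd_nth by (cases "i = k") simp_all
qed

text \<open>Generic in the coordinate measure; it is instantiated with \<open>mm \<beta>\<close> and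
  with \<open>arc_measure\<close>.\<close>

locale coord_measure =
 fixes m :: "complex measure"
 assumes sets_m [measurable_cong, simp]: "sets m = sets borel" and fin_m: "emeasure m UNIV < \<infinity>"
begin

lemma space_m [simp]: "space m = UNIV" using sets_eq_imp_space_eq[OF sets_m] by simp

sublocale finite_measure m by (rule finite_measureI) (use fin_m in auto)
sublocale P: product_sigma_finite "%_. m" by standard

definition vm :: "(complex^'n) measure" where "vm = distr (PiM UNIV (%_. m)) borel vec_lambda"

lemma vec_lambda_meas [measurable]: "vec_lambda \<in> PiM UNIV (%_. m) \<rightarrow>\<^sub>M (borel :: (complex^'n) measure)"
 by (rule borel_measurable_vecI) simp

lemma sets_vm [measurable_cong, simp]: "sets (vm :: (complex^'n) measure) = sets borel" by (simp add: vm_def)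
lemma space_vm [simp]: "space (vm :: (complex^'n) measure) = UNIV" by (simp add: vm_def)

lemma nn_integral_vm:
 fixes f :: "complex^'n => ennreal"
 assumes [measurable]: "f \<in> borel_fun"
 shows "(\<integral>\<^sup>+z. f z \<partial>vm) = (\<integral>\<^sup>+x. f (vec_lambda x) \<partial>PiM UNIV (%_. m))"
 unfolding vm_def by (subst nn_integral_distr) auto

lemma nn_integral_vm_prod:
 fixes f :: "'n::finite => complex => ennreal"
 assumes [measurable]: "\<And>i. f i \<in> borel_fun"
 shows "(\<integral>\<^sup>+z. (\<Prod>i\<in>UNIV. f i (z $ i)) \<partial>vm) = (\<Prod>i\<in>UNIV. \<integral>\<^sup>+y. f i y \<partial>m)"
proof -
 have "(\<integral>\<^sup>+z. (\<Prod>i\<in>UNIV. f i (z $ i)) \<partial>vm) = (\<integral>\<^sup>+x. (\<Prod>i\<in>UNIV. f i (x i)) \<partial>PiM UNIV (%_. m))"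
  by (subst nn_integral_vm) auto
 also have "... = (\<Prod>i\<in>UNIV. \<integral>\<^sup>+y. f i y \<partial>m)" by (rule P.product_nn_integral_prod) auto
 finally show ?thesis .
qed

lemma emeasure_vm_box:
 fixes A :: "'n::finite => complex set"
 assumes [measurable]: "\<And>i. A i \<in> sets borel"
 shows "emeasure vm {z. \<forall>i. z $ i \<in> A i} = (\<Prod>i\<in>UNIV. emeasure m (A i))"
proof -
 have e: "(\<Prod>i\<in>UNIV. indicator (A i) (z $ i)) = (indicator {z :: complex^'n. \<forall>i. z $ i \<in> A i} z :: ennreal)" for z :: "complex^'n"
 proof (cases "\<forall>i. z $ i \<in> A i")
  case False
  then obtain i where "z $ i \<notin> A i" by auto
  then have "(\<Prod>i\<in>UNIV. indicator (A i) (z $ i)) = (0::ennreal)" by (intro prod_zero) (auto simp: indicator_def intro!: exI[of _ i])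
  then show ?thesis using False by simp
 qed simp
 have [measurable]: "{z :: complex^'n. \<forall>i. z $ i \<in> A i} \<in> sets borel" by measurable
 show ?thesis using nn_integral_vm_prod[of "%i. indicator (A i)"] unfolding e by simp
qed

lemma AE_vm:
 assumes "AE z in m. Q z"
 shows "AE z in (vm :: (complex^'n) measure). \<forall>i. Q (z $ i)"
proof -
 obtain N where N: "{z. \<not> Q z} \<subseteq> N" "emeasure m N = 0" "N \<in> sets borel" using assms by (auto elim!: AE_E)
 note [measurable] = N(3)
 have "AE z in (vm :: (complex^'n) measure). z $ i \<notin> N" for i
 proof (rule AE_I')
  have e1: "{z :: complex^'n. z $ i \<in> N} = {z. \<forall>j. z $ j \<in> (if j = i then N else UNIV)}" by auto
  have "emeasure vm {z :: complex^'n. \<forall>j. z $ j \<in> (if j = i then N else UNIV)} = (\<Prod>j\<in>(UNIV::'n set). emeasure m (if j = i then N else UNIV))"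
   by (rule emeasure_vm_box) auto
  also have "... = 0" using N(2) by (intro prod_zero) (auto intro!: bexI[of _ i])
  finally have "emeasure vm {z :: complex^'n. z $ i \<in> N} = 0" unfolding e1 .
  moreover have "{z :: complex^'n. z $ i \<in> N} \<in> sets vm" by simp
  ultimately show "{z :: complex^'n. z $ i \<in> N} \<in> null_sets vm" by (rule null_setsI)
 qed auto
 then have "AE z in (vm :: (complex^'n) measure). \<forall>i. z $ i \<notin> N" by (simp add: AE_all_countable)
 then show ?thesis by (rule eventually_mono) (use N(1) in auto)
qed

lemma finite_vm: "emeasure (vm :: (complex^'n) measure) UNIV < \<infinity>"
proof -
 have "emeasure (vm :: (complex^'n) measure) {z. \<forall>i. z $ i \<in> UNIV} = (\<Prod>i\<in>(UNIV::'n set). emeasure m UNIV)" by (rule emeasure_vm_box) auto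
 also have "... < \<infinity>" using fin_m by (simp add: power_less_top_ennreal)
 finally show ?thesis by simp
qed

lemma finite_measure_vm: "finite_measure (vm :: (complex^'n) measure)"
 by (rule finite_measureI) (use finite_vm[where 'n='n] in auto)

text \<open>Iterated integration in the order of the list, head outermost. The set A confining
  coordinate k may depend on the coordinates before k, which enter through y; only its measure must
  be bounded uniformly.\<close>

lemma fubini_list:
 fixes B :: "'i => ennreal"
 assumes "distinct ks" "E \<in> sets (PiM (set ks) (%_. m))"
  and "\<And>as k bs y. ks = as @ k # bs ==> \<exists>A\<in>sets borel. emeasure m A <= B k \<and> (\<forall>x\<in>E. (\<forall>a\<in>set as. x a = y a) --> x k \<in> A)"
 shows "emeasure (PiM (set ks) (%_. m)) E <= (\<Prod>k\<in>set ks. B k)"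
 using assms
proof (induction ks arbitrary: E)
 case Nil
 then show ?case using emeasure_space[of "PiM {} (%_. m)" E] by (simp add: space_PiM)
next
 case (Cons k ks)
 have dk: "k \<notin> set ks" "distinct ks" using Cons.prems(1) by auto
 have [measurable]: "E \<in> sets (PiM (insert k (set ks)) (%_. m))" using Cons.prems(2) by simp
 obtain A0 where A0: "A0 \<in> sets borel" "emeasure m A0 <= B k" "\<And>x. x \<in> E ==> x k \<in> A0"
  using Cons.prems(3)[of "[]" k ks] by auto
 note [measurable] = A0(1)
 have inner: "(\<integral>\<^sup>+x. indicator E (x(k := y)) \<partial>PiM (set ks) (%_. m)) <= indicator A0 y * (\<Prod>k\<in>set ks. B k)" for y
 proof (cases "y \<in> A0")
  case False
  then have "indicator E (x(k := y)) = (0::ennreal)" for x using A0(3)[of "x(k := y)"] by (auto simp: indicator_def)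
  then show ?thesis by simp
 next
  case True
  \<comment> \<open>The section at a fixed value y of the head. It inherits the hypothesis, the head
    being prescribed through \<open>y'(k := y)\<close>.\<close>
  define Ey where "Ey = {x \<in> space (PiM (set ks) (%_. m)). x(k := y) \<in> E}"
  have Ey: "Ey \<in> sets (PiM (set ks) (%_. m))"
  proof -
   have "(%x. x(k := y)) \<in> measurable (PiM (set ks) (%_. m)) (PiM (insert k (set ks)) (%_. m))"
    by (rule measurable_fun_upd[where J="set ks"]) auto
   then show ?thesis unfolding Ey_def by measurable
  qed
  have "(\<integral>\<^sup>+x. indicator E (x(k := y)) \<partial>PiM (set ks) (%_. m)) = (\<integral>\<^sup>+x. indicator Ey x \<partial>PiM (set ks) (%_. m))"
   by (intro nn_integral_cong) (auto simp: Ey_def indicator_def)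
  also have "... = emeasure (PiM (set ks) (%_. m)) Ey" using Ey by simp
  also have "... <= (\<Prod>k\<in>set ks. B k)"
  proof (rule Cons.IH[OF dk(2) Ey])
   fix as k' bs y' assume ks: "ks = as @ k' # bs"
   then have "k # ks = (k # as) @ k' # bs" by simp
   from Cons.prems(3)[OF this, of "y'(k := y)"] obtain A where A: "A \<in> sets borel" "emeasure m A <= B k'"
    "\<And>x. x \<in> E ==> (\<forall>a\<in>set (k # as). x a = (y'(k := y)) a) ==> x k' \<in> A" by blast
   have kk: "k' \<noteq> k" using dk ks by auto
   show "\<exists>A\<in>sets borel. emeasure m A <= B k' \<and> (\<forall>x\<in>Ey. (\<forall>a\<in>set as. x a = y' a) --> x k' \<in> A)"
   proof (intro bexI[OF _ A(1)] conjI A(2) ballI impI)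
    fix x assume x: "x \<in> Ey" "\<forall>a\<in>set as. x a = y' a"
    have "x(k := y) \<in> E" using x(1) by (simp add: Ey_def)
    moreover have "\<forall>a\<in>set (k # as). (x(k := y)) a = (y'(k := y)) a" using x(2) dk ks by auto
    ultimately have "(x(k := y)) k' \<in> A" by (rule A(3))
    then show "x k' \<in> A" using kk by simp
   qed
  qed
  finally show ?thesis using True by simp
 qed
 have "emeasure (PiM (set (k # ks)) (%_. m)) E = (\<integral>\<^sup>+x. indicator E x \<partial>PiM (insert k (set ks)) (%_. m))" by simp
 also have "... = (\<integral>\<^sup>+y. (\<integral>\<^sup>+x. indicator E (x(k := y)) \<partial>PiM (set ks) (%_. m)) \<partial>m)"
  using dk by (intro P.product_nn_integral_insert_rev) auto
 also have "... <= (\<integral>\<^sup>+y. indicator A0 y * (\<Prod>k\<in>set ks. B k) \<partial>m)" by (intro nn_integral_mono inner)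
 also have "... = emeasure m A0 * (\<Prod>k\<in>set ks. B k)" by (subst nn_integral_multc) auto
 also have "... <= B k * (\<Prod>k\<in>set ks. B k)" using A0 by (intro mult_right_mono) auto
 also have "... = (\<Prod>k\<in>set (k # ks). B k)" using dk by simp
 finally show ?case .
qed

lemma fubini_vec:
 fixes B :: "'n::finite => ennreal" and E :: "(complex^'n) set"
 assumes ks: "distinct ks" "set ks = UNIV" and E: "E \<in> sets borel"
  and cond: "\<And>as k bs y. ks = as @ k # bs ==> \<exists>A\<in>sets borel. emeasure m A <= B k \<and> (\<forall>x\<in>E. (\<forall>a\<in>set as. x $ a = y $ a) --> x $ k \<in> A)"
 shows "emeasure vm E <= (\<Prod>k\<in>UNIV. B k)"
proof -
 define E' where "E' = vec_lambda -` E \<inter> space (PiM UNIV (%_. m))"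
 have "emeasure vm E = emeasure (PiM UNIV (%_. m)) E'" unfolding vm_def E'_def using E by (subst emeasure_distr) auto
 also have "... = emeasure (PiM (set ks) (%_. m)) E'" using ks by simp
 also have "... <= (\<Prod>k\<in>set ks. B k)"
 proof (rule fubini_list[OF ks(1)])
  show "E' \<in> sets (PiM (set ks) (%_. m))" unfolding ks(2) E'_def using E by measurable
  fix as k bs and y :: "'n => complex" assume "ks = as @ k # bs"
  from cond[OF this, of "vec_lambda y"] obtain A where "A \<in> sets borel" "emeasure m A <= B k"
   "\<And>x. x \<in> E ==> (\<forall>a\<in>set as. x $ a = y a) ==> x $ k \<in> A" by auto
  then show "\<exists>A\<in>sets borel. emeasure m A <= B k \<and> (\<forall>x\<in>E'. (\<forall>a\<in>set as. x a = y a) --> x k \<in> A)"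
  proof (intro bexI[of _ A] conjI ballI impI)
   fix x assume "x \<in> E'" "\<forall>a\<in>set as. x a = y a"
   then have "vec_lambda x $ k \<in> A" using \<open>\<And>x. x \<in> E ==> (\<forall>a\<in>set as. x $ a = y a) ==> x $ k \<in> A\<close>[of "vec_lambda x"] by (simp add: E'_def)
   then show "x k \<in> A" by simp
  qed
 qed
 finally show ?thesis by (simp add: ks)
qed

lemma iterate_kernel:
 fixes G :: "complex^'n => ennreal" and a :: "complex^'n"
 assumes [measurable]: "G \<in> borel_fun" "\<And>i. K i \<in> borel_fun"
  and step: "\<And>x i. G (upd x i (a $ i)) <= (\<integral>\<^sup>+y. K i y * G (upd x i y) \<partial>m)"
 shows "G a <= (\<integral>\<^sup>+z. (\<Prod>i\<in>UNIV. K i (z $ i)) * G z \<partial>vm)"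
proof -
 have comb[measurable]: "(%y. (\<chi> i. if i \<in> J then y i else x $ i)) \<in> borel_measurable (PiM J (%_. m))" for J and x :: "complex^'n"
 proof (rule borel_measurable_vecI)
  fix i
  show "(%y. (\<chi> i. if i \<in> J then y i else x $ i) $ i) \<in> borel_measurable (PiM J (%_. m))"
   by (cases "i \<in> J") simp_all
 qed
 have main: "G (\<chi> i. if i \<in> J then a $ i else x $ i) <= (\<integral>\<^sup>+y. (\<Prod>i\<in>J. K i (y i)) * G (\<chi> i. if i \<in> J then y i else x $ i) \<partial>PiM J (%_. m))"
  if "finite J" for J and x :: "complex^'n"
  using that
 proof (induction J arbitrary: x)
  case empty
  show ?case by (simp add: nn_integral_count_space_finite PiM_empty)
 next
  case (insert k J)
  have meas: "(%y. (\<Prod>i\<in>insert k J. K i (y i)) * G (\<chi> i. if i \<in> insert k J then y i else x $ i)) \<in> borel_measurable (PiM (insert k J) (%_. m))"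
   by (intro borel_measurable_times_ennreal borel_measurable_prod_ennreal measurable_compose[OF comb]) measurable
  have "G (\<chi> i. if i \<in> insert k J then a $ i else x $ i) = G (upd (\<chi> i. if i \<in> J then a $ i else x $ i) k (a $ k))"
   by (rule arg_cong[where f=G]) (auto simp: upd_def vec_eq_iff)
  also have "... <= (\<integral>\<^sup>+t. K k t * G (upd (\<chi> i. if i \<in> J then a $ i else x $ i) k t) \<partial>m)" by (rule step)
  also have "... <= (\<integral>\<^sup>+t. (\<integral>\<^sup>+y. (\<Prod>i\<in>insert k J. K i ((y(k := t)) i)) * G (\<chi> i. if i \<in> insert k J then (y(k := t)) i else x $ i) \<partial>PiM J (%_. m)) \<partial>m)"
  proof (intro nn_integral_mono)
   fix t
   have "G (upd (\<chi> i. if i \<in> J then a $ i else x $ i) k t) = G (\<chi> i. if i \<in> J then a $ i else upd x k t $ i)"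
    using insert.hyps by (intro arg_cong[where f=G]) (auto simp: upd_def vec_eq_iff)
   also have "... <= (\<integral>\<^sup>+y. (\<Prod>i\<in>J. K i (y i)) * G (\<chi> i. if i \<in> J then y i else upd x k t $ i) \<partial>PiM J (%_. m))"
    by (rule insert.IH)
   finally have "K k t * G (upd (\<chi> i. if i \<in> J then a $ i else x $ i) k t) <= K k t * (\<integral>\<^sup>+y. (\<Prod>i\<in>J. K i (y i)) * G (\<chi> i. if i \<in> J then y i else upd x k t $ i) \<partial>PiM J (%_. m))"
    by (rule mult_left_mono) simp
   also have "... = (\<integral>\<^sup>+y. K k t * ((\<Prod>i\<in>J. K i (y i)) * G (\<chi> i. if i \<in> J then y i else upd x k t $ i)) \<partial>PiM J (%_. m))"
    by (rule nn_integral_cmult[symmetric]) (intro borel_measurable_times_ennreal borel_measurable_prod_ennreal measurable_compose[OF comb]; measurable)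
   also have "... = (\<integral>\<^sup>+y. (\<Prod>i\<in>insert k J. K i ((y(k := t)) i)) * G (\<chi> i. if i \<in> insert k J then (y(k := t)) i else x $ i) \<partial>PiM J (%_. m))"
   proof (intro nn_integral_cong)
    fix y
    have "(\<Prod>i\<in>insert k J. K i ((y(k := t)) i)) = K k t * (\<Prod>i\<in>J. K i (y i))"
     using insert.hyps by (auto intro!: arg_cong2[where f="(*)"] prod.cong)
    moreover have "(\<chi> i. if i \<in> insert k J then (y(k := t)) i else x $ i) = (\<chi> i. if i \<in> J then y i else upd x k t $ i)"
     using insert.hyps by (auto simp: vec_eq_iff upd_def)
    ultimately show "K k t * ((\<Prod>i\<in>J. K i (y i)) * G (\<chi> i. if i \<in> J then y i else upd x k t $ i)) = (\<Prod>i\<in>insert k J. K i ((y(k := t)) i)) * G (\<chi> i. if i \<in> insert k J then (y(k := t)) i else x $ i)"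
     by (simp add: mult.assoc)
   qed
   finally show "K k t * G (upd (\<chi> i. if i \<in> J then a $ i else x $ i) k t) <= (\<integral>\<^sup>+y. (\<Prod>i\<in>insert k J. K i ((y(k := t)) i)) * G (\<chi> i. if i \<in> insert k J then (y(k := t)) i else x $ i) \<partial>PiM J (%_. m))" .
  qed
  also have "... = (\<integral>\<^sup>+y. (\<Prod>i\<in>insert k J. K i (y i)) * G (\<chi> i. if i \<in> insert k J then y i else x $ i) \<partial>PiM (insert k J) (%_. m))"
   using insert.hyps meas by (intro P.product_nn_integral_insert_rev[symmetric]) auto
  finally show ?case .
 qed
 have "G a <= (\<integral>\<^sup>+y. (\<Prod>i\<in>UNIV. K i (y i)) * G (vec_lambda y) \<partial>PiM UNIV (%_. m))"
  using main[of UNIV a] by simp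
 also have "... = (\<integral>\<^sup>+z. (\<Prod>i\<in>UNIV. K i (z $ i)) * G z \<partial>vm)"
  by (subst nn_integral_vm) auto
 finally show ?thesis .
qed

text \<open>Replacing one coordinate by an independent copy changes nothing for a probability
  measure. In this form an inequality in one variable, with the other coordinates frozen, passes to
  the product.\<close>

lemma resample:
 fixes G :: "complex^'n => ennreal"
 assumes [measurable]: "G \<in> borel_fun" and prob: "emeasure m UNIV = 1"
 shows "(\<integral>\<^sup>+z. G z \<partial>vm) = (\<integral>\<^sup>+z. \<integral>\<^sup>+y. G (upd z k y) \<partial>m \<partial>vm)"
proof -
 define J where "J = UNIV - {k}"
 have J: "insert k J = UNIV" "k \<notin> J" "finite J" by (auto simp: J_def)
 have split: "(\<integral>\<^sup>+z. F z \<partial>vm) = (\<integral>\<^sup>+x. (\<integral>\<^sup>+y. F (vec_lambda (x(k := y))) \<partial>m) \<partial>PiM J (%_. m))"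
  if [measurable]: "F \<in> borel_fun" for F :: "complex^'n => ennreal"
 proof -
  have "(\<integral>\<^sup>+z. F z \<partial>vm) = (\<integral>\<^sup>+x. F (vec_lambda x) \<partial>PiM (insert k J) (%_. m))"
   unfolding J by (rule nn_integral_vm) simp
  also have "... = (\<integral>\<^sup>+x. (\<integral>\<^sup>+y. F (vec_lambda (x(k := y))) \<partial>m) \<partial>PiM J (%_. m))"
  proof (rule P.product_nn_integral_insert[OF J(3,2)])
   show "(%x. F (vec_lambda x)) \<in> borel_measurable (PiM (insert k J) (%_. m))" unfolding J by measurable
  qed
  finally show ?thesis .
 qed
 have "(\<integral>\<^sup>+z. \<integral>\<^sup>+y. G (upd z k y) \<partial>m \<partial>vm) = (\<integral>\<^sup>+x. (\<integral>\<^sup>+y'. (\<integral>\<^sup>+y. G (upd (vec_lambda (x(k := y'))) k y) \<partial>m) \<partial>m) \<partial>PiM J (%_. m))"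
  by (rule split) measurable
 also have "... = (\<integral>\<^sup>+x. (\<integral>\<^sup>+y'. (\<integral>\<^sup>+y. G (vec_lambda (x(k := y))) \<partial>m) \<partial>m) \<partial>PiM J (%_. m))"
 proof -
  have "upd (vec_lambda (x(k := y'))) k y = vec_lambda (x(k := y))" for x y' y by (auto simp: upd_def vec_eq_iff)
  then show ?thesis by simp
 qed
 also have "... = (\<integral>\<^sup>+z. G z \<partial>vm)" using prob by (simp add: split)
 finally show ?thesis by simp
qed

end


section \<open>Conditions (a) and (b), and what they say about the Jacobian\<close>

context smooth_selfmap begin

definition condA :: bool where
 "condA \<longleftrightarrow> (\<forall>j\<in>{1..CARD('n) - 1}. \<phi> ` (cpolydisc - T (j + 1)) \<inter> T (j + 1) = {})"

definition condB :: bool where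
 "condB \<longleftrightarrow> (\<forall>j\<in>{1..CARD('n)}. \<forall>I :: 'n set. card I = j -->
    (\<forall>\<xi>\<in>T j - T (j + 1). (\<forall>i\<in>I. norm (\<phi> \<xi> $ i) = 1) -->
     invertible_on I (P \<phi> I \<xi>) (jac \<phi> \<xi>)))"

lemma T_iff:
 fixes z :: "complex^'n"
 shows "z \<in> T j \<longleftrightarrow> z \<in> cpolydisc \<and> j <= card {k. norm (z $ k) = 1}"
proof
 assume "z \<in> T j"
 then obtain I :: "'n set" where "z \<in> cpolydisc" "card I = j" "\<forall>k\<in>I. norm (z $ k) = 1" by (auto simp: T_def)
 then show "z \<in> cpolydisc \<and> j <= card {k. norm (z $ k) = 1}" using card_mono[of "{k. norm (z $ k) = 1}" I] by auto
next
 assume *: "z \<in> cpolydisc \<and> j <= card {k. norm (z $ k) = 1}"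
 then obtain I where "I \<subseteq> {k. norm (z $ k) = 1}" "card I = j" by (meson obtain_subset_with_card_n)
 then show "z \<in> T j" using * by (auto simp: T_def)
qed

lemma P_unimod:
 assumes "\<xi> \<in> cpolydisc" "\<And>i. i \<in> I ==> norm (\<phi> \<xi> $ i) = 1" "k \<in> P \<phi> I \<xi>"
 shows "norm (\<xi> $ k) = 1"
proof (rule ccontr)
 assume "norm (\<xi> $ k) \<noteq> 1"
 then have "norm (\<xi> $ k) < 1" using cpolydisc_component[OF assms(1), of k] by simp
 then have "jac \<phi> \<xi> i k = 0" if "i \<in> I" for i using jac_interior_zero assms that by blast
 then show False using assms(3) by (auto simp: P_def)
qed

text \<open>Conditions (a) and (b) act at points whose number of unimodular coordinates is known.
  Setting to 0 the coordinates outside N = P_I(\<xi>) produces a point z with exactly card N of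
  them, and rigidity preserves the components in I together with their Jacobian rows. So (a) at
  level card N gives card I \<le> card N, and in case of equality (b) applies to I at z.\<close>

lemma hall_condition:
 assumes A: condA and B: condB and xi: "\<xi> \<in> cpolydisc" and I: "I \<noteq> {}" "\<And>i. i \<in> I ==> norm (\<phi> \<xi> $ i) = 1"
 shows "card I <= card (P \<phi> I \<xi>)"
  and "card I = card (P \<phi> I \<xi>) ==> invertible_on I (P \<phi> I \<xi>) (jac \<phi> \<xi>)"
proof -
 define N where "N = P \<phi> I \<xi>"
 define z :: "complex^'n" where "z = (\<chi> k. if k \<in> N then \<xi> $ k else 0)"
 have z: "z \<in> cpolydisc" using cpolydisc_component[OF xi] by (auto simp: z_def cpolydisc_def)
 have zN: "\<And>k. k \<in> N ==> z $ k = \<xi> $ k" by (simp add: z_def)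
 have N0: "jac \<phi> \<xi> i k = 0" if "i \<in> I" "k \<notin> N" for i k using that by (auto simp: N_def P_def)
 have rig: "\<phi> z $ i = \<phi> \<xi> $ i" if "i \<in> I" for i
  using rigidity[OF xi I(2)[OF that] N0[OF that] z zN] by blast
 have jr: "jac \<phi> z i m = jac \<phi> \<xi> i m" if "i \<in> I" for i m
  using jac_rigidity[OF xi I(2)[OF that] N0[OF that] z zN] by blast
 have uni: "{k. norm (z $ k) = 1} = N" using P_unimod[OF xi I(2)] by (auto simp: z_def N_def)
 have sub: "I \<subseteq> {i. norm (\<phi> z $ i) = 1}" using rig I(2) by auto
 \<comment> \<open>Otherwise z would be the centre, which \<phi> maps into the open polydisc. This
   puts the level card N into the range of (a) and (b), which starts at 1.\<close>
 have N1: "N \<noteq> {}"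
 proof
  assume "N = {}"
  then have "z \<in> polydisc" by (simp add: z_def polydisc_def)
  then have "norm (\<phi> z $ i) < 1" for i using map_polydisc polydisc_component by blast
  moreover obtain i where "i \<in> I" using I(1) by blast
  ultimately show False using sub by (metis (mono_tags, lifting) less_irrefl mem_Collect_eq subsetD)
 qed
 have cN: "1 <= card N" using N1 by (simp add: Suc_leI card_gt_0_iff)
 have zT: "z \<in> T (card N) - T (card N + 1)" using z by (simp add: T_iff uni)
 show le: "card I <= card (P \<phi> I \<xi>)"
 proof (cases "card N = CARD('n)")
  case True
  then show ?thesis unfolding N_def[symmetric] by (simp add: card_mono)
 next
  case False
  then have "card N < CARD('n)" using card_mono[of "UNIV::'n set" N] by simp
  then have "card N \<in> {1..CARD('n) - 1}" using cN by simp
  then have "\<phi> z \<notin> T (card N + 1)" using A zT z unfolding condA_def by blast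
  then have "card {i. norm (\<phi> z $ i) = 1} <= card N" using map_cpolydisc[OF z] by (simp add: T_iff)
  moreover have "card I <= card {i. norm (\<phi> z $ i) = 1}" using sub by (intro card_mono) auto
  ultimately show ?thesis by (simp add: N_def)
 qed
 assume eq: "card I = card (P \<phi> I \<xi>)"
 have "card I \<in> {1..CARD('n)}" using cN eq card_mono[of "UNIV::'n set" I] by (simp add: N_def)
 moreover have "z \<in> T (card I) - T (card I + 1)" using zT eq by (simp add: N_def)
 ultimately have "invertible_on I (P \<phi> I z) (jac \<phi> z)" using B sub unfolding condB_def by blast
 moreover have "P \<phi> I z = P \<phi> I \<xi>" using jr by (auto simp: P_def)
 ultimately show "invertible_on I (P \<phi> I \<xi>) (jac \<phi> \<xi>)"
  using jr unfolding invertible_on_def by simp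
qed

text \<open>Schwarz-Pick for \<phi>_i as a function of the k-th coordinate. Where the entry stays
  away from 0, the distance of z_k to the circle is controlled by that of \<phi>_i.\<close>

lemma radial_bound:
 assumes z: "z \<in> polydisc"
 shows "(1 - norm (z $ k)) * norm (jac \<phi> z i k) <= 1 - (norm (\<phi> z $ i))^2"
proof -
 define g where "g l = \<phi> (z + (l - z $ k) *s axis k 1) $ i" for l
 have inp: "z + (l - z $ k) *s axis k 1 \<in> polydisc" if "norm l < 1" for l
  using that polydisc_component[OF z] by (auto simp: polydisc_def axis_def)
 have e: "z + (l - z $ k) *s axis k 1 = (z - (z $ k) *s axis k 1) + l *s axis k 1" for l
  by (simp add: vec_eq_iff algebra_simps)
 have g: "g holomorphic_on ball 0 1"
 proof (subst holomorphic_on_open, simp, intro ballI)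
  fix l :: complex assume "l \<in> ball 0 1"
  then have "(z - (z $ k) *s axis k 1) + l *s axis k 1 \<in> polydisc" using inp[of l] unfolding e by simp
  then show "\<exists>f'. (g has_field_derivative f') (at l)" unfolding g_def e by (rule holo_along_line[OF holo])
 qed
 have gb: "norm (g l) < 1" if "norm l < 1" for l unfolding g_def using map_polydisc[OF inp[OF that]] polydisc_component by blast
 have "deriv g (z $ k) = jac \<phi> z i k" unfolding g_def by (rule DERIV_imp_deriv[OF has_derivative_jac(2)[OF z]])
 moreover have "g (z $ k) = \<phi> z $ i" by (simp add: g_def)
 ultimately show ?thesis using schwarz_pick[OF g gb polydisc_component[OF z], of k] by simp
qed

end

section \<open>Invertible blocks of a matrix without determinants\<close>

definition bij_block :: "('n::finite => 'n => complex) => 'n set => 'n set => bool" where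
 "bij_block a I K \<longleftrightarrow>
   (\<forall>b. \<exists>v. (\<forall>k. k \<notin> K --> v k = 0) \<and> (\<forall>i\<in>I. (\<Sum>k\<in>UNIV. a i k * v k) = b i)) \<and>
   (\<forall>v. (\<forall>k. k \<notin> K --> v k = 0) --> (\<forall>i\<in>I. (\<Sum>k\<in>UNIV. a i k * v k) = 0) --> (\<forall>k. v k = 0))"

text \<open>Vectors indexed by K are total functions vanishing off K, so that blocks with different
  columns act on one space.\<close>

lemma sum_supported:
 fixes v :: "'n::finite => complex"
 assumes "\<forall>k. k \<notin> K --> v k = 0" shows "(\<Sum>k\<in>UNIV. f k * v k) = (\<Sum>k\<in>K. f k * v k)"
 using assms by (intro sum.mono_neutral_right) auto

lemma invertible_on_bij_block:
 fixes a :: "'n::finite => 'n => complex"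
 assumes "invertible_on I K a" shows "bij_block a I K"
proof -
 obtain B where B: "\<And>i i'. i \<in> I ==> i' \<in> I ==> (\<Sum>k\<in>K. a i k * B k i') = (if i = i' then 1 else 0)"
  "\<And>k k'. k \<in> K ==> k' \<in> K ==> (\<Sum>i\<in>I. B k i * a i k') = (if k = k' then 1 else 0)"
  using assms unfolding invertible_on_def by blast
 show ?thesis
  unfolding bij_block_def
 proof (intro conjI allI impI)
  fix b :: "'n => complex"
  define v where "v k = (if k \<in> K then \<Sum>i\<in>I. B k i * b i else 0)" for k
  have v: "\<forall>k. k \<notin> K --> v k = 0" by (simp add: v_def)
  have "(\<Sum>k\<in>UNIV. a i k * v k) = b i" if i: "i \<in> I" for i
  proof -
   have "(\<Sum>k\<in>UNIV. a i k * v k) = (\<Sum>k\<in>K. \<Sum>i'\<in>I. a i k * B k i' * b i')"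
    unfolding sum_supported[OF v] by (intro sum.cong) (auto simp: v_def sum_distrib_left mult.assoc)
   also have "... = (\<Sum>i'\<in>I. \<Sum>k\<in>K. a i k * B k i' * b i')" by (rule sum.swap)
   also have "... = (\<Sum>i'\<in>I. if i = i' then b i' else 0)"
    using i by (intro sum.cong) (auto simp: B sum_distrib_right[symmetric])
   also have "... = b i" using i by simp
   finally show ?thesis .
  qed
  then show "\<exists>v. (\<forall>k. k \<notin> K --> v k = 0) \<and> (\<forall>i\<in>I. (\<Sum>k\<in>UNIV. a i k * v k) = b i)" using v by blast
 next
  fix v :: "'n => complex" and k
  assume v: "\<forall>k. k \<notin> K --> v k = 0" and 0: "\<forall>i\<in>I. (\<Sum>k\<in>UNIV. a i k * v k) = 0"
  show "v k = 0"
  proof (cases "k \<in> K")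
   case True
   have "0 = (\<Sum>i\<in>I. B k i * (\<Sum>k\<in>UNIV. a i k * v k))" using 0 by simp
   also have "... = (\<Sum>i\<in>I. \<Sum>k'\<in>K. B k i * a i k' * v k')"
    unfolding sum_supported[OF v] by (simp add: sum_distrib_left mult.assoc)
   also have "... = (\<Sum>k'\<in>K. \<Sum>i\<in>I. B k i * a i k' * v k')" by (rule sum.swap)
   also have "... = (\<Sum>k'\<in>K. if k = k' then v k' else 0)"
    using True by (intro sum.cong) (auto simp: B sum_distrib_right[symmetric])
   also have "... = v k" using True by simp
   finally show ?thesis by simp
  qed (use v in simp)
 qed
qed

lemma bij_block_surj:
 "bij_block a I K ==> \<exists>v. (\<forall>k. k \<notin> K --> v k = 0) \<and> (\<forall>i\<in>I. (\<Sum>k\<in>UNIV. a i k * v k) = b i)"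
 unfolding bij_block_def by blast

lemma bij_block_inj:
 "bij_block a I K ==> \<forall>k. k \<notin> K --> v k = 0 ==> \<forall>i\<in>I. (\<Sum>k\<in>UNIV. a i k * v k) = 0 ==> v k = 0"
 unfolding bij_block_def by blast

lemma bij_block_singleton: "a i k \<noteq> 0 ==> bij_block a {i} {k}" for a :: "'n::finite => 'n => complex"
 unfolding bij_block_def
proof (intro conjI allI impI)
 assume a: "a i k \<noteq> 0"
 fix b :: "'n => complex"
 define v where "v k' = (if k' = k then b i / a i k else 0)" for k'
 have v: "\<forall>k'. k' \<notin> {k} --> v k' = 0" by (simp add: v_def)
 moreover have "(\<Sum>k\<in>UNIV. a i k * v k) = b i" unfolding sum_supported[OF v] using a by (simp add: v_def)
 ultimately show "\<exists>v. (\<forall>k'. k' \<notin> {k} --> v k' = 0) \<and> (\<forall>i\<in>{i}. (\<Sum>k\<in>UNIV. a i k * v k) = b i)" by blast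
next
 assume a: "a i k \<noteq> 0"
 fix v :: "'n => complex" and k'
 assume v: "\<forall>k'. k' \<notin> {k} --> v k' = 0" and 0: "\<forall>i\<in>{i}. (\<Sum>k\<in>UNIV. a i k * v k) = 0"
 have "a i k * v k = 0" using 0 unfolding sum_supported[OF v] by simp
 then show "v k' = 0" using a v by (cases "k' = k") auto
qed

lemma bij_block_remove:
 fixes a :: "'n::finite => 'n => complex"
 assumes b: "bij_block a (insert i I) K" and i: "i \<notin> I"
 obtains k where "k \<in> K" "bij_block a I (K - {k})"
proof -
 obtain v where v: "\<And>k. k \<notin> K ==> v k = 0" "\<And>i'. i' \<in> insert i I ==> (\<Sum>k\<in>UNIV. a i' k * v k) = (if i' = i then 1 else 0)"
  using bij_block_surj[OF b, of "%i'. if i' = i then 1 else 0"] by blast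
 have "\<exists>k. v k \<noteq> 0"
 proof (rule ccontr)
  assume "\<not> (\<exists>k. v k \<noteq> 0)"
  then have "(\<Sum>k\<in>UNIV. a i k * v k) = 0" by (intro sum.neutral) auto
  then show False using v(2)[of i] by simp
 qed
 then obtain k where k: "v k \<noteq> 0" by auto
 then have kK: "k \<in> K" using v(1) by auto
 have vI: "(\<Sum>k\<in>UNIV. a i' k * v k) = 0" if "i' \<in> I" for i' using v(2)[of i'] that i by auto
 have lin: "(\<Sum>k\<in>UNIV. a i' k * (u k - c * v k)) = (\<Sum>k\<in>UNIV. a i' k * u k) - c * (\<Sum>k\<in>UNIV. a i' k * v k)" for i' u c
  by (simp add: right_diff_distrib sum_subtractf sum_distrib_left mult.left_commute)
 have "bij_block a I (K - {k})"
  unfolding bij_block_def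
 proof (intro conjI allI impI)
  fix d :: "'n => complex"
  obtain u where u: "\<And>k. k \<notin> K ==> u k = 0" "\<And>i'. i' \<in> insert i I ==> (\<Sum>k\<in>UNIV. a i' k * u k) = d i'"
   using bij_block_surj[OF b, of d] by blast
  define w where "w k' = u k' - u k / v k * v k'" for k'
  have "\<forall>k'. k' \<notin> K - {k} --> w k' = 0" using u(1) v(1) k by (auto simp: w_def)
  moreover have "\<forall>i'\<in>I. (\<Sum>k\<in>UNIV. a i' k * w k) = d i'" unfolding w_def lin using u(2) vI by simp
  ultimately show "\<exists>v. (\<forall>k'. k' \<notin> K - {k} --> v k' = 0) \<and> (\<forall>i\<in>I. (\<Sum>k\<in>UNIV. a i k * v k) = d i)" by blast
 next
  fix u :: "'n => complex" and k'
  assume u: "\<forall>k'. k' \<notin> K - {k} --> u k' = 0" "\<forall>i\<in>I. (\<Sum>k\<in>UNIV. a i k * u k) = 0"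
  define c where "c = (\<Sum>k\<in>UNIV. a i k * u k)"
  define w where "w k' = u k' - c * v k'" for k'
  have "\<forall>k'. k' \<notin> K --> w k' = 0" using u(1) v(1) by (auto simp: w_def)
  moreover have "\<forall>i'\<in>insert i I. (\<Sum>k\<in>UNIV. a i' k * w k) = 0" unfolding w_def lin using u(2) vI v(2)[of i] by (auto simp: c_def)
  ultimately have w: "w k' = 0" for k' by (rule bij_block_inj[OF b])
  have "u k = c * v k" using w[of k] by (simp add: w_def)
  then have "c = 0" using u(1) k by simp
  then show "u k' = 0" using w[of k'] by (simp add: w_def)
 qed
 then show ?thesis using that kK by blast
qed

text \<open>The vectors \<open>u i\<close> are the columns of the inverse block. Expanding v in them
  bounds v by its row values, with 1 plus the sum of all |u i k| as constant.\<close>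

lemma bij_block_lower_bound:
 fixes a :: "'n::finite => 'n => complex"
 assumes b: "bij_block a I K" and I: "I \<noteq> {}"
 shows "\<exists>c>0. \<forall>v. (\<forall>k. k \<notin> K --> v k = 0) --> (\<forall>D\<ge>0. (\<forall>i\<in>I. norm (\<Sum>k\<in>UNIV. a i k * v k) <= D) --> (\<forall>k. c * norm (v k) <= D))"
proof -
 define Q where "Q i u \<longleftrightarrow> (\<forall>k. k \<notin> K --> u k = 0) \<and> (\<forall>i'\<in>I. (\<Sum>k\<in>UNIV. a i' k * u k) = (if i' = i then 1 else 0))" for i u
 define u where "u i = (SOME u. Q i u)" for i
 have "Q i (u i)" for i
 proof -
  have "\<exists>u. Q i u" unfolding Q_def by (rule bij_block_surj[OF b])
  then show ?thesis unfolding u_def by (rule someI_ex)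
 qed
 then have u: "\<And>i k. k \<notin> K ==> u i k = 0" "\<And>i i'. i' \<in> I ==> (\<Sum>k\<in>UNIV. a i' k * u i k) = (if i' = i then 1 else 0)"
  unfolding Q_def by blast+
 define C where "C = 1 + (\<Sum>i\<in>I. \<Sum>k\<in>UNIV. norm (u i k))"
 have C: "C > 0" by (auto simp: C_def intro!: add_pos_nonneg sum_nonneg)
 show ?thesis
 proof (intro exI[of _ "1/C"] conjI allI impI)
  show "1/C > 0" using C by simp
  fix v :: "'n => complex" and D :: real and k
  assume v: "\<forall>k. k \<notin> K --> v k = 0" and D: "0 <= D" "\<forall>i\<in>I. norm (\<Sum>k\<in>UNIV. a i k * v k) <= D"
  define b' where "b' i = (\<Sum>k\<in>UNIV. a i k * v k)" for i
  define w where "w k = v k - (\<Sum>i\<in>I. b' i * u i k)" for k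
  have "\<forall>k. k \<notin> K --> w k = 0" using v u(1) by (auto simp: w_def)
  moreover have "(\<Sum>k\<in>UNIV. a i' k * w k) = 0" if i': "i' \<in> I" for i'
  proof -
   have "(\<Sum>k\<in>UNIV. a i' k * w k) = b' i' - (\<Sum>k\<in>UNIV. \<Sum>i\<in>I. b' i * (a i' k * u i k))"
    by (simp add: w_def b'_def right_diff_distrib sum_subtractf sum_distrib_left mult.left_commute)
   also have "(\<Sum>k\<in>UNIV. \<Sum>i\<in>I. b' i * (a i' k * u i k)) = (\<Sum>i\<in>I. \<Sum>k\<in>UNIV. b' i * (a i' k * u i k))" by (rule sum.swap)
   also have "... = (\<Sum>i\<in>I. if i' = i then b' i else 0)"
    using i' by (intro sum.cong) (auto simp: sum_distrib_left[symmetric] u(2))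
   also have "... = b' i'" using i' by simp
   finally show ?thesis by simp
  qed
  ultimately have "w k = 0" using bij_block_inj[OF b, of w k] by blast
  then have "v k = (\<Sum>i\<in>I. b' i * u i k)" by (simp add: w_def)
  then have "norm (v k) <= (\<Sum>i\<in>I. norm (b' i * u i k))" by (simp add: norm_sum)
  also have "... <= (\<Sum>i\<in>I. D * (\<Sum>k\<in>UNIV. norm (u i k)))"
   unfolding norm_mult using D by (intro sum_mono mult_mono member_le_sum) (auto simp: b'_def)
  also have "... <= D * C" unfolding sum_distrib_left[symmetric] C_def using D by (intro mult_left_mono) auto
  finally show "1/C * norm (v k) <= D" using C by (simp add: field_simps)
 qed
qed

section \<open>Necessity\<close>

lemma ennreal_prod_mono:
 fixes f g :: "'i => ennreal"
 shows "(\<And>i. i \<in> A ==> f i <= g i) ==> prod f A <= prod g A"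
 by (induction A rule: infinite_finite_induct) (auto intro!: mult_mono)

lemma mm_arc: "mm (-1) = arc_measure" by (simp add: mm_def)
lemma mm_dA: "\<beta> > -1 ==> mm \<beta> = dA \<beta>" by (simp add: mm_def)

lemma coord_measure_mm: "\<beta> >= -1 ==> coord_measure (mm \<beta>)"
 by unfold_locales (use finite_mm in auto)

abbreviation mu :: "real => (complex^'n) measure" where "mu \<beta> \<equiv> coord_measure.vm (mm \<beta>)"

lemma vm_eq: "coord_measure m ==> coord_measure.vm m = distr (PiM UNIV (%_. m)) borel vec_lambda"
 by (rule coord_measure.vm_def)

lemma mu_dV: "\<beta> > -1 ==> mu \<beta> = dV \<beta>"
 using vm_eq[OF coord_measure_mm[of \<beta>]] by (simp add: dV_def mm_def)

lemma mu_torus: "mu (-1) = torus_measure"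
 using vm_eq[OF coord_measure_mm[of "-1"]] by (simp add: torus_measure_def mm_def)

lemma AE_mm_cball: "AE z in mm \<beta>. norm z <= 1"
proof (cases "\<beta> = -1")
 case True
 show ?thesis unfolding True mm_arc using AE_arc by (rule eventually_mono) simp
next
 case False
 have "emeasure (dA \<beta>) {z. norm z >= 1} = (\<integral>\<^sup>+z. indicator {z. norm z >= 1} z \<partial>dA \<beta>)" by simp
 also have "... = (\<integral>\<^sup>+(z::complex). 0 \<partial>lborel)"
  by (subst nn_integral_dA, simp, rule nn_integral_cong) (auto split: split_indicator)
 finally have "emeasure (dA \<beta>) {z. norm z >= 1} = 0" by simp
 then have "AE z in dA \<beta>. norm z <= 1" by (intro AE_I[of _ _ "{z. norm z >= 1}"]) auto
 then show ?thesis unfolding mm_def using False by simp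
qed

lemma AE_dA_ball: "AE z in dA \<beta>. norm z < 1"
proof -
 have "emeasure (dA \<beta>) {z. norm z >= 1} = (\<integral>\<^sup>+z. indicator {z. norm z >= 1} z \<partial>dA \<beta>)" by simp
 also have "... = (\<integral>\<^sup>+(z::complex). 0 \<partial>lborel)"
  by (subst nn_integral_dA, simp, rule nn_integral_cong) (auto split: split_indicator)
 finally have "emeasure (dA \<beta>) {z. norm z >= 1} = 0" by simp
 then show ?thesis by (intro AE_I[of _ _ "{z. norm z >= 1}"]) auto
qed

lemma holo_on_const: "holo_on (%_. c) S"
 unfolding holo_on_def by (auto intro!: exI[of _ "%_. 0"])

lemma holo_on_mult:
 assumes "holo_on f S" "holo_on g S" shows "holo_on (%z. f z * g z) S"
 unfolding holo_on_def
proof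
 fix z assume z: "z \<in> S"
 obtain D where D: "(f has_derivative D) (at z)" "\<And>c v. D (c *s v) = c * D v" using assms(1) z by (auto simp: holo_on_def)
 obtain E where E: "(g has_derivative E) (at z)" "\<And>c v. E (c *s v) = c * E v" using assms(2) z by (auto simp: holo_on_def)
 have "((%z. f z * g z) has_derivative (%h. f z * E h + D h * g z)) (at z)" by (rule has_derivative_mult[OF D(1) E(1)])
 moreover have "\<forall>c v. f z * E (c *s v) + D (c *s v) * g z = c * (f z * E v + D v * g z)" by (simp add: D(2) E(2) algebra_simps)
 ultimately show "\<exists>D. ((%z. f z * g z) has_derivative D) (at z) \<and> (\<forall>c v. D (c *s v) = c * D v)" by blast
qed

lemma holo_on_prod: "finite I ==> (\<And>i. i \<in> I ==> holo_on (f i) S) ==> holo_on (%z. \<Prod>i\<in>I. f i z) S"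
 by (induction I rule: finite_induct) (auto intro: holo_on_const holo_on_mult)

lemma holo_on_coord:
 assumes h: "h holomorphic_on ball 0 1"
 shows "holo_on (%z :: complex^'n. h (z $ i)) polydisc"
 unfolding holo_on_def
proof
 fix z :: "complex^'n" assume "z \<in> polydisc"
 then have "z $ i \<in> ball 0 1" using polydisc_component[of z i] by simp
 then have "(h has_field_derivative deriv h (z $ i)) (at (z $ i))" using h by (intro holomorphic_derivI) auto
 then have "(h has_derivative (%x. deriv h (z $ i) * x)) (at (z $ i))" by (simp add: has_field_derivative_def)
 moreover have "((%z :: complex^'n. z $ i) has_derivative (%v. v $ i)) (at z)"
  by (intro bounded_linear_imp_has_derivative bounded_linear_vec_nth)
 ultimately have "((%z. h (z $ i)) has_derivative (%v. deriv h (z $ i) * v $ i)) (at z)"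
  by (rule has_derivative_compose[rotated])
 then show "\<exists>D. ((%z. h (z $ i)) has_derivative D) (at z) \<and> (\<forall>c v. D (c *s v) = c * D v)"
  by (intro exI[of _ "%v. deriv h (z $ i) * v $ i"]) simp
qed

lemma holo_on_continuous: "holo_on f S ==> continuous_on S f"
 unfolding holo_on_def by (intro continuous_at_imp_continuous_on) (blast intro: has_derivative_continuous)

lemma borel_on_indicator:
 fixes f :: "complex^'n => complex"
 assumes "continuous_on S f" "S \<in> sets borel"
 shows "(%z. nsq (f z) * indicator S z) \<in> borel_fun"
  and "(%z. ennreal (norm (f z)) * indicator S z) \<in> borel_fun"
proof -
 have "(%z. indicator S z *\<^sub>R (norm (f z))^2) \<in> borel_fun"
  using assms by (intro borel_measurable_continuous_on_indicator continuous_intros) auto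
 then have "(%z. ennreal (indicator S z *\<^sub>R (norm (f z))^2)) \<in> borel_fun" by measurable
 then show "(%z. nsq (f z) * indicator S z) \<in> borel_fun"
  by (rule measurable_cong[THEN iffD1, rotated]) (auto split: split_indicator)
 have "(%z. indicator S z *\<^sub>R norm (f z)) \<in> borel_fun"
  using assms by (intro borel_measurable_continuous_on_indicator continuous_intros) auto
 then have "(%z. ennreal (indicator S z *\<^sub>R norm (f z))) \<in> borel_fun" by measurable
 then show "(%z. ennreal (norm (f z)) * indicator S z) \<in> borel_fun"
  by (rule measurable_cong[THEN iffD1, rotated]) (auto split: split_indicator)
qed

lemma torus_closed: "closed (torus :: (complex^'n) set)"
proof -
 have "torus = (\<Inter>k\<in>UNIV. {z :: complex^'n. norm (z $ k) = 1})" by (auto simp: torus_def)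
 moreover have "closed ..." by (intro closed_INT ballI closed_Collect_eq continuous_intros)
 ultimately show ?thesis by simp
qed

lemma borel_sets [measurable]: "polydisc \<in> sets borel" "cpolydisc \<in> sets borel" "torus \<in> sets borel"
 by (auto intro: borel_open borel_closed open_polydisc closed_cpolydisc torus_closed)

lemma torus_subset: "torus \<subseteq> cpolydisc" by (auto simp: torus_def cpolydisc_def)

lemma AE_torus: "AE z in (torus_measure :: (complex^'n) measure). z \<in> torus"
proof -
 have "AE z in mm (-1). norm z = 1" unfolding mm_arc by (rule AE_arc)
 from coord_measure.AE_vm[OF coord_measure_mm this]
 have "AE z in (mu (-1) :: (complex^'n) measure). \<forall>i. norm (z $ i) = 1" by simp
 then show ?thesis unfolding mu_torus by (simp add: torus_def)
qed

lemma AE_mu_cpolydisc: "\<beta> >= -1 ==> AE z in (mu \<beta> :: (complex^'n) measure). z \<in> cpolydisc"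
 using coord_measure.AE_vm[OF coord_measure_mm AE_mm_cball, of \<beta>] by (simp add: cpolydisc_def)

lemma AE_dV_polydisc:
 assumes b: "\<beta> > -1" shows "AE z in (dV \<beta> :: (complex^'n) measure). z \<in> polydisc"
proof -
 have "AE z in mm \<beta>. norm z < 1" unfolding mm_dA[OF b] by (rule AE_dA_ball)
 from coord_measure.AE_vm[OF coord_measure_mm this] b
 have "AE z in (mu \<beta> :: (complex^'n) measure). \<forall>i. norm (z $ i) < 1" by simp
 then show ?thesis unfolding mu_dV[OF b] by (simp add: polydisc_def)
qed

lemma sets_torus_measure [measurable_cong, simp]: "sets (torus_measure :: (complex^'n) measure) = sets borel"
 by (simp add: torus_measure_def)

lemma sets_dV [measurable_cong, simp]: "sets (dV \<beta> :: (complex^'n) measure) = sets borel"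
 by (simp add: dV_def)

text \<open>For \<beta> = -1, Fatou along radii tending to 1 compares the boundary values with the
  supremum of the means; for \<beta> > -1 the boundary has measure zero.\<close>

lemma A2_sq_lower:
 fixes g :: "complex^'n => complex"
 assumes b: "\<beta> >= -1" and g: "continuous_on cpolydisc g"
 shows "(\<integral>\<^sup>+z. nsq (g z) * indicator cpolydisc z \<partial>mu \<beta>) <= A2_sq \<beta> g"
proof (cases "\<beta> = -1")
 case False
 then have b: "\<beta> > -1" using b by simp
 have "(\<integral>\<^sup>+z. nsq (g z) * indicator cpolydisc z \<partial>mu \<beta>) = (\<integral>\<^sup>+z. nsq (g z) * indicator polydisc z \<partial>dV \<beta>)"
  unfolding mu_dV[OF b] using AE_dV_polydisc[OF b] polydisc_subset
  by (intro nn_integral_cong_AE) (auto elim!: eventually_mono split: split_indicator)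
 then show ?thesis using False by (simp add: A2_sq_def bergman_sq_def)
next
 case True
 define r where "r n = 1 - 1 / (real n + 2)" for n :: nat
 have r: "0 < r n" "r n < 1" for n by (auto simp: r_def)
 have rl: "r \<longlonglongrightarrow> 1"
 proof -
  have "(%n. 1 / (real n + 2)) \<longlonglongrightarrow> 0" by real_asymp
  then have "(%n. 1 - 1 / (real n + 2)) \<longlonglongrightarrow> 1 - 0" by (intro tendsto_intros)
  then show ?thesis by (simp add: r_def[abs_def])
 qed
 define F where "F n z = nsq (g (r n *\<^sub>R z)) * indicator torus z" for n z
 have [measurable]: "F n \<in> borel_fun" for n
  unfolding F_def
 proof (rule borel_on_indicator)
  show "continuous_on torus (%z. g (r n *\<^sub>R z))"
   by (rule continuous_on_compose2[OF g]) (use r[of n] scale_polydisc[of _ "r n"] polydisc_subset torus_subset in \<open>auto intro!: continuous_intros simp: subset_iff less_imp_le\<close>)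
 qed simp
 have "(\<integral>\<^sup>+z. nsq (g z) * indicator cpolydisc z \<partial>mu \<beta>) <= (\<integral>\<^sup>+z. liminf (%n. F n z) \<partial>torus_measure)"
  unfolding True mu_torus
 proof (rule nn_integral_mono_AE)
  show "AE z in torus_measure. nsq (g z) * indicator cpolydisc z <= liminf (%n. F n z)"
   using AE_torus
  proof (rule eventually_mono)
   fix z :: "complex^'n" assume z: "z \<in> torus"
   then have zc: "z \<in> cpolydisc" using torus_subset by auto
   have "(%n. g (r n *\<^sub>R z)) \<longlonglongrightarrow> g z"
   proof (rule continuous_on_tendsto_compose[where s=cpolydisc and f=g])
    have "(%n. r n *\<^sub>R z) \<longlonglongrightarrow> 1 *\<^sub>R z" by (intro tendsto_intros rl)
    then show "(%n. r n *\<^sub>R z) \<longlonglongrightarrow> z" by simp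
    show "\<forall>\<^sub>F n in sequentially. r n *\<^sub>R z \<in> cpolydisc"
    proof (intro always_eventually allI)
     fix n show "r n *\<^sub>R z \<in> cpolydisc" using scale_polydisc[OF zc, of "r n"] r[of n] polydisc_subset by (auto simp: less_imp_le)
    qed
   qed (use g zc in auto)
   then have "(%n. F n z) \<longlonglongrightarrow> nsq (g z)"
    using z unfolding F_def by (auto intro!: tendsto_intros)
   then have "liminf (%n. F n z) = nsq (g z)" by (intro lim_imp_Liminf) auto
   then show "nsq (g z) * indicator cpolydisc z <= liminf (%n. F n z)" using zc by simp
  qed
 qed
 also have "... <= liminf (%n. \<integral>\<^sup>+z. F n z \<partial>torus_measure)" by (rule nn_integral_liminf) simp
 also have "... <= liminf (%n::nat. hardy_sq g)"
 proof (rule Liminf_mono, rule always_eventually, intro allI)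
  fix n
  show "(\<integral>\<^sup>+z. F n z \<partial>torus_measure) <= hardy_sq g" unfolding hardy_sq_def F_def
   by (rule SUP_upper2[of "r n"]) (use r[of n] in auto)
 qed
 also have "... = hardy_sq g" by (intro lim_imp_Liminf) auto
 finally show ?thesis using True by (simp add: A2_sq_def)
qed

section \<open>Test functions built from powers of kernels\<close>

definition kern :: "'n set => nat => ('n => complex) => complex^'n => complex" where
 "kern I N w z = (\<Prod>i\<in>I. 1 / (1 - cnj (w i) * z $ i) ^ N)"

lemma kern_holo: assumes "\<And>i. i \<in> I ==> norm (w i) < 1"
 shows "holo_on (kern I N w :: complex^'n => complex) polydisc"
 unfolding kern_def
proof (rule holo_on_prod)
 fix i assume i: "i \<in> I"
 have "(%y. 1 / (1 - cnj (w i) * y) ^ N) holomorphic_on ball 0 1"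
  using one_minus_cnj_nz[OF assms[OF i]] by (intro holomorphic_intros) auto
 then show "holo_on (%z :: complex^'n. 1 / (1 - cnj (w i) * z $ i) ^ N) polydisc" by (rule holo_on_coord)
qed simp

lemma kern_cont: assumes "\<And>i. i \<in> I ==> norm (w i) < 1"
 shows "continuous_on cpolydisc (kern I N w :: complex^'n => complex)"
 unfolding kern_def using one_minus_cnj_nz[OF assms] cpolydisc_component
 by (intro continuous_intros) auto

text \<open>The integrand is a product over the coordinates, so one variable suffices: each i in I
  contributes \<delta>^(\<beta>+2-2N) by \<open>mm_kernel_bound\<close>, every other coordinate a
  constant.\<close>

lemma kern_A2_sq:
 assumes b: "\<beta> >= -1" and N: "2 * real N > \<beta> + 2"
 obtains C where "C > 0" "\<And>(I :: 'n::finite set) w \<delta>. 0 < \<delta> ==> \<delta> <= 1 ==> (\<And>i. i \<in> I ==> norm (w i) = 1 - \<delta>) ==>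
  A2_sq \<beta> (kern I N w) <= ennreal (C * (\<delta> powr (\<beta> + 2 - 2 * real N)) ^ card I)"
proof -
 interpret coord_measure "mm \<beta>" by (rule coord_measure_mm[OF b])
 obtain K where K: "K > 0" "\<And>w. norm w < 1 ==>
   (\<integral>\<^sup>+z\<in>cball 0 1. ennreal (1 / norm (1 - cnj w * z) ^ (2*N)) \<partial>mm \<beta>) <= ennreal (K * (1 - norm w) powr (\<beta> + 2 - 2 * real N))"
  by (rule mm_kernel_bound[OF b N], rule that, assumption, blast)
 obtain M where M: "emeasure (mm \<beta>) UNIV = ennreal M" "M >= 0"
  using finite_mm[OF b] by (metis ennreal_cases infinity_ennreal_def less_irrefl)
 define C where "C = (K + M + 1) ^ CARD('n)"
 have C: "C > 0" using K M by (simp add: C_def)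
 show ?thesis
 proof (rule that[OF C])
  fix I :: "'n set" and w :: "'n => complex" and \<delta> :: real
  assume d: "0 < \<delta>" "\<delta> <= 1" and w: "\<And>i. i \<in> I ==> norm (w i) = 1 - \<delta>"
  define p where "p = \<delta> powr (\<beta> + 2 - 2 * real N)"
  have p: "p > 0" using d by (simp add: p_def)
  \<comment> \<open>The dilation r replaces w by r w, which only moves the poles away from the disc;
    r = 1 gives the Bergman norm and r < 1 the means in the Hardy norm.\<close>
  have main: "(\<integral>\<^sup>+z. nsq (kern I N w (r *\<^sub>R z)) * indicator cpolydisc z \<partial>mu \<beta>) <= ennreal (C * p ^ card I)"
   if r: "0 < r" "r <= 1" for r :: real
  proof -
   define f where "f i y = (if i \<in> I then ennreal (1 / norm (1 - cnj (of_real r * w i) * y) ^ (2*N)) * indicator (cball 0 1) y else 1)" for i y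
   have [measurable]: "cnj \<in> borel_fun" by (intro borel_measurable_continuous_onI continuous_intros)
   have [measurable]: "f i \<in> borel_fun" for i
   proof (cases "i \<in> I")
    case True
    have [measurable]: "cball (0::complex) 1 \<in> sets borel" by simp
    show ?thesis unfolding f_def using True by simp
   qed (simp add: f_def[abs_def])
   have "(\<integral>\<^sup>+z. nsq (kern I N w (r *\<^sub>R z)) * indicator cpolydisc z \<partial>mu \<beta>) <= (\<integral>\<^sup>+z. (\<Prod>i\<in>UNIV. f i (z $ i)) \<partial>mu \<beta>)"
   proof (intro nn_integral_mono)
    fix z :: "complex^'n"
    show "nsq (kern I N w (r *\<^sub>R z)) * indicator cpolydisc z <= (\<Prod>i\<in>UNIV. f i (z $ i))"
    proof (cases "z \<in> cpolydisc")
     case True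
     have "(\<Prod>i\<in>UNIV. f i (z $ i)) = (\<Prod>i\<in>I. f i (z $ i))" by (intro prod.mono_neutral_right) (auto simp: f_def)
     also have "... = (\<Prod>i\<in>I. ennreal (1 / norm (1 - cnj (of_real r * w i) * z $ i) ^ (2*N)))"
      using cpolydisc_component[OF True] by (intro prod.cong) (auto simp: f_def)
     also have "... = ennreal (\<Prod>i\<in>I. 1 / norm (1 - cnj (of_real r * w i) * z $ i) ^ (2*N))"
      by (intro prod_ennreal) auto
     also have "(\<Prod>i\<in>I. 1 / norm (1 - cnj (of_real r * w i) * z $ i) ^ (2*N)) = (norm (kern I N w (r *\<^sub>R z)))^2"
      unfolding kern_def prod_norm[symmetric] prod_power_distrib
      by (intro prod.cong) (auto simp: norm_divide norm_power power_divide power_mult[symmetric] mult.commute scaleR_conv_of_real[where 'a=complex] mult.left_commute mult.assoc)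
     finally show ?thesis using True by simp
    qed simp
   qed
   also have "... = (\<Prod>i\<in>UNIV. \<integral>\<^sup>+y. f i y \<partial>mm \<beta>)" by (rule nn_integral_vm_prod) simp
   also have "... <= (\<Prod>i\<in>UNIV. ennreal ((K + M + 1) * (if i \<in> I then p else 1)))"
   proof (rule ennreal_prod_mono)
    fix i
    show "(\<integral>\<^sup>+y. f i y \<partial>mm \<beta>) <= ennreal ((K + M + 1) * (if i \<in> I then p else 1))"
    proof (cases "i \<in> I")
     case True
     have nw: "norm (of_real r * w i) = r * (1 - \<delta>)" using w[OF True] r by (simp add: norm_mult)
     have "r * (1 - \<delta>) <= 1 * (1 - \<delta>)" using r d by (intro mult_right_mono) auto
     then have le: "\<delta> <= 1 - norm (of_real r * w i)" using nw by simp
     have "(\<integral>\<^sup>+y. f i y \<partial>mm \<beta>) <= ennreal (K * (1 - norm (of_real r * w i)) powr (\<beta> + 2 - 2 * real N))"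
      using True K(2)[of "of_real r * w i"] le d by (simp add: f_def)
     also have "... <= ennreal ((K + M + 1) * p)"
      unfolding p_def using le d N K M by (intro ennreal_leI mult_mono powr_mono2') auto
     finally show ?thesis using True by simp
    next
     case False
     then show ?thesis using M K by (simp add: f_def ennreal_leI del: ennreal_plus)
    qed
   qed
   also have "... = ennreal (\<Prod>i\<in>(UNIV::'n set). (K + M + 1) * (if i \<in> I then p else 1))" using K M p by (intro prod_ennreal) auto
   also have "(\<Prod>i\<in>(UNIV::'n set). (K + M + 1) * (if i \<in> I then p else 1)) = C * p ^ card I"
    by (simp add: prod.distrib C_def prod.If_cases)
   finally show ?thesis .
  qed
  show "A2_sq \<beta> (kern I N w) <= ennreal (C * (\<delta> powr (\<beta> + 2 - 2 * real N)) ^ card I)"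
  proof (cases "\<beta> = -1")
   case False
   then have b: "\<beta> > -1" using b by simp
   have "A2_sq \<beta> (kern I N w) = (\<integral>\<^sup>+z. nsq (kern I N w (1 *\<^sub>R z)) * indicator polydisc z \<partial>mu \<beta>)"
    using False by (simp add: A2_sq_def bergman_sq_def mu_dV[OF b])
   also have "... <= (\<integral>\<^sup>+z. nsq (kern I N w (1 *\<^sub>R z)) * indicator cpolydisc z \<partial>mu \<beta>)"
    using polydisc_subset by (intro nn_integral_mono) (auto split: split_indicator)
   also have "... <= ennreal (C * p ^ card I)" by (rule main) auto
   finally show ?thesis by (simp add: p_def)
  next
   case True
   have "hardy_sq (kern I N w) <= ennreal (C * p ^ card I)"
    unfolding hardy_sq_def
   proof (rule SUP_least)
    fix r :: real assume r: "r \<in> {0<..<1}"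
    have "(\<integral>\<^sup>+\<zeta>\<in>torus. nsq (kern I N w (r *\<^sub>R \<zeta>)) \<partial>torus_measure) <= (\<integral>\<^sup>+z. nsq (kern I N w (r *\<^sub>R z)) * indicator cpolydisc z \<partial>mu \<beta>)"
     unfolding True mu_torus using torus_subset by (intro nn_integral_mono) (auto split: split_indicator)
    also have "... <= ennreal (C * p ^ card I)" using r by (intro main) auto
    finally show "(\<integral>\<^sup>+\<zeta>\<in>torus. nsq (kern I N w (r *\<^sub>R \<zeta>)) \<partial>torus_measure) <= ennreal (C * p ^ card I)" .
   qed
   then show ?thesis using True by (simp add: A2_sq_def p_def)
  qed
 qed
qed

lemma composition_bounded_sq:
 fixes \<phi> :: "complex^'n => complex^'n"
 assumes "composition_bounded \<beta> \<phi>"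
 obtains C where "C >= 0" "\<And>f :: complex^'n => complex. f \<in> A2 \<beta> ==> A2_sq \<beta> (f \<circ> \<phi>) <= ennreal C * A2_sq \<beta> f"
proof -
 obtain C0 where C0: "\<And>f :: complex^'n => complex. f \<in> A2 \<beta> ==> f \<circ> \<phi> \<in> A2 \<beta> \<and> A2_norm \<beta> (f \<circ> \<phi>) <= C0 * A2_norm \<beta> f"
  using assms unfolding composition_bounded_def by blast
 define C where "C = \<bar>C0\<bar>"
 show ?thesis
 proof (rule that[of "C\<^sup>2"])
  fix f :: "complex^'n => complex" assume f: "f \<in> A2 \<beta>"
  obtain a where a: "a >= 0" "A2_sq \<beta> f = ennreal a" using f unfolding A2_def
   by (metis (mono_tags, lifting) ennreal_cases infinity_ennreal_def less_irrefl mem_Collect_eq)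
  obtain b where b: "b >= 0" "A2_sq \<beta> (f \<circ> \<phi>) = ennreal b" using C0[OF f] unfolding A2_def
   by (metis (mono_tags, lifting) ennreal_cases infinity_ennreal_def less_irrefl mem_Collect_eq)
  have "sqrt b <= C0 * sqrt a" using C0[OF f] a b by (simp add: A2_norm_def)
  also have "... <= C * sqrt a" using a by (intro mult_right_mono) (auto simp: C_def)
  finally have "(sqrt b)^2 <= (C * sqrt a)^2" using b by (intro power_mono) auto
  then have "b <= C\<^sup>2 * a" using a b by (simp add: power_mult_distrib)
  then show "A2_sq \<beta> (f \<circ> \<phi>) <= ennreal (C\<^sup>2) * A2_sq \<beta> f" using a b by (simp add: ennreal_mult[symmetric] ennreal_leI)
 qed simp
qed

section \<open>Preimages of small boundary boxes\<close>

context smooth_selfmap begin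

text \<open>The test function is \<open>kern\<close> at w_i = (1 - \<delta>) \<eta>_i. On E each 1 -
  cnj w_i \<phi>_i is at most (1 + C0) \<delta> in modulus, so the squared modulus of the
  composition is at least of order \<delta>^(-2N card I) there, against a squared norm of order
  \<delta>^((\<beta>+2-2N) card I). In the quotient N cancels.\<close>

lemma necessary_measure:
 assumes b: "\<beta> >= -1" and cb: "composition_bounded \<beta> \<phi>" and eta: "\<And>i. i \<in> I ==> norm (\<eta> i) = 1" and C0: "C0 >= 0"
 shows "\<exists>K>0. \<forall>\<delta> E. 0 < \<delta> --> \<delta> < 1 --> E \<in> sets borel --> E \<subseteq> cpolydisc --> (\<forall>z\<in>E. \<forall>i\<in>I. norm (\<phi> z $ i - \<eta> i) <= C0 * \<delta>) -->
   emeasure (mu \<beta>) E <= ennreal (K * (\<delta> powr (\<beta> + 2)) ^ card I)"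
proof -
 interpret coord_measure "mm \<beta>" by (rule coord_measure_mm[OF b])
 obtain N :: nat where "\<beta> + 2 < real N" using reals_Archimedean2 by blast
 then have N: "2 * real N > \<beta> + 2" by simp
 obtain C1 where C1: "C1 > 0" "\<And>(I :: 'n set) w \<delta>. 0 < \<delta> ==> \<delta> <= 1 ==> (\<And>i. i \<in> I ==> norm (w i) = 1 - \<delta>) ==>
  A2_sq \<beta> (kern I N w) <= ennreal (C1 * (\<delta> powr (\<beta> + 2 - 2 * real N)) ^ card I)"
  by (rule kern_A2_sq[OF b N], rule that, assumption, blast)
 obtain C where C: "C >= 0" "\<And>f. f \<in> A2 \<beta> ==> A2_sq \<beta> (f \<circ> \<phi>) <= ennreal C * A2_sq \<beta> f"
  by (rule composition_bounded_sq[OF cb], rule that, assumption, blast)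
 define D where "D = (1 + C0) ^ (2 * N)"
 have D: "D > 0" using C0 by (simp add: D_def)
 define K where "K = C * C1 * D ^ card I + 1"
 show ?thesis
 proof (intro exI[of _ K] conjI allI impI)
  show "K > 0" using C C1 D by (simp add: K_def add_nonneg_pos)
  fix \<delta> :: real and E :: "(complex^'n) set"
  assume d: "0 < \<delta>" "\<delta> < 1" and E: "E \<in> sets borel" "E \<subseteq> cpolydisc" and near: "\<forall>z\<in>E. \<forall>i\<in>I. norm (\<phi> z $ i - \<eta> i) <= C0 * \<delta>"
  define w where "w i = of_real (1 - \<delta>) * \<eta> i" for i
  have w: "norm (w i) = 1 - \<delta>" if "i \<in> I" for i using eta[OF that] d by (simp add: w_def norm_mult del: of_real_diff)
  have w1: "norm (w i) < 1" if "i \<in> I" for i using w[OF that] d by simp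
  define f where "f = (kern I N w :: complex^'n => complex)"
  have fA: "A2_sq \<beta> f <= ennreal (C1 * (\<delta> powr (\<beta> + 2 - 2 * real N)) ^ card I)" unfolding f_def using d w by (intro C1) auto
  have "A2_sq \<beta> f < \<infinity>" using fA by (rule le_less_trans) simp
  then have f: "f \<in> A2 \<beta>" using kern_holo[of I w N] w1 by (simp add: A2_def f_def)
  have cont': "continuous_on cpolydisc (f \<circ> \<phi>)"
   unfolding o_def by (rule continuous_on_compose2[OF _ cont]) (use kern_cont[of I w N] w1 map_cpolydisc in \<open>auto simp: f_def\<close>)
  define q where "q = (1 / (D * \<delta> ^ (2 * N))) ^ card I"
  have q: "q > 0" using D d by (simp add: q_def)
  have low: "q <= (norm ((f \<circ> \<phi>) z))^2" if z: "z \<in> E" for z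
  proof -
   have zc: "\<phi> z \<in> cpolydisc" using map_cpolydisc z E by auto
   have i1: "1 / (D * \<delta> ^ (2 * N)) <= (norm (1 / (1 - cnj (w i) * \<phi> z $ i) ^ N))^2" if i: "i \<in> I" for i
   proof -
    have ee: "cnj (\<eta> i) * \<eta> i = 1" using eta[OF i] by (simp add: complex_norm_square[symmetric] mult.commute)
    have "1 - cnj (w i) * \<phi> z $ i = of_real \<delta> * 1 - of_real (1 - \<delta>) * (cnj (\<eta> i) * (\<phi> z $ i - \<eta> i))"
     using ee by (simp add: w_def algebra_simps)
    then have "norm (1 - cnj (w i) * \<phi> z $ i) <= norm (of_real \<delta> * 1 :: complex) + norm (of_real (1 - \<delta>) * (cnj (\<eta> i) * (\<phi> z $ i - \<eta> i)))"
     by (simp only: norm_triangle_ineq4)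
    also have "... = \<delta> + (1 - \<delta>) * norm (\<phi> z $ i - \<eta> i)" using d eta[OF i] by (simp add: norm_mult del: of_real_diff)
    also have "... <= \<delta> + 1 * (C0 * \<delta>)" using near z i d by (intro add_left_mono mult_mono) auto
    finally have le: "norm (1 - cnj (w i) * \<phi> z $ i) <= (1 + C0) * \<delta>" by (simp add: algebra_simps)
    have pos: "norm (1 - cnj (w i) * \<phi> z $ i) > 0" using one_minus_cnj_nz[OF w1[OF i] cpolydisc_component[OF zc]] by simp
    have "1 / ((1 + C0) * \<delta>) ^ (2 * N) <= 1 / norm (1 - cnj (w i) * \<phi> z $ i) ^ (2 * N)"
     using le pos C0 d by (intro divide_left_mono power_mono mult_pos_pos zero_less_power) auto
    then show ?thesis by (simp add: D_def power_mult_distrib norm_divide norm_power power_divide power_mult[symmetric] mult.commute)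
   qed
   have "q = (\<Prod>i\<in>I. 1 / (D * \<delta> ^ (2 * N)))" by (simp add: q_def)
   also have "... <= (\<Prod>i\<in>I. (norm (1 / (1 - cnj (w i) * \<phi> z $ i) ^ N))^2)" using i1 D d by (intro prod_mono) auto
   also have "... = (norm ((f \<circ> \<phi>) z))^2" by (simp add: f_def kern_def prod_norm[symmetric] prod_power_distrib)
   finally show ?thesis .
  qed
  have "ennreal q * emeasure (mu \<beta>) E = (\<integral>\<^sup>+z. ennreal q * indicator E z \<partial>mu \<beta>)" using E by (simp add: nn_integral_cmult_indicator)
  also have "... <= (\<integral>\<^sup>+z. nsq ((f \<circ> \<phi>) z) * indicator cpolydisc z \<partial>mu \<beta>)"
   using low E by (intro nn_integral_mono) (auto split: split_indicator intro!: ennreal_leI)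
  also have "... <= A2_sq \<beta> (f \<circ> \<phi>)" by (rule A2_sq_lower[OF b cont'])
  also have "... <= ennreal C * A2_sq \<beta> f" by (rule C(2)[OF f])
  also have "... <= ennreal C * ennreal (C1 * (\<delta> powr (\<beta> + 2 - 2 * real N)) ^ card I)" by (intro mult_left_mono fA) auto
  finally have 1: "ennreal q * emeasure (mu \<beta>) E <= ennreal (C * (C1 * (\<delta> powr (\<beta> + 2 - 2 * real N)) ^ card I))" using C C1 by (simp add: ennreal_mult)
  have "emeasure (mu \<beta>) E = ennreal (1/q) * (ennreal q * emeasure (mu \<beta>) E)"
   using q by (simp add: mult.assoc[symmetric] ennreal_mult[symmetric])
  also have "... <= ennreal (1/q) * ennreal (C * (C1 * (\<delta> powr (\<beta> + 2 - 2 * real N)) ^ card I))" by (intro mult_left_mono 1) auto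
  also have "... = ennreal (1/q * (C * (C1 * (\<delta> powr (\<beta> + 2 - 2 * real N)) ^ card I)))" using q C C1 by (simp add: ennreal_mult[symmetric])
  also have "1/q * (C * (C1 * (\<delta> powr (\<beta> + 2 - 2 * real N)) ^ card I)) = C * C1 * D ^ card I * (\<delta> powr (\<beta> + 2)) ^ card I"
  proof -
   have "\<delta> ^ (2*N) * \<delta> powr (\<beta> + 2 - 2 * real N) = \<delta> powr (\<beta> + 2)"
    using d powr_realpow[of \<delta> "2*N"] by (simp add: powr_add[symmetric] del: powr_realpow) (simp add: powr_realpow[symmetric] powr_add[symmetric])
   then have "1/q * (\<delta> powr (\<beta> + 2 - 2 * real N)) ^ card I = D ^ card I * (\<delta> powr (\<beta> + 2)) ^ card I"
    by (simp add: q_def power_divide power_mult_distrib[symmetric] mult.assoc)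
   then show ?thesis by (simp add: mult_ac)
  qed
  also have "ennreal (C * C1 * D ^ card I * (\<delta> powr (\<beta> + 2)) ^ card I) <= ennreal (K * (\<delta> powr (\<beta> + 2)) ^ card I)"
   by (intro ennreal_leI mult_right_mono) (auto simp: K_def)
  finally show "emeasure (mu \<beta>) E <= ennreal (K * (\<delta> powr (\<beta> + 2)) ^ card I)" .
 qed
qed

lemma box_measure_lower:
 assumes b: "\<beta> >= -1"
 obtains c where "c > 0" "\<And>(J :: 'n set) \<zeta> \<delta>. (\<And>k. k \<in> J ==> norm (\<zeta> k) = 1) ==> 0 < \<delta> ==> \<delta> <= 1 ==>
   ennreal (c * (\<delta> powr (\<beta>+2)) ^ card J) <= emeasure (mu \<beta>) {z :: complex^'n. z \<in> cpolydisc \<and> (\<forall>k\<in>J. norm (z $ k - \<zeta> k) < \<delta>)}"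
proof -
 interpret coord_measure "mm \<beta>" by (rule coord_measure_mm[OF b])
 obtain c0 where c0: "c0 > 0" "\<And>\<xi> \<delta>. norm \<xi> = 1 ==> 0 < \<delta> ==> \<delta> <= 1 ==> ennreal (c0 * \<delta> powr (\<beta>+2)) <= emeasure (mm \<beta>) (ball \<xi> \<delta>)"
  by (rule mm_ball_lower[OF b], rule that, assumption, blast)
 define c where "c = (min c0 1) ^ CARD('n)"
 have c: "c > 0" using c0 by (simp add: c_def)
 show ?thesis
 proof (rule that[OF c])
  fix J :: "'n set" and \<zeta> :: "'n => complex" and \<delta> :: real
  assume z: "\<And>k. k \<in> J ==> norm (\<zeta> k) = 1" and d: "0 < \<delta>" "\<delta> <= 1"
  define p where "p = \<delta> powr (\<beta>+2)"
  have p: "p > 0" using d by (simp add: p_def)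
  define A where "A k = (if k \<in> J then ball (\<zeta> k) \<delta> else UNIV)" for k
  have [measurable]: "A k \<in> sets borel" for k by (simp add: A_def)
  have lo: "ennreal (min c0 1 * (if k \<in> J then p else 1)) <= emeasure (mm \<beta>) (A k)" for k
  proof (cases "k \<in> J")
   case True
   have "ennreal (min c0 1 * p) <= ennreal (c0 * p)" using p by (intro ennreal_leI mult_right_mono) auto
   also have "... <= emeasure (mm \<beta>) (A k)" using c0(2)[OF z[OF True] d] True by (simp add: A_def p_def)
   finally show ?thesis using True by simp
  next
   case False
   have "ennreal (min c0 1) <= ennreal (c0 * 1 powr (\<beta>+2))" by (intro ennreal_leI) simp
   also have "... <= emeasure (mm \<beta>) (ball 1 1)" by (rule c0(2)) auto
   also have "... <= emeasure (mm \<beta>) UNIV" by (intro emeasure_mono) auto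
   finally show ?thesis using False by (simp add: A_def)
  qed
  have "ennreal (c * p ^ card J) = ennreal (\<Prod>k\<in>(UNIV::'n set). min c0 1 * (if k \<in> J then p else 1))"
   by (simp add: prod.distrib c_def prod.If_cases)
  also have "... = (\<Prod>k\<in>(UNIV::'n set). ennreal (min c0 1 * (if k \<in> J then p else 1)))" using c0 p by (intro prod_ennreal[symmetric]) auto
  also have "... <= (\<Prod>k\<in>(UNIV::'n set). emeasure (mm \<beta>) (A k))" by (intro ennreal_prod_mono lo)
  also have "... = emeasure (mu \<beta>) {z :: complex^'n. \<forall>k. z $ k \<in> A k}" by (rule emeasure_vm_box[symmetric]) simp
  also have "... <= emeasure (mu \<beta>) {z :: complex^'n. z \<in> cpolydisc \<and> (\<forall>k\<in>J. norm (z $ k - \<zeta> k) < \<delta>)}"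
  proof (rule emeasure_mono_AE)
   show "AE z in mu \<beta>. z \<in> {z :: complex^'n. \<forall>k. z $ k \<in> A k} --> z \<in> {z. z \<in> cpolydisc \<and> (\<forall>k\<in>J. norm (z $ k - \<zeta> k) < \<delta>)}"
    using AE_mu_cpolydisc[OF b]
   proof (rule eventually_mono, intro impI CollectI conjI ballI)
    fix z :: "complex^'n" and k assume "z \<in> {z. \<forall>k. z $ k \<in> A k}" "k \<in> J"
    then show "norm (z $ k - \<zeta> k) < \<delta>" by (auto simp: A_def dist_norm norm_minus_commute dest!: spec[of _ k])
   qed
   show "{z :: complex^'n. z \<in> cpolydisc \<and> (\<forall>k\<in>J. norm (z $ k - \<zeta> k) < \<delta>)} \<in> sets (mu \<beta>)" by measurable
  qed
  finally show "ennreal (c * (\<delta> powr (\<beta>+2)) ^ card J) <= emeasure (mu \<beta>) {z :: complex^'n. z \<in> cpolydisc \<and> (\<forall>k\<in>J. norm (z $ k - \<zeta> k) < \<delta>)}"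
   by (simp add: p_def)
 qed
qed

text \<open>Moving the boundary coordinates of a point by angles proportional to a kernel vector of the normalized Jacobian changes the components of \<open>\<phi>\<close> only to second order.\<close>

lemma box_estimate:
 fixes \<xi> :: "complex^'n" and v :: "'n => real" and M :: nat
 assumes xi: "\<xi> \<in> cpolydisc" and I: "\<And>i. i \<in> I ==> norm (\<phi> \<xi> $ i) = 1" and J: "J = {k. norm (\<xi> $ k) = 1}"
  and v: "\<And>i. i \<in> I ==> (\<Sum>k\<in>UNIV. jac \<phi> \<xi> i k * (\<xi> $ k * of_real (v k))) = 0"
  and v1: "\<And>k. \<bar>v k\<bar> <= V"
 defines "C0 \<equiv> real CARD('n) + (\<Sum>i\<in>UNIV. \<Sum>k\<in>UNIV. 2 * norm (jac \<phi> \<xi> i k))"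
 shows "\<exists>d0>0. \<forall>\<delta> l x. 0 < \<delta> --> \<delta> < d0 --> l <= M --> x \<in> cpolydisc -->
  (\<forall>k\<in>J. norm (x $ k - \<xi> $ k * cis (real l * \<delta> * v k)) < \<delta>) --> (\<forall>i\<in>I. norm (\<phi> x $ i - \<phi> \<xi> $ i) <= C0 * \<delta>)"
proof -
 define R where "R = 1 + real M * (\<bar>V\<bar> + 1)"
 have R: "R >= 1" by (simp add: R_def)
 define n where "n = real CARD('n)"
 have n: "n >= 1" by (simp add: n_def Suc_leI)
 have "1 / R > 0" using R by simp
 from strict_diff[OF this] obtain r where r: "r > 0" "\<And>i x y \<xi>. \<xi> \<in> cpolydisc ==> x \<in> cpolydisc ==> y \<in> cpolydisc ==> dist x \<xi> < r ==> dist y \<xi> < r ==>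
   norm (\<phi> x $ i - \<phi> y $ i - (\<Sum>k\<in>UNIV. jac \<phi> \<xi> i k * (x $ k - y $ k))) <= 1 / R * norm (x - y)"
  by blast
 \<comment> \<open>The first bound keeps x within the radius of strict differentiability around
   \<open>y\<close>; the second makes the squared angles at most \<delta>.\<close>
 define d0 where "d0 = min (r / (n * R)) (1 / (R * R))"
 have d0: "d0 > 0" using r R n by (auto simp: d0_def)
 show ?thesis
 proof (intro exI[of _ d0] conjI d0 allI impI ballI)
  fix \<delta> :: real and l x i
  assume d: "0 < \<delta>" "\<delta> < d0" and l: "l <= M" and x: "x \<in> cpolydisc"
   and near: "\<forall>k\<in>J. norm (x $ k - \<xi> $ k * cis (real l * \<delta> * v k)) < \<delta>" and i: "i \<in> I"
  define \<theta> where "\<theta> k = real l * \<delta> * v k" for k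
  have th: "\<bar>\<theta> k\<bar> <= (R - 1) * \<delta>" for k
  proof -
   have "\<bar>\<theta> k\<bar> = real l * \<bar>v k\<bar> * \<delta>" using d by (simp add: \<theta>_def abs_mult)
   also have "... <= real M * (\<bar>V\<bar> + 1) * \<delta>" using l d v1[of k] by (intro mult_right_mono mult_mono) auto
   finally show ?thesis by (simp add: R_def)
  qed
  have RRd: "R * R * \<delta> <= 1"
  proof -
   have "\<delta> <= 1 / (R * R)" using d by (simp add: d0_def)
   then show ?thesis using R by (simp add: field_simps)
  qed
  have th2: "(\<theta> k)^2 <= \<delta>" for k
  proof -
   have "(\<theta> k)^2 <= ((R - 1) * \<delta>)^2" using th[of k] by (metis abs_ge_zero power2_abs power_mono)
   also have "... <= (R * \<delta>)^2" using R d by (intro power_mono mult_right_mono) auto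
   also have "... = (R * R * \<delta>) * \<delta>" by (simp add: power2_eq_square)
   also have "... <= 1 * \<delta>" using RRd d by (intro mult_right_mono) auto
   finally show ?thesis by simp
  qed
  \<comment> \<open>y agrees with \<xi> on the boundary coordinates and with x elsewhere. By
    rigidity \<phi>_i and its Jacobian row are the same at y as at \<xi>, and y is close to x
    although x is unrestricted outside J.\<close>
  define y :: "complex^'n" where "y = (\<chi> k. if k \<in> J then \<xi> $ k else x $ k)"
  have y: "y \<in> cpolydisc" using cpolydisc_component[OF x] cpolydisc_component[OF xi] by (auto simp: y_def cpolydisc_def)
  have N: "jac \<phi> \<xi> i k = 0" if "k \<notin> J" for k
   using jac_interior_zero[OF xi I[OF i], of k] that cpolydisc_component[OF xi, of k] by (auto simp: J)
  have yJ: "\<And>k. k \<in> J ==> y $ k = \<xi> $ k" by (simp add: y_def)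
  have phi_y: "\<phi> y $ i = \<phi> \<xi> $ i" by (rule rigidity[OF xi I[OF i] N y yJ])
  have jac_y: "jac \<phi> y i k = jac \<phi> \<xi> i k" for k by (rule jac_rigidity[OF xi I[OF i] N y yJ])
  have xy: "norm (x $ k - y $ k) <= R * \<delta>" for k
  proof (cases "k \<in> J")
   case True
   have "norm (\<xi> $ k * cis (\<theta> k) - \<xi> $ k) = norm (\<xi> $ k) * norm (cis (\<theta> k) - cis 0)"
    by (simp add: norm_mult[symmetric] algebra_simps)
   also have "... <= (R - 1) * \<delta>" using True norm_cis_diff_le[of "\<theta> k" 0] th[of k] by (simp add: J)
   finally have "norm (\<xi> $ k * cis (\<theta> k) - \<xi> $ k) <= (R - 1) * \<delta>" .
   moreover have "norm (x $ k - \<xi> $ k * cis (\<theta> k)) < \<delta>" using near True by (simp add: \<theta>_def)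
   moreover have "norm (x $ k - y $ k) <= norm (x $ k - \<xi> $ k * cis (\<theta> k)) + norm (\<xi> $ k * cis (\<theta> k) - \<xi> $ k)"
    using norm_triangle_ineq[of "x $ k - \<xi> $ k * cis (\<theta> k)" "\<xi> $ k * cis (\<theta> k) - \<xi> $ k"] True by (simp add: y_def)
   ultimately show ?thesis by (simp add: algebra_simps)
  next
   case False
   then show ?thesis using R d by (simp add: y_def)
  qed
  have nxy: "norm (x - y) <= n * (R * \<delta>)"
  proof -
   have "norm (x - y) <= (\<Sum>k\<in>UNIV. norm ((x - y) $ k))" by (rule norm_le_sum_vec)
   also have "... <= (\<Sum>k\<in>(UNIV::'n set). R * \<delta>)" using xy by (intro sum_mono) simp
   finally show ?thesis by (simp add: n_def)
  qed
  also have "n * (R * \<delta>) < r"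
  proof -
   have "\<delta> < r / (n * R)" using d by (simp add: d0_def)
   then show ?thesis using n R by (simp add: field_simps)
  qed
  finally have nr: "norm (x - y) < r" .
  have 1: "norm (\<phi> x $ i - \<phi> y $ i - (\<Sum>k\<in>UNIV. jac \<phi> y i k * (x $ k - y $ k))) <= n * \<delta>"
  proof -
   have "norm (\<phi> x $ i - \<phi> y $ i - (\<Sum>k\<in>UNIV. jac \<phi> y i k * (x $ k - y $ k))) <= 1 / R * norm (x - y)"
    using y x r(1) nr by (intro r(2)) (auto simp: dist_norm)
   also have "... <= 1 / R * (n * (R * \<delta>))" using nxy R by (intro mult_left_mono) auto
   also have "... = n * \<delta>" using R by simp
   finally show ?thesis .
  qed
  have decomp: "norm (jac \<phi> \<xi> i k * (x $ k - y $ k) - \<i> * of_real (real l * \<delta>) * (jac \<phi> \<xi> i k * (\<xi> $ k * of_real (v k)))) <= 2 * norm (jac \<phi> \<xi> i k) * \<delta>" for k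
  proof (cases "k \<in> J")
   case True
   have cis2: "norm (cis t - 1 - \<i> * of_real t) <= t\<^sup>2" for t
   proof -
    have "norm (exp (\<i> * of_real t) - (\<Sum>k\<le>1. (\<i> * of_real t) ^ k / fact k)) <= exp \<bar>Re (\<i> * of_real t)\<bar> * norm (\<i> * of_real t) ^ (Suc 1) / fact 1"
     by (rule Taylor_exp)
    then show ?thesis by (simp add: cis_conv_exp norm_mult power2_eq_square algebra_simps)
   qed
   have nk: "norm (\<xi> $ k) = 1" using True by (simp add: J)
   have "x $ k - y $ k - \<i> * of_real (\<theta> k) * \<xi> $ k = (x $ k - \<xi> $ k * cis (\<theta> k)) + \<xi> $ k * (cis (\<theta> k) - 1 - \<i> * of_real (\<theta> k))"
    using True by (simp add: y_def algebra_simps)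
   then have "norm (x $ k - y $ k - \<i> * of_real (\<theta> k) * \<xi> $ k) <= norm (x $ k - \<xi> $ k * cis (\<theta> k)) + norm (\<xi> $ k * (cis (\<theta> k) - 1 - \<i> * of_real (\<theta> k)))"
    by (simp only: norm_triangle_ineq)
   also have "... <= \<delta> + \<delta>"
   proof (rule add_mono)
    show "norm (x $ k - \<xi> $ k * cis (\<theta> k)) <= \<delta>" using near True by (simp add: \<theta>_def less_imp_le)
    show "norm (\<xi> $ k * (cis (\<theta> k) - 1 - \<i> * of_real (\<theta> k))) <= \<delta>"
     unfolding norm_mult nk using cis2[of "\<theta> k"] th2[of k] by simp
   qed
   finally have le: "norm (x $ k - y $ k - \<i> * of_real (\<theta> k) * \<xi> $ k) <= 2 * \<delta>" by simp
   have "jac \<phi> \<xi> i k * (x $ k - y $ k) - \<i> * of_real (real l * \<delta>) * (jac \<phi> \<xi> i k * (\<xi> $ k * of_real (v k)))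
    = jac \<phi> \<xi> i k * (x $ k - y $ k - \<i> * of_real (\<theta> k) * \<xi> $ k)"
    by (simp add: \<theta>_def algebra_simps)
   then show ?thesis using mult_left_mono[OF le norm_ge_zero[of "jac \<phi> \<xi> i k"]] by (simp add: norm_mult mult_ac)
  qed (simp add: N)
  have "norm (\<Sum>k\<in>UNIV. jac \<phi> \<xi> i k * (x $ k - y $ k)) <= (\<Sum>k\<in>UNIV. 2 * norm (jac \<phi> \<xi> i k) * \<delta>)"
  proof -
   have "(\<Sum>k\<in>UNIV. jac \<phi> \<xi> i k * (x $ k - y $ k)) = (\<Sum>k\<in>UNIV. jac \<phi> \<xi> i k * (x $ k - y $ k) - \<i> * of_real (real l * \<delta>) * (jac \<phi> \<xi> i k * (\<xi> $ k * of_real (v k))))"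
    unfolding sum_subtractf sum_distrib_left[symmetric] v[OF i] by simp
   then show ?thesis using decomp by (simp add: sum_norm_le)
  qed
  also have "... = (\<Sum>k\<in>UNIV. 2 * norm (jac \<phi> \<xi> i k)) * \<delta>" by (simp add: sum_distrib_right)
  also have "... <= (\<Sum>i\<in>UNIV. \<Sum>k\<in>UNIV. 2 * norm (jac \<phi> \<xi> i k)) * \<delta>"
   using d by (intro mult_right_mono member_le_sum[of i UNIV "%i. \<Sum>k\<in>UNIV. 2 * norm (jac \<phi> \<xi> i k)"]) (auto intro!: sum_nonneg)
  finally have 2: "norm (\<Sum>k\<in>UNIV. jac \<phi> \<xi> i k * (x $ k - y $ k)) <= (\<Sum>i\<in>UNIV. \<Sum>k\<in>UNIV. 2 * norm (jac \<phi> \<xi> i k)) * \<delta>" .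
  have "norm (\<phi> x $ i - \<phi> \<xi> $ i) <= norm (\<phi> x $ i - \<phi> y $ i - (\<Sum>k\<in>UNIV. jac \<phi> y i k * (x $ k - y $ k))) + norm (\<Sum>k\<in>UNIV. jac \<phi> y i k * (x $ k - y $ k))"
   using norm_triangle_ineq[of "\<phi> x $ i - \<phi> y $ i - (\<Sum>k\<in>UNIV. jac \<phi> y i k * (x $ k - y $ k))" "\<Sum>k\<in>UNIV. jac \<phi> y i k * (x $ k - y $ k)"] phi_y by simp
  also have "... <= C0 * \<delta>" using 1 2 unfolding jac_y C0_def n_def by (simp add: algebra_simps)
  finally show "norm (\<phi> x $ i - \<phi> \<xi> $ i) <= C0 * \<delta>" .
 qed
qed

text \<open>The M boxes obtained by turning the boundary coordinates through multiples of \<delta> u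
  are disjoint, all are sent within C0 \<delta> of \<phi> \<xi> in the components I, and each has
  mass at least c \<delta>^((\<beta>+2) card J). As card J \<le> card I, their union is too large
  once M > K/c.\<close>

lemma necessary_kernel:
 fixes \<xi> :: "complex^'n" and v :: "'n => real"
 assumes b: "\<beta> >= -1" and cb: "composition_bounded \<beta> \<phi>"
  and xi: "\<xi> \<in> cpolydisc" and I: "\<And>i. i \<in> I ==> norm (\<phi> \<xi> $ i) = 1" and J: "J = {k. norm (\<xi> $ k) = 1}"
  and v: "\<And>i. i \<in> I ==> (\<Sum>k\<in>UNIV. jac \<phi> \<xi> i k * (\<xi> $ k * of_real (v k))) = 0"
  and le: "card J <= card I" and k0: "k0 \<in> J" "v k0 \<noteq> 0"
 shows False
proof -
 interpret coord_measure "mm \<beta>" by (rule coord_measure_mm[OF b])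
 \<comment> \<open>Normalized so that coordinate k0 turns by 8\<delta> per step: chords are at least
   half as long as arcs, so distinct centres are at least 4\<delta> apart, whereas boxes can meet
   only below 2\<delta>.\<close>
 define u where "u k = 8 * v k / v k0" for k
 define V where "V = Max (range (%k. \<bar>u k\<bar>))"
 have V: "\<bar>u k\<bar> <= V" for k unfolding V_def by (intro Max_ge) auto
 have u: "(\<Sum>k\<in>UNIV. jac \<phi> \<xi> i k * (\<xi> $ k * of_real (u k))) = 0" if "i \<in> I" for i
 proof -
  have "(\<Sum>k\<in>UNIV. jac \<phi> \<xi> i k * (\<xi> $ k * of_real (u k))) = of_real (8 / v k0) * (\<Sum>k\<in>UNIV. jac \<phi> \<xi> i k * (\<xi> $ k * of_real (v k)))"
   by (simp add: u_def sum_distrib_left mult_ac)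
  then show ?thesis using v[OF that] by simp
 qed
 define C0 where "C0 = real CARD('n) + (\<Sum>i\<in>UNIV. \<Sum>k\<in>UNIV. 2 * norm (jac \<phi> \<xi> i k))"
 have C0: "C0 >= 0" unfolding C0_def by (intro add_nonneg_nonneg sum_nonneg) auto
 obtain K where K': "K > 0 \<and> (\<forall>\<delta> E. 0 < \<delta> --> \<delta> < 1 --> E \<in> sets borel --> E \<subseteq> cpolydisc --> (\<forall>z\<in>E. \<forall>i\<in>I. norm (\<phi> z $ i - \<phi> \<xi> $ i) <= C0 * \<delta>) -->
   emeasure (mu \<beta>) E <= ennreal (K * (\<delta> powr (\<beta> + 2)) ^ card I))"
  using necessary_measure[OF b cb I C0] by (rule exE)
 note K = K'[THEN conjunct1] K'[THEN conjunct2, THEN spec, THEN spec, THEN mp, THEN mp, THEN mp, THEN mp, THEN mp]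
 obtain c where c: "c > 0" "\<And>(J :: 'n set) \<zeta> \<delta>. (\<And>k. k \<in> J ==> norm (\<zeta> k) = 1) ==> 0 < \<delta> ==> \<delta> <= 1 ==>
   ennreal (c * (\<delta> powr (\<beta>+2)) ^ card J) <= emeasure (mu \<beta>) {z :: complex^'n. z \<in> cpolydisc \<and> (\<forall>k\<in>J. norm (z $ k - \<zeta> k) < \<delta>)}"
  by (rule box_measure_lower[OF b], rule that, assumption, blast)
 obtain M :: nat where M: "K / c < real M" using reals_Archimedean2 by blast
 obtain d0 where d0': "d0 > 0 \<and> (\<forall>\<delta> l x. 0 < \<delta> --> \<delta> < d0 --> l <= M --> x \<in> cpolydisc -->
  (\<forall>k\<in>J. norm (x $ k - \<xi> $ k * cis (real l * \<delta> * u k)) < \<delta>) --> (\<forall>i\<in>I. norm (\<phi> x $ i - \<phi> \<xi> $ i) <= C0 * \<delta>))"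
  using box_estimate[OF xi I J u V, where M=M, folded C0_def] by (rule exE)
 note d0 = d0'[THEN conjunct1] d0'[THEN conjunct2, THEN spec, THEN spec, THEN spec, THEN mp, THEN mp, THEN mp, THEN mp, THEN mp]
 \<comment> \<open>The last bound keeps the angles of coordinate k0 at most 1, so that no box comes
   back around the circle.\<close>
 define \<delta> where "\<delta> = min (d0/2) (min (1/2) (1 / (8 * (real M + 1))))"
 have "\<delta> <= 1/2" unfolding \<delta>_def by (intro min.coboundedI2 min.cobounded1)
 then have d: "0 < \<delta>" "\<delta> < d0" "\<delta> < 1" using d0(1) by (auto simp: \<delta>_def)
 have dM: "8 * real M * \<delta> <= 1"
 proof -
  have "8 * real M * \<delta> <= 8 * real M * (1 / (8 * (real M + 1)))" by (intro mult_left_mono) (auto simp: \<delta>_def)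
  also have "... <= 1" by (simp add: field_simps)
  finally show ?thesis .
 qed
 define E where "E l = {z :: complex^'n. z \<in> cpolydisc \<and> (\<forall>k\<in>J. norm (z $ k - \<xi> $ k * cis (real l * \<delta> * u k)) < \<delta>)}" for l :: nat
 have [measurable]: "E l \<in> sets borel" for l unfolding E_def by measurable
 have Elow: "ennreal (c * (\<delta> powr (\<beta>+2)) ^ card J) <= emeasure (mu \<beta>) (E l)" for l
  unfolding E_def using d by (intro c(2)) (auto simp: J norm_mult)
 have disj: "disjoint_family_on E {..<M}"
  unfolding disjoint_family_on_def
 proof (intro ballI impI)
  fix l l' assume l: "l \<in> {..<M}" "l' \<in> {..<M}" "l \<noteq> l'"
  show "E l \<inter> E l' = {}"
  proof (rule ccontr)
   assume "E l \<inter> E l' \<noteq> {}"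
   then obtain x where x: "x \<in> E l" "x \<in> E l'" by auto
   define a where "a = real l * \<delta> * 8"
   define a' where "a' = real l' * \<delta> * 8"
   have uk: "u k0 = 8" using k0 by (simp add: u_def)
   have "norm (x $ k0 - \<xi> $ k0 * cis a) < \<delta>" "norm (x $ k0 - \<xi> $ k0 * cis a') < \<delta>"
    using x k0 uk by (auto simp: E_def a_def a'_def)
   then have "norm (\<xi> $ k0 * cis a - \<xi> $ k0 * cis a') < 2 * \<delta>"
    using norm_triangle_ineq4[of "x $ k0 - \<xi> $ k0 * cis a'" "x $ k0 - \<xi> $ k0 * cis a"] by simp
   moreover have "norm (\<xi> $ k0 * cis a - \<xi> $ k0 * cis a') = norm (cis a - cis a')"
   proof -
    have "\<xi> $ k0 * cis a - \<xi> $ k0 * cis a' = \<xi> $ k0 * (cis a - cis a')" by (simp add: right_diff_distrib)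
    then show ?thesis using k0 by (simp add: norm_mult J)
   qed
   ultimately have "norm (cis a - cis a') < 2 * \<delta>" by simp
   moreover have aa: "\<bar>a - a'\<bar> = 8 * \<delta> * \<bar>real l - real l'\<bar>"
   proof -
    have "a - a' = (8 * \<delta>) * (real l - real l')" by (simp add: a_def a'_def algebra_simps)
    then show ?thesis using d by (simp add: abs_mult)
   qed
   have "\<bar>real l - real l'\<bar> <= real M" using l by auto
   then have "\<bar>a - a'\<bar> <= 8 * \<delta> * real M" unfolding aa using d by (intro mult_left_mono) auto
   then have "\<bar>a - a'\<bar> <= 1" using dM by (simp add: mult_ac)
   then have "min \<bar>a - a'\<bar> (2*pi - \<bar>a - a'\<bar>) = \<bar>a - a'\<bar>" "\<bar>a - a'\<bar> <= 2*pi" using pi_gt3 by auto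
   then have "\<bar>a - a'\<bar> <= 2 * norm (cis a - cis a')" using norm_cis_diff_ge[of a a'] by simp
   moreover have "1 <= \<bar>real l - real l'\<bar>" using l(3) by (cases "l < l'") auto
   then have "8 * \<delta> * 1 <= \<bar>a - a'\<bar>" unfolding aa using d by (intro mult_left_mono) auto
   ultimately show False using d by simp
  qed
 qed
 define p where "p = (\<delta> powr (\<beta>+2)) ^ card J"
 have p: "p > 0" using d by (simp add: p_def)
 have "ennreal (real M * (c * p)) = (\<Sum>l<M. ennreal (c * p))" using c p by (simp add: ennreal_mult ennreal_of_nat_eq_real_of_nat)
 also have "... <= (\<Sum>l<M. emeasure (mu \<beta>) (E l))" using Elow by (intro sum_mono) (simp add: p_def)
 also have "... = emeasure (mu \<beta>) (\<Union>l<M. E l)" using disj by (intro sum_emeasure) auto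
 also have "... <= ennreal (K * (\<delta> powr (\<beta> + 2)) ^ card I)"
 proof (rule K(2)[OF d(1,3)])
  show "(\<Union>l<M. E l) \<in> sets borel" by measurable
  show "(\<Union>l<M. E l) \<subseteq> cpolydisc" by (auto simp: E_def)
  show "\<forall>z\<in>\<Union>l<M. E l. \<forall>i\<in>I. norm (\<phi> z $ i - \<phi> \<xi> $ i) <= C0 * \<delta>"
  proof
   fix z assume "z \<in> (\<Union>l<M. E l)"
   then obtain l where "l < M" "z \<in> E l" by blast
   then show "\<forall>i\<in>I. norm (\<phi> z $ i - \<phi> \<xi> $ i) <= C0 * \<delta>" by (intro d0(2)[OF d(1,2), of l]) (auto simp: E_def)
  qed
 qed
 finally have "real M * (c * p) <= K * (\<delta> powr (\<beta> + 2)) ^ card I" using K p c d by (subst (asm) ennreal_le_iff) auto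
 also have "(\<delta> powr (\<beta> + 2)) ^ card I <= p"
  unfolding p_def using d b le by (intro power_decreasing) (auto intro!: powr_le1)
 then have "K * (\<delta> powr (\<beta> + 2)) ^ card I <= K * p" using K by (intro mult_left_mono) auto
 finally have "real M * c <= K" using p by simp
 then show False using M c by (simp add: field_simps)
qed

text \<open>A single box at \<xi> already contradicts the estimate: its mass is of order q^(card J)
  with q = \<delta>^(\<beta>+2), against q^(card I) with a larger exponent. No motion is involved,
  so \<open>box_estimate\<close> is taken with v = 0.\<close>

lemma necessary_card:
 fixes \<xi> :: "complex^'n"
 assumes b: "\<beta> >= -1" and cb: "composition_bounded \<beta> \<phi>" and xi: "\<xi> \<in> cpolydisc"
 shows "card {i. norm (\<phi> \<xi> $ i) = 1} <= card {k. norm (\<xi> $ k) = 1}"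
proof (rule ccontr)
 define I where "I = {i. norm (\<phi> \<xi> $ i) = 1}"
 define J where "J = {k. norm (\<xi> $ k) = 1}"
 assume "\<not> ?thesis"
 then have lt: "card J < card I" by (simp add: I_def J_def)
 have I: "\<And>i. i \<in> I ==> norm (\<phi> \<xi> $ i) = 1" by (simp add: I_def)
 define C0 where "C0 = real CARD('n) + (\<Sum>i\<in>UNIV. \<Sum>k\<in>UNIV. 2 * norm (jac \<phi> \<xi> i k))"
 have C0: "C0 >= 0" unfolding C0_def by (intro add_nonneg_nonneg sum_nonneg) auto
 obtain K where K': "K > 0 \<and> (\<forall>\<delta> E. 0 < \<delta> --> \<delta> < 1 --> E \<in> sets borel --> E \<subseteq> cpolydisc --> (\<forall>z\<in>E. \<forall>i\<in>I. norm (\<phi> z $ i - \<phi> \<xi> $ i) <= C0 * \<delta>) -->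
   emeasure (mu \<beta>) E <= ennreal (K * (\<delta> powr (\<beta> + 2)) ^ card I))"
  using necessary_measure[OF b cb I C0] by (rule exE)
 note K = K'[THEN conjunct1] K'[THEN conjunct2, THEN spec, THEN spec, THEN mp, THEN mp, THEN mp, THEN mp, THEN mp]
 obtain c where c: "c > 0" "\<And>(J :: 'n set) \<zeta> \<delta>. (\<And>k. k \<in> J ==> norm (\<zeta> k) = 1) ==> 0 < \<delta> ==> \<delta> <= 1 ==>
   ennreal (c * (\<delta> powr (\<beta>+2)) ^ card J) <= emeasure (mu \<beta>) {z :: complex^'n. z \<in> cpolydisc \<and> (\<forall>k\<in>J. norm (z $ k - \<zeta> k) < \<delta>)}"
  by (rule box_measure_lower[OF b], rule that, assumption, blast)
 have z00: "\<bar>0::real\<bar> <= 0" by simp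
 have 0: "(\<Sum>k\<in>UNIV. jac \<phi> \<xi> i k * (\<xi> $ k * of_real 0)) = 0" for i by simp
 obtain d0 where d0': "d0 > 0 \<and> (\<forall>\<delta> l x. 0 < \<delta> --> \<delta> < d0 --> l <= 0 --> x \<in> cpolydisc -->
  (\<forall>k\<in>J. norm (x $ k - \<xi> $ k * cis (real l * \<delta> * 0)) < \<delta>) --> (\<forall>i\<in>I. norm (\<phi> x $ i - \<phi> \<xi> $ i) <= C0 * \<delta>))"
  using box_estimate[where I=I and v="%_. 0" and V=0 and M=0, OF xi I J_def 0 z00, folded C0_def] by (rule exE)
 have d0: "d0 > 0" using d0' by (rule conjunct1)
 have d02: "\<forall>i\<in>I. norm (\<phi> x $ i - \<phi> \<xi> $ i) <= C0 * \<delta>" if "0 < \<delta>" "\<delta> < d0" "x \<in> cpolydisc" "\<forall>k\<in>J. norm (x $ k - \<xi> $ k) < \<delta>" for \<delta> x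
  using d0'[THEN conjunct2, THEN spec, THEN spec, THEN spec, THEN mp, THEN mp, THEN mp, THEN mp, THEN mp, of \<delta> 0 x] that by simp
 define \<delta> where "\<delta> = min (d0/2) (min (1/2) (c / (2 * K)))"
 have d: "0 < \<delta>" "\<delta> < d0" "\<delta> < 1" using d0 c K by (auto simp: \<delta>_def)
 define q where "q = \<delta> powr (\<beta>+2)"
 have q: "q > 0" using d by (simp add: q_def)
 have q1: "q <= \<delta>" using d b powr_mono'[of 1 "\<beta>+2" \<delta>] by (simp add: q_def)
 define E where "E = {z :: complex^'n. z \<in> cpolydisc \<and> (\<forall>k\<in>J. norm (z $ k - \<xi> $ k) < \<delta>)}"
 have "ennreal (c * q ^ card J) <= emeasure (mu \<beta>) E"
  unfolding E_def q_def using d by (intro c(2)) (auto simp: J_def)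
 also have "... <= ennreal (K * (\<delta> powr (\<beta> + 2)) ^ card I)"
 proof (rule K(2)[OF d(1,3)])
  show "E \<in> sets borel" unfolding E_def by measurable
  show "\<forall>z\<in>E. \<forall>i\<in>I. norm (\<phi> z $ i - \<phi> \<xi> $ i) <= C0 * \<delta>" using d02[OF d(1,2)] by (auto simp: E_def)
 qed (auto simp: E_def)
 finally have "c * q ^ card J <= K * q ^ card I" using K q c by (subst (asm) ennreal_le_iff) (auto simp: q_def)
 also have "q ^ card I <= q ^ Suc (card J)" using lt q q1 d by (intro power_decreasing) auto
 then have "K * q ^ card I <= K * q ^ Suc (card J)" using K by (intro mult_left_mono) auto
 finally have "c * q ^ card J <= (K * q) * q ^ card J" by (simp add: mult_ac)
 then have "c <= K * q" using q by simp
 also have "... <= K * \<delta>" using q1 K by (intro mult_left_mono) auto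
 also have "... <= K * (c / (2 * K))" using K by (intro mult_left_mono) (auto simp: \<delta>_def)
 also have "... = c / 2" using K by simp
 finally show False using c by simp
qed

end

text \<open>The block is completed to a square matrix over the whole index type, by the identity
  outside J and with the rows of I carried to J by a bijection p; for a square matrix injectivity
  gives a two-sided inverse.\<close>

lemma injective_invertible_on:
 fixes a :: "'n::finite => 'n => complex"
 assumes card: "card I = card J"
  and inj: "\<And>v. (\<And>k. k \<notin> J ==> v k = 0) ==> (\<And>i. i \<in> I ==> (\<Sum>k\<in>UNIV. a i k * v k) = 0) ==> (\<And>k. v k = 0)"
 shows "invertible_on I J a"
proof -
 obtain p where p: "bij_betw p J I" using card by (metis finite finite_same_card_bij)
 define M :: "complex^'n^'n" where "M = (\<chi> r k. if r \<in> J then (if k \<in> J then a (p r) k else 0) else (if r = k then 1 else 0))"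
 have "\<forall>x. M *v x = 0 --> x = 0"
 proof (intro allI impI)
  fix x assume 0: "M *v x = 0"
  have out: "x $ k = 0" if "k \<notin> J" for k
  proof -
   have "(M *v x) $ k = (\<Sum>j\<in>UNIV. (if k = j then 1 else 0) * x $ j)" using that by (simp add: matrix_vector_mult_def M_def)
   also have "... = (\<Sum>j\<in>UNIV. if j = k then x $ j else 0)" by (intro sum.cong) auto
   finally show ?thesis using 0 by simp
  qed
  have "(\<Sum>k\<in>UNIV. a i k * x $ k) = 0" if i: "i \<in> I" for i
  proof -
   obtain r where r: "r \<in> J" "i = p r" using p i by (auto simp: bij_betw_def)
   have "(M *v x) $ r = (\<Sum>k\<in>UNIV. a i k * x $ k)"
    unfolding matrix_vector_mult_def M_def using r out by (auto intro!: sum.cong)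
   then show ?thesis using 0 by simp
  qed
  then have "x $ k = 0" for k using inj[of "%k. x $ k"] out by blast
  then show "x = 0" by (simp add: vec_eq_iff)
 qed
 then obtain B where BM: "B ** M = mat 1" using matrix_left_invertible_ker[of M] by blast
 then have MB: "M ** B = mat 1" using matrix_left_right_inverse by blast
 define q where "q = inv_into J p"
 have q: "q i \<in> J" "p (q i) = i" if "i \<in> I" for i
  using p that unfolding q_def by (auto simp: bij_betw_def inv_into_into f_inv_into_f)
 have qinj: "q i = q i' \<longleftrightarrow> i = i'" if "i \<in> I" "i' \<in> I" for i i' using q that by metis
 have qp: "q (p r) = r" if "r \<in> J" for r using p that unfolding q_def by (auto simp: bij_betw_def)
 show ?thesis
  unfolding invertible_on_def
 proof (intro conjI card exI[of _ "%k i. B $ k $ (q i)"] ballI)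
  fix i i' assume i: "i \<in> I" "i' \<in> I"
  have "(\<Sum>k\<in>J. a i k * B $ k $ q i') = (\<Sum>k\<in>UNIV. M $ q i $ k * B $ k $ q i')"
   using q i by (intro sum.mono_neutral_cong_left) (auto simp: M_def)
  also have "... = (M ** B) $ q i $ q i'" by (simp add: matrix_matrix_mult_def)
  also have "... = (if i = i' then 1 else 0)" using qinj[OF i] by (simp add: MB mat_def)
  finally show "(\<Sum>k\<in>J. a i k * B $ k $ q i') = (if i = i' then 1 else 0)" .
 next
  fix k k' assume k: "k \<in> J" "k' \<in> J"
  have "(\<Sum>i\<in>I. B $ k $ q i * a i k') = (\<Sum>r\<in>J. B $ k $ q (p r) * a (p r) k')"
   by (rule sum.reindex_bij_betw[OF p, symmetric])
  also have "... = (\<Sum>r\<in>UNIV. B $ k $ r * M $ r $ k')"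
   using k by (intro sum.mono_neutral_cong_left) (auto simp: M_def qp)
  also have "... = (B ** M) $ k $ k'" by (simp add: matrix_matrix_mult_def)
  also have "... = (if k = k' then 1 else 0)" by (simp add: BM mat_def)
  finally show "(\<Sum>i\<in>I. B $ k $ q i * a i k') = (if k = k' then 1 else 0)" .
 qed
qed

context smooth_selfmap begin

theorem necessity:
 assumes b: "\<beta> >= -1" and cb: "composition_bounded \<beta> \<phi>"
 shows condA condB
proof -
 show condA
  unfolding condA_def
 proof (intro ballI equals0I)
  fix j y assume j: "j \<in> {1..CARD('n) - 1}" and y: "y \<in> \<phi> ` (cpolydisc - T (j + 1)) \<inter> T (j + 1)"
  then obtain \<xi> where "\<xi> \<in> cpolydisc" "\<xi> \<notin> T (j + 1)" "\<phi> \<xi> \<in> T (j + 1)" by auto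
  then show False using necessary_card[OF b cb, of \<xi>] by (auto simp: T_iff)
 qed
 show condB
  unfolding condB_def
 proof (intro ballI allI impI)
  fix j :: nat and I :: "'n set" and \<xi> :: "complex^'n"
  assume cI: "card I = j" and xi: "\<xi> \<in> T j - T (j + 1)" and I: "\<forall>i\<in>I. norm (\<phi> \<xi> $ i) = 1"
  define J where "J = {k. norm (\<xi> $ k) = 1}"
  have xc: "\<xi> \<in> cpolydisc" using xi by (simp add: T_iff)
  have cJ: "card J = j" using xi by (auto simp: T_iff J_def)
  have I': "\<And>i. i \<in> I ==> norm (\<phi> \<xi> $ i) = 1" using I by blast
  have inj: "w k = 0" if out: "\<And>k. k \<notin> J ==> w k = 0" and 0: "\<And>i. i \<in> I ==> (\<Sum>k\<in>UNIV. jac \<phi> \<xi> i k * w k) = 0" for w k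
  proof (rule ccontr)
   assume wk: "w k \<noteq> 0"
   then have kJ: "k \<in> J" using out by blast
   \<comment> \<open>Angular coordinates. After multiplication by cnj (\<phi>_i \<xi>) the rows are
     real in them, so the real and the imaginary part of a complex kernel vector are kernel vectors
     too; \<open>fin\<close> treats both through f = Re and f = Im.\<close>
   define y where "y k = w k / \<xi> $ k" for k
   have xy: "\<xi> $ k * y k = w k" for k using out[of k] by (cases "k \<in> J") (auto simp: y_def J_def)
   have fin: False if f: "\<And>z. f (of_real x * z) = x * f z" "\<And>F. f (\<Sum>k\<in>(UNIV::'n set). F k) = (\<Sum>k\<in>UNIV. f (F k))" "f (y k) \<noteq> 0"
    and freal: "\<And>r z. Im r = 0 ==> f (r * z) = Re r * f z" for f :: "complex => real" and x
   proof (rule necessary_kernel[OF b cb xc I' J_def, of I "%k. f (y k)" k])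
    fix i assume i: "i \<in> I"
    define e where "e = cnj (\<phi> \<xi> $ i)"
    have e0: "e \<noteq> 0" using I'[OF i] by (auto simp: e_def)
    have re: "Im (e * jac \<phi> \<xi> i k * \<xi> $ k) = 0" for k unfolding e_def by (rule jac_real[OF xc I'[OF i]])
    have "(\<Sum>k\<in>UNIV. (e * jac \<phi> \<xi> i k * \<xi> $ k) * y k) = e * (\<Sum>k\<in>UNIV. jac \<phi> \<xi> i k * w k)"
     by (simp add: sum_distrib_left xy[symmetric] mult_ac)
    then have "f (\<Sum>k\<in>UNIV. (e * jac \<phi> \<xi> i k * \<xi> $ k) * y k) = 0" using 0[OF i] freal[of 0 0] by simp
    then have s: "(\<Sum>k\<in>UNIV. Re (e * jac \<phi> \<xi> i k * \<xi> $ k) * f (y k)) = 0" unfolding f(2) freal[OF re] .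
    have rr: "of_real (Re (e * jac \<phi> \<xi> i k * \<xi> $ k)) = e * jac \<phi> \<xi> i k * \<xi> $ k" for k using re[of k] by (simp add: complex_eq_iff)
    have "e * (\<Sum>k\<in>UNIV. jac \<phi> \<xi> i k * (\<xi> $ k * of_real (f (y k)))) = (\<Sum>k\<in>UNIV. (e * jac \<phi> \<xi> i k * \<xi> $ k) * of_real (f (y k)))"
     by (simp add: sum_distrib_left mult_ac)
    also have "... = of_real (\<Sum>k\<in>UNIV. Re (e * jac \<phi> \<xi> i k * \<xi> $ k) * f (y k))" by (simp only: of_real_sum of_real_mult rr)
    also have "... = 0" unfolding s by simp
    finally show "(\<Sum>k\<in>UNIV. jac \<phi> \<xi> i k * (\<xi> $ k * of_real (f (y k)))) = 0" using e0 by (simp only: mult_eq_0_iff) simp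
   qed (use I' cI cJ kJ f(3) in \<open>auto simp: J_def\<close>)
   have "y k \<noteq> 0" using wk xy[of k] by auto
   then have "Re (y k) \<noteq> 0 \<or> Im (y k) \<noteq> 0" by (auto simp: complex_eq_iff)
   then show False using fin[of Re 1] fin[of Im 1] by auto
  qed
  \<comment> \<open>Injectivity has been shown on the columns J of all unimodular coordinates. A
    column of zeros would contradict it, so P_I is the whole of J.\<close>
  have PJ: "P \<phi> I \<xi> = J"
  proof
   show "P \<phi> I \<xi> \<subseteq> J" using P_unimod[OF xc I'] by (auto simp: J_def)
   show "J \<subseteq> P \<phi> I \<xi>"
   proof (rule ccontr)
    assume "\<not> J \<subseteq> P \<phi> I \<xi>"
    then obtain k where k: "k \<in> J" "\<And>i. i \<in> I ==> jac \<phi> \<xi> i k = 0" by (auto simp: P_def)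
    have "(%m. if m = k then 1 else 0 :: complex) k = 0"
    proof (rule inj[of "%m. if m = k then 1 else 0"])
     fix i assume i: "i \<in> I"
     have "(\<Sum>m\<in>UNIV. jac \<phi> \<xi> i m * (if m = k then 1 else 0)) = (\<Sum>m\<in>UNIV. if m = k then jac \<phi> \<xi> i m else 0)"
      by (intro sum.cong) auto
     then show "(\<Sum>m\<in>UNIV. jac \<phi> \<xi> i m * (if m = k then 1 else 0)) = 0" using k(2)[OF i] by simp
    qed (use k in auto)
    then show False by simp
   qed
  qed
  show "invertible_on I (P \<phi> I \<xi>) (jac \<phi> \<xi>)"
   unfolding PJ by (rule injective_invertible_on) (use cI cJ inj in auto)
 qed
qed

end

section \<open>Sufficiency in the Bergman case\<close>

text \<open>The outermost integrations run over the coordinates outside the flag, followed by k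
  (q-1), ..., k 0. When k r is reached, exactly k 0, ..., k r are still free, and the hypothesis
  confines coordinate k r to a set that depends on the fixed ones through z0.\<close>

lemma (in coord_measure) flag_fubini:
 fixes E :: "(complex^'n) set" and B :: "'n => ennreal" and q :: nat and k :: "nat => 'n"
 assumes E: "E \<in> sets borel" and k: "inj_on k {..<q}"
  and flag: "\<And>r z0. r < q ==> z0 \<in> E ==> \<exists>A\<in>sets borel. emeasure m A <= B (k r) \<and> (\<forall>z\<in>E. (\<forall>l. l \<notin> k ` {..r} --> z $ l = z0 $ l) --> z $ (k r) \<in> A)"
  and free: "\<And>l. l \<notin> k ` {..<q} ==> \<exists>A\<in>sets borel. emeasure m A <= B l \<and> (\<forall>z\<in>E. z $ l \<in> A)"
 shows "emeasure vm E <= (\<Prod>l\<in>UNIV. B l)"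
proof -
 obtain xs where xs: "set xs = UNIV - k ` {..<q}" "distinct xs" using finite_distinct_list[of "UNIV - k ` {..<q}"] by auto
 define ks where "ks = xs @ rev (map k [0..<q])"
 have ksd: "distinct ks" unfolding ks_def using xs k by (auto simp: distinct_map lessThan_atLeast0)
 have ksu: "set ks = UNIV" unfolding ks_def using xs by (auto simp: lessThan_atLeast0)
 show ?thesis
 proof (rule fubini_vec[OF ksd ksu E])
  fix as l bs and y :: "complex^'n" assume dec: "ks = as @ l # bs"
  show "\<exists>A\<in>sets borel. emeasure m A <= B l \<and> (\<forall>x\<in>E. (\<forall>a\<in>set as. x $ a = y $ a) --> x $ l \<in> A)"
  proof (cases "l \<in> k ` {..<q}")
   case False
   then show ?thesis using free[OF False] by blast
  next
   case True
   then obtain r where r: "r < q" "l = k r" by auto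
   have "[0..<q] = [0..<r] @ r # [Suc r..<q]" using r(1) upt_add_eq_append[of 0 r "q - r"] by (simp add: upt_conv_Cons)
   then have "ks = (xs @ rev (map k [Suc r..<q])) @ l # rev (map k [0..<r])" by (simp add: ks_def r(2))
   then have "as @ l # bs = (xs @ rev (map k [Suc r..<q])) @ l # rev (map k [0..<r])" using dec by metis
   moreover have "l \<notin> set as" "l \<notin> set bs" using ksd dec by auto
   ultimately have as: "as = xs @ rev (map k [Suc r..<q])" using append_Cons_eq_iff by metis
   have inas: "l' \<in> set as" if "l' \<notin> k ` {..r}" for l'
   proof (cases "l' \<in> k ` {..<q}")
    case True
    then obtain r' where r': "r' < q" "l' = k r'" by auto
    then have "Suc r <= r'" using that by (metis atMost_iff image_eqI not_less_eq_eq)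
    then show ?thesis using r' by (simp add: as)
   qed (use xs in \<open>simp add: as\<close>)
   show ?thesis
   proof (cases "\<exists>z0\<in>E. \<forall>a\<in>set as. z0 $ a = y $ a")
    case True
    then obtain z0 where z0: "z0 \<in> E" "\<forall>a\<in>set as. z0 $ a = y $ a" by blast
    obtain A where A: "A \<in> sets borel" "emeasure m A <= B (k r)" "\<forall>z\<in>E. (\<forall>l. l \<notin> k ` {..r} --> z $ l = z0 $ l) --> z $ (k r) \<in> A"
     using flag[OF r(1) z0(1)] by blast
    show ?thesis
    proof (intro bexI[OF _ A(1)] conjI ballI impI)
     show "emeasure m A <= B l" using A(2) r by simp
     fix x assume x: "x \<in> E" "\<forall>a\<in>set as. x $ a = y $ a"
     then have "\<forall>l. l \<notin> k ` {..r} --> x $ l = z0 $ l" using inas z0(2) by auto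
     then show "x $ l \<in> A" using A(3) x(1) r(2) by blast
    qed
   next
    case False
    then show ?thesis by (intro bexI[of _ "{}"]) auto
   qed
  qed
 qed
qed

section \<open>Pivots for an ordered family of rows\<close>

lemma bij_block_empty: "bij_block a {} K ==> K = {}" for a :: "'n::finite => 'n => complex"
proof (rule ccontr)
 assume b: "bij_block a {} K" and "K \<noteq> {}"
 then obtain k where k: "k \<in> K" by auto
 have "(%l. if l = k then 1 else 0 :: complex) k = 0" by (rule bij_block_inj[OF b]) (use k in auto)
 then show False by simp
qed

lemma bij_block_column:
 fixes a :: "'n::finite => 'n => complex"
 assumes b: "bij_block a I K" and k: "k \<in> K"
 shows "\<exists>i\<in>I. a i k \<noteq> 0"
proof (rule ccontr)
 assume "\<not> ?thesis"
 then have 0: "a i k = 0" if "i \<in> I" for i using that by blast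
 define v where "v l = (if l = k then 1 else 0 :: complex)" for l
 have v: "\<forall>l. l \<notin> {k} --> v l = 0" by (simp add: v_def)
 have "v k = 0"
 proof (rule bij_block_inj[OF b])
  show "\<forall>l. l \<notin> K --> v l = 0" using k by (auto simp: v_def)
  show "\<forall>i\<in>I. (\<Sum>l\<in>UNIV. a i l * v l) = 0" unfolding sum_supported[OF v] using 0 by simp
 qed
 then show False by (simp add: v_def)
qed

text \<open>Rows are removed from the last to the first by \<open>bij_block_remove\<close>; each
  removal names a pivot, and the remaining blocks are nested.\<close>

lemma bij_block_flag:
 fixes a :: "'n::finite => 'n => complex" and e :: "nat => 'n" and q :: nat
 assumes "bij_block a (e ` {..<q}) K" "inj_on e {..<q}"
 shows "\<exists>k. inj_on k {..<q} \<and> k ` {..<q} = K \<and> (\<forall>r\<le>q. bij_block a (e ` {..<r}) (k ` {..<r}))"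
 using assms
proof (induction q arbitrary: K)
 case 0
 then show ?case using bij_block_empty[of a K] by auto
next
 case (Suc q)
 have "e ` {..<Suc q} = insert (e q) (e ` {..<q})" by (simp add: lessThan_Suc)
 moreover have "e q \<notin> e ` {..<q}" using Suc.prems(2) unfolding inj_on_def by (metis imageE lessThan_iff less_Suc_eq less_irrefl)
 ultimately obtain k' where k': "k' \<in> K" "bij_block a (e ` {..<q}) (K - {k'})"
  using bij_block_remove[of a "e q" "e ` {..<q}" K] Suc.prems(1) by metis
 have "inj_on e {..<q}" using Suc.prems(2) by (rule inj_on_subset) auto
 from Suc.IH[OF k'(2) this] obtain k where k: "inj_on k {..<q}" "k ` {..<q} = K - {k'}" "\<forall>r\<le>q. bij_block a (e ` {..<r}) (k ` {..<r})" by blast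
 define k2 where "k2 = k(q := k')"
 have im: "k2 ` {..<r} = k ` {..<r}" if "r <= q" for r using that by (auto simp: k2_def image_def)
 have full: "k2 ` {..<Suc q} = K" using k(2) k'(1) im[of q] by (auto simp: lessThan_Suc k2_def)
 show ?case
 proof (intro exI[of _ k2] conjI allI impI)
  have "k' \<notin> k ` {..<q}" using k(2) by auto
  then have "inj_on k2 (insert q {..<q})" unfolding inj_on_insert using k(1) by (auto simp: k2_def inj_on_def)
  then show "inj_on k2 {..<Suc q}" by (simp add: lessThan_Suc)
  show "k2 ` {..<Suc q} = K" by (rule full)
  fix r assume "r <= Suc q"
  then show "bij_block a (e ` {..<r}) (k2 ` {..<r})"
   using k(3) im full Suc.prems(1) by (cases "r = Suc q") auto
 qed
qed

text \<open>There are only finitely many pairs (I, K). A common constant is wanted because the rows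
  will be ordered by the sides of the box, and the pivots change with that order.\<close>

lemma uniform_block_bound:
 fixes a :: "'n::finite => 'n => complex"
 shows "\<exists>c>0. \<forall>I K v D. I \<noteq> {} --> bij_block a I K --> (\<forall>k. k \<notin> K --> v k = 0) --> D >= 0 --> (\<forall>i\<in>I. norm (\<Sum>k\<in>UNIV. a i k * v k) <= D) --> (\<forall>k. c * norm (v k) <= D)"
proof -
 define Q where "Q I K c \<longleftrightarrow> c > 0 \<and> (\<forall>v. (\<forall>k. k \<notin> K --> v k = 0) --> (\<forall>D\<ge>0. (\<forall>i\<in>I. norm (\<Sum>k\<in>UNIV. a i k * v k) <= D) --> (\<forall>k. c * norm (v k) <= D)))" for I K c
 define S where "S = {(I, K). I \<noteq> {} \<and> bij_block a I K}"
 define f where "f p = (SOME c. Q (fst p) (snd p) c)" for p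
 have f: "Q (fst p) (snd p) (f p)" if "p \<in> S" for p
 proof -
  have b: "bij_block a (fst p) (snd p)" and I: "fst p \<noteq> {}" using that by (auto simp: S_def)
  have "\<exists>c. Q (fst p) (snd p) c" unfolding Q_def using bij_block_lower_bound[OF b I] by blast
  then show ?thesis unfolding f_def by (rule someI_ex)
 qed
 define c where "c = Min (insert 1 (f ` S))"
 have c: "c > 0" unfolding c_def using f by (subst Min_gr_iff) (auto simp: Q_def)
 show ?thesis
 proof (intro exI[of _ c] conjI c allI impI)
  fix I K and v :: "'n => complex" and D k
  assume *: "I \<noteq> {}" "bij_block a I K" "\<forall>k. k \<notin> K --> v k = 0" "0 <= D" "\<forall>i\<in>I. norm (\<Sum>k\<in>UNIV. a i k * v k) <= D"
  then have S: "(I, K) \<in> S" by (simp add: S_def)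
  have "c <= f (I, K)" unfolding c_def using S by (intro Min_le) auto
  then have "c * norm (v k) <= f (I, K) * norm (v k)" by (rule mult_right_mono) simp
  also have "... <= D" using f[OF S] * unfolding Q_def by simp
  finally show "c * norm (v k) <= D" .
 qed
qed

text \<open>The radial constraints of the columns outside a pivot set supply one factor more than the rows that remain.\<close>

lemma radial_product_bound:
 fixes \<epsilon> :: "'n::finite => real" and d :: "nat => real"
 assumes d: "\<And>j. 0 < d j" "\<And>j. j < p ==> d j <= 1" "\<And>i j. i <= j ==> j < p ==> d i <= d j"
  and eps: "\<And>m l. m < p ==> l \<in> X (Suc m) ==> \<epsilon> l <= d m" "\<And>l. 0 < \<epsilon> l"
  and X: "\<And>m. q < m ==> m <= p ==> Suc m - q <= card (X m)" and qp: "q < p"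
 shows "q < m ==> m <= p ==> \<exists>Y. Y \<subseteq> (\<Union>j\<in>{..m}. X j) \<and> card Y = Suc m - q \<and> (\<Prod>l\<in>Y. \<epsilon> l) <= d q * (\<Prod>j\<in>{q..<m}. d j)"
proof (induction m)
 case 0
 then show ?case by simp
next
 case (Suc m)
 have ub: "\<epsilon> l <= d m" if "l \<in> X (Suc m)" for l using eps(1)[of m l] that Suc.prems by simp
 show ?case
 proof (cases "q = m")
  case True
  \<comment> \<open>At the first step two columns are available, both bounded by d q; the square
    supplies the additional factor that the later steps carry along.\<close>
  have "2 <= card (X (Suc m))" using X[of "Suc m"] Suc.prems True by simp
  then obtain Y where Y: "Y \<subseteq> X (Suc m)" "card Y = 2" by (meson obtain_subset_with_card_n)
  have "(\<Prod>l\<in>Y. \<epsilon> l) <= (\<Prod>l\<in>Y. d m)" using Y(1) ub eps(2) by (intro prod_mono) (auto simp: less_imp_le)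
  also have "... = d q * (\<Prod>j\<in>{q..<Suc m}. d j)" using True Y(2) by (simp add: power2_eq_square)
  finally show ?thesis using Y True by (intro exI[of _ Y]) auto
 next
  case False
  then have "q < m" using Suc.prems by simp
  from Suc.IH[OF this] Suc.prems obtain Y where Y: "Y \<subseteq> (\<Union>j\<in>{..m}. X j)" "card Y = Suc m - q" "(\<Prod>l\<in>Y. \<epsilon> l) <= d q * (\<Prod>j\<in>{q..<m}. d j)" by auto
  have "card Y < card (X (Suc m))" using X[of "Suc m"] Suc.prems \<open>q < m\<close> Y(2) by simp
  then have "\<not> X (Suc m) \<subseteq> Y" using card_mono[of Y "X (Suc m)"] by auto
  then obtain y where y: "y \<in> X (Suc m)" "y \<notin> Y" by auto
  have "(\<Prod>l\<in>insert y Y. \<epsilon> l) = \<epsilon> y * (\<Prod>l\<in>Y. \<epsilon> l)" using y by simp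
  also have "... <= d m * (d q * (\<Prod>j\<in>{q..<m}. d j))"
   using ub[OF y(1)] Y(3) eps(2) d(1) by (intro mult_mono) (auto intro!: prod_nonneg simp: less_imp_le)
  also have "... = d q * (\<Prod>j\<in>{q..<Suc m}. d j)" using \<open>q < m\<close> by (simp add: prod.atLeastLessThan_Suc mult_ac)
  finally have "(\<Prod>l\<in>insert y Y. \<epsilon> l) <= d q * (\<Prod>j\<in>{q..<Suc m}. d j)" .
  moreover have "card (insert y Y) = Suc (Suc m) - q" using y Y(2) \<open>q < m\<close> by simp
  moreover have "insert y Y \<subseteq> (\<Union>j\<in>{..Suc m}. X j)" using y(1) Y(1) by (auto simp: atMost_Suc)
  ultimately show ?thesis by blast
 qed
qed

lemma sorted_enumeration:
 fixes \<delta> :: "'i => real"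
 assumes "finite I"
 obtains e where "bij_betw e {..<card I} I" "\<And>i j. i <= j ==> j < card I ==> \<delta> (e i) <= \<delta> (e j)"
proof -
 obtain ys where ys: "set ys = I" "distinct ys" using assms finite_distinct_list by blast
 define xs where "xs = sort_key \<delta> ys"
 have xs: "set xs = I" "distinct xs" "sorted (map \<delta> xs)" using ys by (auto simp: xs_def)
 have len: "length xs = card I" using xs distinct_card by metis
 show ?thesis
 proof (rule that[of "%m. xs ! m"])
  show "bij_betw (%m. xs ! m) {..<card I} I" using bij_betw_nth[OF xs(2)] xs(1) len by simp
  fix i j assume "i <= j" "j < card I"
  then show "\<delta> (xs ! i) <= \<delta> (xs ! j)" using sorted_nth_mono[OF xs(3), of i j] len by simp
 qed
qed


text \<open>M is the last length at which the initial rows are tight, that is, the first M rows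
  involve exactly M columns; they form an invertible block and supply q = M pivots. If M = 0 < p,
  the first row supplies one pivot, so that q \<ge> 1. Beyond M the first m rows involve at least m
  + 1 columns, hence m + 1 - q outside the pivots; for m = p this also gives p < d.\<close>

lemma pivot_block:
 fixes a :: "'n::finite => 'n => complex" and e :: "nat => 'n" and p :: nat
 defines "N \<equiv> %I. {k. \<exists>i\<in>I. a i k \<noteq> 0}"
 assumes e: "inj_on e {..<p}"
  and hall: "\<And>I. I \<subseteq> e ` {..<p} ==> I \<noteq> {} ==> card I <= card (N I)"
  and block: "\<And>I. I \<subseteq> e ` {..<p} ==> I \<noteq> {} ==> card I = card (N I) ==> bij_block a I (N I)"
 shows "\<exists>q k. q <= p \<and> inj_on k {..<q} \<and> (\<forall>r\<le>q. bij_block a (e ` {..<r}) (k ` {..<r})) \<and>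
  (q < p --> 1 <= q \<and> p < CARD('n) \<and> (\<forall>m. q < m --> m <= p --> Suc m - q <= card (N (e ` {..<m}) - k ` {..<q})))"
proof -
 have ce: "card (e ` {..<m}) = m" if "m <= p" for m
  using that by (subst card_image) (auto intro: inj_on_subset[OF e])
 have ge: "m <= card (N (e ` {..<m}))" if "m <= p" for m
 proof (cases "m = 0")
  case False
  then have "e ` {..<m} \<noteq> {}" by auto
  then show ?thesis using hall[of "e ` {..<m}"] that ce[OF that] by (auto simp: image_subset_iff)
 qed simp
 define M where "M = Max {m. m <= p \<and> card (N (e ` {..<m})) = m}"
 have "0 \<in> {m. m <= p \<and> card (N (e ` {..<m})) = m}" by (simp add: N_def)
 then have fin: "finite {m. m <= p \<and> card (N (e ` {..<m})) = m}" "{m. m <= p \<and> card (N (e ` {..<m})) = m} \<noteq> {}" by auto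
 have M: "M <= p" "card (N (e ` {..<M})) = M" using Max_in[OF fin] by (auto simp: M_def)
 have gt: "Suc m <= card (N (e ` {..<m}))" if "M < m" "m <= p" for m
 proof -
  have "m <= M" if "card (N (e ` {..<m})) = m" unfolding M_def by (rule Max_ge[OF fin(1)]) (use that \<open>m <= p\<close> in simp)
  then have "card (N (e ` {..<m})) \<noteq> m" using that by auto
  then show ?thesis using ge[OF that(2)] by simp
 qed
 have pn: "p < CARD('n)" if "M < p"
 proof -
  have "Suc p <= card (N (e ` {..<p}))" using gt that by simp
  also have "... <= CARD('n)" by (intro card_mono) auto
  finally show ?thesis by simp
 qed
 have mono: "N (e ` {..<i}) \<subseteq> N (e ` {..<j})" if "i <= j" for i j using that by (fastforce simp: N_def)
 have "\<exists>q K. q <= p \<and> M <= q \<and> (q = 0 --> p = 0) \<and> q <= Suc M \<and> K \<subseteq> N (e ` {..<q}) \<and> bij_block a (e ` {..<q}) K \<and> (\<forall>m. q < m --> m <= p --> Suc m - q <= card (N (e ` {..<m}) - K))"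
 proof (cases "M = 0")
  case False
  then have "e ` {..<M} \<noteq> {}" by auto
  then have "bij_block a (e ` {..<M}) (N (e ` {..<M}))" using block[of "e ` {..<M}"] M ce[OF M(1)] by (auto simp: image_subset_iff)
  moreover have "Suc m - M <= card (N (e ` {..<m}) - N (e ` {..<M}))" if "M < m" "m <= p" for m
   using card_Diff_subset[OF _ mono[of M m]] gt[OF that] M(2) that by simp
  ultimately show ?thesis using M False by (intro exI[of _ M] exI[of _ "N (e ` {..<M})"]) auto
 next
  case True
  show ?thesis
  proof (cases "p = 0")
   case True
   have "bij_block a {} {}" by (auto simp: bij_block_def)
   then show ?thesis using True \<open>M = 0\<close> by (intro exI[of _ 0] exI[of _ "{}"]) auto
  next
   case False
   then have "1 <= card (N (e ` {..<1}))" using ge[of 1] by simp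
   then have "N (e ` {..<1}) \<noteq> {}" by auto
   then obtain k where k: "a (e 0) k \<noteq> 0" by (auto simp: N_def lessThan_Suc)
   have im: "e ` {..<1} = {e 0}" by (simp add: lessThan_Suc)
   have kN: "k \<in> N (e ` {..<m})" if "1 <= m" for m using that k unfolding N_def by (intro CollectI bexI[of _ "e 0"]) auto
   show ?thesis
   proof (intro exI[of _ 1] exI[of _ "{k}"] conjI allI impI)
    show "bij_block a (e ` {..<1}) {k}" unfolding im by (rule bij_block_singleton[of a "e 0" k]) (rule k)
    show "{k} \<subseteq> N (e ` {..<1})" using kN[of 1] by simp
    fix m assume "1 < m" "m <= p"
    then show "Suc m - 1 <= card (N (e ` {..<m}) - {k})" using gt[of m] kN[of m] \<open>M = 0\<close> by simp
   qed (use False \<open>M = 0\<close> in auto)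
  qed
 qed
 then obtain q K where qK: "q <= p" "M <= q" "q = 0 --> p = 0" "bij_block a (e ` {..<q}) K" "\<forall>m. q < m --> m <= p --> Suc m - q <= card (N (e ` {..<m}) - K)" by blast
 have "inj_on e {..<q}" by (rule inj_on_subset[OF e]) (use qK(1) in auto)
 from bij_block_flag[OF qK(4) this] obtain k where k: "inj_on k {..<q}" "k ` {..<q} = K" "\<forall>r\<le>q. bij_block a (e ` {..<r}) (k ` {..<r})" by blast
 show ?thesis using qK k pn by (intro exI[of _ q] exI[of _ k]) auto
qed

text \<open>Abstracts from \<phi> a set on which each \<phi>_i, i in I0, varies by at most
  2\<delta>_i: linearized increments with relative error e, and radial constraints with constant D.
  The error e will be chosen from the matrix alone, while C may depend on D.\<close>

definition tube_bound :: "('n::finite => 'n => complex) => 'n set => real => real => real => real => bool" where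
 "tube_bound a I0 \<beta> e D C \<longleftrightarrow> (\<forall>E\<in>sets borel. \<forall>\<delta>::'n => real. (\<forall>i. 0 < \<delta> i \<and> \<delta> i <= 1) -->
   (\<forall>z\<in>E. \<forall>z'\<in>E. \<forall>i\<in>I0. norm (\<Sum>k\<in>UNIV. a i k * (z $ k - z' $ k)) <= 2 * \<delta> i + e * norm (z - z')) -->
   (\<forall>z\<in>E. \<forall>i\<in>I0. \<forall>l. a i l \<noteq> 0 --> 1 - norm (z $ l) <= D * \<delta> i) -->
   emeasure (mu \<beta>) E <= ennreal (C * (\<Prod>i\<in>I0. \<delta> i powr (\<beta> + 2))))"

text \<open>Rows are ordered by increasing \<delta>. Two points that agree outside the pivots k 0,
  ..., k r differ by at most a multiple of \<delta> (e r), so pivot r contributes \<delta>(e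
  r)^(\<beta>+2); any other column l contributes \<epsilon>_l^(\<beta>+1) through its radial
  constraint. By \<open>radial_product_bound\<close> these columns yield the power \<beta>+1 of each
  remaining row and a spare d_q^(\<beta>+1), which has to raise all those exponents by 1.\<close>

lemma tube_measure:
 fixes a :: "'n::finite => 'n => complex" and I0 :: "'n set" and \<beta> :: real
 defines "N \<equiv> %I. {k. \<exists>i\<in>I. a i k \<noteq> 0}"
 assumes beta: "\<beta> > -1" "\<beta> >= real CARD('n) - 3"
  and hall: "\<And>I. I \<subseteq> I0 ==> I \<noteq> {} ==> card I <= card (N I)"
  and block: "\<And>I. I \<subseteq> I0 ==> I \<noteq> {} ==> card I = card (N I) ==> bij_block a I (N I)"
 shows "\<exists>e>0. \<forall>D>0. \<exists>C>0. tube_bound a I0 \<beta> e D C"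
proof -
 obtain c where c: "c > 0" "\<forall>I K v D. I \<noteq> {} --> bij_block a I K --> (\<forall>k. k \<notin> K --> v k = 0) --> D >= 0 --> (\<forall>i\<in>I. norm (\<Sum>k\<in>UNIV. a i k * v k) <= D) --> (\<forall>k. c * norm (v k) <= D)"
  using uniform_block_bound[of a] by blast
 define n where "n = real CARD('n)"
 have n: "n >= 1" by (simp add: n_def)
 \<comment> \<open>So small that the linearization error, summed over the n coordinates, is at most
   half of |z - z'| and can be absorbed.\<close>
 define \<eta> where "\<eta> = c / (2 * n)"
 have eta: "\<eta> > 0" using c n by (simp add: \<eta>_def)
 obtain C1 where C1: "C1 > 0" "\<And>\<delta> b. \<delta> > 0 ==> emeasure (mm \<beta>) {z. 1 - \<delta> <= norm z \<and> norm (z - b) <= \<delta>} <= ennreal (C1 * \<delta> powr (\<beta> + 2))"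
  "\<And>\<delta>. \<delta> > 0 ==> emeasure (mm \<beta>) {z. 1 - \<delta> <= norm z} <= ennreal (C1 * \<delta> powr (\<beta> + 1))"
  by (rule mm_shell_box[of \<beta>]) (use beta(1) in simp, rule that, assumption, blast+)
 interpret coord_measure "mm \<beta>" using coord_measure_mm beta(1) by simp
 define p where "p = card I0"
 have Neq: "{k. \<exists>i\<in>I. a i k \<noteq> 0} = N I" for I by (simp add: N_def)
 show ?thesis
 proof (rule exI[of _ \<eta>], intro conjI eta allI impI)
  fix D :: real assume D: "D > 0"
  \<comment> \<open>1 is for columns without constraint, D for the radial constraints, 4 n / c for
    the diameter at the pivots.\<close>
  define D2 where "D2 = 1 + D + 4 * n / c"
  have D2: "D2 >= 1" using D c n by (simp add: D2_def)
  define C2 where "C2 = C1 * D2 powr (\<beta> + 2)"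
  have C2: "C2 > 0" using C1 D2 by (simp add: C2_def)
  show "\<exists>C>0. tube_bound a I0 \<beta> \<eta> D C" unfolding tube_bound_def
  proof (intro exI[of _ "C2 ^ CARD('n)"] conjI ballI allI impI)
   show "C2 ^ CARD('n) > 0" using C2 by simp
   fix E :: "(complex^'n) set" and \<delta> :: "'n => real"
   assume E: "E \<in> sets borel" and d: "\<forall>i. 0 < \<delta> i \<and> \<delta> i <= 1"
    and diff: "\<forall>z\<in>E. \<forall>z'\<in>E. \<forall>i\<in>I0. norm (\<Sum>k\<in>UNIV. a i k * (z $ k - z' $ k)) <= 2 * \<delta> i + \<eta> * norm (z - z')"
    and rad: "\<forall>z\<in>E. \<forall>i\<in>I0. \<forall>l. a i l \<noteq> 0 --> 1 - norm (z $ l) <= D * \<delta> i"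
   obtain e where e: "bij_betw e {..<p} I0" "\<And>i j. i <= j ==> j < p ==> \<delta> (e i) <= \<delta> (e j)"
    by (rule sorted_enumeration[of I0 \<delta>, OF finite, folded p_def]) (rule that, assumption, blast)
   have ei: "inj_on e {..<p}" "e ` {..<p} = I0" using e(1) by (auto simp: bij_betw_def)
   have eI: "e j \<in> I0" if "j < p" for j using ei(2) that by auto
   have "\<exists>q k. q <= p \<and> inj_on k {..<q} \<and> (\<forall>r\<le>q. bij_block a (e ` {..<r}) (k ` {..<r})) \<and>
    (q < p --> 1 <= q \<and> p < CARD('n) \<and> (\<forall>m. q < m --> m <= p --> Suc m - q <= card (N (e ` {..<m}) - k ` {..<q})))"
    by (rule pivot_block[of e p a, unfolded ei(2) Neq]) (use ei(1) hall block in auto)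
   then obtain q k where qk: "q <= p" "inj_on k {..<q}" "\<forall>r\<le>q. bij_block a (e ` {..<r}) (k ` {..<r})"
    and q2: "q < p --> 1 <= q \<and> p < CARD('n) \<and> (\<forall>m. q < m --> m <= p --> Suc m - q <= card (N (e ` {..<m}) - k ` {..<q}))"
    by (elim exE conjE) (rule that)
   \<comment> \<open>The best radial scale that the rows give for column l. The default 1 stands for
     a column in which all entries of the rows I0 vanish.\<close>
   define \<epsilon> where "\<epsilon> l = Min (insert 1 (\<delta> ` {i\<in>I0. a i l \<noteq> 0}))" for l
   have eps: "0 < \<epsilon> l" "\<epsilon> l <= 1" for l unfolding \<epsilon>_def using d by (auto intro!: Min_le)
   have eps_le: "\<epsilon> l <= \<delta> i" if "i \<in> I0" "a i l \<noteq> 0" for i l unfolding \<epsilon>_def using that by (intro Min_le) auto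
   have eps_rad: "1 - norm (z $ l) <= D2 * \<epsilon> l" if z: "z \<in> E" for z l
   proof -
    have "\<epsilon> l \<in> insert 1 (\<delta> ` {i\<in>I0. a i l \<noteq> 0})" unfolding \<epsilon>_def by (intro Min_in) auto
    then consider "\<epsilon> l = 1" | i where "i \<in> I0" "a i l \<noteq> 0" "\<epsilon> l = \<delta> i" by auto
    then show ?thesis
    proof cases
     case 1
     then show ?thesis using D2 by simp (smt (verit) norm_ge_zero)
    next
     case 2
     have "1 - norm (z $ l) <= D * \<delta> i" using rad z 2 by blast
     also have "... <= D2 * \<epsilon> l" unfolding 2(3) using d c n by (intro mult_right_mono) (auto simp: D2_def less_imp_le)
     finally show ?thesis .
    qed
   qed
   define K where "K = k ` {..<q}"
   define b where "b l = (if l \<in> K then \<delta> (e (inv_into {..<q} k l)) powr (\<beta> + 2) else \<epsilon> l powr (\<beta> + 1))" for l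
   have bk: "b (k r) = \<delta> (e r) powr (\<beta> + 2)" if "r < q" for r using that qk(2) by (simp add: b_def K_def)
   have "emeasure vm E <= (\<Prod>l\<in>UNIV. ennreal (C2 * b l))"
   proof (rule flag_fubini[OF E qk(2)])
    fix r z0 assume r: "r < q" and z0: "z0 \<in> E"
    define \<Delta> where "\<Delta> = \<delta> (e r)"
    have De: "\<Delta> > 0" using d by (simp add: \<Delta>_def)
    have bb: "bij_block a (e ` {..r}) (k ` {..r})" using qk(3) r by (metis Suc_leI lessThan_Suc_atMost)
    have dle: "i \<in> I0" "\<delta> i <= \<Delta>" if "i \<in> e ` {..r}" for i
     using that e(2) eI r qk(1) unfolding \<Delta>_def by auto
    obtain i where i: "i \<in> e ` {..r}" "a i (k r) \<noteq> 0" using bij_block_column[OF bb, of "k r"] by auto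
    show "\<exists>A\<in>sets borel. emeasure (mm \<beta>) A <= ennreal (C2 * b (k r)) \<and> (\<forall>z\<in>E. (\<forall>l. l \<notin> k ` {..r} --> z $ l = z0 $ l) --> z $ k r \<in> A)"
    proof (intro bexI conjI ballI impI)
     show "{y. 1 - D2 * \<Delta> <= norm y \<and> norm (y - z0 $ k r) <= D2 * \<Delta>} \<in> sets borel" by measurable
     have "emeasure (mm \<beta>) {y. 1 - D2 * \<Delta> <= norm y \<and> norm (y - z0 $ k r) <= D2 * \<Delta>} <= ennreal (C1 * (D2 * \<Delta>) powr (\<beta> + 2))"
      by (rule C1(2)) (use D2 De in simp)
     also have "C1 * (D2 * \<Delta>) powr (\<beta> + 2) = C2 * b (k r)" unfolding bk[OF r] by (simp add: C2_def powr_mult \<Delta>_def)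
     finally show "emeasure (mm \<beta>) {y. 1 - D2 * \<Delta> <= norm y \<and> norm (y - z0 $ k r) <= D2 * \<Delta>} <= ennreal (C2 * b (k r))" .
     fix z assume z: "z \<in> E" and ag: "\<forall>l. l \<notin> k ` {..r} --> z $ l = z0 $ l"
     define v where "v l = z $ l - z0 $ l" for l
     define R where "R = norm (z - z0)"
     have "\<forall>l. c * norm (v l) <= 2 * \<Delta> + \<eta> * R"
     proof (rule c(2)[rule_format, OF _ bb, THEN allI])
      fix l
      show "e ` {..r} \<noteq> {}" by simp
      show "0 <= 2 * \<Delta> + \<eta> * R" using De eta by (simp add: R_def)
      show "v l = 0" if "l \<notin> k ` {..r}" for l using ag that by (simp add: v_def)
      fix i assume i: "i \<in> e ` {..r}"
      have "norm (\<Sum>l\<in>UNIV. a i l * v l) <= 2 * \<delta> i + \<eta> * R" unfolding v_def R_def using diff z z0 dle(1)[OF i] by blast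
      also have "... <= 2 * \<Delta> + \<eta> * R" using dle(2)[OF i] by simp
      finally show "norm (\<Sum>l\<in>UNIV. a i l * v l) <= 2 * \<Delta> + \<eta> * R" .
     qed
     then have vl: "norm (v l) <= (2 * \<Delta> + \<eta> * R) / c" for l using c(1) by (simp add: field_simps)
     have "R <= (\<Sum>l\<in>UNIV. norm ((z - z0) $ l))" unfolding R_def by (rule norm_le_sum_vec)
     also have "... <= (\<Sum>l\<in>(UNIV::'n set). (2 * \<Delta> + \<eta> * R) / c)" using vl by (intro sum_mono) (simp add: v_def)
     also have "... = 2 * n * \<Delta> / c + R / 2" using c(1) n by (simp add: n_def[symmetric] \<eta>_def field_simps)
     finally have R: "R <= 4 * n / c * \<Delta>" by simp
     have "norm (z $ k r - z0 $ k r) <= R" unfolding R_def using vec_nth_norm_le[of "z - z0" "k r"] by simp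
     also have "... <= D2 * \<Delta>" using R De D by (simp add: D2_def distrib_right) (smt (verit) mult_pos_pos)
     finally have 1: "norm (z $ k r - z0 $ k r) <= D2 * \<Delta>" .
     have "1 - norm (z $ k r) <= D * \<delta> i" using rad z i(2) dle(1)[OF i(1)] by blast
     also have "... <= D2 * \<Delta>" using d dle(2)[OF i(1)] D c n by (intro mult_mono) (auto simp: D2_def less_imp_le)
     finally show "z $ k r \<in> {y. 1 - D2 * \<Delta> <= norm y \<and> norm (y - z0 $ k r) <= D2 * \<Delta>}" using 1 by simp
    qed
   next
    fix l assume l: "l \<notin> k ` {..<q}"
    show "\<exists>A\<in>sets borel. emeasure (mm \<beta>) A <= ennreal (C2 * b l) \<and> (\<forall>z\<in>E. z $ l \<in> A)"
    proof (intro bexI conjI ballI)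
     show "{y. 1 - D2 * \<epsilon> l <= norm y} \<in> sets borel" by measurable
     have "emeasure (mm \<beta>) {y. 1 - D2 * \<epsilon> l <= norm y} <= ennreal (C1 * (D2 * \<epsilon> l) powr (\<beta> + 1))"
      by (rule C1(3)) (use D2 eps in simp)
     also have "C1 * (D2 * \<epsilon> l) powr (\<beta> + 1) <= C2 * b l"
     proof -
      have "D2 powr (\<beta> + 1) <= D2 powr (\<beta> + 2)" using D2 by (intro powr_mono) auto
      then show ?thesis using l C1(1) by (auto simp: C2_def b_def K_def powr_mult mult.assoc intro!: mult_right_mono mult_left_mono)
     qed
     finally show "emeasure (mm \<beta>) {y. 1 - D2 * \<epsilon> l <= norm y} <= ennreal (C2 * b l)" by (simp add: ennreal_leI)
     fix z assume "z \<in> E"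
     then show "z $ l \<in> {y. 1 - D2 * \<epsilon> l <= norm y}" using eps_rad[of z l] by simp
    qed
   qed
   also have "... = ennreal (C2 ^ CARD('n) * (\<Prod>l\<in>UNIV. b l))"
    using C2 by (subst prod_ennreal) (auto simp: b_def prod.distrib)
   also have "(\<Prod>l\<in>UNIV. b l) = (\<Prod>l\<in>K. b l) * (\<Prod>l\<in>-K. b l)"
    by (metis Compl_eq_Diff_UNIV finite_class.finite_UNIV mult.commute prod.subset_diff top_greatest)
   also have "(\<Prod>l\<in>K. b l) = (\<Prod>r<q. \<delta> (e r) powr (\<beta> + 2))" unfolding K_def using qk(2) bk by (subst prod.reindex) auto
   finally have main: "emeasure vm E <= ennreal (C2 ^ CARD('n) * ((\<Prod>r<q. \<delta> (e r) powr (\<beta> + 2)) * (\<Prod>l\<in>-K. b l)))" .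
   have "(\<Prod>l\<in>-K. b l) <= (\<Prod>r\<in>{q..<p}. \<delta> (e r) powr (\<beta> + 2))"
   proof (cases "q = p")
    case True
    have "(\<Prod>l\<in>-K. b l) <= 1" using eps beta by (intro prod_le_1) (auto simp: b_def powr_le1 less_imp_le)
    then show ?thesis using True by simp
   next
    case False
    then have qp: "q < p" using qk(1) by simp
    define d' where "d' j = \<delta> (e j)" for j
    have "\<exists>Y. Y \<subseteq> (\<Union>j\<in>{..p}. N (e ` {..<j}) - K) \<and> card Y = Suc p - q \<and> (\<Prod>l\<in>Y. \<epsilon> l) <= d' q * (\<Prod>j\<in>{q..<p}. d' j)"
    proof (rule radial_product_bound[where p = p and q = q])
     fix m l assume m: "m < p" "l \<in> N (e ` {..<Suc m}) - K"
     then obtain j where "j < Suc m" "a (e j) l \<noteq> 0" by (auto simp: N_def)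
     then show "\<epsilon> l <= d' m" using eps_le[of "e j" l] eI[of j] e(2)[of j m] m by (simp add: d'_def)
    qed (use d e(2) q2[rule_format, OF qp] qp eps in \<open>auto simp: d'_def K_def\<close>)
    then obtain Y where Y: "Y \<subseteq> - K" "(\<Prod>l\<in>Y. \<epsilon> l) <= d' q * (\<Prod>j\<in>{q..<p}. d' j)" by blast
    have dp: "0 < d' j" "d' j <= 1" for j using d by (auto simp: d'_def)
    have "(\<Prod>l\<in>-K. b l) = (\<Prod>l\<in>Y. b l) * (\<Prod>l\<in>-K - Y. b l)" using prod.subset_diff[OF Y(1), of b] by (simp add: mult.commute)
    also have "... <= (\<Prod>l\<in>Y. b l) * 1" using eps beta
     by (intro mult_left_mono prod_le_1 prod_nonneg) (auto simp: b_def powr_le1 less_imp_le)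
    also have "... = (\<Prod>l\<in>Y. \<epsilon> l powr (\<beta> + 1))" using Y(1) by (auto simp: b_def intro!: prod.cong)
    also have "... = (\<Prod>l\<in>Y. \<epsilon> l) powr (\<beta> + 1)" by (rule prod_powr_distrib[symmetric])
    also have "... <= (d' q * (\<Prod>j\<in>{q..<p}. d' j)) powr (\<beta> + 1)" using Y(2) beta eps by (intro powr_mono2) (auto intro!: prod_nonneg simp: less_imp_le)
    also have "... = d' q powr (\<beta> + 1) * (\<Prod>j\<in>{q..<p}. d' j powr (\<beta> + 1))"
     by (simp add: powr_mult prod_powr_distrib)
    also have "d' q powr (\<beta> + 1) <= (\<Prod>j\<in>{q..<p}. d' j)"
    proof -
     \<comment> \<open>Here q \<ge> 1, p \<le> d - 1 and \<beta> \<ge> d - 3 meet. The exponents are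
       then compared in reverse order because d' q \<le> 1.\<close>
     have "real (p - q) <= \<beta> + 1" using q2[rule_format, OF qp] beta(2) qp by (simp add: of_nat_diff)
     then have "d' q powr (\<beta> + 1) <= d' q powr real (p - q)" using dp by (intro powr_mono') (auto simp: less_imp_le)
     also have "... = (\<Prod>j\<in>{q..<p}. d' q)" using dp by (simp add: powr_realpow)
     also have "... <= (\<Prod>j\<in>{q..<p}. d' j)" using dp e(2) by (intro prod_mono) (auto simp: d'_def less_imp_le)
     finally show ?thesis .
    qed
    also have "(\<Prod>j\<in>{q..<p}. d' j) * (\<Prod>j\<in>{q..<p}. d' j powr (\<beta> + 1)) = (\<Prod>r\<in>{q..<p}. \<delta> (e r) powr (\<beta> + 2))"
     unfolding prod.distrib[symmetric]
    proof (intro prod.cong refl)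
     fix j
     have "d' j * d' j powr (\<beta> + 1) = d' j powr (1 + (\<beta> + 1))" using dp[of j] by (subst powr_add) auto
     then show "d' j * d' j powr (\<beta> + 1) = \<delta> (e j) powr (\<beta> + 2)" by (simp add: d'_def add.commute)
    qed
    finally show ?thesis by (auto simp: mult_right_mono prod_nonneg)
   qed
   then have "(\<Prod>r<q. \<delta> (e r) powr (\<beta> + 2)) * (\<Prod>l\<in>-K. b l) <= (\<Prod>r<q. \<delta> (e r) powr (\<beta> + 2)) * (\<Prod>r\<in>{q..<p}. \<delta> (e r) powr (\<beta> + 2))"
    by (rule mult_left_mono) (simp add: prod_nonneg)
   also have "... = (\<Prod>r<p. \<delta> (e r) powr (\<beta> + 2))"
    using qk(1) by (metis lessThan_atLeast0 prod.atLeastLessThan_concat zero_le)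
   also have "... = (\<Prod>i\<in>I0. \<delta> i powr (\<beta> + 2))" unfolding ei(2)[symmetric] using ei(1) by (subst prod.reindex) auto
   finally have "C2 ^ CARD('n) * ((\<Prod>r<q. \<delta> (e r) powr (\<beta> + 2)) * (\<Prod>l\<in>-K. b l)) <= C2 ^ CARD('n) * (\<Prod>i\<in>I0. \<delta> i powr (\<beta> + 2))"
    using C2 by (intro mult_left_mono) auto
   from ennreal_leI[OF this] main show "emeasure vm E <= ennreal (C2 ^ CARD('n) * (\<Prod>i\<in>I0. \<delta> i powr (\<beta> + 2)))" by (rule order_trans[rotated])
  qed
 qed
qed

section \<open>The Carleson condition for boxes\<close>

context smooth_selfmap begin

lemma tube_borel: "{z\<in>polydisc. dist z \<xi> < r \<and> (\<forall>i. norm (\<phi> z $ i - w $ i) <= 1 - norm (w $ i))} \<in> sets borel"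
proof -
 have cl: "closed {z\<in>cpolydisc. norm (\<phi> z $ i - w $ i) \<in> {..1 - norm (w $ i)}}" for i
 proof -
  have "continuous_on cpolydisc (%z. norm (\<phi> z $ i - w $ i))" by (intro continuous_intros cont_i)
  from continuous_closed_preimage[OF this closed_cpolydisc, of "{..1 - norm (w $ i)}"] show ?thesis by (simp add: vimage_def Int_def)
 qed
 have "{z\<in>polydisc. dist z \<xi> < r \<and> (\<forall>i. norm (\<phi> z $ i - w $ i) <= 1 - norm (w $ i))}
  = polydisc \<inter> ball \<xi> r \<inter> (\<Inter>i. {z\<in>cpolydisc. norm (\<phi> z $ i - w $ i) \<in> {..1 - norm (w $ i)}})"
  using polydisc_subset by (auto simp: dist_commute)
 also have "... \<in> sets borel" using cl open_polydisc by (intro sets.Int borel_open borel_closed closed_INT) auto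
 finally show ?thesis .
qed

text \<open>Only the components in I0, unimodular at \<xi>, are linearized. For the others
  |\<phi>_i| stays away from 1 near \<xi>, so a nonempty preimage forces 1 - |w_i| to be bounded
  below, and their factors cost no more than the constant \<open>\<kappa>\<close>.\<close>

lemma local_estimate:
 assumes A: condA and B: condB and beta: "\<beta> > -1" "\<beta> >= real CARD('n) - 3" and xi: "\<xi> \<in> cpolydisc"
 shows "\<exists>r>0. \<exists>C>0. \<forall>w\<in>polydisc. emeasure (mu \<beta>) {z\<in>polydisc. dist z \<xi> < r \<and> (\<forall>i. norm (\<phi> z $ i - w $ i) <= 1 - norm (w $ i))}
   <= ennreal (C * (\<Prod>i\<in>UNIV. (1 - norm (w $ i)) powr (\<beta> + 2)))"
proof -
 define I0 where "I0 = {i. norm (\<phi> \<xi> $ i) = 1}"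
 define a where "a = jac \<phi> \<xi>"
 have PN: "P \<phi> I \<xi> = {k. \<exists>i\<in>I. a i k \<noteq> 0}" for I by (simp add: P_def a_def)
 have hall: "card I <= card {k. \<exists>i\<in>I. a i k \<noteq> 0}" if "I \<subseteq> I0" "I \<noteq> {}" for I
  using hall_condition(1)[OF A B xi that(2)] that(1) unfolding PN by (auto simp: I0_def)
 have block: "bij_block a I {k. \<exists>i\<in>I. a i k \<noteq> 0}" if "I \<subseteq> I0" "I \<noteq> {}" "card I = card {k. \<exists>i\<in>I. a i k \<noteq> 0}" for I
 proof (rule invertible_on_bij_block)
  show "invertible_on I {k. \<exists>i\<in>I. a i k \<noteq> 0} a"
   using hall_condition(2)[OF A B xi that(2)] that(1,3) unfolding PN a_def[symmetric] by (auto simp: I0_def)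
 qed
 have "\<exists>e>0. \<forall>D>0. \<exists>C>0. tube_bound a I0 \<beta> e D C"
  by (rule tube_measure[OF beta]) (use hall block in auto)
 then obtain e where e: "e > 0" and tube: "\<forall>D>0. \<exists>C>0. tube_bound a I0 \<beta> e D C"
  by (elim exE conjE) (rule that)
 obtain r1 where r1: "r1 > 0" and sd: "\<forall>i. \<forall>\<xi>\<in>cpolydisc. \<forall>x\<in>cpolydisc. \<forall>y\<in>cpolydisc. dist x \<xi> < r1 \<and> dist y \<xi> < r1 -->
   norm (\<phi> x $ i - \<phi> y $ i - (\<Sum>k\<in>UNIV. jac \<phi> \<xi> i k * (x $ k - y $ k))) <= e * norm (x - y)"
  using strict_diff[OF e] by (elim exE conjE) (rule that)
 define m0 where "m0 = Min (insert 1 {norm (a i l) |i l. a i l \<noteq> 0})"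
 have fin: "finite {norm (a i l) |i l. a i l \<noteq> 0}"
  by (rule finite_subset[of _ "range (%(i,l). norm (a i l))"]) auto
 have m0: "m0 > 0" unfolding m0_def using fin by (subst Min_gr_iff) auto
 have m0_le: "m0 <= norm (a i l)" if "a i l \<noteq> 0" for i l unfolding m0_def using fin that by (intro Min_le) auto
 obtain r2 where r2: "r2 > 0" and ju: "\<forall>i k. \<forall>x\<in>cpolydisc. \<forall>y\<in>cpolydisc. dist x y < r2 --> norm (jac \<phi> x i k - jac \<phi> y i k) < m0 / 2"
  using jac_unif[OF half_gt_zero[OF m0]] by (elim exE conjE) (rule that)
 define \<rho> where "\<rho> = Max (insert 0 ((%i. norm (\<phi> \<xi> $ i)) ` (-I0)))"
 have phi_le: "norm (\<phi> \<xi> $ i) <= 1" for i using cpolydisc_component[OF map_cpolydisc[OF xi], of i] by simp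
 have "norm (\<phi> \<xi> $ i) < 1" if "i \<in> -I0" for i using that phi_le[of i] by (simp add: I0_def)
 then have rho: "0 <= \<rho>" "\<rho> < 1" unfolding \<rho>_def by (auto intro: Max_ge)
 have rho_ge: "norm (\<phi> \<xi> $ i) <= \<rho>" if "i \<notin> I0" for i unfolding \<rho>_def using that by (intro Max_ge) auto
 obtain r3 where r3: "r3 > 0" and cn: "\<forall>z\<in>cpolydisc. dist z \<xi> < r3 --> dist (\<phi> z) (\<phi> \<xi>) < (1 - \<rho>) / 2"
  using cont xi rho unfolding continuous_on_iff by (metis diff_gt_0_iff_gt half_gt_zero)
 define r where "r = min r1 (min r2 r3)"
 have r: "r > 0" using r1 r2 r3 by (simp add: r_def)
 \<comment> \<open>Near \<xi> a nonzero entry keeps modulus at least m0/2, and 1 - |\<phi>_i|^2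
   \<le> 4\<delta>_i on the preimage; \<open>radial_bound\<close> then gives 1 - |z_l| \<le>
   8\<delta>_i / m0.\<close>
 define D where "D = 8 / m0"
 have D: "D > 0" using m0 by (simp add: D_def)
 obtain C where C: "C > 0" and tube2: "tube_bound a I0 \<beta> e D C"
  using tube[rule_format, OF D] by (elim exE conjE) (rule that)
 define \<kappa> where "\<kappa> = ((1 - \<rho>) / 4) powr (\<beta> + 2)"
 have kap: "\<kappa> > 0" "\<kappa> <= 1" using rho beta(1) by (auto simp: \<kappa>_def powr_le1)
 show ?thesis
 proof (rule exI[of _ r], rule conjI[OF r], rule exI[of _ "C / \<kappa> ^ CARD('n)"], intro conjI ballI)
  show "C / \<kappa> ^ CARD('n) > 0" using C kap by simp
  fix w :: "complex^'n" assume w: "w \<in> polydisc"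
  define \<delta> where "\<delta> i = 1 - norm (w $ i)" for i
  have d: "0 < \<delta> i" "\<delta> i <= 1" for i using polydisc_component[OF w, of i] by (auto simp: \<delta>_def)
  define E where "E = {z\<in>polydisc. dist z \<xi> < r \<and> (\<forall>i. norm (\<phi> z $ i - w $ i) <= 1 - norm (w $ i))}"
  have Eb: "E \<in> sets borel" unfolding E_def by (rule tube_borel)
  have "emeasure (mu \<beta>) E <= ennreal (C * (\<Prod>i\<in>I0. \<delta> i powr (\<beta> + 2)))"
  proof (rule tube2[unfolded tube_bound_def, rule_format, OF Eb])
   show "0 < \<delta> i \<and> \<delta> i <= 1" for i using d by simp
   fix z i assume z: "z \<in> E" and i: "i \<in> I0"
   have zz: "z \<in> cpolydisc" "dist z \<xi> < r1" "norm (\<phi> z $ i - w $ i) <= \<delta> i" "z \<in> polydisc" "dist z \<xi> < r2"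
    using z polydisc_subset by (auto simp: E_def r_def \<delta>_def)
   {
    fix z' assume z': "z' \<in> E"
    have zz': "z' \<in> cpolydisc" "dist z' \<xi> < r1" "norm (\<phi> z' $ i - w $ i) <= \<delta> i"
     using z' polydisc_subset by (auto simp: E_def r_def \<delta>_def)
    have 1: "norm (\<phi> z $ i - \<phi> z' $ i - (\<Sum>k\<in>UNIV. a i k * (z $ k - z' $ k))) <= e * norm (z - z')"
     unfolding a_def using sd xi zz zz' by blast
    have "norm (\<phi> z $ i - \<phi> z' $ i) <= 2 * \<delta> i"
     using zz(3) zz'(3) norm_triangle_ineq4[of "\<phi> z $ i - w $ i" "\<phi> z' $ i - w $ i"] by simp
    then show "norm (\<Sum>k\<in>UNIV. a i k * (z $ k - z' $ k)) <= 2 * \<delta> i + e * norm (z - z')"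
     using 1 norm_triangle_ineq4[of "\<phi> z $ i - \<phi> z' $ i" "\<phi> z $ i - \<phi> z' $ i - (\<Sum>k\<in>UNIV. a i k * (z $ k - z' $ k))"] by simp
   }
   fix l assume l: "a i l \<noteq> 0"
   have "norm (jac \<phi> z i l - a i l) < m0 / 2" unfolding a_def using ju zz xi by blast
   then have j: "m0 / 2 <= norm (jac \<phi> z i l)" using m0_le[OF l] norm_triangle_ineq2[of "a i l" "jac \<phi> z i l"] by (simp add: norm_minus_commute)
   have "norm (w $ i) - norm (\<phi> z $ i) <= norm (w $ i - \<phi> z $ i)" by (rule norm_triangle_ineq2)
   then have p1: "1 - norm (\<phi> z $ i) <= 2 * \<delta> i" using zz(3) by (simp add: \<delta>_def norm_minus_commute)
   have p2: "norm (\<phi> z $ i) <= 1" using cpolydisc_component[OF map_cpolydisc[OF zz(1)], of i] by simp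
   have "(1 - norm (z $ l)) * (m0 / 2) <= (1 - norm (z $ l)) * norm (jac \<phi> z i l)"
    using j polydisc_component[OF zz(4), of l] by (intro mult_left_mono) auto
   also have "... <= 1 - (norm (\<phi> z $ i))^2" by (rule radial_bound[OF zz(4)])
   also have "... = (1 + norm (\<phi> z $ i)) * (1 - norm (\<phi> z $ i))" by (simp add: power2_eq_square algebra_simps)
   also have "... <= 2 * (2 * \<delta> i)" using p1 p2 by (intro mult_mono) auto
   finally show "1 - norm (z $ l) <= D * \<delta> i" using m0 by (simp add: D_def field_simps)
  qed
  moreover have "C * (\<Prod>i\<in>I0. \<delta> i powr (\<beta> + 2)) <= C / \<kappa> ^ CARD('n) * (\<Prod>i\<in>UNIV. \<delta> i powr (\<beta> + 2))" if ne: "E \<noteq> {}"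
  proof -
   obtain z where z: "z \<in> E" using ne by blast
   have "\<kappa> <= \<delta> i powr (\<beta> + 2)" if i: "i \<notin> I0" for i
   proof -
    have "dist (\<phi> z) (\<phi> \<xi>) < (1 - \<rho>) / 2" using cn z polydisc_subset by (auto simp: E_def r_def)
    then have "norm (\<phi> z $ i - \<phi> \<xi> $ i) < (1 - \<rho>) / 2" using vec_nth_norm_le[of "\<phi> z - \<phi> \<xi>" i] by (simp add: dist_norm)
    then have "norm (\<phi> z $ i) <= (1 - \<rho>) / 2 + \<rho>" using rho_ge[OF i] norm_triangle_ineq2[of "\<phi> z $ i" "\<phi> \<xi> $ i"] by linarith
    moreover have "norm (\<phi> z $ i - w $ i) <= \<delta> i" using z by (auto simp: E_def \<delta>_def)
    moreover have "norm (w $ i) - norm (\<phi> z $ i) <= norm (\<phi> z $ i - w $ i)" by (metis norm_minus_commute norm_triangle_ineq2)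
    ultimately have "(1 - \<rho>) / 4 <= \<delta> i" by (simp add: \<delta>_def field_simps)
    then show ?thesis unfolding \<kappa>_def using rho beta(1) by (intro powr_mono2) auto
   qed
   then have "(\<Prod>i\<in>-I0. \<kappa>) <= (\<Prod>i\<in>-I0. \<delta> i powr (\<beta> + 2))" using kap by (intro prod_mono) auto
   moreover have "\<kappa> ^ CARD('n) <= (\<Prod>i\<in>-I0. \<kappa>)" using kap by (auto intro!: power_decreasing card_mono)
   ultimately have k: "\<kappa> ^ CARD('n) <= (\<Prod>i\<in>-I0. \<delta> i powr (\<beta> + 2))" by simp
   have "(\<Prod>i\<in>UNIV. \<delta> i powr (\<beta> + 2)) = (\<Prod>i\<in>-I0. \<delta> i powr (\<beta> + 2)) * (\<Prod>i\<in>I0. \<delta> i powr (\<beta> + 2))"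
    by (metis Compl_eq_Diff_UNIV finite_class.finite_UNIV prod.subset_diff top_greatest)
   then have "\<kappa> ^ CARD('n) * (\<Prod>i\<in>I0. \<delta> i powr (\<beta> + 2)) <= (\<Prod>i\<in>UNIV. \<delta> i powr (\<beta> + 2))"
    using k by (simp add: mult_right_mono prod_nonneg)
   then show ?thesis using C kap by (simp add: field_simps)
  qed
  ultimately have "emeasure (mu \<beta>) E <= ennreal (C / \<kappa> ^ CARD('n) * (\<Prod>i\<in>UNIV. \<delta> i powr (\<beta> + 2)))"
   by (cases "E = {}") (auto intro: order_trans ennreal_leI)
  then show "emeasure (mu \<beta>) {z\<in>polydisc. dist z \<xi> < r \<and> (\<forall>i. norm (\<phi> z $ i - w $ i) <= 1 - norm (w $ i))}
   <= ennreal (C / \<kappa> ^ CARD('n) * (\<Prod>i\<in>UNIV. (1 - norm (w $ i)) powr (\<beta> + 2)))"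
   by (simp add: E_def \<delta>_def)
 qed
qed

text \<open>Finitely many of the local neighbourhoods cover the compact closed polydisc; interior
  points are included, with I0 possibly empty.\<close>

lemma global_estimate:
 assumes A: condA and B: condB and beta: "\<beta> > -1" "\<beta> >= real CARD('n) - 3"
 shows "\<exists>C>0. \<forall>w\<in>polydisc. emeasure (mu \<beta>) {z\<in>polydisc. \<forall>i. norm (\<phi> z $ i - w $ i) <= 1 - norm (w $ i)}
   <= ennreal (C * (\<Prod>i\<in>UNIV. (1 - norm (w $ i)) powr (\<beta> + 2)))"
proof -
 interpret coord_measure "mm \<beta>" using coord_measure_mm beta(1) by simp
 define E where "E w \<xi> r = {z\<in>polydisc. dist z \<xi> < r \<and> (\<forall>i. norm (\<phi> z $ i - w $ i) <= 1 - norm (w $ i))}" for w \<xi> :: "complex^'n" and r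
 define p where "p w = (\<Prod>i\<in>UNIV. (1 - norm (w $ i)) powr (\<beta> + 2))" for w :: "complex^'n"
 have p: "p w >= 0" for w by (simp add: p_def prod_nonneg)
 have "\<forall>\<xi>\<in>cpolydisc. \<exists>r. r > 0 \<and> (\<exists>C>0. \<forall>w\<in>polydisc. emeasure vm (E w \<xi> r) <= ennreal (C * p w))"
  unfolding E_def p_def using local_estimate[OF A B beta] by blast
 then obtain r where r: "\<forall>\<xi>\<in>cpolydisc. r \<xi> > 0 \<and> (\<exists>C>0. \<forall>w\<in>polydisc. emeasure vm (E w \<xi> (r \<xi>)) <= ennreal (C * p w))"
  by (auto dest: bchoice)
 then have "\<forall>\<xi>\<in>cpolydisc. \<exists>C. C > 0 \<and> (\<forall>w\<in>polydisc. emeasure vm (E w \<xi> (r \<xi>)) <= ennreal (C * p w))" by blast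
 then obtain C where C: "\<forall>\<xi>\<in>cpolydisc. C \<xi> > 0 \<and> (\<forall>w\<in>polydisc. emeasure vm (E w \<xi> (r \<xi>)) <= ennreal (C \<xi> * p w))"
  by (auto dest: bchoice)
 have "(cpolydisc :: (complex^'n) set) \<subseteq> (\<Union>\<xi>\<in>cpolydisc. ball \<xi> (r \<xi>))"
 proof
  fix z :: "complex^'n" assume "z \<in> cpolydisc"
  then show "z \<in> (\<Union>\<xi>\<in>cpolydisc. ball \<xi> (r \<xi>))" using r by (intro UN_I[of z]) auto
 qed
 then obtain F where F: "F \<subseteq> cpolydisc" "finite F" "cpolydisc \<subseteq> (\<Union>\<xi>\<in>F. ball \<xi> (r \<xi>))"
  using compactE_image[OF compact_cpolydisc, of cpolydisc "%\<xi>. ball \<xi> (r \<xi>)"] by (metis open_ball)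
 have CF: "C \<xi> > 0" if "\<xi> \<in> F" for \<xi> using C F(1) that by blast
 show ?thesis
 proof (intro exI[of _ "1 + (\<Sum>\<xi>\<in>F. C \<xi>)"] conjI ballI)
  show "1 + (\<Sum>\<xi>\<in>F. C \<xi>) > 0" using CF by (intro add_pos_nonneg sum_nonneg) (auto simp: less_imp_le)
  fix w :: "complex^'n" assume w: "w \<in> polydisc"
  have "{z\<in>polydisc. \<forall>i. norm (\<phi> z $ i - w $ i) <= 1 - norm (w $ i)} \<subseteq> (\<Union>\<xi>\<in>F. E w \<xi> (r \<xi>))"
   using F(3) polydisc_subset by (fastforce simp: E_def dist_commute)
  then have "emeasure vm {z\<in>polydisc. \<forall>i. norm (\<phi> z $ i - w $ i) <= 1 - norm (w $ i)} <= emeasure vm (\<Union>\<xi>\<in>F. E w \<xi> (r \<xi>))"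
   using F(2) by (intro emeasure_mono) (auto simp: E_def intro!: sets.finite_UN tube_borel)
  also have "... <= (\<Sum>\<xi>\<in>F. emeasure vm (E w \<xi> (r \<xi>)))"
   using F(2) by (intro emeasure_subadditive_finite) (auto simp: E_def intro!: tube_borel)
  also have "... <= (\<Sum>\<xi>\<in>F. ennreal (C \<xi> * p w))" using C F(1) w by (intro sum_mono) auto
  also have "... = ennreal ((\<Sum>\<xi>\<in>F. C \<xi>) * p w)" using CF p by (subst sum_ennreal) (auto simp: sum_distrib_right less_imp_le)
  also have "... <= ennreal ((1 + (\<Sum>\<xi>\<in>F. C \<xi>)) * p w)" using p by (intro ennreal_leI mult_right_mono) auto
  finally show "emeasure vm {z\<in>polydisc. \<forall>i. norm (\<phi> z $ i - w $ i) <= 1 - norm (w $ i)}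
   <= ennreal ((1 + (\<Sum>\<xi>\<in>F. C \<xi>)) * (\<Prod>i\<in>UNIV. (1 - norm (w $ i)) powr (\<beta> + 2)))" by (simp add: p_def)
 qed
qed

lemma holo_on_comp:
 assumes f: "holo_on f polydisc" shows "holo_on (f \<circ> \<phi>) polydisc"
 unfolding holo_on_def
proof
 fix z :: "complex^'n" assume z: "z \<in> polydisc"
 obtain D where D: "(f has_derivative D) (at (\<phi> z))" "\<And>c v. D (c *s v) = c * D v"
  using f map_polydisc[OF z] by (auto simp: holo_on_def)
 define J where "J v = (\<Sum>i\<in>UNIV. (\<Sum>k\<in>UNIV. jac \<phi> z i k * v $ k) *s axis i 1 :: complex^'n)" for v :: "complex^'n"
 have bl: "bounded_linear (%h. h *s (axis i 1 :: complex^'n))" for i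
  by (rule linear_conv_bounded_linear[THEN iffD1]) (rule linearI; simp add: vec_eq_iff algebra_simps)
 have "((%z. \<phi> z $ i *s (axis i 1 :: complex^'n)) has_derivative (%v. (\<Sum>k\<in>UNIV. jac \<phi> z i k * v $ k) *s axis i 1)) (at z)" for i
  by (rule bounded_linear.has_derivative[OF bl has_derivative_jac(1)[OF z]])
 then have "((%z. \<Sum>i\<in>UNIV. \<phi> z $ i *s axis i 1) has_derivative J) (at z)" unfolding J_def
  by (intro has_derivative_sum) auto
 then have "(\<phi> has_derivative J) (at z)" by (simp add: vec_expand[symmetric])
 then have "(f \<circ> \<phi> has_derivative D \<circ> J) (at z)" using D(1) by (rule diff_chain_at)
 moreover have "J (c *s v) = c *s J v" for c v
  by (simp add: J_def vec_eq_iff sum_distrib_left mult_ac)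
 ultimately show "\<exists>D. (f \<circ> \<phi> has_derivative D) (at z) \<and> (\<forall>c v. D (c *s v) = c * D v)"
  by (intro exI[of _ "D \<circ> J"]) (simp add: D(2))
qed

end

section \<open>From the Carleson condition to boundedness\<close>

lemma composition_boundedI:
 fixes \<phi> :: "complex^'n => complex^'n"
 assumes C: "C >= 0" and hol: "\<And>f. holo_on f polydisc ==> holo_on (f \<circ> \<phi>) polydisc"
  and le: "\<And>f :: complex^'n => complex. holo_on f polydisc ==> A2_sq \<beta> (f \<circ> \<phi>) <= ennreal C * A2_sq \<beta> f"
 shows "composition_bounded \<beta> \<phi>"
 unfolding composition_bounded_def
proof (rule exI[of _ "sqrt C"], intro ballI)
 fix f :: "complex^'n => complex" assume f: "f \<in> A2 \<beta>"
 obtain a where a: "a >= 0" "A2_sq \<beta> f = ennreal a" using f unfolding A2_def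
  by (metis (mono_tags, lifting) ennreal_cases infinity_ennreal_def less_irrefl mem_Collect_eq)
 have l: "A2_sq \<beta> (f \<circ> \<phi>) <= ennreal (C * a)" using le[of f] f C a by (simp add: A2_def ennreal_mult)
 then have "A2_sq \<beta> (f \<circ> \<phi>) < \<infinity>" by (metis ennreal_less_top infinity_ennreal_def order_le_less_trans)
 then have "f \<circ> \<phi> \<in> A2 \<beta>" using hol f by (simp add: A2_def)
 moreover have "enn2real (A2_sq \<beta> (f \<circ> \<phi>)) <= C * a" using l C a by (intro enn2real_leI) auto
 then have "A2_norm \<beta> (f \<circ> \<phi>) <= sqrt (C * a)" unfolding A2_norm_def by (rule real_sqrt_le_mono)
 then have "A2_norm \<beta> (f \<circ> \<phi>) <= sqrt C * A2_norm \<beta> f" using a by (simp add: A2_norm_def real_sqrt_mult)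
 ultimately show "f \<circ> \<phi> \<in> A2 \<beta> \<and> A2_norm \<beta> (f \<circ> \<phi>) <= sqrt C * A2_norm \<beta> f" by blast
qed

lemma polydisc_kernel:
 fixes f :: "complex^'n => complex"
 assumes beta: "\<beta> > -1"
  and mv: "\<And>h a. h holomorphic_on ball 0 1 ==> norm a < 1 ==> nsq (h a) <=
   ennreal (C1 * (1 - norm a) powr (- (\<beta>+2))) * (\<integral>\<^sup>+z. nsq (h z) * indicator (ball a ((1 - norm a)/2)) z \<partial>dA \<beta>)"
  and f: "holo_on f polydisc" and a: "a \<in> polydisc"
 shows "nsq (f a) <= (\<integral>\<^sup>+y. (\<Prod>i\<in>UNIV. ennreal (C1 * (1 - norm (a $ i)) powr (- (\<beta>+2))) * indicator (ball (a $ i) ((1 - norm (a $ i))/2)) (y $ i))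
   * (nsq (f y) * indicator polydisc y) \<partial>mu \<beta>)"
proof -
 interpret coord_measure "mm \<beta>" using coord_measure_mm beta by simp
 define G where "G z = nsq (f z) * indicator polydisc z" for z
 define K where "K i y = ennreal (C1 * (1 - norm (a $ i)) powr (- (\<beta>+2))) * indicator (ball (a $ i) ((1 - norm (a $ i))/2)) y" for i and y :: complex
 have Gm[measurable]: "G \<in> borel_fun"
  unfolding G_def[abs_def] by (rule borel_on_indicator(1)[OF holo_on_continuous[OF f] borel_sets(1)])
 have Km[measurable]: "K i \<in> borel_fun" for i
  unfolding K_def[abs_def] by (intro borel_measurable_times_ennreal borel_measurable_const borel_measurable_indicator) auto
 have "G a <= (\<integral>\<^sup>+y. (\<Prod>i\<in>UNIV. K i (y $ i)) * G y \<partial>vm)"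
 proof (rule iterate_kernel[where K = K and G = G and a = a])
  fix x :: "complex^'n" and i
  define R where "R = (1 - norm (a $ i))/2"
  have ai: "norm (a $ i) < 1" using polydisc_component[OF a] by simp
  show "G (upd x i (a $ i)) <= (\<integral>\<^sup>+y. K i y * G (upd x i y) \<partial>mm \<beta>)"
  proof (cases "upd x i (a $ i) \<in> polydisc")
   case False
   then show ?thesis by (simp add: G_def)
  next
   case True
   have inp: "upd x i y \<in> polydisc" if "norm y < 1" for y
    using True that by (auto simp: polydisc_def upd_nth) metis
   define x0 where "x0 = upd x i 0"
   have line: "upd x i y = x0 + y *s axis i 1" for y by (simp add: x0_def vec_eq_iff upd_nth axis_def)
   have h: "(%y. f (upd x i y)) holomorphic_on ball 0 1"
   proof -
    have "\<exists>D. ((%l. f (x0 + l *s axis i 1)) has_field_derivative D) (at y)" if "norm y < 1" for y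
     by (rule holo_along_line[OF f]) (use inp[OF that] line[of y] in simp)
    then show ?thesis unfolding line by (simp add: holomorphic_on_open)
   qed
   have "G (upd x i (a $ i)) = nsq (f (upd x i (a $ i)))" using True by (simp add: G_def)
   also have "... <= ennreal (C1 * (1 - norm (a $ i)) powr (- (\<beta>+2))) * (\<integral>\<^sup>+z. nsq (f (upd x i z)) * indicator (ball (a $ i) R) z \<partial>dA \<beta>)"
    unfolding R_def by (rule mv[OF h ai])
   also have "... <= ennreal (C1 * (1 - norm (a $ i)) powr (- (\<beta>+2))) * (\<integral>\<^sup>+z. indicator (ball (a $ i) R) z * G (upd x i z) \<partial>mm \<beta>)"
    unfolding mm_dA[OF beta]
   proof (intro mult_left_mono nn_integral_mono)
    fix z
    show "nsq (f (upd x i z)) * indicator (ball (a $ i) R) z <= indicator (ball (a $ i) R) z * G (upd x i z)"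
    proof (cases "z \<in> ball (a $ i) R")
     case True
     then have "norm z < 1" using ai norm_triangle_ineq2[of z "a $ i"] by (simp add: R_def dist_norm norm_minus_commute)
     then show ?thesis using inp[of z] by (simp add: G_def mult.commute)
    qed simp
   qed simp
   also have "... = (\<integral>\<^sup>+z. ennreal (C1 * (1 - norm (a $ i)) powr (- (\<beta>+2))) * (indicator (ball (a $ i) R) z * G (upd x i z)) \<partial>mm \<beta>)"
    by (rule nn_integral_cmult[symmetric], intro borel_measurable_times_ennreal borel_measurable_indicator) (simp, measurable)
   finally show ?thesis by (simp add: K_def R_def mult.assoc)
  qed
 qed measurable
 moreover have "G a = nsq (f a)" using a by (simp add: G_def)
 ultimately show ?thesis by (simp add: G_def K_def)
qed

text \<open>Exchanges centre and point: if y_i lies in the disc of radius (1 - |a_i|)/2 about a_i,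
  then a_i lies in the disc of radius 1 - |y_i| about y_i, and 1 - |y_i| \<le> 2 (1 - |a_i|).
  Afterwards a occurs only in the indicator.\<close>

lemma kernel_product_bound:
 fixes a y :: "complex^'n"
 assumes C1: "C1 > 0" and s: "s > 0" and a: "a \<in> polydisc"
 shows "(\<Prod>i\<in>UNIV. ennreal (C1 * (1 - norm (a $ i)) powr (- s)) * indicator (ball (a $ i) ((1 - norm (a $ i))/2)) (y $ i))
  <= ennreal (\<Prod>i\<in>UNIV. C1 * 2 powr s * (1 - norm (y $ i)) powr (- s)) * indicator {y. \<forall>i. norm (a $ i - y $ i) <= 1 - norm (y $ i)} y"
proof (cases "\<forall>i. y $ i \<in> ball (a $ i) ((1 - norm (a $ i))/2)")
 case False
 then obtain i where "y $ i \<notin> ball (a $ i) ((1 - norm (a $ i))/2)" by blast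
 then have 0: "(\<Prod>i\<in>UNIV. ennreal (C1 * (1 - norm (a $ i)) powr (- s)) * indicator (ball (a $ i) ((1 - norm (a $ i))/2)) (y $ i)) = 0"
  by (intro prod_zero bexI[of _ i]) auto
 show ?thesis unfolding 0 by simp
next
 case True
 have ai: "norm (a $ i) < 1" for i using polydisc_component[OF a] by simp
 have d: "norm (a $ i - y $ i) < (1 - norm (a $ i))/2" for i using True by (simp add: dist_norm)
 have t1: "norm (y $ i) <= norm (a $ i) + norm (a $ i - y $ i)" for i using norm_triangle_ineq2[of "y $ i" "a $ i"] by (simp add: norm_minus_commute)
 have t2: "norm (a $ i) <= norm (y $ i) + norm (a $ i - y $ i)" for i using norm_triangle_ineq2[of "a $ i" "y $ i"] by simp
 have tube: "norm (a $ i - y $ i) <= 1 - norm (y $ i)" for i using d[of i] t1[of i] by simp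
 have pos: "0 < 1 - norm (y $ i)" for i using d[of i] t1[of i] ai[of i] by simp
 have up: "1 - norm (y $ i) <= 2 * (1 - norm (a $ i))" for i using d[of i] t2[of i] ai[of i] by (simp add: field_simps)
 have "C1 * (1 - norm (a $ i)) powr (- s) <= C1 * 2 powr s * (1 - norm (y $ i)) powr (- s)" for i
 proof -
  have "(2 * (1 - norm (a $ i))) powr (- s) <= (1 - norm (y $ i)) powr (- s)" using up[of i] pos[of i] s by (intro powr_mono2') auto
  then have "2 powr s * (2 * (1 - norm (a $ i))) powr (- s) <= 2 powr s * (1 - norm (y $ i)) powr (- s)" by (intro mult_left_mono) auto
  moreover have "2 powr s * (2 * (1 - norm (a $ i))) powr (- s) = (1 - norm (a $ i)) powr (- s)"
   by (simp only: powr_mult) (simp add: powr_minus)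
  ultimately have "(1 - norm (a $ i)) powr (- s) <= 2 powr s * (1 - norm (y $ i)) powr (- s)" by (simp only:)
  then show ?thesis using C1 by (simp add: mult.assoc)
 qed
 then have "(\<Prod>i\<in>UNIV. ennreal (C1 * (1 - norm (a $ i)) powr (- s)) * indicator (ball (a $ i) ((1 - norm (a $ i))/2)) (y $ i))
   <= (\<Prod>i\<in>UNIV. ennreal (C1 * 2 powr s * (1 - norm (y $ i)) powr (- s)))"
  using True by (intro ennreal_prod_mono) (auto intro!: ennreal_leI)
 also have "... = ennreal (\<Prod>i\<in>UNIV. C1 * 2 powr s * (1 - norm (y $ i)) powr (- s))" using C1 by (intro prod_ennreal) auto
 finally show ?thesis using tube by simp
qed

context smooth_selfmap begin

text \<open>Inserting the mean value estimate at \<phi> z and integrating over z first leaves, for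
  each y, the measure of the preimage of the box at y. The Carleson condition cancels the
  normalizing powers in \<open>H y\<close>.\<close>

lemma bergman_carleson:
 assumes beta: "\<beta> > -1" and C: "C > 0"
  and est: "\<forall>w\<in>polydisc. emeasure (mu \<beta>) {z\<in>polydisc. \<forall>i. norm (\<phi> z $ i - w $ i) <= 1 - norm (w $ i)}
   <= ennreal (C * (\<Prod>i\<in>UNIV. (1 - norm (w $ i)) powr (\<beta> + 2)))"
 shows "composition_bounded \<beta> \<phi>"
proof -
 interpret coord_measure "mm \<beta>" using coord_measure_mm beta by simp
 interpret fv: finite_measure "vm :: (complex^'n) measure" by (rule finite_measure_vm)
 interpret pair_sigma_finite "vm :: (complex^'n) measure" "vm :: (complex^'n) measure" ..
 obtain C1 where C1: "C1 > 0" and mv: "\<And>h a. h holomorphic_on ball 0 1 ==> norm a < 1 ==> nsq (h a) <=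
   ennreal (C1 * (1 - norm a) powr (- (\<beta>+2))) * (\<integral>\<^sup>+z. nsq (h z) * indicator (ball a ((1 - norm a)/2)) z \<partial>dA \<beta>)"
  by (rule mean_value_dA[OF beta]) (rule that, assumption, blast)
 define s where "s = \<beta> + 2"
 \<comment> \<open>\<phi> is unrestricted off the closed polydisc; cutting it off makes it Borel on
   the whole space.\<close>
 define \<Phi> where "\<Phi> z = (if z \<in> polydisc then \<phi> z else 0)" for z
 have Phi[measurable]: "\<Phi> \<in> borel_fun" unfolding \<Phi>_def[abs_def]
  by (rule borel_measurable_continuous_on_if) (auto intro: continuous_on_subset[OF cont polydisc_subset])
 define W where "W = {p :: (complex^'n) \<times> (complex^'n). fst p \<in> polydisc \<and> (\<forall>i\<in>UNIV. norm (\<Phi> (fst p) $ i - snd p $ i) <= 1 - norm (snd p $ i))}"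
 have W[measurable]: "W \<in> sets (vm \<Otimes>\<^sub>M vm)"
 proof -
  have sp: "space (vm \<Otimes>\<^sub>M vm) = (UNIV :: ((complex^'n) \<times> (complex^'n)) set)" by (simp add: space_pair_measure)
  have 1: "{p \<in> space (vm \<Otimes>\<^sub>M vm). fst p \<in> (polydisc :: (complex^'n) set)} \<in> sets (vm \<Otimes>\<^sub>M vm)" by measurable
  have "{p \<in> space (vm \<Otimes>\<^sub>M vm). norm (\<Phi> (fst p) $ i - snd p $ i) <= 1 - norm (snd p $ i)} \<in> sets (vm \<Otimes>\<^sub>M vm)" for i by measurable
  then have 2: "{p \<in> space (vm \<Otimes>\<^sub>M vm). \<forall>i\<in>UNIV. norm (\<Phi> (fst p) $ i - snd p $ i) <= 1 - norm (snd p $ i)} \<in> sets (vm \<Otimes>\<^sub>M vm)"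
   by (intro sets.sets_Collect_finite_All) auto
  have "W = {p \<in> space (vm \<Otimes>\<^sub>M vm). fst p \<in> polydisc} \<inter> {p \<in> space (vm \<Otimes>\<^sub>M vm). \<forall>i\<in>UNIV. norm (\<Phi> (fst p) $ i - snd p $ i) <= 1 - norm (snd p $ i)}"
   unfolding W_def sp by auto
  then show ?thesis using sets.Int[OF 1 2] by simp
 qed
 define H where "H y = (\<Prod>i\<in>UNIV. C1 * 2 powr s * (1 - norm (y $ i)) powr (- s))" for y :: "complex^'n"
 have Hm[measurable]: "H \<in> borel_fun" unfolding H_def[abs_def] by measurable
 define C2 where "C2 = C * (C1 * 2 powr s) ^ CARD('n)"
 show ?thesis
 proof (rule composition_boundedI[of C2])
  show "C2 >= 0" using C C1 by (simp add: C2_def)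
  show "holo_on (f \<circ> \<phi>) polydisc" if "holo_on f polydisc" for f by (rule holo_on_comp[OF that])
  fix f :: "complex^'n => complex" assume f: "holo_on f polydisc"
  define G where "G z = nsq (f z) * indicator polydisc z" for z
  have Gm[measurable]: "G \<in> borel_fun"
   unfolding G_def[abs_def] by (rule borel_on_indicator(1)[OF holo_on_continuous[OF f] borel_sets(1)])
  have pt: "nsq (f (\<phi> z)) * indicator polydisc z <= (\<integral>\<^sup>+y. ennreal (H y) * G y * indicator W (z, y) \<partial>vm)" for z
  proof (cases "z \<in> polydisc")
   case True
   have pz: "\<phi> z \<in> polydisc" by (rule map_polydisc[OF True])
   have "nsq (f (\<phi> z)) <= (\<integral>\<^sup>+y. (\<Prod>i\<in>UNIV. ennreal (C1 * (1 - norm (\<phi> z $ i)) powr (- s)) * indicator (ball (\<phi> z $ i) ((1 - norm (\<phi> z $ i))/2)) (y $ i)) * G y \<partial>vm)"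
    unfolding s_def G_def by (rule polydisc_kernel[OF beta mv f pz])
   also have "... <= (\<integral>\<^sup>+y. (ennreal (H y) * indicator {y. \<forall>i. norm (\<phi> z $ i - y $ i) <= 1 - norm (y $ i)} y) * G y \<partial>vm)"
    unfolding H_def by (intro nn_integral_mono mult_right_mono kernel_product_bound C1 pz) (use beta in \<open>auto simp: s_def\<close>)
   also have "... = (\<integral>\<^sup>+y. ennreal (H y) * G y * indicator W (z, y) \<partial>vm)"
    using True by (intro nn_integral_cong) (auto simp: W_def \<Phi>_def split: split_indicator)
   finally show ?thesis using True by simp
  qed simp
  have "A2_sq \<beta> (f \<circ> \<phi>) = (\<integral>\<^sup>+z. nsq (f (\<phi> z)) * indicator polydisc z \<partial>vm)"
   using beta by (simp add: A2_sq_def bergman_sq_def mu_dV)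
  also have "... <= (\<integral>\<^sup>+z. \<integral>\<^sup>+y. ennreal (H y) * G y * indicator W (z, y) \<partial>vm \<partial>vm)" by (intro nn_integral_mono pt)
  also have "... = (\<integral>\<^sup>+y. \<integral>\<^sup>+z. ennreal (H y) * G y * indicator W (z, y) \<partial>vm \<partial>vm)"
   by (rule Fubini'[symmetric]) measurable
  also have "... <= (\<integral>\<^sup>+y. ennreal C2 * G y \<partial>vm)"
  proof (intro nn_integral_mono)
   fix y :: "complex^'n"
   show "(\<integral>\<^sup>+z. ennreal (H y) * G y * indicator W (z, y) \<partial>vm) <= ennreal C2 * G y"
   proof (cases "y \<in> polydisc")
    case True
    define Ey where "Ey = {z\<in>polydisc. \<forall>i. norm (\<phi> z $ i - y $ i) <= 1 - norm (y $ i)}"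
    have eq: "indicator W (z, y) = (indicator Ey z :: ennreal)" for z by (auto simp: W_def Ey_def \<Phi>_def split: split_indicator)
    have Ey: "Ey \<in> sets borel"
    proof -
     have "{z. (z, y) \<in> W} \<in> sets vm" using sets_Pair2[OF W, of y] by (simp add: vimage_def)
     moreover have "{z. (z, y) \<in> W} = Ey" by (auto simp: W_def Ey_def \<Phi>_def)
     ultimately show ?thesis by simp
    qed
    have pos: "0 < 1 - norm (y $ i)" for i using polydisc_component[OF True, of i] by simp
    have HC: "H y * (C * (\<Prod>i\<in>UNIV. (1 - norm (y $ i)) powr s)) = C2"
    proof -
     have "H y * (\<Prod>i\<in>UNIV. (1 - norm (y $ i)) powr s) = (\<Prod>i\<in>(UNIV::'n set). C1 * 2 powr s)"
      unfolding H_def prod.distrib[symmetric]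
     proof (intro prod.cong refl)
      fix i
      show "C1 * 2 powr s * (1 - norm (y $ i)) powr - s * (1 - norm (y $ i)) powr s = C1 * 2 powr s"
       using pos[of i] by (simp add: powr_minus)
     qed
     then show ?thesis by (simp add: C2_def mult_ac)
    qed
    have "(\<integral>\<^sup>+z. ennreal (H y) * G y * indicator W (z, y) \<partial>vm) = ennreal (H y) * G y * emeasure vm Ey"
     unfolding eq using Ey by (intro nn_integral_cmult_indicator) simp
    also have "... <= ennreal (H y) * G y * ennreal (C * (\<Prod>i\<in>UNIV. (1 - norm (y $ i)) powr s))"
     unfolding Ey_def s_def by (intro mult_left_mono est[rule_format, OF True]) simp
    also have "... = ennreal (H y * (C * (\<Prod>i\<in>UNIV. (1 - norm (y $ i)) powr s))) * G y"
     using C C1 by (subst ennreal_mult) (auto simp: H_def mult_ac intro!: prod_nonneg mult_nonneg_nonneg)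
    finally show ?thesis unfolding HC .
   qed (simp add: G_def)
  qed
  also have "... = ennreal C2 * (\<integral>\<^sup>+y. G y \<partial>vm)" by (rule nn_integral_cmult) measurable
  also have "(\<integral>\<^sup>+y. G y \<partial>vm) = A2_sq \<beta> f" using beta by (simp add: A2_sq_def bergman_sq_def mu_dV G_def)
  finally show "A2_sq \<beta> (f \<circ> \<phi>) <= ennreal C2 * A2_sq \<beta> f" .
 qed
qed

theorem bergman_sufficiency:
 assumes "condA" "condB" "\<beta> > -1" "\<beta> >= real CARD('n) - 3"
 shows "composition_bounded \<beta> \<phi>"
 using global_estimate[OF assms] bergman_carleson[OF assms(3)] by blast

end

section \<open>Sufficiency in the Hardy case\<close>

text \<open>The value 0 off the circle |z_k| = 1, which carries the arc measure, lets pointwise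
  bounds hold at every z.\<close>

definition coord_max :: "real set => 'n => (complex^'n => ennreal) => complex^'n => ennreal" where
 "coord_max R k G z = (if norm (z $ k) = 1 then Mx R (%y. G (upd z k y)) (z $ k) else 0)"

lemma upd_self: "upd z k (z $ k) = z" by (simp add: vec_eq_iff upd_nth)
lemma upd_upd: "upd (upd z k x) k y = upd z k y" by (simp add: vec_eq_iff upd_nth)
lemma upd_commute: "k \<noteq> l ==> upd (upd z k x) l y = upd (upd z l y) k x" by (auto simp: vec_eq_iff upd_nth)

text \<open>On the unit circle |1 - r u| \<ge> 1 - r, so changing the radius by at most 1 - r at
  most doubles |1 - r u|, while the numerator grows as the radius shrinks. An arbitrary radius can
  thus be replaced by one from a finite grid.\<close>

lemma poisson_le_scaled:
 assumes e: "norm e = 1" "norm y = 1" and r: "0 <= r'" "r' <= r" "r < 1" and "r - r' <= 1 - r"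
 shows "poisson (of_real r * e) y <= 4 * poisson (of_real r' * e) y"
proof -
 define u where "u = cnj e * y"
 have u: "norm u = 1" using e by (simp add: u_def norm_mult)
 have d: "norm (1 - of_real r * u) >= 1 - r" using norm_triangle_ineq2[of 1 "of_real r * u"] u r by (simp add: norm_mult)
 then have d0: "norm (1 - of_real r * u) > 0" using r by linarith
 have "norm (1 - of_real r' * u) >= 1 - r'" using norm_triangle_ineq2[of 1 "of_real r' * u"] u r by (simp add: norm_mult)
 then have d': "norm (1 - of_real r' * u) > 0" using r by linarith
 have "1 - of_real r' * u = (1 - of_real r * u) + of_real (r - r') * u" by (simp add: algebra_simps)
 then have "norm (1 - of_real r' * u) <= norm (1 - of_real r * u) + norm (of_real (r - r') * u)" by (metis norm_triangle_ineq)
 also have "norm (of_real (r - r') * u) = r - r'" using u r by (simp add: norm_mult del: of_real_diff)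
 also have "norm (1 - of_real r * u) + (r - r') <= 2 * norm (1 - of_real r * u)" using d assms(6) by simp
 finally have "(norm (1 - of_real r' * u))^2 <= (2 * norm (1 - of_real r * u))^2" by (intro power_mono) auto
 then have n: "(norm (1 - of_real r' * u))^2 <= 4 * (norm (1 - of_real r * u))^2" by (simp add: power_mult_distrib)
 have rr: "r'\<^sup>2 <= r\<^sup>2" using r by (intro power_mono) auto
 have r1: "r\<^sup>2 <= 1" using r by (intro power_le_one) auto
 have "(1 - r\<^sup>2) * (norm (1 - of_real r' * u))^2 <= (1 - r'\<^sup>2) * (4 * (norm (1 - of_real r * u))^2)"
  using rr r1 n by (intro mult_mono) auto
 then have "(1 - r\<^sup>2) / (norm (1 - of_real r * u))^2 <= 4 * ((1 - r'\<^sup>2) / (norm (1 - of_real r' * u))^2)"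
  using d0 d' by (simp add: field_simps)
 then show ?thesis using e r by (simp add: poisson_def norm_mult u_def mult.assoc)
qed

text \<open>The same doubling of the denominator's modulus, here for a displacement t \<le> 1 - r
  along the circle.\<close>

lemma poisson_le_rotated:
 assumes e: "norm e = 1" "norm e' = 1" "norm y = 1" and r: "0 <= r" "r <= 1 - t" "t > 0" and "norm (e - e') <= t"
 shows "poisson (of_real r * e) y <= 4 * poisson (of_real r * e') y"
proof -
 have d: "norm (1 - of_real r * cnj e * y) >= 1 - r" using norm_triangle_ineq2[of 1 "of_real r * cnj e * y"] e r by (simp add: norm_mult)
 then have d0: "norm (1 - of_real r * cnj e * y) > 0" using r by linarith
 have "norm (1 - of_real r * cnj e' * y) >= 1 - r" using norm_triangle_ineq2[of 1 "of_real r * cnj e' * y"] e r by (simp add: norm_mult)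
 then have d': "norm (1 - of_real r * cnj e' * y) > 0" using r by linarith
 have "1 - of_real r * cnj e' * y = (1 - of_real r * cnj e * y) + of_real r * cnj (e - e') * y" by (simp add: algebra_simps)
 then have "norm (1 - of_real r * cnj e' * y) <= norm (1 - of_real r * cnj e * y) + norm (of_real r * cnj (e - e') * y)"
  by (metis norm_triangle_ineq)
 also have "norm (of_real r * cnj (e - e') * y) = r * norm (e - e')" using e r by (simp add: norm_mult del: complex_cnj_diff)
 also have "r * norm (e - e') <= 1 * t" using r assms(7) by (intro mult_mono) auto
 finally have "norm (1 - of_real r * cnj e' * y) <= 2 * norm (1 - of_real r * cnj e * y)" using d r by simp
 then have "(norm (1 - of_real r * cnj e' * y))^2 <= (2 * norm (1 - of_real r * cnj e * y))^2" by (intro power_mono) auto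
 then have n: "(norm (1 - of_real r * cnj e' * y))^2 <= 4 * (norm (1 - of_real r * cnj e * y))^2" by (simp add: power_mult_distrib)
 have "r\<^sup>2 <= 1" using r by (intro power_le_one) auto
 then have "(1 - r\<^sup>2) * (norm (1 - of_real r * cnj e' * y))^2 <= (1 - r\<^sup>2) * (4 * (norm (1 - of_real r * cnj e * y))^2)"
  using n by (intro mult_left_mono) auto
 then have "(1 - r\<^sup>2) / (norm (1 - of_real r * cnj e * y))^2 <= 4 * ((1 - r\<^sup>2) / (norm (1 - of_real r * cnj e' * y))^2)"
  using d0 d' by (simp add: field_simps)
 then show ?thesis using e r by (simp add: poisson_def norm_mult)
qed

lemma nn_integral_arc_cmono:
 assumes [measurable]: "g \<in> borel_fun" and le: "\<And>y. norm y = 1 ==> f y <= c * g y"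
 shows "(ARC y. f y) <= c * (ARC y. g y)"
proof -
 have "(ARC y. f y) <= (ARC y. c * g y)"
  by (rule nn_integral_mono_AE) (use AE_arc le in auto)
 also have "... = c * (ARC y. g y)" by (rule nn_integral_cmult) (simp add: arc_measure_def)
 finally show ?thesis .
qed

lemma coord_max_measurable [measurable]:
 assumes "finite R" and [measurable]: "G \<in> borel_fun"
 shows "coord_max R k G \<in> borel_fun"
proof -
 have [simp]: "countable R" using assms(1) by (rule countable_finite)
 show ?thesis unfolding coord_max_def[abs_def] Mx_def by measurable
qed

lemma coord_max_le:
 assumes R: "R \<subseteq> {0..<1}" and G: "\<And>z. G z <= B" shows "coord_max R k G z <= B"
proof (cases "norm (z $ k) = 1")
 case True
 have "(ARC y. ennreal (poisson (of_real r * z $ k) y) * G (upd z k y)) <= B" if r: "r \<in> R" for r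
 proof -
  have "(ARC y. ennreal (poisson (of_real r * z $ k) y) * G (upd z k y)) <= B * (ARC y. ennreal (poisson (of_real r * z $ k) y))"
   by (rule nn_integral_arc_cmono) (auto simp: mult.commute[of B] intro: mult_left_mono G)
  also have "(ARC y. ennreal (poisson (of_real r * z $ k) y)) = 1"
   by (rule poisson_int) (use R r True in \<open>auto simp: norm_mult\<close>)
  finally show ?thesis by simp
 qed
 then show ?thesis using True by (auto simp: coord_max_def Mx_def intro: SUP_least)
qed (simp add: coord_max_def)

text \<open>\<open>resample\<close> averages over the k-th coordinate, where
  \<open>maximal_L2\<close> applies with the other coordinates frozen.\<close>

lemma coord_max_L2:
 fixes G :: "complex^'n => ennreal"
 assumes R: "finite R" "R \<noteq> {}" "R \<subseteq> {0..<1}"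
  and G[measurable]: "G \<in> borel_fun" and B: "\<And>z. G z <= ennreal B" "B >= 0"
 shows "(\<integral>\<^sup>+z. (coord_max R k G z)^2 \<partial>mu (-1)) <= 64 * (\<integral>\<^sup>+z. (G z)^2 \<partial>mu (-1))"
proof -
 interpret coord_measure arc_measure using coord_measure_mm[of "-1"] by (simp add: mm_arc)
 have sq: "(%z. (coord_max R k G z)^2) \<in> borel_fun"
  unfolding power2_eq_square by (intro borel_measurable_times_ennreal coord_max_measurable[OF R(1) G])
 have "(\<integral>\<^sup>+z. (coord_max R k G z)^2 \<partial>vm) = (\<integral>\<^sup>+z. (ARC y. (coord_max R k G (upd z k y))^2) \<partial>vm)"
  by (rule resample[OF sq arc_prob])
 also have "... <= (\<integral>\<^sup>+z. 64 * (ARC y. (G (upd z k y))^2) \<partial>vm)"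
 proof (intro nn_integral_mono)
  fix z :: "complex^'n"
  have "(ARC y. (coord_max R k G (upd z k y))^2) <= (ARC y. (Mx R (%y. G (upd z k y)) y)^2)"
   by (intro nn_integral_mono) (simp add: coord_max_def upd_upd upd_nth)
  also have "... <= 64 * (ARC y. (G (upd z k y))^2)"
   by (rule maximal_L2[OF R, where B = B]) (use B in \<open>auto\<close>)
  finally show "(ARC y. (coord_max R k G (upd z k y))^2) <= 64 * (ARC y. (G (upd z k y))^2)" .
 qed
 also have "... = 64 * (\<integral>\<^sup>+z. (ARC y. (G (upd z k y))^2) \<partial>vm)" by (rule nn_integral_cmult) measurable
 also have "(\<integral>\<^sup>+z. (ARC y. (G (upd z k y))^2) \<partial>vm) = (\<integral>\<^sup>+z. (G z)^2 \<partial>vm)"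
  by (rule resample[symmetric, OF _ arc_prob]) measurable
 finally show ?thesis by (simp add: mm_arc)
qed

text \<open>The function f and the factor b are there for nesting: G may itself be a maximal
  function in another coordinate that dominates f up to b.\<close>

lemma coord_max_ge:
 assumes R: "r \<in> R" and G[measurable]: "G \<in> borel_fun" and z: "norm (z $ k) = 1"
  and P: "\<And>y. norm y = 1 ==> poisson w y <= c * poisson (of_real r * z $ k) y" and c: "c >= 0"
  and f: "\<And>y. norm y = 1 ==> f y <= b * G (upd z k y)"
 shows "(ARC y. ennreal (poisson w y) * f y) <= ennreal c * b * coord_max R k G z"
proof -
 have "(ARC y. ennreal (poisson w y) * f y) <= ennreal c * b * (ARC y. ennreal (poisson (of_real r * z $ k) y) * G (upd z k y))"
 proof (rule nn_integral_arc_cmono)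
  fix y :: complex assume y: "norm y = 1"
  have "ennreal (poisson w y) * f y <= ennreal (c * poisson (of_real r * z $ k) y) * (b * G (upd z k y))"
   using P[OF y] f[OF y] by (intro mult_mono ennreal_leI) auto
  also have "... = ennreal c * b * (ennreal (poisson (of_real r * z $ k) y) * G (upd z k y))"
   using c by (simp add: ennreal_mult' mult_ac)
  finally show "ennreal (poisson w y) * f y <= ennreal c * b * (ennreal (poisson (of_real r * z $ k) y) * G (upd z k y))" .
 qed measurable
 also have "... <= ennreal c * b * coord_max R k G z" using z R by (auto simp: coord_max_def Mx_def intro!: mult_left_mono SUP_upper)
 finally show ?thesis .
qed

lemma coord_max_mono:
 assumes G[measurable]: "G \<in> borel_fun" and z: "z $ k = z' $ k" and le: "\<And>y. norm y = 1 ==> G (upd z k y) <= c * G (upd z' k y)"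
 shows "coord_max R k G z <= c * coord_max R k G z'"
proof (cases "norm (z $ k) = 1")
 case True
 have "(ARC y. ennreal (poisson (of_real r * z $ k) y) * G (upd z k y)) <= c * coord_max R k G z'" if r: "r \<in> R" for r
  using coord_max_ge[OF r G, of z' k "of_real r * z $ k" 1 "%y. G (upd z k y)" c] True le z by simp
 then show ?thesis using True by (auto simp: coord_max_def[of R k G z] Mx_def intro: SUP_least)
qed (simp add: coord_max_def)

lemma coord_max_harnack:
 assumes R: "R \<subseteq> {0..1 - t}" "t > 0" and G[measurable]: "G \<in> borel_fun"
  and e: "norm (z $ k) = 1" "norm e = 1" "norm (z $ k - e) <= t"
 shows "coord_max R k G z <= 4 * coord_max R k G (upd z k e)"
proof -
 have "(ARC y. ennreal (poisson (of_real r * z $ k) y) * G (upd z k y)) <= 4 * coord_max R k G (upd z k e)" if r: "r \<in> R" for r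
 proof -
  have "(ARC y. ennreal (poisson (of_real r * z $ k) y) * G (upd z k y)) <= ennreal 4 * 1 * coord_max R k G (upd z k e)"
  proof (rule coord_max_ge[OF r G])
   fix y :: complex assume "norm y = 1"
   then show "poisson (of_real r * z $ k) y <= 4 * poisson (of_real r * upd z k e $ k) y"
    using poisson_le_rotated[OF e(1,2), of y r t] R r e(3) by (auto simp: upd_nth)
  qed (use e in \<open>auto simp: upd_nth upd_upd\<close>)
  then show ?thesis by simp
 qed
 then show ?thesis using e by (auto simp: coord_max_def[of R k G z] Mx_def intro: SUP_least)
qed

lemma ennreal_cancel_factor:
 assumes q: "q > 0" and le: "x * ennreal q <= ennreal (q * c) * y" and c: "c >= 0" shows "x <= ennreal c * y"
proof -
 have "x = x * ennreal q * ennreal (1 / q)" using q by (simp add: mult.assoc ennreal_mult'[symmetric])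
 also have "... <= ennreal (q * c) * y * ennreal (1 / q)" by (intro mult_right_mono le) simp
 also have "... = ennreal c * y" using q c by (simp add: mult.commute[of _ "ennreal (1 / q)"] mult.assoc[symmetric] ennreal_mult'[symmetric])
 finally show ?thesis .
qed

text \<open>By Harnack, the square of a maximal function at scale \<open>t\<close> is controlled by its averages over boxes of side \<open>t\<close>,
 so the push-forward of the surface measure only has to be compared with it at that scale.\<close>

lemma maximal_transfer:
 fixes M :: "complex^'n => ennreal" and F :: "complex^'n => complex^'n"
 assumes t: "0 < t" "t <= 1" and M[measurable]: "M \<in> borel_fun" and F[measurable]: "F \<in> borel_fun"
  and U[measurable]: "U \<in> sets borel" and FU: "\<And>\<zeta>. \<zeta> \<in> U ==> F \<zeta> \<in> torus"
  and harn: "\<And>e e'. e \<in> torus ==> e' \<in> torus ==> (\<forall>i. norm (e $ i - e' $ i) <= t) ==> M e <= ennreal H * M e'" and H: "H >= 0"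
  and dens: "\<And>e. emeasure (mu (-1)) {\<zeta>\<in>U. \<forall>i. norm (F \<zeta> $ i - e $ i) <= t} <= ennreal (C * t ^ CARD('n))" and C: "C >= 0"
 shows "(\<integral>\<^sup>+\<zeta>. (M (F \<zeta>))^2 * indicator U \<zeta> \<partial>mu (-1)) <= ennreal (H\<^sup>2 * C * (2*pi) ^ CARD('n)) * (\<integral>\<^sup>+e. (M e)^2 \<partial>mu (-1))"
proof -
 interpret coord_measure arc_measure using coord_measure_mm[of "-1"] by (simp add: mm_arc)
 interpret fv: finite_measure "vm :: (complex^'n) measure" by (rule finite_measure_vm)
 interpret pair_sigma_finite "vm :: (complex^'n) measure" "vm :: (complex^'n) measure" ..
 have AEt: "AE e in (vm :: (complex^'n) measure). e \<in> torus" unfolding mm_arc[symmetric] mu_torus by (rule AE_torus)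
 \<comment> \<open>A lower bound for the mass of a box of side t centred at a point of the torus;
   \<open>pt\<close> spreads the square of M at F \<zeta> over such a box by means of
   \<open>harn\<close>.\<close>
 define q where "q = (t / (2*pi)) ^ CARD('n)"
 have q: "q > 0" using t by (simp add: q_def)
 define W where "W = {p :: (complex^'n) \<times> (complex^'n). \<forall>i\<in>UNIV. norm (F (fst p) $ i - snd p $ i) <= t}"
 have W[measurable]: "W \<in> sets (vm \<Otimes>\<^sub>M vm)"
 proof -
  have "{p \<in> space (vm \<Otimes>\<^sub>M vm). norm (F (fst p) $ i - snd p $ i) <= t} \<in> sets (vm \<Otimes>\<^sub>M (vm :: (complex^'n) measure))" for i by measurable
  then have "{p \<in> space (vm \<Otimes>\<^sub>M vm). \<forall>i\<in>UNIV. norm (F (fst p) $ i - snd p $ i) <= t} \<in> sets (vm \<Otimes>\<^sub>M (vm :: (complex^'n) measure))"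
   by (intro sets.sets_Collect_finite_All) auto
  then show ?thesis by (simp add: W_def space_pair_measure)
 qed
 have pt: "(M (F \<zeta>))^2 * indicator U \<zeta> * ennreal q <= (\<integral>\<^sup>+e. ennreal (H\<^sup>2) * (M e)^2 * (indicator W (\<zeta>, e) * indicator U \<zeta>) \<partial>vm)" for \<zeta>
 proof (cases "\<zeta> \<in> U")
  case True
  define A where "A i = ball (F \<zeta> $ i) t" for i
  define Bx where "Bx = {e :: complex^'n. \<forall>i. e $ i \<in> A i}"
  have Bx: "Bx \<in> sets borel"
  proof -
   have "(%e :: complex^'n. e $ i) -` A i \<in> sets borel" for i
    using measurable_sets[OF vec_nth_measurable[of i], of "A i"] by (simp add: A_def)
   then have "(\<Inter>i. (%e :: complex^'n. e $ i) -` A i) \<in> sets borel" by (intro sets.finite_INT) auto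
   moreover have "Bx = (\<Inter>i. (%e :: complex^'n. e $ i) -` A i)" by (auto simp: Bx_def)
   ultimately show ?thesis by simp
  qed
  have "ennreal q = (\<Prod>i\<in>(UNIV::'n set). ennreal (t / (2*pi)))" using t by (simp add: q_def ennreal_power)
  also have "... <= (\<Prod>i\<in>UNIV. emeasure arc_measure (A i))"
   using FU[OF True] t unfolding A_def by (intro ennreal_prod_mono arc_ball_lower) (auto simp: torus_def)
  also have "... = emeasure vm Bx" unfolding Bx_def by (rule emeasure_vm_box[symmetric]) (simp add: A_def)
  finally have "(M (F \<zeta>))^2 * ennreal q <= (M (F \<zeta>))^2 * emeasure vm Bx" by (rule mult_left_mono) simp
  also have "... = (\<integral>\<^sup>+e. (M (F \<zeta>))^2 * indicator Bx e \<partial>vm)" using Bx by (intro nn_integral_cmult_indicator[symmetric]) simp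
  also have "... <= (\<integral>\<^sup>+e. ennreal (H\<^sup>2) * (M e)^2 * (indicator W (\<zeta>, e) * indicator U \<zeta>) \<partial>vm)"
  proof (rule nn_integral_mono_AE, use AEt in eventually_elim)
   fix e :: "complex^'n" assume e: "e \<in> torus"
   show "(M (F \<zeta>))^2 * indicator Bx e <= ennreal (H\<^sup>2) * (M e)^2 * (indicator W (\<zeta>, e) * indicator U \<zeta>)"
   proof (cases "e \<in> Bx")
    case b: True
    then have near: "\<forall>i. norm (F \<zeta> $ i - e $ i) <= t" by (auto simp: Bx_def A_def dist_norm less_imp_le)
    have "(M (F \<zeta>))^2 <= (ennreal H * M e)^2" by (intro power_mono harn FU[OF True] e near) simp
    also have "... = ennreal (H\<^sup>2) * (M e)^2" using H by (simp add: power_mult_distrib ennreal_power)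
    finally show ?thesis using near True b by (simp add: W_def)
   qed simp
  qed
  finally show ?thesis using True by simp
 qed simp
 have Wm: "(%p. ennreal (H\<^sup>2) * (M (snd p))^2 * (indicator W p * indicator U (fst p))) \<in> borel_measurable (vm \<Otimes>\<^sub>M vm)"
  by measurable
 have "(\<integral>\<^sup>+\<zeta>. (M (F \<zeta>))^2 * indicator U \<zeta> \<partial>vm) * ennreal q = (\<integral>\<^sup>+\<zeta>. (M (F \<zeta>))^2 * indicator U \<zeta> * ennreal q \<partial>vm)"
  by (rule nn_integral_multc[symmetric]) measurable
 also have "... <= (\<integral>\<^sup>+\<zeta>. \<integral>\<^sup>+e. ennreal (H\<^sup>2) * (M e)^2 * (indicator W (\<zeta>, e) * indicator U \<zeta>) \<partial>vm \<partial>vm)" by (intro nn_integral_mono pt)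
 also have "... = (\<integral>\<^sup>+e. \<integral>\<^sup>+\<zeta>. ennreal (H\<^sup>2) * (M e)^2 * (indicator W (\<zeta>, e) * indicator U \<zeta>) \<partial>vm \<partial>vm)"
  by (rule Fubini'[symmetric]) (use Wm in \<open>simp add: case_prod_beta'\<close>)
 also have "... <= (\<integral>\<^sup>+e. ennreal (H\<^sup>2 * C * t ^ CARD('n)) * (M e)^2 \<partial>vm)"
 proof (intro nn_integral_mono)
  fix e :: "complex^'n"
  define E where "E = {\<zeta>\<in>U. \<forall>i. norm (F \<zeta> $ i - e $ i) <= t}"
  have EW: "indicator W (\<zeta>, e) * indicator U \<zeta> = (indicator E \<zeta> :: ennreal)" for \<zeta> by (auto simp: W_def E_def split: split_indicator)
  have E: "E \<in> sets borel"
  proof -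
   have "{\<zeta>. (\<zeta>, e) \<in> W} \<in> sets vm" using sets_Pair2[OF W, of e] by (simp add: vimage_def)
   then have "{\<zeta>. (\<zeta>, e) \<in> W} \<inter> U \<in> sets borel" using U by (intro sets.Int) simp_all
   moreover have "{\<zeta>. (\<zeta>, e) \<in> W} \<inter> U = E" by (auto simp: W_def E_def)
   ultimately show ?thesis by simp
  qed
  have "(\<integral>\<^sup>+\<zeta>. ennreal (H\<^sup>2) * (M e)^2 * (indicator W (\<zeta>, e) * indicator U \<zeta>) \<partial>vm) = ennreal (H\<^sup>2) * (M e)^2 * emeasure vm E"
   unfolding EW using E by (intro nn_integral_cmult_indicator) simp
  also have "... <= ennreal (H\<^sup>2) * (M e)^2 * ennreal (C * t ^ CARD('n))"
   using dens[of e] unfolding E_def mm_arc by (intro mult_left_mono) simp_all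
  also have "... = ennreal (H\<^sup>2 * C * t ^ CARD('n)) * (M e)^2"
   using C t by (simp add: ennreal_mult mult_ac)
  finally show "(\<integral>\<^sup>+\<zeta>. ennreal (H\<^sup>2) * (M e)^2 * (indicator W (\<zeta>, e) * indicator U \<zeta>) \<partial>vm) <= ennreal (H\<^sup>2 * C * t ^ CARD('n)) * (M e)^2" .
 qed
 also have "... = ennreal (H\<^sup>2 * C * t ^ CARD('n)) * (\<integral>\<^sup>+e. (M e)^2 \<partial>vm)" by (rule nn_integral_cmult) measurable
 also have "H\<^sup>2 * C * t ^ CARD('n) = q * (H\<^sup>2 * C * (2*pi) ^ CARD('n))" by (simp add: q_def power_divide field_simps)
 finally show ?thesis unfolding mm_arc by (rule ennreal_cancel_factor[OF q]) (use C in simp)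
qed

lemma disc_alg_upd:
 fixes g :: "complex^'n => complex"
 assumes g: "continuous_on cpolydisc g" "holo_on g polydisc" and x: "\<And>l. norm l <= 1 ==> upd x i l \<in> cpolydisc"
 shows "disc_alg (%l. g (upd x i l))"
proof -
 define x0 where "x0 = upd x i 0"
 have line: "upd x i l = x0 + l *s axis i 1" for l by (simp add: x0_def vec_eq_iff upd_nth axis_def)
 show ?thesis using disc_alg_slice[OF g, of x0 "axis i 1"] x unfolding line by blast
qed

lemma upd_cpolydisc: "upd x i w \<in> cpolydisc ==> norm y <= 1 ==> upd x i y \<in> cpolydisc"
 by (auto simp: cpolydisc_def upd_nth) metis

lemma poisson_upd_le:
 fixes g :: "complex^'n => complex"
 assumes g: "continuous_on cpolydisc g" "holo_on g polydisc" and w: "norm w < 1" and p: "p = 1 \<or> p = (2::nat)"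
 shows "ennreal (norm (g (upd x i w)) ^ p) * indicator cpolydisc (upd x i w)
  <= (ARC y. ennreal (poisson w y) * (ennreal (norm (g (upd x i y)) ^ p) * indicator cpolydisc (upd x i y)))"
proof (cases "upd x i w \<in> cpolydisc")
 case True
 have da: "disc_alg (%l. g (upd x i l))" by (rule disc_alg_upd[OF g upd_cpolydisc[OF True]])
 have "ennreal (norm (g (upd x i w)) ^ p) <= (ARC y. ennreal (poisson w y) * (ennreal (norm (g (upd x i y)) ^ p) * indicator (cball 0 1) y))"
  using p poisson_norm_le[OF da w] poisson_norm_sq_le[OF da w] by auto
 also have "... <= (ARC y. ennreal (poisson w y) * (ennreal (norm (g (upd x i y)) ^ p) * indicator cpolydisc (upd x i y)))"
  using upd_cpolydisc[OF True] by (intro nn_integral_mono mult_left_mono) (auto split: split_indicator)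
 finally show ?thesis using True by simp
qed simp

text \<open>The Poisson integral in all coordinates dominates |h (r \<zeta>)|^2. Integrating in
  \<zeta> first, the kernel has mass 1 in that variable as well, by its symmetry on the
  circle.\<close>

lemma torus_mean_increasing:
 fixes h :: "complex^'n => complex"
 assumes h: "continuous_on cpolydisc h" "holo_on h polydisc" and r: "0 < r" "r < 1"
 shows "(\<integral>\<^sup>+\<zeta>. nsq (h (r *\<^sub>R \<zeta>)) * indicator torus \<zeta> \<partial>torus_measure) <= (\<integral>\<^sup>+\<zeta>. nsq (h \<zeta>) * indicator torus \<zeta> \<partial>torus_measure)"
proof -
 interpret coord_measure arc_measure using coord_measure_mm[of "-1"] by (simp add: mm_arc)
 interpret fv: finite_measure "vm :: (complex^'n) measure" by (rule finite_measure_vm)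
 interpret pair_sigma_finite "vm :: (complex^'n) measure" "vm :: (complex^'n) measure" ..
 have tm: "(torus_measure :: (complex^'n) measure) = vm" unfolding mm_arc[symmetric] by (rule mu_torus[symmetric])
 have AEt: "AE e in (vm :: (complex^'n) measure). e \<in> torus" unfolding tm[symmetric] by (rule AE_torus)
 define G where "G z = nsq (h z) * indicator cpolydisc z" for z
 have Gm[measurable]: "G \<in> borel_fun" unfolding G_def[abs_def] by (rule borel_on_indicator(1)[OF h(1) borel_sets(2)])
 have pt: "nsq (h (r *\<^sub>R \<zeta>)) * indicator torus \<zeta> <= (\<integral>\<^sup>+y. (\<Prod>i\<in>UNIV. ennreal (poisson (of_real r * \<zeta> $ i) (y $ i))) * G y \<partial>vm)" for \<zeta>
 proof (cases "\<zeta> \<in> torus")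
  case True
  have n1: "norm (\<zeta> $ i) = 1" for i using True by (simp add: torus_def)
  have in': "r *\<^sub>R \<zeta> \<in> cpolydisc" using n1 r by (simp add: cpolydisc_def)
  have "G (r *\<^sub>R \<zeta>) <= (\<integral>\<^sup>+y. (\<Prod>i\<in>UNIV. ennreal (poisson (of_real r * \<zeta> $ i) (y $ i))) * G y \<partial>vm)"
  proof (rule iterate_kernel[where K = "%i y. ennreal (poisson (of_real r * \<zeta> $ i) y)"])
   fix x :: "complex^'n" and i
   have eq: "(r *\<^sub>R \<zeta>) $ i = of_real r * \<zeta> $ i" unfolding vector_scaleR_component by (rule scaleR_conv_of_real)
   show "G (upd x i ((r *\<^sub>R \<zeta>) $ i)) <= (ARC y. ennreal (poisson (of_real r * \<zeta> $ i) y) * G (upd x i y))"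
    unfolding G_def eq by (rule poisson_upd_le[OF h]) (use n1 r in \<open>auto simp: norm_mult\<close>)
  qed measurable
  then show ?thesis using True in' by (simp add: G_def)
 qed simp
 have "(\<integral>\<^sup>+\<zeta>. nsq (h (r *\<^sub>R \<zeta>)) * indicator torus \<zeta> \<partial>vm) <= (\<integral>\<^sup>+\<zeta>. \<integral>\<^sup>+y. (\<Prod>i\<in>UNIV. ennreal (poisson (of_real r * \<zeta> $ i) (y $ i))) * G y \<partial>vm \<partial>vm)"
  by (intro nn_integral_mono pt)
 also have "... = (\<integral>\<^sup>+y. \<integral>\<^sup>+\<zeta>. (\<Prod>i\<in>UNIV. ennreal (poisson (of_real r * \<zeta> $ i) (y $ i))) * G y \<partial>vm \<partial>vm)"
  by (rule Fubini'[symmetric]) measurable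
 also have "... <= (\<integral>\<^sup>+y. nsq (h y) * indicator torus y \<partial>vm)"
 proof (rule nn_integral_mono_AE, use AEt in eventually_elim)
  fix y :: "complex^'n" assume y: "y \<in> torus"
  have n1: "norm (y $ i) = 1" for i using y by (simp add: torus_def)
  have "(\<integral>\<^sup>+\<zeta>. (\<Prod>i\<in>UNIV. ennreal (poisson (of_real r * \<zeta> $ i) (y $ i))) * G y \<partial>vm) = (\<integral>\<^sup>+\<zeta>. (\<Prod>i\<in>UNIV. ennreal (poisson (of_real r * \<zeta> $ i) (y $ i))) \<partial>vm) * G y"
   by (rule nn_integral_multc) measurable
  also have "(\<integral>\<^sup>+\<zeta>. (\<Prod>i\<in>UNIV. ennreal (poisson (of_real r * \<zeta> $ i) (y $ i))) \<partial>vm) = (\<Prod>i\<in>UNIV. (ARC \<zeta>. ennreal (poisson (of_real r * \<zeta>) (y $ i))))"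
   by (rule nn_integral_vm_prod[where f = "%i \<zeta>. ennreal (poisson (of_real r * \<zeta>) (y $ i))"]) measurable
  also have "... = (\<Prod>i\<in>(UNIV::'n set). 1)"
  proof (intro prod.cong refl)
   fix i
   have "(ARC \<zeta>. ennreal (poisson (of_real r * \<zeta>) (y $ i))) = (ARC \<zeta>. ennreal (poisson (of_real r * y $ i) \<zeta>))"
    by (rule nn_integral_cong_AE) (use AE_arc poisson_swap n1[of i] in \<open>auto intro: poisson_swap\<close>)
   also have "... = 1" by (rule poisson_int) (use n1 r in \<open>simp add: norm_mult\<close>)
   finally show "(ARC \<zeta>. ennreal (poisson (of_real r * \<zeta>) (y $ i))) = 1" .
  qed
  finally show "(\<integral>\<^sup>+\<zeta>. (\<Prod>i\<in>UNIV. ennreal (poisson (of_real r * \<zeta> $ i) (y $ i))) * G y \<partial>vm) <= nsq (h y) * indicator torus y"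
   using y torus_subset by (auto simp: G_def)
 qed
 finally show ?thesis by (simp add: tm)
qed

section \<open>Charts of the torus by arguments of components\<close>

lemma norm_sq_diff: "(norm x)^2 - (norm y)^2 = Re ((x - y) * cnj (x + y))" for x y :: complex
 unfolding cmod_power2 by (simp add: power2_eq_square algebra_simps)

text \<open>For points of the circle x - y is orthogonal to x + y, and x + y differs from 2c by at
  most 2r.\<close>

lemma circle_radial_increment:
 fixes x y c :: complex
 assumes "norm x = 1" "norm y = 1" "norm (x - c) <= r" "norm (y - c) <= r"
 shows "\<bar>Re (cnj c * (x - y))\<bar> <= r * norm (x - y)"
proof -
 have "Re ((x - y) * cnj (x + y)) = 0" using norm_sq_diff[of x y] assms by simp
 then have "2 * Re (cnj c * (x - y)) = Re ((x - y) * cnj ((c - x) + (c - y)))" by (simp add: algebra_simps)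
 also have "\<bar>...\<bar> <= norm ((x - y) * cnj ((c - x) + (c - y)))" by (rule abs_Re_le_cmod)
 also have "... = norm (x - y) * norm ((c - x) + (c - y))" by (simp only: norm_mult complex_mod_cnj)
 also have "... <= norm (x - y) * (r + r)"
  using norm_triangle_mono[of "c - x" r "c - y" r] assms by (intro mult_left_mono) (auto simp: norm_minus_commute)
 finally show ?thesis by (simp add: algebra_simps)
qed

context smooth_selfmap begin

text \<open>The rows of the Jacobian at a boundary value are real in the angular coordinates,
 so along the torus the modulus is stationary to first order.\<close>

lemma modulus_increment:
 fixes \<xi> :: "complex^'n"
 assumes xi: "\<xi> \<in> torus" "norm (\<phi> \<xi> $ i) = 1" and eta: "\<eta> > 0"
 shows "\<exists>r>0. \<forall>x\<in>torus. \<forall>y\<in>torus. dist x \<xi> < r \<and> dist y \<xi> < r --> \<bar>norm (\<phi> x $ i) - norm (\<phi> y $ i)\<bar> <= \<eta> * norm (x - y)"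
proof -
 define c where "c = \<phi> \<xi> $ i"
 have c: "norm c = 1" by (simp add: c_def xi)
 have xic: "\<xi> \<in> cpolydisc" using xi torus_subset by blast
 define a where "a k = jac \<phi> \<xi> i k" for k
 define L where "L = (\<Sum>k\<in>UNIV. norm (a k))"
 have L: "L >= 0" by (simp add: L_def sum_nonneg)
 define K where "K = L + 1"
 have K: "K >= 1" using L by (simp add: K_def)
 \<comment> \<open>e is the linearization error and \<epsilon> the allowed distance from \<xi> and
   from c; the final error for squared moduli is (4 K \<epsilon> + 2 e) |x - y|.\<close>
 define e where "e = min 1 (\<eta> / 8)"
 define \<epsilon> where "\<epsilon> = min (1/2) (\<eta> / (8 * K))"
 have e: "e > 0" "e <= 1" "8 * e <= \<eta>" using eta by (auto simp: e_def)
 have eps: "\<epsilon> > 0" "\<epsilon> <= 1/2" "8 * (K * \<epsilon>) <= \<eta>" using eta K by (auto simp: \<epsilon>_def min_def field_simps)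
 obtain r1 where r1: "r1 > 0" and sd: "\<forall>i. \<forall>\<xi>\<in>cpolydisc. \<forall>x\<in>cpolydisc. \<forall>y\<in>cpolydisc. dist x \<xi> < r1 \<and> dist y \<xi> < r1 -->
   norm (\<phi> x $ i - \<phi> y $ i - (\<Sum>k\<in>UNIV. jac \<phi> \<xi> i k * (x $ k - y $ k))) <= e * norm (x - y)"
  using strict_diff[OF e(1)] by (elim exE conjE) (rule that)
 obtain r2 where r2: "r2 > 0" and cn: "\<forall>z\<in>cpolydisc. dist z \<xi> < r2 --> dist (\<phi> z $ i) (\<phi> \<xi> $ i) < \<epsilon>"
  using cont_i[of i] xic eps(1) unfolding continuous_on_iff by metis
 define r where "r = min r1 (min r2 \<epsilon>)"
 show ?thesis
 proof (rule exI[of _ r], rule conjI, use r1 r2 eps in \<open>simp add: r_def\<close>, intro ballI impI)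
  fix x y :: "complex^'n" assume x: "x \<in> torus" and y: "y \<in> torus" and "dist x \<xi> < r \<and> dist y \<xi> < r"
  then have dx: "dist x \<xi> < r1" "dist x \<xi> < r2" "dist x \<xi> < \<epsilon>" and dy: "dist y \<xi> < r1" "dist y \<xi> < r2" "dist y \<xi> < \<epsilon>"
   by (auto simp: r_def)
  have xc: "x \<in> cpolydisc" "y \<in> cpolydisc" using x y torus_subset by auto
  define N where "N = norm (x - y)"
  define w where "w = \<phi> x $ i"
  define w' where "w' = \<phi> y $ i"
  define S where "S = (\<Sum>k\<in>UNIV. a k * (x $ k - y $ k))"
  have vk: "norm (x $ k - y $ k) <= N" for k unfolding N_def using vec_nth_norm_le[of "x - y" k] by simp
  have N: "N >= 0" by (simp add: N_def)
  have 1: "norm (w - w' - S) <= e * N" unfolding w_def w'_def S_def a_def N_def using sd xic xc dx(1) dy(1) by blast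
  have "norm S <= (\<Sum>k\<in>UNIV. norm (a k) * N)" unfolding S_def
   by (rule order_trans[OF norm_sum]) (auto simp: norm_mult intro!: sum_mono mult_left_mono vk)
  then have S: "norm S <= L * N" by (simp add: L_def sum_distrib_right)
  have ww: "norm (w - w') <= K * N"
  proof -
   have "norm (w - w') <= norm (w - w' - S) + norm S" using norm_triangle_sub[of "w - w'" S] by simp
   also have "... <= 1 * N + L * N" using 1 S mult_right_mono[OF e(2) N] by linarith
   finally show ?thesis by (simp add: K_def algebra_simps)
  qed
  have "\<bar>Re (cnj c * (a k * (x $ k - y $ k)))\<bar> <= norm (a k) * (\<epsilon> * N)" for k
  proof -
   \<comment> \<open>Real by \<open>jac_real\<close>, so only the radial part of x_k - y_k at
     \<xi>_k enters the real part, and on the circle this part is small.\<close>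
   define \<alpha> where "\<alpha> = cnj c * a k * \<xi> $ k"
   have u: "norm (\<xi> $ k) = 1" "norm (x $ k) = 1" "norm (y $ k) = 1" using xi x y by (auto simp: torus_def)
   have Im: "Im \<alpha> = 0" unfolding \<alpha>_def c_def a_def by (rule jac_real[OF xic xi(2)])
   have "\<xi> $ k * cnj (\<xi> $ k) = 1" using u(1) by (simp add: complex_norm_square[symmetric])
   then have eq: "cnj c * (a k * (x $ k - y $ k)) = \<alpha> * (cnj (\<xi> $ k) * (x $ k - y $ k))" unfolding \<alpha>_def
    by (metis (no_types, opaque_lifting) mult.assoc mult.commute mult.right_neutral)
   have "Re (\<alpha> * b) = Re \<alpha> * Re b" for b using Im by simp
   then have "\<bar>Re (cnj c * (a k * (x $ k - y $ k)))\<bar> = \<bar>Re \<alpha>\<bar> * \<bar>Re (cnj (\<xi> $ k) * (x $ k - y $ k))\<bar>" by (simp only: eq abs_mult)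
   also have "... <= norm \<alpha> * (\<epsilon> * norm (x $ k - y $ k))"
   proof (intro mult_mono abs_Re_le_cmod circle_radial_increment u)
    show "norm (x $ k - \<xi> $ k) <= \<epsilon>" using dx(3) vec_nth_norm_le[of "x - \<xi>" k] by (simp add: dist_norm)
    show "norm (y $ k - \<xi> $ k) <= \<epsilon>" using dy(3) vec_nth_norm_le[of "y - \<xi>" k] by (simp add: dist_norm)
   qed (use eps in auto)
   also have "norm \<alpha> = norm (a k)" using c u by (simp add: \<alpha>_def norm_mult)
   also have "norm (a k) * (\<epsilon> * norm (x $ k - y $ k)) <= norm (a k) * (\<epsilon> * N)" using vk eps by (intro mult_left_mono) auto
   finally show ?thesis .
  qed
  then have "(\<Sum>k\<in>UNIV. \<bar>Re (cnj c * (a k * (x $ k - y $ k)))\<bar>) <= (\<Sum>k\<in>UNIV. norm (a k) * (\<epsilon> * N))" by (rule sum_mono)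
  then have "\<bar>Re (cnj c * S)\<bar> <= L * (\<epsilon> * N)"
   unfolding S_def sum_distrib_left Re_sum L_def sum_distrib_right by (rule order_trans[OF sum_abs])
  moreover have "\<bar>Re (cnj c * (w - w' - S))\<bar> <= e * N"
   using 1 abs_Re_le_cmod[of "cnj c * (w - w' - S)"] c by (simp add: norm_mult del: complex_cnj_diff)
  moreover have "Re (cnj c * (w - w')) = Re (cnj c * S) + Re (cnj c * (w - w' - S))" by (simp add: algebra_simps)
  ultimately have Re: "\<bar>Re (cnj c * (w - w'))\<bar> <= L * (\<epsilon> * N) + e * N" by linarith
  have wc: "norm (w - c) <= \<epsilon>" "norm (w' - c) <= \<epsilon>" using cn xc dx(2) dy(2) by (auto simp: w_def w'_def c_def dist_norm less_imp_le)
  have "\<bar>Re ((w - w') * cnj ((w - c) + (w' - c)))\<bar> <= norm (w - w') * norm ((w - c) + (w' - c))"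
   using abs_Re_le_cmod[of "(w - w') * cnj ((w - c) + (w' - c))"] by (simp only: norm_mult complex_mod_cnj)
  also have "... <= K * N * (\<epsilon> + \<epsilon>)" using ww wc norm_triangle_mono[of "w - c" \<epsilon> "w' - c" \<epsilon>] K N by (intro mult_mono) auto
  finally have R2: "\<bar>Re ((w - w') * cnj ((w - c) + (w' - c)))\<bar> <= K * N * (\<epsilon> + \<epsilon>)" .
  have "(norm w)^2 - (norm w')^2 = 2 * Re (cnj c * (w - w')) + Re ((w - w') * cnj ((w - c) + (w' - c)))"
   unfolding norm_sq_diff by (simp add: algebra_simps)
  moreover have "\<bar>A\<bar> <= 2 * X + Y" if "A = 2 * B + E" "\<bar>B\<bar> <= X" "\<bar>E\<bar> <= Y" for A B E X Y :: real
   using that by linarith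
  ultimately have "\<bar>(norm w)^2 - (norm w')^2\<bar> <= 2 * (L * (\<epsilon> * N) + e * N) + K * N * (\<epsilon> + \<epsilon>)"
   using Re R2 by blast
  also have "... <= 2 * (K * (\<epsilon> * N) + e * N) + K * N * (\<epsilon> + \<epsilon>)"
   using N eps by (intro add_mono mult_left_mono mult_right_mono) (auto simp: K_def)
  also have "... = (4 * (K * \<epsilon>) + 2 * e) * N" by (simp add: algebra_simps)
  also have "... <= \<eta> * N" using eps e N by (intro mult_right_mono) auto
  finally have sq: "\<bar>(norm w)^2 - (norm w')^2\<bar> <= \<eta> * N" .
  have "norm w >= 1/2" using wc(1) c eps(2) norm_triangle_ineq2[of c w] by (simp add: norm_minus_commute)
  moreover have "norm w' >= 1/2" using wc(2) c eps(2) norm_triangle_ineq2[of c w'] by (simp add: norm_minus_commute)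
  ultimately have "\<bar>norm w - norm w'\<bar> * 1 <= \<bar>norm w - norm w'\<bar> * (norm w + norm w')" by (intro mult_left_mono) auto
  also have "... = \<bar>(norm w - norm w') * (norm w + norm w')\<bar>" by (simp add: abs_mult)
  also have "(norm w - norm w') * (norm w + norm w') = (norm w)^2 - (norm w')^2" by (simp add: power2_eq_square algebra_simps)
  finally show "\<bar>norm (\<phi> x $ i) - norm (\<phi> y $ i)\<bar> <= \<eta> * norm (x - y)" using sq by (simp add: w_def w'_def N_def)
 qed
qed

text \<open>By the Hall condition the unimodular component has a nonzero entry in some column k0.
  Taking the other coordinate k1 as the second chart coordinate makes the matrix triangular with
  nonzero diagonal.\<close>

lemma chart_matrix_mixed:
 fixes \<xi> :: "complex^'n"
 assumes A: condA and B: condB and xi: "\<xi> \<in> cpolydisc" and pq: "UNIV = {p, q}" "p \<noteq> q"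
  and J: "norm (\<phi> \<xi> $ p) = 1" "norm (\<phi> \<xi> $ q) \<noteq> 1"
 shows "\<exists>\<kappa> c. c > 0 \<and> (\<forall>v D. D >= 0 --> (\<forall>i. norm (\<Sum>k\<in>UNIV. (if norm (\<phi> \<xi> $ i) = 1 then jac \<phi> \<xi> i k else if k = \<kappa> i then 1 else 0) * v k) <= D)
  --> (\<forall>k::'n. c * norm (v k) <= D))"
proof -
 have "card {p} <= card (P \<phi> {p} \<xi>)" by (rule hall_condition(1)[OF A B xi]) (use J in auto)
 then have "P \<phi> {p} \<xi> \<noteq> {}" by auto
 then obtain k0 where k0: "jac \<phi> \<xi> p k0 \<noteq> 0" by (auto simp: P_def)
 define k1 where "k1 = (if k0 = p then q else p)"
 have k01: "UNIV = {k0, k1}" "k0 \<noteq> k1" using pq by (auto simp: k1_def)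
 define a0 where "a0 = norm (jac \<phi> \<xi> p k0)"
 define a1 where "a1 = norm (jac \<phi> \<xi> p k1)"
 have a: "a0 > 0" "a1 >= 0" using k0 by (auto simp: a0_def a1_def)
 have s: "(\<Sum>k\<in>UNIV. f k) = f k0 + f k1" for f :: "'n => complex" unfolding k01(1) using k01(2) by simp
 define c where "c = min 1 (a0 / (1 + a1))"
 have c: "c > 0" "c <= 1" using a by (auto simp: c_def)
 have "c <= a0 / (1 + a1)" by (simp add: c_def)
 then have c3: "c * (1 + a1) <= a0" using a by (simp add: pos_le_divide_eq)
 show ?thesis
 proof (rule exI[of _ "%_. k1"], rule exI[of _ c], intro conjI allI impI, rule c(1))
  fix v :: "'n => complex" and D :: real and k
  assume D: "D >= 0" and h: "\<forall>i. norm (\<Sum>k\<in>UNIV. (if norm (\<phi> \<xi> $ i) = 1 then jac \<phi> \<xi> i k else if k = k1 then 1 else 0) * v k) <= D"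
  have 1: "norm (v k1) <= D" using spec[OF h, of q] J k01(2) unfolding s by simp
  have 0: "norm (jac \<phi> \<xi> p k0 * v k0 + jac \<phi> \<xi> p k1 * v k1) <= D" using spec[OF h, of p] J unfolding s by simp
  have "norm (jac \<phi> \<xi> p k0 * v k0) <= norm (jac \<phi> \<xi> p k0 * v k0 + jac \<phi> \<xi> p k1 * v k1) + norm (jac \<phi> \<xi> p k1 * v k1)"
   by (metis add_diff_cancel_right' norm_triangle_ineq4)
  also have "... <= D + a1 * D" using 0 1 a by (intro add_mono) (auto simp: norm_mult a1_def intro: mult_left_mono)
  finally have 2: "a0 * norm (v k0) <= D * (1 + a1)" by (simp add: norm_mult a0_def algebra_simps)
  have "c * (1 + a1) * norm (v k0) <= a0 * norm (v k0)" by (rule mult_right_mono[OF c3]) simp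
  with 2 have "(c * norm (v k0)) * (1 + a1) <= D * (1 + a1)" by (simp add: mult_ac)
  then have "c * norm (v k0) <= D" using a by simp
  moreover have "c * norm (v k1) <= 1 * D" using 1 c by (intro mult_mono) auto
  ultimately show "c * norm (v k) <= D" using k01(1) by (cases "k = k0") auto
 qed
qed

text \<open>If both components are unimodular, the Hall condition forces both columns to occur and,
  equality holding, the Jacobian to be invertible. If none is, \<open>\<kappa>\<close> and the
  matrix are the identity.\<close>

lemma chart_matrix:
 fixes \<xi> :: "complex^'n"
 assumes A: condA and B: condB and xi: "\<xi> \<in> cpolydisc" and n: "CARD('n) = 2"
 shows "\<exists>\<kappa> c. c > 0 \<and> (\<forall>v D. D >= 0 --> (\<forall>i. norm (\<Sum>k\<in>UNIV. (if norm (\<phi> \<xi> $ i) = 1 then jac \<phi> \<xi> i k else if k = \<kappa> i then 1 else 0) * v k) <= D)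
  --> (\<forall>k::'n. c * norm (v k) <= D))"
proof -
 obtain p q :: 'n where pq: "UNIV = {p, q}" "p \<noteq> q" using n by (auto simp: card_2_iff)
 have qp: "UNIV = {q, p}" "q \<noteq> p" using pq by auto
 consider "norm (\<phi> \<xi> $ p) = 1" "norm (\<phi> \<xi> $ q) = 1" | "norm (\<phi> \<xi> $ p) = 1" "norm (\<phi> \<xi> $ q) \<noteq> 1"
  | "norm (\<phi> \<xi> $ p) \<noteq> 1" "norm (\<phi> \<xi> $ q) = 1" | "norm (\<phi> \<xi> $ p) \<noteq> 1" "norm (\<phi> \<xi> $ q) \<noteq> 1" by blast
 then show ?thesis
 proof cases
  case 1
  have all: "norm (\<phi> \<xi> $ i) = 1" for i
  proof -
   have "i \<in> {p, q}" using pq(1) by blast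
   then show ?thesis using 1 by auto
  qed
  have ne: "(UNIV :: 'n set) \<noteq> {}" by simp
  have "card (UNIV :: 'n set) <= card (P \<phi> UNIV \<xi>)" by (rule hall_condition(1)[OF A B xi ne]) (rule all)
  then have PU: "P \<phi> UNIV \<xi> = UNIV" by (intro card_seteq) auto
  have "invertible_on UNIV (P \<phi> UNIV \<xi>) (jac \<phi> \<xi>)" by (rule hall_condition(2)[OF A B xi ne]) (use all PU in auto)
  then have "bij_block (jac \<phi> \<xi>) UNIV UNIV" unfolding PU by (rule invertible_on_bij_block)
  from bij_block_lower_bound[OF this ne] obtain c where "c > 0" "\<forall>v. \<forall>D\<ge>0. (\<forall>i. norm (\<Sum>k\<in>UNIV. jac \<phi> \<xi> i k * v k) <= D) --> (\<forall>k. c * norm (v k) <= D)"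
   by auto
  then show ?thesis using all by (intro exI[of _ id] exI[of _ c]) simp
 next
  case 2
  then show ?thesis by (rule chart_matrix_mixed[OF A B xi pq])
 next
  case 3
  then show ?thesis by (intro chart_matrix_mixed[OF A B xi qp])
 next
  case 4
  have all: "norm (\<phi> \<xi> $ i) \<noteq> 1" for i
  proof -
   have "i \<in> {p, q}" using pq(1) by blast
   then show ?thesis using 4 by auto
  qed
  have s: "(\<Sum>k\<in>UNIV. (if k = i then 1 else 0) * v k) = v i" for v :: "'n => complex" and i
   by (simp add: if_distrib[of "%x. x * _"] cong: if_cong)
  show ?thesis by (rule exI[of _ "%i. i"], rule exI[of _ 1]) (simp add: all s)
 qed
qed

text \<open>The chart takes the arguments of the unimodular components and coordinates of \<zeta> in
  place of the others. The arguments determine the components well enough because the moduli are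
  nearly stationary (\<open>modulus_increment\<close>), so points with chart values at most 2t apart
  lie within a multiple of t of each other, and the preimage of a box of side t lies in a box of
  comparable side.\<close>

lemma chart_density:
 fixes \<xi> :: "complex^'n"
 assumes A: condA and B: condB and xi: "\<xi> \<in> torus" and n2: "CARD('n) = 2"
 shows "\<exists>\<kappa> r \<rho> C. r > 0 \<and> 0 <= \<rho> \<and> \<rho> < 1 \<and> C >= 0 \<and>
  (\<forall>\<zeta>\<in>torus. dist \<zeta> \<xi> < r --> (\<forall>i. (norm (\<phi> \<xi> $ i) = 1 --> \<phi> \<zeta> $ i \<noteq> 0) \<and> (norm (\<phi> \<xi> $ i) \<noteq> 1 --> norm (\<phi> \<zeta> $ i) <= \<rho>))) \<and>
  (\<forall>t>0. \<forall>e. emeasure (mu (-1)) {\<zeta>\<in>torus. dist \<zeta> \<xi> < r \<and> (\<forall>i. norm ((if norm (\<phi> \<xi> $ i) = 1 then sgn (\<phi> \<zeta> $ i) else \<zeta> $ \<kappa> i) - e $ i) <= t)} <= ennreal (C * t ^ CARD('n)))"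
proof -
 interpret coord_measure arc_measure using coord_measure_mm[of "-1"] by (simp add: mm_arc)
 have xic: "\<xi> \<in> cpolydisc" using xi torus_subset by blast
 define J where "J = {i. norm (\<phi> \<xi> $ i) = 1}"
 obtain \<kappa> c where c: "c > 0" and inj: "\<forall>v D. D >= 0 --> (\<forall>i. norm (\<Sum>k\<in>UNIV. (if norm (\<phi> \<xi> $ i) = 1 then jac \<phi> \<xi> i k else if k = \<kappa> i then 1 else 0) * v k) <= D)
  --> (\<forall>k::'n. c * norm (v k) <= D)"
  using chart_matrix[OF A B xic n2] by (elim exE conjE) (rule that)
 define n where "n = real CARD('n)"
 have n: "n >= 1" by (simp add: n_def)
 \<comment> \<open>Linearization and modulus each contribute \<eta> |x - y|; divided by c and summed
   over the n coordinates this is half of |x - y|.\<close>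
 define \<eta> where "\<eta> = c / (4 * n)"
 have eta: "\<eta> > 0" using c n by (simp add: \<eta>_def)
 obtain r1 where r1: "r1 > 0" and sd: "\<forall>i. \<forall>\<xi>\<in>cpolydisc. \<forall>x\<in>cpolydisc. \<forall>y\<in>cpolydisc. dist x \<xi> < r1 \<and> dist y \<xi> < r1 -->
   norm (\<phi> x $ i - \<phi> y $ i - (\<Sum>k\<in>UNIV. jac \<phi> \<xi> i k * (x $ k - y $ k))) <= \<eta> * norm (x - y)"
  using strict_diff[OF eta] by (elim exE conjE) (rule that)
 have "\<forall>i\<in>J. \<exists>r>0. \<forall>x\<in>torus. \<forall>y\<in>torus. dist x \<xi> < r \<and> dist y \<xi> < r --> \<bar>norm (\<phi> x $ i) - norm (\<phi> y $ i)\<bar> <= \<eta> * norm (x - y)"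
  using modulus_increment[OF xi _ eta] by (auto simp: J_def)
 then obtain rr where rr: "\<forall>i\<in>J. rr i > 0 \<and> (\<forall>x\<in>torus. \<forall>y\<in>torus. dist x \<xi> < rr i \<and> dist y \<xi> < rr i --> \<bar>norm (\<phi> x $ i) - norm (\<phi> y $ i)\<bar> <= \<eta> * norm (x - y))"
  by (auto dest: bchoice)
 define r2 where "r2 = Min (insert 1 (rr ` J))"
 have r2: "r2 > 0" unfolding r2_def using rr by (subst Min_gr_iff) auto
 have r2_le: "r2 <= rr i" if "i \<in> J" for i unfolding r2_def using that by (intro Min_le) auto
 define \<rho>0 where "\<rho>0 = Max (insert 0 ((%i. norm (\<phi> \<xi> $ i)) ` (-J)))"
 have phi_le: "norm (\<phi> \<xi> $ i) <= 1" for i using cpolydisc_component[OF map_cpolydisc[OF xic], of i] by simp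
 have "norm (\<phi> \<xi> $ i) < 1" if "i \<in> -J" for i using that phi_le[of i] by (simp add: J_def)
 then have rho0: "0 <= \<rho>0" "\<rho>0 < 1" unfolding \<rho>0_def by (auto intro: Max_ge)
 have rho_ge: "norm (\<phi> \<xi> $ i) <= \<rho>0" if "i \<notin> J" for i unfolding \<rho>0_def using that by (intro Max_ge) auto
 have "(1 - \<rho>0) / 2 > 0" using rho0 by simp
 then obtain r3 where r3: "r3 > 0" and cn: "\<forall>z\<in>cpolydisc. dist z \<xi> < r3 --> dist (\<phi> z) (\<phi> \<xi>) < (1 - \<rho>0) / 2"
  using cont xic unfolding continuous_on_iff by metis
 define r where "r = min r1 (min r2 r3)"
 define \<rho> where "\<rho> = (1 + \<rho>0) / 2"
 define C where "C = (16 * n / c) ^ CARD('n)"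
 show ?thesis
 proof (rule exI[of _ \<kappa>], rule exI[of _ r], rule exI[of _ \<rho>], rule exI[of _ C], intro conjI ballI allI impI)
  show "r > 0" using r1 r2 r3 by (simp add: r_def)
  show "0 <= \<rho>" "\<rho> < 1" using rho0 by (auto simp: \<rho>_def)
  show "0 <= C" using c n by (simp add: C_def)
  fix \<zeta> :: "complex^'n" and i assume z: "\<zeta> \<in> torus" "dist \<zeta> \<xi> < r"
  have "dist (\<phi> \<zeta>) (\<phi> \<xi>) < (1 - \<rho>0) / 2" using cn z torus_subset by (auto simp: r_def)
  then have d: "norm (\<phi> \<zeta> $ i - \<phi> \<xi> $ i) < (1 - \<rho>0) / 2" using vec_nth_norm_le[of "\<phi> \<zeta> - \<phi> \<xi>" i] by (simp add: dist_norm)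
  {
   assume "norm (\<phi> \<xi> $ i) = 1"
   then show "\<phi> \<zeta> $ i \<noteq> 0" using d rho0 by auto
  next
   assume "norm (\<phi> \<xi> $ i) \<noteq> 1"
   then have "norm (\<phi> \<xi> $ i) <= \<rho>0" using rho_ge by (simp add: J_def)
   then have "norm (\<phi> \<zeta> $ i) <= \<rho>0 + (1 - \<rho>0) / 2" using d norm_triangle_ineq2[of "\<phi> \<zeta> $ i" "\<phi> \<xi> $ i"] by linarith
   then show "norm (\<phi> \<zeta> $ i) <= \<rho>" by (simp add: \<rho>_def field_simps)
  }
 next
  fix t :: real and e :: "complex^'n" assume t: "t > 0"
  define F where "F i \<zeta> = (if norm (\<phi> \<xi> $ i) = 1 then sgn (\<phi> \<zeta> $ i) else \<zeta> $ \<kappa> i)" for i and \<zeta> :: "complex^'n"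
  define E where "E = {\<zeta>\<in>torus. dist \<zeta> \<xi> < r \<and> (\<forall>i. norm (F i \<zeta> - e $ i) <= t)}"
  have diam: "norm (x - y) <= 4 * n / c * t" if x: "x \<in> E" and y: "y \<in> E" for x y
  proof -
   define N where "N = norm (x - y)"
   define v where "v k = x $ k - y $ k" for k
   have Nv: "N <= (\<Sum>k\<in>UNIV. norm (v k))" unfolding N_def v_def using norm_le_sum_vec[of "x - y"] by simp
   have xy: "x \<in> torus" "y \<in> torus" "x \<in> cpolydisc" "y \<in> cpolydisc" "dist x \<xi> < r" "dist y \<xi> < r" using x y torus_subset by (auto simp: E_def)
   have FF: "norm (F i x - F i y) <= 2 * t" for i
   proof -
    have "norm (F i x - e $ i) <= t" "norm (F i y - e $ i) <= t" using x y by (auto simp: E_def)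
    then show ?thesis using norm_triangle_ineq4[of "F i x - e $ i" "F i y - e $ i"] by simp
   qed
   have row: "norm (\<Sum>k\<in>UNIV. (if norm (\<phi> \<xi> $ i) = 1 then jac \<phi> \<xi> i k else if k = \<kappa> i then 1 else 0) * v k) <= 2 * t + 2 * \<eta> * N" for i
   proof (cases "norm (\<phi> \<xi> $ i) = 1")
    case True
    define w where "w = \<phi> x $ i"
    define w' where "w' = \<phi> y $ i"
    have iJ: "i \<in> J" using True by (simp add: J_def)
    have 1: "norm (w - w' - (\<Sum>k\<in>UNIV. jac \<phi> \<xi> i k * v k)) <= \<eta> * N"
     unfolding w_def w'_def v_def N_def using sd xic xy by (simp add: r_def)
    have "dist x \<xi> < rr i \<and> dist y \<xi> < rr i" using xy(5,6) r2_le[OF iJ] by (auto simp: r_def)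
    then have 2: "\<bar>norm w - norm w'\<bar> <= \<eta> * N" unfolding w_def w'_def N_def using rr iJ xy(1,2) by blast
    have "of_real (norm u) * sgn u = u" for u :: complex by (cases "u = 0") (auto simp: sgn_div_norm scaleR_conv_of_real)
    then have "w - w' = of_real (norm w) * (sgn w - sgn w') + of_real (norm w - norm w') * sgn w'"
     by (simp add: algebra_simps)
    then have "norm (w - w') <= norm (of_real (norm w) * (sgn w - sgn w')) + norm (of_real (norm w - norm w') * sgn w')" by (metis norm_triangle_ineq)
    also have "... <= 1 * (2 * t) + \<eta> * N * 1"
    proof (intro add_mono)
     have "norm w <= 1" unfolding w_def using cpolydisc_component[OF map_cpolydisc[OF xy(3)], of i] by simp
     moreover have "norm (sgn w - sgn w') <= 2 * t" using FF[of i] True by (simp add: F_def w_def w'_def)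
     ultimately show "norm (of_real (norm w) * (sgn w - sgn w')) <= 1 * (2 * t)" unfolding norm_mult by (intro mult_mono) auto
     show "norm (of_real (norm w - norm w') * sgn w') <= \<eta> * N * 1"
      unfolding norm_mult norm_of_real using 2 by (intro mult_mono) (auto simp: norm_sgn)
    qed
    finally have 3: "norm (w - w') <= 2 * t + \<eta> * N" by simp
    have "norm (\<Sum>k\<in>UNIV. jac \<phi> \<xi> i k * v k) <= norm (w - w') + norm (w - w' - (\<Sum>k\<in>UNIV. jac \<phi> \<xi> i k * v k))"
     using norm_triangle_ineq4[of "w - w'" "w - w' - (\<Sum>k\<in>UNIV. jac \<phi> \<xi> i k * v k)"] by simp
    then show ?thesis using True 1 3 by simp
   next
    case False
    have "(\<Sum>k\<in>UNIV. (if k = \<kappa> i then 1 else 0) * v k) = v (\<kappa> i)" by (simp add: if_distrib[of "%x. x * _"] cong: if_cong)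
    moreover have "v (\<kappa> i) = F i x - F i y" using False by (simp add: F_def v_def)
    moreover have "norm (F i x - F i y) <= 2 * t + 2 * \<eta> * N"
    proof -
     have "0 <= 2 * \<eta> * N" using eta by (simp add: N_def)
     then show ?thesis using FF[of i] by linarith
    qed
    ultimately show ?thesis using False by simp
   qed
   have "0 <= 2 * t + 2 * \<eta> * N" using t eta by (simp add: N_def)
   then have "\<forall>k. c * norm (v k) <= 2 * t + 2 * \<eta> * N" using inj row by blast
   then have vl: "norm (v k) <= (2 * t + 2 * \<eta> * N) / c" for k using c by (simp add: field_simps)
   have "N <= (\<Sum>k\<in>(UNIV::'n set). (2 * t + 2 * \<eta> * N) / c)" by (rule order_trans[OF Nv]) (intro sum_mono vl)
   also have "... = 2 * n * t / c + N / 2" using c n by (simp add: n_def[symmetric] \<eta>_def field_simps)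
   finally show ?thesis by (simp add: N_def)
  qed
  have "emeasure (mu (-1)) E <= ennreal (C * t ^ CARD('n))"
  proof (cases "E = {}")
   case False
   then obtain z0 where z0: "z0 \<in> E" by blast
   define R where "R = 4 * n / c * t"
   have R: "R > 0" using c n t by (simp add: R_def)
   have box: "E \<subseteq> {z. \<forall>i. z $ i \<in> {y. norm (y - z0 $ i) <= R}}"
   proof (intro subsetI CollectI allI)
    fix z i assume "z \<in> E"
    then show "norm (z $ i - z0 $ i) <= R" using diam[OF _ z0] vec_nth_norm_le[of "z - z0" i] unfolding R_def by fastforce
   qed
   have cb: "{y. norm (y - z0 $ i) <= R} = cball (z0 $ i) R" for i by (auto simp: dist_norm norm_minus_commute)
   have boxm: "{z :: complex^'n. \<forall>i. z $ i \<in> {y. norm (y - z0 $ i) <= R}} \<in> sets borel"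
   proof -
    have "closed {z :: complex^'n. \<forall>i. norm (z $ i - z0 $ i) <= R}" by (intro closed_Collect_all closed_Collect_le continuous_intros)
    then show ?thesis by simp
   qed
   have "emeasure (mu (-1)) E <= emeasure vm {z. \<forall>i. z $ i \<in> {y. norm (y - z0 $ i) <= R}}"
    unfolding mm_arc by (rule emeasure_mono[OF box]) (use boxm in simp)
   also have "... = (\<Prod>i\<in>UNIV. emeasure arc_measure {y. norm (y - z0 $ i) <= R})" by (rule emeasure_vm_box) (simp add: cb)
   also have "... <= (\<Prod>i\<in>(UNIV::'n set). ennreal (4 * R))" by (intro ennreal_prod_mono arc_ball_upper R)
   also have "... = ennreal ((4 * R) ^ CARD('n))" using R by (simp add: ennreal_power)
   also have "(4 * R) ^ CARD('n) = C * t ^ CARD('n)" by (simp add: C_def R_def power_mult_distrib[symmetric] mult_ac)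
   finally show ?thesis .
  qed simp
  then show "emeasure (mu (-1)) {\<zeta>\<in>torus. dist \<zeta> \<xi> < r \<and> (\<forall>i. norm ((if norm (\<phi> \<xi> $ i) = 1 then sgn (\<phi> \<zeta> $ i) else \<zeta> $ \<kappa> i) - e $ i) <= t)} <= ennreal (C * t ^ CARD('n))"
   by (simp add: E_def F_def)
 qed
qed

end

section \<open>Boundedness on the Hardy space\<close>

lemma poisson_zero: "poisson 0 y = 1" by (simp add: poisson_def)

text \<open>Multiples of the mesh 1 - s up to s. The number of radii grows as s tends to 1, but the
  constant of the maximal inequality does not depend on it.\<close>

lemma radius_grid:
 assumes s: "0 < s" "s < (1::real)"
 shows "\<exists>R. finite R \<and> 0 \<in> R \<and> R \<subseteq> {0..s} \<and> (\<forall>x. 0 <= x --> x <= s --> (\<exists>r\<in>R. r <= x \<and> x - r <= 1 - s))"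
proof -
 define f where "f j = real j * (1 - s)" for j
 define R where "R = f ` {j. f j <= s}"
 have "{j. f j <= s} \<subseteq> {..nat \<lfloor>s / (1 - s)\<rfloor>}"
 proof
  fix j assume "j \<in> {j. f j <= s}"
  then have "real j <= s / (1 - s)" using s by (simp add: f_def field_simps)
  then show "j \<in> {..nat \<lfloor>s / (1 - s)\<rfloor>}" by (simp add: le_nat_floor)
 qed
 then have "finite R" unfolding R_def by (intro finite_imageI) (rule finite_subset, auto)
 moreover have "0 \<in> R" unfolding R_def using s by (intro image_eqI[of _ _ 0]) (auto simp: f_def)
 moreover have "R \<subseteq> {0..s}" using s by (auto simp: R_def f_def)
 moreover have "\<exists>r\<in>R. r <= x \<and> x - r <= 1 - s" if x: "0 <= x" "x <= s" for x
 proof -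
  define j where "j = nat \<lfloor>x / (1 - s)\<rfloor>"
  have "real j <= x / (1 - s)" "x / (1 - s) < real j + 1" using x s unfolding j_def by (auto simp: of_nat_nat)
  then have "f j <= x" "x <= f j + (1 - s)" using s by (auto simp: f_def field_simps)
  then show ?thesis using x by (intro bexI[of _ "f j"]) (auto simp: R_def)
 qed
 ultimately show ?thesis by blast
qed

text \<open>One coordinate is moved at a time: the p-th by \<open>coord_max_harnack\<close> for the
  outer maximal function, the q-th by the same lemma inside \<open>coord_max_mono\<close>. Each
  costs a factor 4.\<close>

lemma coord_max2_harnack:
 fixes G :: "complex^'n => ennreal"
 assumes pq: "UNIV = {p, q}" "p \<noteq> (q :: 'n)" and R: "finite R" "R \<subseteq> {0..1 - t}" "t > 0" and G[measurable]: "G \<in> borel_fun"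
  and e: "e \<in> torus" "e' \<in> torus" "\<forall>i. norm (e $ i - e' $ i) <= t"
 shows "coord_max R p (coord_max R q G) e <= ennreal 16 * coord_max R p (coord_max R q G) e'"
proof -
 have n1: "norm (e $ i) = 1" "norm (e' $ i) = 1" for i using e by (auto simp: torus_def)
 have M: "coord_max R q G \<in> borel_fun" by (rule coord_max_measurable[OF R(1) G])
 define z where "z = upd e p (e' $ p)"
 have ze: "upd z q (e' $ q) = e'"
 proof (rule vec_eq_iff[THEN iffD2], rule allI)
  fix i
  have "i \<in> {p, q}" using pq(1) by blast
  then show "upd z q (e' $ q) $ i = e' $ i" using pq(2) by (auto simp: z_def upd_nth)
 qed
 have "coord_max R p (coord_max R q G) e <= 4 * coord_max R p (coord_max R q G) z"
  unfolding z_def by (rule coord_max_harnack[OF R(2,3) M]) (use n1 e in auto)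
 also have "coord_max R p (coord_max R q G) z <= 4 * coord_max R p (coord_max R q G) (upd z q (e' $ q))"
 proof (rule coord_max_mono[OF M])
  show "z $ p = upd z q (e' $ q) $ p" using pq(2) by (simp add: upd_nth)
  fix y :: complex assume "norm y = 1"
  have "coord_max R q G (upd z p y) <= 4 * coord_max R q G (upd (upd z p y) q (e' $ q))"
   by (rule coord_max_harnack[OF R(2,3) G]) (use n1 e pq(2) in \<open>auto simp: upd_nth z_def\<close>)
  then show "coord_max R q G (upd z p y) <= 4 * coord_max R q G (upd (upd z q (e' $ q)) p y)"
   using upd_commute[OF pq(2)] by metis
 qed
 finally show ?thesis unfolding ze by (simp add: mult.assoc[symmetric] mult_left_mono)
qed

text \<open>|g| is dominated by its Poisson integral in each coordinate separately, hence by the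
  iterated one; the kernel at w_i is exchanged for one at a radius of R over e_i, at cost c. Only
  \<open>dom\<close> relates e_i to w_i, so a coordinate deep inside the disc may be paired with any
  e_i.\<close>

lemma coord_max2_dominates:
 fixes g :: "complex^'n => complex"
 defines "G \<equiv> %z. ennreal (norm (g z)) * indicator cpolydisc z"
 assumes pq: "UNIV = {p, q}" "p \<noteq> (q :: 'n)" and R: "finite R" and g: "continuous_on cpolydisc g" "holo_on g polydisc"
  and w: "w \<in> polydisc" and e: "e \<in> torus" and c: "c >= 0"
  and dom: "\<And>i. \<exists>r\<in>R. \<forall>y. norm y = 1 --> poisson (w $ i) y <= c * poisson (of_real r * e $ i) y"
 shows "ennreal (norm (g w)) <= ennreal (c\<^sup>2) * coord_max R p (coord_max R q G) e"
proof -
 have G: "G \<in> borel_fun" unfolding G_def by (rule borel_on_indicator(2)[OF g(1) borel_sets(2)])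
 have n1: "norm (e $ i) = 1" for i using e by (auto simp: torus_def)
 have w1: "norm (w $ i) < 1" for i by (rule polydisc_component[OF w])
 obtain rp where rp: "rp \<in> R" "\<forall>y. norm y = 1 --> poisson (w $ p) y <= c * poisson (of_real rp * e $ p) y" using dom by blast
 obtain rq where rq: "rq \<in> R" "\<forall>y. norm y = 1 --> poisson (w $ q) y <= c * poisson (of_real rq * e $ q) y" using dom by blast
 have step: "G (upd x i u) <= (ARC y. ennreal (poisson u y) * G (upd x i y))" if "norm u < 1" for x i u
  using poisson_upd_le[OF g that, of 1 x i] by (simp add: G_def)
 have inner: "G (upd w p y) <= ennreal c * coord_max R q G (upd e p y)" for y
 proof -
  have z: "upd (upd w p y) q (e $ q) = upd e p y"
  proof (rule vec_eq_iff[THEN iffD2], rule allI)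
   fix i
   have "i \<in> {p, q}" using pq(1) by blast
   then show "upd (upd w p y) q (e $ q) $ i = upd e p y $ i" using pq(2) by (auto simp: upd_nth)
  qed
  have "upd (upd w p y) q (w $ q) = upd w p y" using pq(2) by (auto simp: vec_eq_iff upd_nth)
  then have "G (upd w p y) <= (ARC y'. ennreal (poisson (w $ q) y') * G (upd (upd w p y) q y'))"
   using step[OF w1, of "upd w p y" q q] by simp
  also have "... <= ennreal c * 1 * coord_max R q G (upd (upd w p y) q (e $ q))"
   by (rule coord_max_ge[OF rq(1) G]) (use n1 rq(2) c in \<open>auto simp: upd_nth upd_upd\<close>)
  finally show ?thesis by (simp add: z)
 qed
 have "G w <= (ARC y. ennreal (poisson (w $ p) y) * G (upd w p y))" using step[OF w1, of w p p] by (simp add: upd_self)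
 also have "... <= ennreal c * ennreal c * coord_max R p (coord_max R q G) e"
  by (rule coord_max_ge[OF rp(1) coord_max_measurable[OF R G]]) (use n1 rp(2) c inner in auto)
 finally show ?thesis using w polydisc_subset c by (auto simp: G_def power2_eq_square ennreal_mult)
qed

lemma mu_torus_AE: "AE e in (mu (-1) :: (complex^'n) measure). e \<in> torus"
 unfolding mu_torus by (rule AE_torus)

context smooth_selfmap begin

text \<open>The dilation by s limits all radii to s, which gives a finite grid and the scale 1 - s
  for Harnack. The point is that C does not depend on s.\<close>

definition hardy_dominated :: "(complex^'n) set => real => bool" where
 "hardy_dominated U C \<longleftrightarrow> (\<forall>s g. 0 < s --> s < 1 --> continuous_on cpolydisc g --> holo_on g polydisc -->
  (\<integral>\<^sup>+\<zeta>. nsq (g (s *\<^sub>R \<phi> \<zeta>)) * indicator U \<zeta> \<partial>mu (-1))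
   <= ennreal C * (\<integral>\<^sup>+\<zeta>. nsq (g \<zeta>) * indicator torus \<zeta> \<partial>mu (-1)))"

text \<open>At scale 1 - s the chart F carries surface measure on U to at most a multiple of itself,
  so the square integral of M composed with F is bounded by that of M; two uses of
  \<open>coord_max_L2\<close> then lead back to g.\<close>

lemma hardy_local:
 fixes \<xi> :: "complex^'n"
 assumes A: condA and B: condB and xi: "\<xi> \<in> torus" and n2: "CARD('n) = 2"
 shows "\<exists>r>0. \<exists>C\<ge>0. hardy_dominated {\<zeta>\<in>torus. dist \<zeta> \<xi> < r} C"
proof -
 obtain p q :: 'n where pq: "UNIV = {p, q}" "p \<noteq> q" using n2 by (auto simp: card_2_iff)
 obtain \<kappa> r \<rho> C1 where r: "r > 0" and rho: "0 <= \<rho>" "\<rho> < 1" and C1: "C1 >= 0"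
  and near: "\<forall>\<zeta>\<in>torus. dist \<zeta> \<xi> < r --> (\<forall>i. (norm (\<phi> \<xi> $ i) = 1 --> \<phi> \<zeta> $ i \<noteq> 0) \<and> (norm (\<phi> \<xi> $ i) \<noteq> 1 --> norm (\<phi> \<zeta> $ i) <= \<rho>))"
  and dens: "\<forall>t>0. \<forall>e. emeasure (mu (-1)) {\<zeta>\<in>torus. dist \<zeta> \<xi> < r \<and> (\<forall>i. norm ((if norm (\<phi> \<xi> $ i) = 1 then sgn (\<phi> \<zeta> $ i) else \<zeta> $ \<kappa> i) - e $ i) <= t)} <= ennreal (C1 * t ^ CARD('n))"
  using chart_density[OF A B xi n2] by (elim exE conjE) (rule that)
 define U where "U = {\<zeta>\<in>torus. dist \<zeta> \<xi> < r}"
 have U: "U \<in> sets borel"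
 proof -
  have "U = torus \<inter> ball \<xi> r" by (auto simp: U_def dist_commute)
  then show ?thesis by simp
 qed
 \<comment> \<open>4 serves components that may approach the circle, through the grid of radii; (1 +
   \<rho>)/(1 - \<rho>) serves components bounded by \<rho>, whose Poisson kernel is compared with
   the constant kernel at radius 0.\<close>
 define c where "c = max 4 ((1 + \<rho>) / (1 - \<rho>))"
 have c: "c >= 4" "c >= (1 + \<rho>) / (1 - \<rho>)" by (auto simp: c_def)
 \<comment> \<open>c^4 is the square of the domination constant c^2, 16^2 comes from Harnack, C1 and
   (2 pi)^d from the transfer, and 4096 = 64^2 from the two maximal inequalities.\<close>
 define C where "C = c ^ 4 * (16\<^sup>2 * C1 * (2*pi) ^ CARD('n)) * 4096"
 have C: "C >= 0" using c C1 by (simp add: C_def)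
 define \<Phi> where "\<Phi> z = (if z \<in> cpolydisc then \<phi> z else 0)" for z
 have Phi[measurable]: "\<Phi> \<in> borel_fun" unfolding \<Phi>_def[abs_def]
  by (rule borel_measurable_continuous_on_if) (auto intro: cont)
 define F where "F \<zeta> = (\<chi> i. if norm (\<phi> \<xi> $ i) = 1 then \<Phi> \<zeta> $ i / of_real (norm (\<Phi> \<zeta> $ i)) else \<zeta> $ \<kappa> i)" for \<zeta> :: "complex^'n"
 have Fm: "F \<in> borel_fun"
 proof (rule borel_measurable_vecI)
  fix i show "(%\<zeta>. F \<zeta> $ i) \<in> borel_fun" unfolding F_def by (cases "norm (\<phi> \<xi> $ i) = 1") simp_all
 qed
 have FU: "F \<zeta> $ i = (if norm (\<phi> \<xi> $ i) = 1 then sgn (\<phi> \<zeta> $ i) else \<zeta> $ \<kappa> i)" if "\<zeta> \<in> U" for \<zeta> i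
  using that torus_subset by (auto simp: F_def U_def \<Phi>_def sgn_eq)
 have Ft: "F \<zeta> \<in> torus" if z: "\<zeta> \<in> U" for \<zeta>
 proof -
  have "norm (F \<zeta> $ i) = 1" for i
   using z near unfolding FU[OF z] by (auto simp: U_def norm_sgn torus_def)
  then show ?thesis by (simp add: torus_def)
 qed
 show ?thesis
 proof (rule exI[of _ r], rule conjI[OF r], rule exI[of _ C], rule conjI[OF C], unfold hardy_dominated_def, intro allI impI)
  fix s :: real and g :: "complex^'n => complex"
  assume s: "0 < s" "s < 1" and g: "continuous_on cpolydisc g" "holo_on g polydisc"
  obtain R where R: "finite R" "0 \<in> R" "R \<subseteq> {0..s}" and grid: "\<forall>x. 0 <= x --> x <= s --> (\<exists>r\<in>R. r <= x \<and> x - r <= 1 - s)"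
   using radius_grid[OF s] by (elim exE conjE) (rule that)
  have R01: "R \<noteq> {}" "R \<subseteq> {0..<1}" "R \<subseteq> {0..1 - (1 - s)}" using R s by auto
  define G where "G z = ennreal (norm (g z)) * indicator cpolydisc z" for z
  have G: "G \<in> borel_fun" unfolding G_def[abs_def] by (rule borel_on_indicator(2)[OF g(1) borel_sets(2)])
  have "bounded (g ` cpolydisc)" by (intro compact_imp_bounded compact_continuous_image g(1) compact_cpolydisc)
  then obtain K where K: "K > 0" "\<forall>x\<in>g ` cpolydisc. norm x <= K" unfolding bounded_pos by blast
  have GB: "G z <= ennreal K" for z using K by (auto simp: G_def split: split_indicator intro!: ennreal_leI)
  have Mq: "coord_max R q G \<in> borel_fun" by (rule coord_max_measurable[OF R(1) G])
  define M where "M = coord_max R p (coord_max R q G)"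
  have M: "M \<in> borel_fun" unfolding M_def by (rule coord_max_measurable[OF R(1) Mq])
  have MB: "coord_max R q G z <= ennreal K" for z by (rule coord_max_le[OF R01(2) GB])
  have dom: "ennreal (norm (g (s *\<^sub>R \<phi> \<zeta>))) <= ennreal (c\<^sup>2) * M (F \<zeta>)" if z: "\<zeta> \<in> U" for \<zeta>
   unfolding M_def G_def[abs_def]
  proof (rule coord_max2_dominates[OF pq R(1) g _ Ft[OF z]])
   have zc: "\<zeta> \<in> cpolydisc" using z torus_subset by (auto simp: U_def)
   show "s *\<^sub>R \<phi> \<zeta> \<in> polydisc" by (rule scale_polydisc[OF map_cpolydisc[OF zc]]) (use s in auto)
   show "0 <= c" using c by simp
   fix i
   have le1: "norm (\<phi> \<zeta> $ i) <= 1" by (rule cpolydisc_component[OF map_cpolydisc[OF zc]])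
   have comp: "(s *\<^sub>R \<phi> \<zeta>) $ i = of_real s * \<phi> \<zeta> $ i" unfolding vector_scaleR_component by (rule scaleR_conv_of_real)
   show "\<exists>r\<in>R. \<forall>y. norm y = 1 --> poisson ((s *\<^sub>R \<phi> \<zeta>) $ i) y <= c * poisson (of_real r * F \<zeta> $ i) y"
   proof (cases "norm (\<phi> \<xi> $ i) = 1")
    case True
    define x where "x = s * norm (\<phi> \<zeta> $ i)"
    have x: "0 <= x" "x <= s" using s le1 by (auto simp: x_def mult_left_le)
    obtain r' where r': "r' \<in> R" "r' <= x" "x - r' <= 1 - s" using grid x by blast
    have n1: "norm (F \<zeta> $ i) = 1" using Ft[OF z] by (simp add: torus_def)
    have nz: "\<phi> \<zeta> $ i \<noteq> 0" using near z True by (auto simp: U_def)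
    then have w: "(s *\<^sub>R \<phi> \<zeta>) $ i = of_real x * F \<zeta> $ i" unfolding comp FU[OF z] by (simp add: True x_def sgn_eq)
    show ?thesis
    proof (intro bexI[OF _ r'(1)] allI impI)
     fix y :: complex assume y: "norm y = 1"
     have r0: "0 <= r'" using r' R by auto
     have "poisson ((s *\<^sub>R \<phi> \<zeta>) $ i) y <= 4 * poisson (of_real r' * F \<zeta> $ i) y"
      unfolding w by (rule poisson_le_scaled[OF n1 y r0 r'(2)]) (use x s r' in auto)
     also have "... <= c * poisson (of_real r' * F \<zeta> $ i) y"
      using r' R s c n1 by (intro mult_right_mono poisson_nonneg) (auto simp: norm_mult)
     finally show "poisson ((s *\<^sub>R \<phi> \<zeta>) $ i) y <= c * poisson (of_real r' * F \<zeta> $ i) y" .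
    qed
   next
    case False
    have "norm (\<phi> \<zeta> $ i) <= \<rho>" using near z False by (auto simp: U_def)
    then have "s * norm (\<phi> \<zeta> $ i) <= 1 * \<rho>" using s by (intro mult_mono) auto
    then have nr: "norm ((s *\<^sub>R \<phi> \<zeta>) $ i) <= \<rho>" unfolding comp using s by (simp add: norm_mult)
    show ?thesis
    proof (intro bexI[OF _ R(2)] allI impI)
     fix y :: complex assume "norm y = 1"
     then have "poisson ((s *\<^sub>R \<phi> \<zeta>) $ i) y <= (1 + \<rho>) / (1 - \<rho>)" by (intro poisson_le[OF nr rho(2)]) simp
     then show "poisson ((s *\<^sub>R \<phi> \<zeta>) $ i) y <= c * poisson (of_real 0 * F \<zeta> $ i) y" using c by (simp add: poisson_zero)
    qed
   qed
  qed
  have "(\<integral>\<^sup>+\<zeta>. nsq (g (s *\<^sub>R \<phi> \<zeta>)) * indicator U \<zeta> \<partial>mu (-1)) <= (\<integral>\<^sup>+\<zeta>. ennreal (c ^ 4) * ((M (F \<zeta>))^2 * indicator U \<zeta>) \<partial>mu (-1))"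
  proof (rule nn_integral_mono)
   fix \<zeta> :: "complex^'n"
   show "nsq (g (s *\<^sub>R \<phi> \<zeta>)) * indicator U \<zeta> <= ennreal (c ^ 4) * ((M (F \<zeta>))^2 * indicator U \<zeta>)"
   proof (cases "\<zeta> \<in> U")
    case True
    have "nsq (g (s *\<^sub>R \<phi> \<zeta>)) = (ennreal (norm (g (s *\<^sub>R \<phi> \<zeta>))))^2" by (simp add: ennreal_power)
    also have "... <= (ennreal (c\<^sup>2) * M (F \<zeta>))^2" by (intro power_mono dom True) simp
    also have "... = ennreal (c ^ 4) * (M (F \<zeta>))^2" using c by (simp add: power_mult_distrib ennreal_power power_mult[symmetric])
    finally show ?thesis using True by simp
   qed simp
  qed
  also have "... = ennreal (c ^ 4) * (\<integral>\<^sup>+\<zeta>. (M (F \<zeta>))^2 * indicator U \<zeta> \<partial>mu (-1))"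
  proof (rule nn_integral_cmult)
   interpret coord_measure arc_measure using coord_measure_mm[of "-1"] by (simp add: mm_arc)
   show "(%\<zeta>. (M (F \<zeta>))^2 * indicator U \<zeta>) \<in> borel_measurable (mu (-1))"
    unfolding mm_arc power2_eq_square using M Fm U by measurable
  qed
  also have "(\<integral>\<^sup>+\<zeta>. (M (F \<zeta>))^2 * indicator U \<zeta> \<partial>mu (-1)) <= ennreal (16\<^sup>2 * C1 * (2*pi) ^ CARD('n)) * (\<integral>\<^sup>+e. (M e)^2 \<partial>mu (-1))"
  proof (rule maximal_transfer[where t = "1 - s"])
   show "M e <= ennreal 16 * M e'" if "e \<in> torus" "e' \<in> torus" "\<forall>i. norm (e $ i - e' $ i) <= 1 - s" for e e'
    unfolding M_def by (rule coord_max2_harnack[OF pq R(1) R01(3) _ G that]) (use s in simp)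
   fix e :: "complex^'n"
   have "{\<zeta>\<in>U. \<forall>i. norm (F \<zeta> $ i - e $ i) <= 1 - s} =
    {\<zeta>\<in>U. \<forall>i. norm ((if norm (\<phi> \<xi> $ i) = 1 then sgn (\<phi> \<zeta> $ i) else \<zeta> $ \<kappa> i) - e $ i) <= 1 - s}"
    by (intro Collect_cong conj_cong refl) (simp only: FU)
   also have "... = {\<zeta>\<in>torus. dist \<zeta> \<xi> < r \<and> (\<forall>i. norm ((if norm (\<phi> \<xi> $ i) = 1 then sgn (\<phi> \<zeta> $ i) else \<zeta> $ \<kappa> i) - e $ i) <= 1 - s)}"
    by (simp add: U_def)
   finally show "emeasure (mu (-1)) {\<zeta>\<in>U. \<forall>i. norm (F \<zeta> $ i - e $ i) <= 1 - s} <= ennreal (C1 * (1 - s) ^ CARD('n))"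
    using dens s by simp
  qed (use s M Fm U Ft C1 in auto)
  also have "(\<integral>\<^sup>+e. (M e)^2 \<partial>mu (-1)) <= 64 * (\<integral>\<^sup>+e. (coord_max R q G e)^2 \<partial>mu (-1))"
   unfolding M_def by (rule coord_max_L2[OF R(1) R01(1,2) Mq MB]) (use K in simp)
  also have "(\<integral>\<^sup>+e. (coord_max R q G e)^2 \<partial>mu (-1)) <= 64 * (\<integral>\<^sup>+e. (G e)^2 \<partial>mu (-1))"
   by (rule coord_max_L2[OF R(1) R01(1,2) G GB]) (use K in simp)
  also have "(\<integral>\<^sup>+e. (G e)^2 \<partial>mu (-1)) = (\<integral>\<^sup>+\<zeta>. nsq (g \<zeta>) * indicator torus \<zeta> \<partial>mu (-1))"
  proof (rule nn_integral_cong_AE, use mu_torus_AE in eventually_elim)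
   fix e :: "complex^'n" assume "e \<in> torus"
   then show "(G e)^2 = nsq (g e) * indicator torus e" using torus_subset by (auto simp: G_def ennreal_power)
  qed
  finally have "(\<integral>\<^sup>+\<zeta>. nsq (g (s *\<^sub>R \<phi> \<zeta>)) * indicator U \<zeta> \<partial>mu (-1))
   <= ennreal (c ^ 4) * (ennreal (16\<^sup>2 * C1 * (2*pi) ^ CARD('n)) * (64 * (64 * (\<integral>\<^sup>+\<zeta>. nsq (g \<zeta>) * indicator torus \<zeta> \<partial>mu (-1)))))"
   by (simp add: mult_left_mono)
  also have "... = ennreal C * (\<integral>\<^sup>+\<zeta>. nsq (g \<zeta>) * indicator torus \<zeta> \<partial>mu (-1))"
  proof -
   have "ennreal (x * y * z) = ennreal x * ennreal y * ennreal z" if "x >= 0" "y >= 0" "z >= 0" for x y z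
    using that by (simp add: ennreal_mult)
   then have "ennreal C = ennreal (c ^ 4) * ennreal (16\<^sup>2 * C1 * (2*pi) ^ CARD('n)) * ennreal 4096"
    unfolding C_def by this (use c C1 in auto)
   also have "ennreal 4096 = 64 * 64" by simp
   finally show ?thesis by (simp only: mult.assoc)
  qed
  finally show "(\<integral>\<^sup>+\<zeta>. nsq (g (s *\<^sub>R \<phi> \<zeta>)) * indicator {\<zeta>\<in>torus. dist \<zeta> \<xi> < r} \<zeta> \<partial>mu (-1))
   <= ennreal C * (\<integral>\<^sup>+\<zeta>. nsq (g \<zeta>) * indicator torus \<zeta> \<partial>mu (-1))"
   by (simp add: U_def)
 qed
qed

end

lemma holo_on_scale:
 fixes f :: "complex^'n => complex"
 assumes f: "holo_on f polydisc" and t: "0 < t" "t < 1"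
 shows "holo_on (%z. f (t *\<^sub>R z)) polydisc" "continuous_on cpolydisc (%z. f (t *\<^sub>R z))"
proof -
 have in': "t *\<^sub>R z \<in> polydisc" if "z \<in> cpolydisc" for z :: "complex^'n" by (rule scale_polydisc[OF that]) (use t in auto)
 show "holo_on (%z. f (t *\<^sub>R z)) polydisc"
  unfolding holo_on_def
 proof
  fix z :: "complex^'n" assume "z \<in> polydisc"
  then have "t *\<^sub>R z \<in> polydisc" using in'[of z] polydisc_subset by blast
  then obtain D where D: "(f has_derivative D) (at (t *\<^sub>R z))" "\<And>c v. D (c *s v) = c * D v"
   using f unfolding holo_on_def by blast
  have "((%z :: complex^'n. t *\<^sub>R z) has_derivative (%v. t *\<^sub>R v)) (at z)" by (intro derivative_eq_intros) auto
  from has_derivative_compose[OF this D(1)] have "((%z. f (t *\<^sub>R z)) has_derivative (%v. D (t *\<^sub>R v))) (at z)" .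
  moreover have "t *\<^sub>R (c *s v) = c *s (t *\<^sub>R v)" for c and v :: "complex^'n" by (simp add: vec_eq_iff)
  ultimately show "\<exists>D. ((%z. f (t *\<^sub>R z)) has_derivative D) (at z) \<and> (\<forall>c v. D (c *s v) = c * D v)"
   by (intro exI[of _ "%v. D (t *\<^sub>R v)"]) (simp add: D(2))
 qed
 show "continuous_on cpolydisc (%z. f (t *\<^sub>R z))"
  by (rule continuous_on_compose2[OF holo_on_continuous[OF f]]) (auto intro!: continuous_intros in')
qed

context smooth_selfmap begin

lemma scaled_comp:
 fixes f :: "complex^'n => complex"
 assumes f: "holo_on f polydisc" and t: "0 < t" "t < 1"
 shows "holo_on (%z. f (t *\<^sub>R \<phi> z)) polydisc" "continuous_on cpolydisc (%z. f (t *\<^sub>R \<phi> z))"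
proof -
 show "holo_on (%z. f (t *\<^sub>R \<phi> z)) polydisc" using holo_on_comp[OF holo_on_scale(1)[OF f t]] by (simp add: o_def)
 show "continuous_on cpolydisc (%z. f (t *\<^sub>R \<phi> z))"
  by (rule continuous_on_compose2[OF holo_on_scale(2)[OF f t] cont]) (auto intro: map_cpolydisc)
qed

lemma hardy_global:
 assumes A: condA and B: condB and n2: "CARD('n) = 2"
 shows "\<exists>C\<ge>0. hardy_dominated torus C"
proof -
 interpret coord_measure arc_measure using coord_measure_mm[of "-1"] by (simp add: mm_arc)
 define Y where "Y g = (\<integral>\<^sup>+\<zeta>. nsq (g \<zeta>) * indicator torus (\<zeta> :: complex^'n) \<partial>mu (-1))" for g :: "complex^'n => complex"
 define X where "X s g U = (\<integral>\<^sup>+\<zeta>. nsq (g (s *\<^sub>R \<phi> \<zeta>)) * indicator U \<zeta> \<partial>mu (-1))" for s :: real and g :: "complex^'n => complex" and U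
 define good where "good s g \<longleftrightarrow> 0 < s \<and> s < 1 \<and> continuous_on cpolydisc g \<and> holo_on g polydisc" for s :: real and g :: "complex^'n => complex"
 have loc: "\<forall>\<xi>\<in>torus. \<exists>r. r > 0 \<and> (\<exists>C\<ge>0. \<forall>s g. good s g --> X s g {\<zeta>\<in>torus. dist \<zeta> \<xi> < r} <= ennreal C * Y g)"
  unfolding X_def Y_def good_def imp_conjL hardy_dominated_def[symmetric] by (intro ballI hardy_local[OF A B _ n2])
 then obtain r where r: "\<forall>\<xi>\<in>torus. r \<xi> > 0 \<and> (\<exists>C\<ge>0. \<forall>s g. good s g --> X s g {\<zeta>\<in>torus. dist \<zeta> \<xi> < r \<xi>} <= ennreal C * Y g)"
  by (auto dest: bchoice)
 then have "\<forall>\<xi>\<in>torus. \<exists>C. C >= 0 \<and> (\<forall>s g. good s g --> X s g {\<zeta>\<in>torus. dist \<zeta> \<xi> < r \<xi>} <= ennreal C * Y g)" by blast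
 then obtain C where C: "\<forall>\<xi>\<in>torus. C \<xi> >= 0 \<and> (\<forall>s g. good s g --> X s g {\<zeta>\<in>torus. dist \<zeta> \<xi> < r \<xi>} <= ennreal (C \<xi>) * Y g)"
  by (auto dest: bchoice)
 have "compact (torus :: (complex^'n) set)"
 proof -
  have "cpolydisc \<inter> torus = (torus :: (complex^'n) set)" using torus_subset by blast
  then show ?thesis by (metis compact_Int_closed compact_cpolydisc torus_closed)
 qed
 moreover have "(torus :: (complex^'n) set) \<subseteq> (\<Union>\<xi>\<in>torus. ball \<xi> (r \<xi>))"
 proof
  fix z :: "complex^'n" assume "z \<in> torus"
  then show "z \<in> (\<Union>\<xi>\<in>torus. ball \<xi> (r \<xi>))" using r by (intro UN_I[of z]) auto
 qed
 ultimately obtain S where S: "S \<subseteq> torus" "finite S" "torus \<subseteq> (\<Union>\<xi>\<in>S. ball \<xi> (r \<xi>))"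
  using compactE_image[of torus torus "%\<xi>. ball \<xi> (r \<xi>)"] by (metis open_ball)
 have CS: "C \<xi> >= 0" if "\<xi> \<in> S" for \<xi> using C S(1) that by blast
 have "X s g torus <= ennreal (\<Sum>\<xi>\<in>S. C \<xi>) * Y g" if sg: "good s g" for s g
 proof -
  define H where "H \<zeta> = nsq (g (s *\<^sub>R \<phi> \<zeta>)) * indicator torus \<zeta>" for \<zeta>
  have s: "0 < s" "s < 1" and g: "continuous_on cpolydisc g" "holo_on g polydisc" using sg by (auto simp: good_def)
  have H: "H \<in> borel_fun" unfolding H_def[abs_def]
   by (rule borel_on_indicator(1)[OF continuous_on_subset[OF scaled_comp(2)[OF g(2) s] torus_subset] borel_sets(3)])
  have HU: "nsq (g (s *\<^sub>R \<phi> \<zeta>)) * indicator {\<zeta>\<in>torus. dist \<zeta> \<xi> < r \<xi>} \<zeta> = H \<zeta> * indicator (ball \<xi> (r \<xi>)) \<zeta>" for \<xi> \<zeta>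
   by (auto simp: H_def dist_commute split: split_indicator)
  have "X s g torus <= (\<integral>\<^sup>+\<zeta>. (\<Sum>\<xi>\<in>S. H \<zeta> * indicator (ball \<xi> (r \<xi>)) \<zeta>) \<partial>mu (-1))"
   unfolding X_def
  proof (rule nn_integral_mono)
   fix \<zeta> :: "complex^'n"
   show "nsq (g (s *\<^sub>R \<phi> \<zeta>)) * indicator torus \<zeta> <= (\<Sum>\<xi>\<in>S. H \<zeta> * indicator (ball \<xi> (r \<xi>)) \<zeta>)"
   proof (cases "\<zeta> \<in> torus")
    case True
    then obtain \<xi> where x: "\<xi> \<in> S" "\<zeta> \<in> ball \<xi> (r \<xi>)" using S(3) by blast
    have "H \<zeta> = H \<zeta> * indicator (ball \<xi> (r \<xi>)) \<zeta>" using x by simp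
    also have "... <= (\<Sum>\<xi>\<in>S. H \<zeta> * indicator (ball \<xi> (r \<xi>)) \<zeta>)" using x S(2) by (intro member_le_sum) auto
    finally show ?thesis by (simp add: H_def)
   qed simp
  qed
  also have "... = (\<Sum>\<xi>\<in>S. \<integral>\<^sup>+\<zeta>. H \<zeta> * indicator (ball \<xi> (r \<xi>)) \<zeta> \<partial>mu (-1))"
   unfolding mm_arc
  proof (rule nn_integral_sum)
   fix \<xi>
   have "(%\<zeta>. H \<zeta> * indicator (ball \<xi> (r \<xi>)) \<zeta>) \<in> borel_fun"
    by (intro borel_measurable_times_ennreal H borel_measurable_indicator) simp
   then show "(%\<zeta>. H \<zeta> * indicator (ball \<xi> (r \<xi>)) \<zeta>) \<in> borel_measurable vm"
    using measurable_cong_sets[OF sets_vm refl] by blast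
  qed
  also have "... = (\<Sum>\<xi>\<in>S. X s g {\<zeta>\<in>torus. dist \<zeta> \<xi> < r \<xi>})" by (simp add: X_def HU)
  also have "... <= (\<Sum>\<xi>\<in>S. ennreal (C \<xi>) * Y g)" using C S(1) sg by (intro sum_mono) blast
  also have "... = ennreal (\<Sum>\<xi>\<in>S. C \<xi>) * Y g" using CS by (simp add: sum_distrib_right[symmetric] sum_ennreal)
  finally show ?thesis .
 qed
 then show ?thesis using CS unfolding X_def Y_def good_def hardy_dominated_def by (intro exI[of _ "\<Sum>\<xi>\<in>S. C \<xi>"]) (auto intro: sum_nonneg)
qed

text \<open>Boundary values of f are avoided. The dilation is split as s = t^2: one factor t makes f
  continuous on the closed polydisc, the other is the dilation in \<open>hardy_dominated\<close>.
  Fatou then lets s tend to 1 for fixed r < 1.\<close>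

theorem hardy_sufficiency:
 assumes A: condA and B: condB and n2: "CARD('n) = 2"
 shows "composition_bounded (-1) \<phi>"
proof -
 obtain C where C: "C >= 0" and est: "hardy_dominated torus C"
  using hardy_global[OF A B n2] by (elim exE conjE) (rule that)
 show ?thesis
 proof (rule composition_boundedI[OF C])
  show "holo_on (f \<circ> \<phi>) polydisc" if "holo_on f polydisc" for f by (rule holo_on_comp[OF that])
  fix f :: "complex^'n => complex" assume f: "holo_on f polydisc"
  have bound: "(\<integral>\<^sup>+\<zeta>. nsq (f (s *\<^sub>R \<phi> (r *\<^sub>R \<zeta>))) * indicator torus \<zeta> \<partial>torus_measure) <= ennreal C * hardy_sq f"
   if s: "0 < s" "s < 1" and r: "0 < r" "r < 1" for s r :: real
  proof -
   define t where "t = sqrt s"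
   have t: "0 < t" "t < 1" "t * t = s" using s by (auto simp: t_def)
   have "(\<integral>\<^sup>+\<zeta>. nsq (f (s *\<^sub>R \<phi> (r *\<^sub>R \<zeta>))) * indicator torus \<zeta> \<partial>torus_measure)
    <= (\<integral>\<^sup>+\<zeta>. nsq (f (s *\<^sub>R \<phi> \<zeta>)) * indicator torus \<zeta> \<partial>torus_measure)"
    by (rule torus_mean_increasing[OF scaled_comp(2,1)[OF f s] r])
   also have "... = (\<integral>\<^sup>+\<zeta>. nsq (f (t *\<^sub>R (t *\<^sub>R \<phi> \<zeta>))) * indicator torus \<zeta> \<partial>mu (-1))" by (simp add: mu_torus t(3))
   also have "... <= ennreal C * (\<integral>\<^sup>+\<zeta>. nsq (f (t *\<^sub>R \<zeta>)) * indicator torus \<zeta> \<partial>mu (-1))"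
    using est[unfolded hardy_dominated_def, rule_format, OF t(1,2) holo_on_scale(2,1)[OF f t(1,2)]] .
   also have "... <= ennreal C * hardy_sq f" unfolding hardy_sq_def mu_torus using t by (intro mult_left_mono SUP_upper) auto
   finally show ?thesis .
  qed
  have "(\<integral>\<^sup>+\<zeta>. nsq (f (\<phi> (r *\<^sub>R \<zeta>))) * indicator torus \<zeta> \<partial>torus_measure) <= ennreal C * hardy_sq f" if r: "0 < r" "r < 1" for r :: real
  proof -
   define s where "s m = 1 - 1 / (real m + 2)" for m :: nat
   have s: "0 < s m" "s m < 1" for m by (auto simp: s_def field_simps)
   have slim: "s \<longlonglongrightarrow> 1" unfolding s_def by real_asymp
   define u where "u m \<zeta> = nsq (f (s m *\<^sub>R \<phi> (r *\<^sub>R \<zeta>))) * indicator torus \<zeta>" for m \<zeta>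
   have in': "r *\<^sub>R \<zeta> \<in> polydisc" if "\<zeta> \<in> torus" for \<zeta> :: "complex^'n"
    by (rule scale_polydisc) (use that torus_subset r in auto)
   have um: "u m \<in> borel_measurable torus_measure" for m
   proof -
    have "continuous_on torus (%\<zeta>. f (s m *\<^sub>R \<phi> (r *\<^sub>R \<zeta>)))"
     by (rule continuous_on_compose2[OF scaled_comp(2)[OF f s[of m]]]) (use in' polydisc_subset in \<open>auto intro!: continuous_intros\<close>)
    from borel_on_indicator(1)[OF this borel_sets(3)] have "u m \<in> borel_fun" unfolding u_def[abs_def] .
    then show ?thesis by simp
   qed
   have lim: "(%m. u m \<zeta>) \<longlonglongrightarrow> nsq (f (\<phi> (r *\<^sub>R \<zeta>))) * indicator torus \<zeta>" for \<zeta>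
   proof (cases "\<zeta> \<in> torus")
    case True
    define w where "w = \<phi> (r *\<^sub>R \<zeta>)"
    have w: "w \<in> polydisc" unfolding w_def by (rule map_polydisc[OF in'[OF True]])
    have cf: "isCont f w" using holo_on_continuous[OF f] w continuous_on_eq_continuous_at[OF open_polydisc, of f] by blast
    have "(%m. s m *\<^sub>R w) \<longlonglongrightarrow> 1 *\<^sub>R w" by (intro tendsto_intros slim)
    then have "(%m. s m *\<^sub>R w) \<longlonglongrightarrow> w" by simp
    then have "(%m. f (s m *\<^sub>R w)) \<longlonglongrightarrow> f w" by (rule isCont_tendsto_compose[OF cf])
    then have "(%m. nsq (f (s m *\<^sub>R w))) \<longlonglongrightarrow> nsq (f w)" by (intro tendsto_intros tendsto_ennrealI)
    then show ?thesis using True by (simp add: u_def w_def)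
   qed (simp add: u_def)
   have "(\<integral>\<^sup>+\<zeta>. nsq (f (\<phi> (r *\<^sub>R \<zeta>))) * indicator torus \<zeta> \<partial>torus_measure) = (\<integral>\<^sup>+\<zeta>. liminf (%m. u m \<zeta>) \<partial>torus_measure)"
    by (intro nn_integral_cong lim_imp_Liminf[OF _ lim, symmetric]) simp
   also have "... <= liminf (%m. \<integral>\<^sup>+\<zeta>. u m \<zeta> \<partial>torus_measure)" by (rule nn_integral_liminf[OF um])
   also have "... <= liminf (%m. ennreal C * hardy_sq f)"
    by (rule Liminf_mono) (simp add: u_def bound[OF s r])
   also have "... = ennreal C * hardy_sq f" by (simp add: Liminf_const)
   finally show ?thesis .
  qed
  then show "A2_sq (-1) (f \<circ> \<phi>) <= ennreal C * A2_sq (-1) f"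
   by (auto simp: A2_sq_def hardy_sq_def[of "f \<circ> \<phi>"] intro!: SUP_least)
 qed
qed

end

theorem theorem1p1:
  fixes \<phi> :: "complex ^ 'n \<Rightarrow> complex ^ 'n" and \<beta> :: real
  assumes "CARD('n) \<ge> 2"
    and "\<beta> \<ge> real CARD('n) - 3"
    and "holo_selfmap \<phi>"
    and "C1_closed \<phi>"
  shows "composition_bounded \<beta> \<phi> \<longleftrightarrow>
    (\<forall>j\<in>{1..CARD('n) - 1}. \<phi> ` (cpolydisc - T (j + 1)) \<inter> T (j + 1) = {}) \<and>
    (\<forall>j\<in>{1..CARD('n)}. \<forall>I :: 'n set. card I = j \<longrightarrow>
       (\<forall>\<xi>\<in>T j - T (j + 1). (\<forall>i\<in>I. norm (\<phi> \<xi> $ i) = 1) \<longrightarrow>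
          invertible_on I (P \<phi> I \<xi>) (jac \<phi> \<xi>)))"
proof -
 interpret smooth_selfmap \<phi> using assms(3,4) by unfold_locales
 have d: "real CARD('n) >= 2" using assms(1) by simp
 have "composition_bounded \<beta> \<phi> \<longleftrightarrow> condA \<and> condB"
 proof
  assume "composition_bounded \<beta> \<phi>"
  then show "condA \<and> condB" using necessity[of \<beta>] assms(2) d by simp
 next
  assume c: "condA \<and> condB"
  show "composition_bounded \<beta> \<phi>"
  proof (cases "\<beta> = -1")
   case True
   \<comment> \<open>\<beta> = -1 and \<beta> \<ge> d - 3 leave only d = 2, the dimension for which
     the charts of the torus are built.\<close>
   then have "CARD('n) = 2" using assms(1,2) by simp
   then show ?thesis using hardy_sufficiency c True by simp
  next
   case False
   then have "\<beta> > -1" using assms(2) d by simp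
   then show ?thesis using bergman_sufficiency c assms(2) by simp
  qed
 qed
 then show ?thesis unfolding condA_def condB_def .
qed

end
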